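(* Let $K=\mathbb{C}(t)$. There is an absolute constant $c>0$ such that the following holds. Let $C\subset \mathbb{P}^n_K$ be an irreducible projective curve of degree $d$ over $K$. Then for every integer $b\geq 1$, $$\dim C(b)\leq \left\lfloor \frac{2(b-1)}{d}\right\rfloor +1 \le \left\lceil \frac{2b}{d}\right\rceil,$$ and the number of irreducible components of $C(b)$ of dimension $\left\lfloor \frac{2(b-1)}{d}\right\rfloor +1$ is at most $c\,d^3b$.
   Context: Every point of $\mathbb{P}^n(K)$ can be written as $x=(x_0:\ldots:x_n)$ with $x_i\in\mathbb{C}[t]$ coprime; its height is $h(x)=\max_i\deg x_i$. For a quasi-projective variety $X\subset\mathbb{P}^n_K$ and an integer $b\ge 1$, put $X(b)=\{x\in X(K): h(x)<b\}$. Identifying $(n+1)$-tuples of polynomials of degree $<b$, up to $\mathbb{C}^\times$, with points of $\mathbb{P}^{b(n+1)-1}_{\mathbb{C}}$ (coordinates being the coefficients), and representing points by coprime tuples, $X(b)$ is naturally a quasi-projective variety over $\mathbb{C}$ in $\mathbb{P}^{b(n+1)-1}_{\mathbb{C}}$; its equations are obtained by expanding the equations of $X$ in powers of $t$. Dimension and irreducible components of $X(b)$ are those of this variety over $\mathbb{C}$. *)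

theory Defs
  imports
    "HOL-Analysis.Analysis"
    "HOL-Library.Poly_Mapping"
    "HOL-Algebra.Algebraic_Closure_Type"
begin

section \<open>Dimension and irreducible components of a topological space\<close>

definition irreducible_in :: "'a topology \<Rightarrow> 'a set \<Rightarrow> bool" where
  "irreducible_in T S \<longleftrightarrow> S \<subseteq> topspace T \<and> S \<noteq> {} \<and>
     (\<forall>A B. closedin T A \<and> closedin T B \<and> S \<subseteq> A \<union> B \<longrightarrow> S \<subseteq> A \<or> S \<subseteq> B)"

definition irreducible_components :: "'a topology \<Rightarrow> 'a set set" where
  "irreducible_components T =
     {S. irreducible_in T S \<and> (\<forall>S'. irreducible_in T S' \<and> S \<subseteq> S' \<longrightarrow> S' = S)}"

text \<open>The dimension of the empty space is \<open>-\<infinity>\<close>.\<close>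

definition krull_dim :: "'a topology \<Rightarrow> ereal" where
  "krull_dim T = Sup {ereal (real k) | k.
     \<exists>Y :: nat \<Rightarrow> 'a set. (\<forall>i\<le>k. closedin T (Y i) \<and> irreducible_in T (Y i)) \<and>
       (\<forall>i<k. Y i \<subset> Y (Suc i))}"


section \<open>Polynomials in several variables\<close>

text \<open>A polynomial with variables indexed by \<open>'i\<close> maps finitely many monomials
  \<open>'i \<Rightarrow>\<^sub>0 nat\<close> to nonzero coefficients; its ring structure is that of
  \<^theory>\<open>HOL-Library.Poly_Mapping\<close>.\<close>

type_synonym ('i, 'a) mpoly = "('i \<Rightarrow>\<^sub>0 nat) \<Rightarrow>\<^sub>0 'a"

text \<open>The forms of degree \<open>m\<close> in the variables indexed by \<open>I\<close> (including \<open>0\<close>).\<close>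

definition forms :: "'i set \<Rightarrow> nat \<Rightarrow> ('i, 'a::zero) mpoly set" where
  "forms I m = {f. \<forall>e \<in> Poly_Mapping.keys f.
     Poly_Mapping.keys e \<subseteq> I \<and> (\<Sum>i\<in>Poly_Mapping.keys e. Poly_Mapping.lookup e i) = m}"

text \<open>The value of \<open>f\<close> at a vector over an extension \<open>\<phi> : 'a \<rightarrow> 'b\<close> of the coefficient field.\<close>

definition mpoly_eval ::
    "('a::zero \<Rightarrow> 'b::comm_semiring_1) \<Rightarrow> ('i, 'a) mpoly \<Rightarrow> ('i \<Rightarrow> 'b) \<Rightarrow> 'b" where
  "mpoly_eval \<phi> f v = (\<Sum>e\<in>Poly_Mapping.keys f. \<phi> (Poly_Mapping.lookup f e) *
     (\<Prod>i\<in>Poly_Mapping.keys e. v i ^ Poly_Mapping.lookup e i))"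

definition mpoly_scale :: "'a::comm_semiring_1 \<Rightarrow> ('i, 'a) mpoly \<Rightarrow> ('i, 'a) mpoly" where
  "mpoly_scale c f = Poly_Mapping.single 0 c * f"

interpretation mpoly: vector_space "mpoly_scale :: 'a::field \<Rightarrow> ('i, 'a) mpoly \<Rightarrow> ('i, 'a) mpoly"
  by unfold_locales
    (simp_all add: mpoly_scale_def single_add algebra_simps mult_single flip: mult.assoc)


section \<open>Projective space and its Zariski topology\<close>

text \<open>Homogeneous coordinates are indexed by a finite set \<open>I\<close> and extended by \<open>0\<close> outside \<open>I\<close>;
  a point is the class of a nonzero vector under scaling. The space has dimension \<open>card I - 1\<close>.\<close>

definition proj_class :: "('i \<Rightarrow> 'a::field) \<Rightarrow> ('i \<Rightarrow> 'a) set" where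
  "proj_class v = {(\<lambda>i. c * v i) | c. c \<noteq> 0}"

definition proj_space :: "'i set \<Rightarrow> ('i \<Rightarrow> 'a::field) set set" where
  "proj_space I = {proj_class v | v. (\<forall>i. i \<notin> I \<longrightarrow> v i = 0) \<and> (\<exists>i\<in>I. v i \<noteq> 0)}"

definition vanishes_at ::
    "('a::zero \<Rightarrow> 'b::field) \<Rightarrow> ('i, 'a) mpoly \<Rightarrow> ('i \<Rightarrow> 'b) set \<Rightarrow> bool" where
  "vanishes_at \<phi> f p \<longleftrightarrow> (\<forall>v\<in>p. mpoly_eval \<phi> f v = 0)"

text \<open>The Zariski topology on projective space over \<open>'b\<close> whose closed sets are cut out by forms
  with coefficients in \<open>'a\<close>, embedded into \<open>'b\<close> by \<open>\<phi>\<close>. If \<open>'b\<close> is an algebraic closure of \<open>'a\<close>,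
  its closed sets are the algebraic sets over \<open>'a\<close>, and irreducibility in it is
  irreducibility over \<open>'a\<close>.\<close>

definition zariski :: "('a::zero \<Rightarrow> 'b::field) \<Rightarrow> 'i set \<Rightarrow> ('i \<Rightarrow> 'b) set topology" where
  "zariski \<phi> I = topology_generated_by
     {{p \<in> proj_space I. \<not> vanishes_at \<phi> f p} | f. \<exists>m. f \<in> forms I m}"


section \<open>Projective curves and their degree\<close>

text \<open>A variety in \<open>n\<close>-dimensional projective space over a field \<open>'a\<close> is given by its points over
  the algebraic closure of \<open>'a\<close>.\<close>

definition irreducible_projective_curve ::
    "nat \<Rightarrow> (nat \<Rightarrow> 'a::field alg_closure) set set \<Rightarrow> bool" where
  "irreducible_projective_curve n V \<longleftrightarrow>
     closedin (zariski (to_ac :: 'a \<Rightarrow> _) {..n}) V \<and>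
     irreducible_in (zariski (to_ac :: 'a \<Rightarrow> _) {..n}) V \<and>
     krull_dim (subtopology (zariski (to_ac :: 'a \<Rightarrow> _) {..n}) V) = 1"

text \<open>The dimension over \<open>'a\<close> of the degree \<open>m\<close> part of the homogeneous coordinate ring of \<open>V\<close>.\<close>

definition hilbert_function :: "nat \<Rightarrow> (nat \<Rightarrow> 'a::field alg_closure) set set \<Rightarrow> nat \<Rightarrow> nat" where
  "hilbert_function n V m =
     mpoly.dim (forms {..n} m :: (nat, 'a) mpoly set) -
     mpoly.dim {f \<in> (forms {..n} m :: (nat, 'a) mpoly set). \<forall>p\<in>V. vanishes_at to_ac f p}"

text \<open>The degree of a variety of dimension \<open>r\<close> is \<open>r!\<close> times the leading coefficient of its
  Hilbert polynomial, which has degree \<open>r\<close>.\<close>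

definition has_proj_degree ::
    "nat \<Rightarrow> (nat \<Rightarrow> 'a::field alg_closure) set set \<Rightarrow> nat \<Rightarrow> bool" where
  "has_proj_degree n V d \<longleftrightarrow> (\<exists>P :: rat poly.
     (\<forall>\<^sub>F m in sequentially. of_nat (hilbert_function n V m) = poly P (of_nat m)) \<and>
     ereal (real (Polynomial.degree P)) =
       krull_dim (subtopology (zariski (to_ac :: 'a \<Rightarrow> _) {..n}) V) \<and>
     of_nat d = fact (Polynomial.degree P) * Polynomial.lead_coeff P)"

definition rational_points ::
    "nat \<Rightarrow> (nat \<Rightarrow> 'a::field alg_closure) set set \<Rightarrow> (nat \<Rightarrow> 'a) set set" where
  "rational_points n V =
     {p \<in> proj_space {..n}. \<forall>v\<in>p. proj_class (\<lambda>i. to_ac (v i)) \<in> V}"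


section \<open>Points of bounded height over the rational function field\<close>

definition coprime_rep ::
    "nat \<Rightarrow> (nat \<Rightarrow> complex poly fract) set \<Rightarrow> (nat \<Rightarrow> complex poly) \<Rightarrow> bool" where
  "coprime_rep n p x \<longleftrightarrow>
     (\<forall>i. i \<notin> {..n} \<longrightarrow> x i = 0) \<and>
     (\<forall>q. (\<forall>i\<le>n. q dvd x i) \<longrightarrow> is_unit q) \<and>
     p = proj_class (\<lambda>i. to_fract (x i))"

definition height :: "nat \<Rightarrow> (nat \<Rightarrow> complex poly fract) set \<Rightarrow> nat" where
  "height n p = (THE h. \<exists>x. coprime_rep n p x \<and> h = Max ((\<lambda>i. Polynomial.degree (x i)) ` {..n}))"

definition points_below ::
    "nat \<Rightarrow> (nat \<Rightarrow> complex poly fract alg_closure) set set \<Rightarrow> nat \<Rightarrow>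
     (nat \<Rightarrow> complex poly fract) set set" where
  "points_below n V b = {p \<in> rational_points n V. height n p < b}"

text \<open>The coefficient of \<open>t\<^sup>j\<close> in the \<open>i\<close>-th polynomial of a tuple is the homogeneous
  coordinate with index \<open>(i, j)\<close>. The \<open>b (n + 1)\<close> pairs with \<open>i \<le> n\<close> and \<open>j < b\<close> index the
  coordinates of the complex projective space of dimension \<open>b (n + 1) - 1\<close>.\<close>

definition coeff_point :: "(nat \<Rightarrow> complex poly) \<Rightarrow> (nat \<times> nat \<Rightarrow> complex) set" where
  "coeff_point x = proj_class (\<lambda>(i, j). Polynomial.coeff (x i) j)"

definition bounded_height_space ::
    "nat \<Rightarrow> (nat \<Rightarrow> complex poly fract alg_closure) set set \<Rightarrow> nat \<Rightarrow>
     (nat \<times> nat \<Rightarrow> complex) set topology" where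
  "bounded_height_space n V b =
     subtopology (zariski (id :: complex \<Rightarrow> complex) ({..n} \<times> {..<b}))
       {coeff_point x | x. \<exists>p \<in> points_below n V b. coprime_rep n p x}"


lemma coprime_rep_unique:
  assumes "coprime_rep n p x" "coprime_rep n p y"
  shows "\<exists>c. c \<noteq> 0 \<and> (\<forall>i. y i = Polynomial.smult c (x i))"
proof -
  have "(\<lambda>i. to_fract (y i)) \<in> proj_class (\<lambda>i. to_fract (y i))"
    unfolding proj_class_def by (auto intro!: exI[of _ 1])
  then have "(\<lambda>i. to_fract (y i)) \<in> proj_class (\<lambda>i. to_fract (x i))"
    using assms by (simp add: coprime_rep_def)
  then obtain r where r: "r \<noteq> 0" "\<And>i. to_fract (y i) = r * to_fract (x i)"
    unfolding proj_class_def by (auto simp: fun_eq_iff)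
  obtain a b where ab: "quot_of_fract r = (a, b)" by (cases "quot_of_fract r") auto
  have b0: "b \<noteq> 0" using snd_quot_of_fract_nonzero[of r] ab by simp
  have cop: "coprime a b" using coprime_quot_of_fract[of r] ab by simp
  have rab: "r = to_fract a / to_fract b"
    using quot_to_fract_quot_of_fract[of r] ab
    by (simp add: quot_to_fract_def to_fract_def b0 One_fract_def)
  have eq: "b * y i = a * x i" for i
  proof -
    have "to_fract (b * y i) = to_fract (a * x i)"
      using r(2)[of i] b0 rab by (simp add: field_simps)
    then show ?thesis by (simp only: to_fract_eq_iff)
  qed
  have "a dvd y i" for i
    using eq[of i] cop by (metis coprime_dvd_mult_right_iff dvd_triv_left)
  then have ua: "is_unit a" using assms by (simp add: coprime_rep_def)
  have "b dvd x i" for i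
    using eq[of i] cop by (metis coprime_commute coprime_dvd_mult_right_iff dvd_triv_left)
  then have ub: "is_unit b" using assms by (simp add: coprime_rep_def)
  from ua ub obtain u v where uv: "a = [:u:]" "b = [:v:]" "u \<noteq> 0" "v \<noteq> 0"
    by (auto simp: is_unit_poly_iff dvd_field_iff)
  have "y i = Polynomial.smult (u / v) (x i)" for i
  proof -
    have "Polynomial.smult (1 / v) (Polynomial.smult v (y i)) =
          Polynomial.smult (1 / v) (Polynomial.smult u (x i))"
      using eq[of i] uv by simp
    then show ?thesis using uv by simp
  qed
  then show ?thesis using uv by (intro exI[of _ "u / v"]) auto
qed

lemma height_eq:
  assumes "coprime_rep n p x"
  shows "height n p = Max ((\<lambda>i. Polynomial.degree (x i)) ` {..n})"
  unfolding height_def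
proof (rule the_equality)
  show "\<exists>y. coprime_rep n p y \<and>
      Max ((\<lambda>i. Polynomial.degree (x i)) ` {..n}) = Max ((\<lambda>i. Polynomial.degree (y i)) ` {..n})"
    using assms by blast
next
  fix h assume "\<exists>y. coprime_rep n p y \<and> h = Max ((\<lambda>i. Polynomial.degree (y i)) ` {..n})"
  then obtain y where y: "coprime_rep n p y" "h = Max ((\<lambda>i. Polynomial.degree (y i)) ` {..n})"
    by blast
  from coprime_rep_unique[OF assms y(1)] obtain c where
    "c \<noteq> 0" "\<And>i. y i = Polynomial.smult c (x i)" by blast
  then show "h = Max ((\<lambda>i. Polynomial.degree (x i)) ` {..n})" using y(2) by simp
qed

end

theory Submission
  imports
    Defs
    "HOL-Library.Function_Algebras"
    "HOL-Computational_Algebra.Fundamental_Theorem_Algebra"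
    "HOL-Computational_Algebra.Polynomial_FPS"
begin

text \<open>
  Put \<open>h = b - 1\<close> and \<open>k = 2 h div d + 1\<close>, so that \<open>k d > 2 h\<close>, and choose linear forms \<open>u\<close>, \<open>v\<close> over
  which the homogeneous coordinate ring of the curve is finite. For a general \<open>t0\<close>, a point of height
  at most \<open>h\<close>, that is, a primitive tuple \<open>x\<close> of polynomials, is sent to the \<open>k\<close>-jet of \<open>u x / v x\<close> at
  \<open>t0\<close>. The fibres of this map to \<open>k\<close>-space have at most \<open>d\<^sup>2 m\<close> points for a suitable degree \<open>m\<close>. Indeed,
  a fibre meets at most \<open>d\<close> branches over the point \<open>t0\<close>, and on one branch the coordinates of \<open>x\<close> are
  given modulo high powers of \<open>t - t0\<close> by a common power series in the parameter. Siegel's lemma then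
  provides a nonzero form of degree \<open>m\<close> on the curve, with polynomial coefficients of small degree in
  \<open>t\<close>, whose value at each of these tuples vanishes at \<open>t0\<close> to an order larger than its degree, hence
  is zero. Such a form has at most \<open>d m\<close> zeros on the curve.

  So the space of sections has dimension at most \<open>k\<close>, and the map is dominant on every component of
  dimension \<open>k\<close>. A general jet has a preimage in each of these components that lies in no other one,
  and the bound for the fibres becomes a bound for the number of components. The choice of \<open>m\<close> makes
  it at most \<open>2 d\<^sup>3 b\<close>.

  Dimensions are compared by counting polynomial functions of bounded degree: a chain of \<open>r + 1\<close>
  irreducible closed sets yields \<open>r\<close> algebraically independent functions, and a set that is finite over
  its first \<open>k\<close> coordinates carries at most \<open>O(D\<^sup>k)\<close> linearly independent functions of degree at most \<open>D\<close>.
\<close>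

section \<open>Graded domains with linear Hilbert function\<close>

text \<open>Why \<open>k d > 2 h\<close> is the right threshold: let \<open>N\<close> be the number
  of independent monomials of degree \<open>m\<close>. Coefficients of degree less than
  \<open>T\<close> give \<open>N T\<close> unknowns, and the value at a tuple has degree less than
  \<open>T + m h\<close>. Two parameters with the same \<open>k\<close>-jet differ by a multiple of
  \<open>(t - t0)^k\<close>, so order \<open>k N\<close> is reached if the \<open>r\<close>-th
  Taylor coefficient is divisible by \<open>(t - t0)^(k (N - r))\<close>, which costs
  \<open>k N (N + 1) / 2\<close> conditions. With \<open>T = k N - m h\<close> the unknowns win
  exactly when \<open>2 m h < k (N - 1)\<close>. As \<open>N\<close> grows like \<open>d m\<close>,
  large \<open>m\<close> work once \<open>2 h < k d\<close>. The number of components needs an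
  explicit \<open>m\<close>, hence a lower bound for the Hilbert function in every degree and not
  only asymptotically.

  The obstacle that shapes the second half: the closure of a family of sections contains tuples that
  are not primitive or degenerate at \<open>t0\<close>, while the fibre bound concerns good sections
  only. All dimension arguments are therefore made on an open part \<open>v \<noteq> 0\<close> of
  the closure.\<close>

lemma (in vector_space) finite_basis_dim:
  assumes "finite S"
  obtains B where "B \<subseteq> S" "finite B" "independent B" "span B = span S" "card B = dim (span S)"
proof -
  obtain B where B: "B \<subseteq> S" "independent B" "S \<subseteq> span B"
    using maximal_independent_subset[of S] by blast
  have "span B = span S"
    using B by (metis span_mono span_span span_subspace subspace_span subset_antisym)
  then have "card B = dim (span S)"
    using B by (metis dim_eq_card_independent dim_span)
  with B \<open>span B = span S\<close> assms show ?thesis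
    by (meson finite_subset that)
qed

text \<open>Indexed families instead of sets: different exponents may give the same ring element,
  and such a repetition already counts as a dependence.\<close>

lemma (in vector_space) dependent_family:
  assumes "finite S" "finite J" "\<And>j. j \<in> J \<Longrightarrow> f j \<in> span S" "dim (span S) < card J"
  shows "\<exists>\<gamma>. (\<exists>j\<in>J. \<gamma> j \<noteq> 0) \<and> (\<Sum>j\<in>J. scale (\<gamma> j) (f j)) = 0"
proof (cases "inj_on f J")
  case True
  obtain B where B: "finite B" "span B = span S" "card B = dim (span S)"
    using finite_basis_dim[OF assms(1)] by metis
  have "\<not> independent (f ` J)"
  proof
    assume "independent (f ` J)"
    moreover have "f ` J \<subseteq> span B" using assms(3) B by auto
    ultimately have "card (f ` J) \<le> card B"
      using independent_span_bound[OF B(1)] by blast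
    then show False using True assms(4) B(3) by (simp add: card_image)
  qed
  then obtain u where u: "(\<Sum>v\<in>f ` J. scale (u v) v) = 0" "\<exists>v\<in>f ` J. u v \<noteq> 0"
    using assms(2) by (auto simp: dependent_finite)
  then show ?thesis
    using True by (intro exI[of _ "\<lambda>j. u (f j)"]) (auto simp: sum.reindex)
next
  case False
  then obtain i j where ij: "i \<in> J" "j \<in> J" "i \<noteq> j" "f i = f j" by (auto simp: inj_on_def)
  define \<gamma> where "\<gamma> l = (if l = i then 1 else if l = j then -1 else (0::'a))" for l
  have "(\<Sum>l\<in>J. scale (\<gamma> l) (f l)) = (\<Sum>l\<in>{i,j}. scale (\<gamma> l) (f l))"
    using ij assms(2) by (intro sum.mono_neutral_right) (auto simp: \<gamma>_def)
  also have "\<dots> = 0" using ij by (simp add: \<gamma>_def)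
  finally show ?thesis using ij by (intro exI[of _ \<gamma>]) (auto simp: \<gamma>_def)
qed

lemma (in vector_space) span_family:
  assumes "finite J" "x \<in> span (f ` J)"
  shows "\<exists>\<gamma>. x = (\<Sum>j\<in>J. scale (\<gamma> j) (f j))"
proof -
  have "\<exists>\<gamma>. x = (\<Sum>j\<in>J. scale (\<gamma> j) (f j))" if "x \<in> span (f ` J)" for x
    using that
  proof (induction rule: span_induct_alt)
    case base
    then show ?case by (intro exI[of _ "\<lambda>_. 0"]) simp
  next
    case (step c y z)
    then obtain j \<gamma> where j: "j \<in> J" "y = f j" and \<gamma>: "z = (\<Sum>j\<in>J. scale (\<gamma> j) (f j))" by auto
    have "(\<Sum>l\<in>J. scale (\<gamma> l + (if l = j then c else 0)) (f l)) = z + (\<Sum>l\<in>J. scale (if l = j then c else 0) (f l))"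
      by (simp add: scale_left_distrib sum.distrib \<gamma>)
    also have "(\<Sum>l\<in>J. scale (if l = j then c else 0) (f l)) = (\<Sum>l\<in>J. if l = j then scale c (f j) else 0)"
      by (intro sum.cong) auto
    also have "\<dots> = scale c y" using j assms(1) by simp
    finally show ?case by (intro exI[of _ "\<lambda>l. \<gamma> l + (if l = j then c else 0)"]) (simp add: add.commute)
  qed
  with assms(2) show ?thesis by blast
qed

lemma (in vector_space) dim_span_le_card:
  assumes "finite S" "finite B" "S \<subseteq> span B"
  shows "dim (span S) \<le> card B"
proof -
  obtain B' where B': "B' \<subseteq> S" "independent B'" "card B' = dim (span S)"
    using finite_basis_dim[OF assms(1)] by metis
  then show ?thesis using independent_span_bound[of B B'] assms by auto
qed

section \<open>Graded algebras generated in degree one\<close>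

locale graded_algebra = vector_space scale
  for scale :: "'k::field \<Rightarrow> 'r::comm_ring_1 \<Rightarrow> 'r" (infixr \<open>\<cdot>\<close> 75) +
  fixes G :: "'r set"
  assumes scale_mult: "c \<cdot> (a * b) = (c \<cdot> a) * b"
    and finite_G: "finite G"
begin

primrec A :: "nat \<Rightarrow> 'r set" where
  "A 0 = span {1}"
| "A (Suc m) = span {x * a | x a. x \<in> G \<and> a \<in> A m}"

primrec mons :: "nat \<Rightarrow> 'r set" where
  "mons 0 = {1}"
| "mons (Suc m) = {x * a | x a. x \<in> G \<and> a \<in> mons m}"

lemma scale_mult_right: "a * (c \<cdot> b) = c \<cdot> (a * b)"
  using scale_mult[of c b a] by (simp add: mult.commute)

lemma mult_mem_span:
  assumes "x \<in> span S" "\<And>s. s \<in> S \<Longrightarrow> a * s \<in> span S'"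
  shows "a * x \<in> span S'"
  using assms(1)
proof (induction rule: span_induct_alt)
  case base
  then show ?case by (simp add: span_zero)
next
  case (step c y z)
  then show ?case using assms(2)
    by (simp add: distrib_left scale_mult_right span_add span_scale)
qed

lemma mult_span_span:
  assumes "x \<in> span S" "y \<in> span S'" "\<And>s s'. s \<in> S \<Longrightarrow> s' \<in> S' \<Longrightarrow> s * s' \<in> span S''"
  shows "x * y \<in> span S''"
proof (rule mult_mem_span[OF assms(2)])
  fix s' assume "s' \<in> S'"
  then have "s' * x \<in> span S''"
    by (intro mult_mem_span[OF assms(1)]) (metis assms(3) mult.commute)
  then show "x * s' \<in> span S''" by (simp add: mult.commute)
qed

lemma finite_mons: "finite (mons m)"
proof (induction m)
  case (Suc m)
  have "mons (Suc m) = (\<lambda>(x, a). x * a) ` (G \<times> mons m)" by auto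
  then show ?case using Suc finite_G by simp
qed simp

lemma A_eq_span: "A m = span (mons m)"
proof (induction m)
  case (Suc m)
  have "{x * a | x a. x \<in> G \<and> a \<in> A m} \<subseteq> span (mons (Suc m))"
  proof clarify
    fix x a assume "x \<in> G" "a \<in> A m"
    then show "x * a \<in> span (mons (Suc m))"
      using \<open>x \<in> G\<close> unfolding Suc by (elim mult_mem_span) (rule span_base, auto)
  qed
  moreover have "mons (Suc m) \<subseteq> {x * a | x a. x \<in> G \<and> a \<in> A m}"
    using Suc span_superset[of "mons m"] by auto
  ultimately have "span {x * a | x a. x \<in> G \<and> a \<in> A m} = span (mons (Suc m))"
    by (intro subset_antisym span_minimal span_mono subspace_span)
  then show ?case by (simp only: A.simps)
qed simp

declare A.simps [simp del]

lemma subspace_A: "subspace (A m)" by (simp add: A_eq_span)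

lemma A_add: "a \<in> A m \<Longrightarrow> b \<in> A m \<Longrightarrow> a + b \<in> A m"
  and A_diff: "a \<in> A m \<Longrightarrow> b \<in> A m \<Longrightarrow> a - b \<in> A m"
  and A_neg: "a \<in> A m \<Longrightarrow> - a \<in> A m"
  and A_scale: "a \<in> A m \<Longrightarrow> c \<cdot> a \<in> A m"
  and A_zero: "0 \<in> A m"
  and A_sum: "(\<And>j. j \<in> J \<Longrightarrow> f j \<in> A m) \<Longrightarrow> sum f J \<in> A m"
  by (simp_all add: A_eq_span span_add span_diff span_neg span_scale span_zero span_sum)

lemma mons_mult: "a \<in> mons m \<Longrightarrow> b \<in> mons l \<Longrightarrow> a * b \<in> mons (m + l)"
proof (induction m arbitrary: a)
  case (Suc m)
  then obtain x a' where "x \<in> G" "a' \<in> mons m" "a = x * a'" by auto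
  then show ?case using Suc by (auto simp: mult.assoc)
qed simp

lemma A_mult: "a \<in> A m \<Longrightarrow> b \<in> A l \<Longrightarrow> a * b \<in> A (m + l)"
  unfolding A_eq_span by (erule mult_span_span) (auto intro: span_base mons_mult)

lemma A_one: "1 \<in> A 0" by (simp add: A.simps span_base)

lemma G_A: "x \<in> G \<Longrightarrow> x \<in> A 1"
  using A_one by (force simp: A.simps intro: span_base)

lemma A_power: "a \<in> A m \<Longrightarrow> a ^ i \<in> A (m * i)"
  by (induction i) (auto simp: A_one A_mult)

lemma A_power1: "a \<in> A (Suc 0) \<Longrightarrow> a ^ i \<in> A i"
  using A_power[of a 1 i] by simp

lemma A_mult': "a \<in> A m \<Longrightarrow> b \<in> A l \<Longrightarrow> n = m + l \<Longrightarrow> a * b \<in> A n"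
  by (simp add: A_mult)

text \<open>For \<open>Z\<close> in degree one, the degree \<open>m + 1\<close> part of the ideal
  generated by \<open>Z\<close>; the index is the degree of the cofactors.\<close>

definition lin :: "'r set \<Rightarrow> nat \<Rightarrow> 'r set" where
  "lin Z m = span {z * a | z a. z \<in> Z \<and> a \<in> A m}"

lemma A_Suc: "A (Suc m) = lin G m"
  by (simp add: lin_def A.simps)

lemma lin_mono: "Z \<subseteq> Z' \<Longrightarrow> lin Z m \<subseteq> lin Z' m"
  unfolding lin_def by (intro span_mono) auto

lemma lin_base: "z \<in> Z \<Longrightarrow> a \<in> A m \<Longrightarrow> z * a \<in> lin Z m"
  unfolding lin_def by (intro span_base) auto

lemma lin_add: "a \<in> lin Z m \<Longrightarrow> b \<in> lin Z m \<Longrightarrow> a + b \<in> lin Z m"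
  and lin_diff: "a \<in> lin Z m \<Longrightarrow> b \<in> lin Z m \<Longrightarrow> a - b \<in> lin Z m"
  and lin_scale: "a \<in> lin Z m \<Longrightarrow> c \<cdot> a \<in> lin Z m"
  and lin_zero: "0 \<in> lin Z m"
  and lin_sum: "(\<And>j. j \<in> J \<Longrightarrow> f j \<in> lin Z m) \<Longrightarrow> sum f J \<in> lin Z m"
  unfolding lin_def by (auto intro: span_add span_diff span_scale span_zero span_sum)

lemma lin_mult: "x \<in> lin Z m \<Longrightarrow> a \<in> A l \<Longrightarrow> x * a \<in> lin Z (m + l)"
  unfolding lin_def
proof (subst mult.commute, erule mult_mem_span)
  fix s assume "a \<in> A l" "s \<in> {z * a | z a. z \<in> Z \<and> a \<in> A m}"
  then obtain z b where "s = z * b" "z \<in> Z" "b \<in> A m" by auto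
  then show "a * s \<in> span {z * a | z a. z \<in> Z \<and> a \<in> A (m + l)}"
    using A_mult[of b m a l] \<open>a \<in> A l\<close> mult.left_commute[of a z b] mult.commute[of a b]
    by (intro span_base CollectI exI[of _ z] exI[of _ "b * a"]) auto
qed

lemma lin_induct [consumes 1, case_names zero add]:
  assumes "x \<in> lin Z m" "P 0" "\<And>z a x. z \<in> Z \<Longrightarrow> a \<in> A m \<Longrightarrow> P x \<Longrightarrow> P (z * a + x)"
  shows "P x"
  using assms(1) unfolding lin_def
proof (induction rule: span_induct_alt)
  case base
  show ?case by (rule assms(2))
next
  case (step c y w)
  then obtain z a where za: "y = z * a" "z \<in> Z" "a \<in> A m" by auto
  then show ?case using assms(3)[of z "c \<cdot> a" w] step(2) by (simp add: scale_mult_right A_scale)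
qed

lemma lin_insert:
  assumes "x \<in> lin (insert y Z) m"
  obtains a w where "a \<in> A m" "w \<in> lin Z m" "x = y * a + w"
proof -
  from assms have "\<exists>a w. a \<in> A m \<and> w \<in> lin Z m \<and> x = y * a + w"
  proof (induction rule: lin_induct)
    case zero
    then show ?case using A_zero lin_zero by (metis add_0 mult_zero_right)
  next
    case (add z a x)
    then obtain b w where bw: "b \<in> A m" "w \<in> lin Z m" "x = y * b + w" by auto
    show ?case
    proof (cases "z = y")
      case True
      then show ?thesis using bw add A_add[of a m b]
        by (intro exI[of _ "a + b"] exI[of _ w]) (simp add: algebra_simps)
    next
      case False
      then have "z * a + w \<in> lin Z m" using bw add lin_add lin_base by auto
      then show ?thesis using bw add
        by (intro exI[of _ b] exI[of _ "z * a + w"]) (auto simp: ac_simps)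
    qed
  qed
  then show ?thesis using that by blast
qed

lemma lin_single: "x \<in> lin {y} m \<longleftrightarrow> (\<exists>a\<in>A m. x = y * a)"
proof
  assume "x \<in> lin {y} m"
  then show "\<exists>a\<in>A m. x = y * a"
    by (elim lin_insert) (auto simp: lin_def)
qed (auto intro: lin_base)

text \<open>\<open>A\<close> is a finite module over the subalgebra generated by \<open>Z\<close>.\<close>

definition red :: "'r set \<Rightarrow> bool" where
  "red Z \<longleftrightarrow> (\<exists>m0. \<forall>m\<ge>m0. A (Suc m) \<subseteq> lin Z m)"

lemma red_mono: "red Z \<Longrightarrow> Z \<subseteq> Z' \<Longrightarrow> red Z'"
  unfolding red_def using lin_mono by blast

lemma red_G: "red G"
  unfolding red_def A_Suc by blast

text \<open>Modulo the ideal of \<open>Z\<close> the form \<open>y\<close> is nilpotent. In large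
  degrees every element is \<open>y\<close> times a form modulo that ideal; iterating
  \<open>q + 1\<close> times leaves a multiple of \<open>y ^ Suc q\<close>, which lies in the
  ideal.\<close>

lemma red_drop:
  assumes "red (insert y Z)" "y \<in> A 1" "Z \<subseteq> A 1" "y ^ Suc q \<in> lin Z q"
  shows "red Z"
proof -
  from assms(1) obtain m0 where m0: "\<And>m. m \<ge> m0 \<Longrightarrow> A (Suc m) \<subseteq> lin (insert y Z) m"
    by (auto simp: red_def)
  have *: "\<exists>a\<in>A m. \<exists>w\<in>lin Z (m + i). x = y ^ Suc i * a + w"
    if "m \<ge> m0" "x \<in> A (Suc (m + i))" for m i x
    using that(2)
  proof (induction i arbitrary: x)
    case 0
    then have "x \<in> lin (insert y Z) m" using m0[OF that(1)] by auto
    then show ?case by (rule lin_insert) auto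
  next
    case (Suc i)
    then have "x \<in> lin (insert y Z) (Suc (m + i))"
      using m0[of "Suc (m + i)"] that by auto
    then obtain a w where a: "a \<in> A (Suc (m + i))" "w \<in> lin Z (Suc (m + i))" "x = y * a + w"
      by (rule lin_insert)
    then obtain a' w' where a': "a' \<in> A m" "w' \<in> lin Z (m + i)" "a = y ^ Suc i * a' + w'"
      using Suc.IH by metis
    have "w' * y \<in> lin Z (Suc (m + i))" using lin_mult[OF a'(2) assms(2)] by simp
    then have "w' * y + w \<in> lin Z (m + Suc i)" using lin_add a(2) by simp
    then show ?case using a a' by (intro bexI[of _ a'] bexI[of _ "w' * y + w"]) (auto simp: algebra_simps)
  qed
  have "A (Suc m) \<subseteq> lin Z m" if "m \<ge> m0 + q" for m
  proof
    fix x assume "x \<in> A (Suc m)"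
    moreover have "m - q + q = m" "m0 \<le> m - q" using that by auto
    ultimately obtain a w where a: "a \<in> A (m - q)" "w \<in> lin Z m" "x = y ^ Suc q * a + w"
      using *[of "m - q" x q] that by (auto simp del: power_Suc)
    have "y ^ Suc q * a \<in> lin Z (q + (m - q))" by (rule lin_mult[OF assms(4) a(1)])
    then show "x \<in> lin Z m" using a that lin_add by simp
  qed
  then show ?thesis by (auto simp: red_def)
qed

end

text \<open>In the application the elements are functions on a set, and the ring of all functions
  has zero divisors; hence cancellation is assumed only between homogeneous elements. The linear
  Hilbert function of slope \<open>d\<close> is how dimension one and degree \<open>d\<close> of the
  curve enter. Characteristic zero supplies infinitely many scalars and separable relations.\<close>

locale graded_domain = graded_algebra scale G
  for scale :: "'k::field \<Rightarrow> 'r::comm_ring_1 \<Rightarrow> 'r" (infixr \<open>\<cdot>\<close> 75) and G :: "'r set" +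
  fixes d :: nat and e0 :: int and m0 :: nat
  assumes dom: "a \<in> A m \<Longrightarrow> b \<in> A l \<Longrightarrow> a * b = 0 \<Longrightarrow> a = 0 \<or> b = 0"
    and dim_A: "m \<ge> m0 \<Longrightarrow> int (dim (A m)) = int d * int m + e0"
    and d_pos: "d > 0"
    and char_0: "of_nat (Suc j) \<noteq> (0::'k)"
begin

section \<open>Noether normalisation by two linear forms\<close>

lemma A_dependent_family:
  assumes "finite J" "\<And>j. j \<in> J \<Longrightarrow> f j \<in> A m" "dim (A m) < card J"
  shows "\<exists>\<gamma>. (\<exists>j\<in>J. \<gamma> j \<noteq> 0) \<and> (\<Sum>j\<in>J. \<gamma> j \<cdot> f j) = 0"
  using dependent_family[of "mons m" J f] finite_mons[of m] assms by (simp add: A_eq_span)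

lemma A_basis:
  obtains B where "finite B" "independent B" "span B = A m" "card B = dim (A m)" "B \<subseteq> mons m"
  using finite_basis_dim[OF finite_mons[of m]] by (metis A_eq_span)

lemma A_dim_le: "finite S \<Longrightarrow> A m \<subseteq> span S \<Longrightarrow> dim (A m) \<le> card S"
  using dim_span_le_card[OF finite_mons[of m]] A_eq_span[of m] span_superset[of "mons m"] by auto

lemma dim_Suc: "m \<ge> m0 \<Longrightarrow> dim (A (Suc m)) = dim (A m) + d"
  using dim_A[of m] dim_A[of "Suc m"] by (simp add: algebra_simps)

lemma infinite_scalars: "infinite (UNIV :: 'k set)"
proof
  assume fin: "finite (UNIV :: 'k set)"
  have "inj (of_nat :: nat \<Rightarrow> 'k)"
  proof (rule injI)
    have *: "x = y" if "x \<le> y" "of_nat x = (of_nat y :: 'k)" for x y :: nat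
    proof (rule ccontr)
      assume "x \<noteq> y"
      then obtain j where "y = x + Suc j" using \<open>x \<le> y\<close> by (metis add_Suc_right le_Suc_ex less_imp_Suc_add nat_less_le)
      with that(2) have "(of_nat x::'k) + of_nat (Suc j) = of_nat x + 0" by simp
      then have "of_nat (Suc j) = (0::'k)" by (rule add_left_imp_eq)
      then show False using char_0 by blast
    qed
    fix x y :: nat assume "of_nat x = (of_nat y :: 'k)"
    then show "x = y" using *[of x y] *[of y x] by (metis nat_le_linear)
  qed
  with finite_subset[OF subset_UNIV fin] have "finite (UNIV :: nat set)"
    by (metis finite_imageD)
  then show False by simp
qed

lemma power_nonzero: "a \<in> A 1 \<Longrightarrow> a \<noteq> 0 \<Longrightarrow> a ^ i \<noteq> 0"
proof (induction i)
  case (Suc i)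
  then show ?case using dom[of a 1 "a ^ i" i] A_power1[of a i] by auto
qed simp

lemma independent_mult:
  assumes "independent B" "finite B" "B \<subseteq> A m" "u \<in> A l" "u \<noteq> 0"
  shows "inj_on ((*) u) B" "independent ((*) u ` B)"
proof -
  have eq: "x = y" if "x \<in> A m" "y \<in> A m" "u * x = u * y" for x y
    using dom[OF assms(4) A_diff[OF that(1,2)]] assms(5) that(3) by (auto simp: algebra_simps)
  show inj: "inj_on ((*) u) B" by (intro inj_onI) (use eq assms(3) in auto)
  show "independent ((*) u ` B)"
    unfolding independent_explicit_module
  proof (intro allI impI)
    fix t c v assume t: "finite t" "t \<subseteq> (*) u ` B" "(\<Sum>v\<in>t. c v \<cdot> v) = 0" "v \<in> t"
    then obtain B' where B': "B' \<subseteq> B" "t = (*) u ` B'" by (meson subset_imageE)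
    have injB': "inj_on ((*) u) B'" using inj B' by (meson inj_on_subset)
    have "u * (\<Sum>b\<in>B'. c (u * b) \<cdot> b) = (\<Sum>v\<in>t. c v \<cdot> v)"
      unfolding B' by (simp add: sum.reindex[OF injB'] sum_distrib_left scale_mult_right)
    then have "(\<Sum>b\<in>B'. c (u * b) \<cdot> b) = 0"
      using t(3) assms(3,4,5) B' dom[of u l "\<Sum>b\<in>B'. c (u * b) \<cdot> b" m]
      by (auto intro!: A_sum A_scale)
    moreover obtain b where b: "b \<in> B'" "v = u * b" using t(4) B' by auto
    moreover have "finite B'" using B' assms(2) finite_subset by blast
    ultimately show "c v = 0"
      using assms(1) B'(1) by (metis independentD)
  qed
qed

text \<open>Multiplication by \<open>u\<close> is injective, so in large degrees the quotient of
  \<open>A (Suc M)\<close> by \<open>u A M\<close> has dimension \<open>d\<close>, and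
  \<open>d + 1\<close> monomials in \<open>y\<close> and \<open>z\<close> are dependent
  there.\<close>

lemma binary_relation_mod:
  assumes "u \<in> A 1" "u \<noteq> 0" "y \<in> A 1" "z \<in> A 1"
  shows "\<exists>M\<ge>d. \<exists>\<gamma>. (\<exists>i\<le>d. \<gamma> i \<noteq> 0) \<and> (\<Sum>i\<le>d. \<gamma> i \<cdot> (y ^ i * z ^ (Suc M - i))) \<in> lin {u} M"
proof -
  define M where "M = d + m0"
  obtain B where B: "finite B" "independent B" "span B = A M" "card B = dim (A M)"
    by (rule A_basis)
  define J where "J = Inl ` {..d} \<union> Inr ` B"
  define f where "f = case_sum (\<lambda>i. y ^ i * z ^ (Suc M - i)) (\<lambda>b. u * b)"
  have BA: "b \<in> A M" if "b \<in> B" for b using B that by (metis span_base)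
  have "f j \<in> A (Suc M)" if "j \<in> J" for j
  proof -
    have "i \<le> d \<Longrightarrow> y ^ i * z ^ (Suc M - i) \<in> A (Suc M)" for i
      using assms(3,4) by (intro A_mult'[where m = i and l = "Suc M - i"] A_power1) (auto simp: M_def)
    moreover have "b \<in> B \<Longrightarrow> u * b \<in> A (Suc M)" for b
      using A_mult[OF assms(1) BA] by simp
    ultimately show ?thesis using that by (auto simp: J_def f_def)
  qed
  moreover have fin: "finite J" using B(1) by (simp add: J_def)
  moreover have "card J = Suc d + card B"
    unfolding J_def using B(1) by (subst card_Un_disjoint) (auto simp: card_image)
  then have "dim (A (Suc M)) < card J"
    using B(4) dim_Suc[of M] by (simp add: M_def)
  ultimately obtain \<gamma> where \<gamma>: "\<exists>j\<in>J. \<gamma> j \<noteq> 0" "(\<Sum>j\<in>J. \<gamma> j \<cdot> f j) = 0"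
    using A_dependent_family[of J f "Suc M"] by blast
  have "(\<Sum>j\<in>J. \<gamma> j \<cdot> f j) = (\<Sum>j\<in>Inl ` {..d}. \<gamma> j \<cdot> f j) + (\<Sum>j\<in>Inr ` B. \<gamma> j \<cdot> f j)"
    unfolding J_def using B(1) by (intro sum.union_disjoint) auto
  also have "(\<Sum>j\<in>Inl ` {..d}. \<gamma> j \<cdot> f j) = (\<Sum>i\<le>d. \<gamma> (Inl i) \<cdot> (y ^ i * z ^ (Suc M - i)))"
    by (subst sum.reindex) (auto simp: f_def)
  also have "(\<Sum>j\<in>Inr ` B. \<gamma> j \<cdot> f j) = u * (\<Sum>b\<in>B. \<gamma> (Inr b) \<cdot> b)"
    by (subst sum.reindex) (auto simp: f_def sum_distrib_left scale_mult_right)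
  finally have eq: "(\<Sum>i\<le>d. \<gamma> (Inl i) \<cdot> (y ^ i * z ^ (Suc M - i))) = u * (- (\<Sum>b\<in>B. \<gamma> (Inr b) \<cdot> b))"
    using \<gamma>(2) by (simp add: eq_neg_iff_add_eq_0)
  have inA: "(\<Sum>b\<in>B. \<gamma> (Inr b) \<cdot> b) \<in> A M" by (intro A_sum A_scale BA)
  have "\<exists>i\<le>d. \<gamma> (Inl i) \<noteq> 0"
  proof (rule ccontr)
    assume neg: "\<not> ?thesis"
    then have "u * (\<Sum>b\<in>B. \<gamma> (Inr b) \<cdot> b) = 0" using eq by simp
    then have "(\<Sum>b\<in>B. \<gamma> (Inr b) \<cdot> b) = 0" using dom[OF assms(1) inA] assms(2) by simp
    then have "\<forall>b\<in>B. \<gamma> (Inr b) = 0" using B(1,2) independentD by fast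
    then show False using \<gamma>(1) neg by (auto simp: J_def)
  qed
  moreover have "(\<Sum>i\<le>d. \<gamma> (Inl i) \<cdot> (y ^ i * z ^ (Suc M - i))) \<in> lin {u} M"
    unfolding eq by (intro lin_base A_neg inA) simp
  moreover have "M \<ge> d" by (simp add: M_def)
  ultimately show ?thesis
    by (intro exI[of _ M] conjI) (auto intro!: exI[of _ "\<lambda>i. \<gamma> (Inl i)"])
qed

lemma power_diff_lin:
  assumes "y \<in> A 1" "z \<in> A 1"
  shows "y ^ Suc i - z ^ Suc i \<in> lin {y - z} i"
proof (induction i)
  case 0
  then show ?case using lin_base[of "y - z" "{y - z}" 1 0] A_one by simp
next
  case (Suc i)
  have "y ^ Suc (Suc i) - z ^ Suc (Suc i) = (y ^ Suc i - z ^ Suc i) * y + (y - z) * z ^ Suc i"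
    by (simp add: algebra_simps)
  moreover have "(y ^ Suc i - z ^ Suc i) * y \<in> lin {y - z} (Suc i)"
    using lin_mult[OF Suc assms(1)] by simp
  moreover have "(y - z) * z ^ Suc i \<in> lin {y - z} (Suc i)"
    using A_power1[of z "Suc i"] assms(2) by (intro lin_base) auto
  ultimately show ?case using lin_add by simp
qed

lemma red_step:
  assumes "u \<in> A 1" "u \<noteq> 0" "y \<in> A 1" "z \<in> A 1" "Y \<subseteq> A 1" "red (insert u (insert y (insert z Y)))"
  shows "\<exists>y'\<in>A 1. red (insert u (insert y' Y))"
proof -
  obtain M \<gamma> where M: "M \<ge> d" and \<gamma>: "\<exists>i\<le>d. \<gamma> i \<noteq> 0"
    and rel: "(\<Sum>i\<le>d. \<gamma> i \<cdot> (y ^ i * z ^ (Suc M - i))) \<in> lin {u} M"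
    using binary_relation_mod[OF assms(1-4)] by blast
  define p where "p = (\<Sum>i\<le>d. Polynomial.monom (\<gamma> i) i)"
  have "p \<noteq> 0"
  proof
    assume "p = 0"
    then have "Polynomial.coeff p i = 0" for i by simp
    moreover obtain i where "i \<le> d" "\<gamma> i \<noteq> 0" using \<gamma> by blast
    moreover have "Polynomial.coeff p i = (if i \<le> d then \<gamma> i else 0)" by (simp add: p_def coeff_sum)
    ultimately show False by simp
  qed
  then have "finite {x. poly p x = 0}" by (rule poly_roots_finite)
  then obtain l where l: "poly p l \<noteq> 0" using infinite_scalars ex_new_if_finite[of "{x. poly p x = 0}"] by blast
  define y' where "y' = y - l \<cdot> z"
  have y': "y' \<in> A 1" using assms unfolding y'_def by (intro A_diff A_scale)
  let ?Z = "insert u (insert y' Y)"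
  have pw: "y ^ i * z ^ (Suc M - i) - (l ^ i) \<cdot> z ^ Suc M \<in> lin {y'} M" if "i \<le> d" for i
  proof (cases i)
    case 0
    then show ?thesis by (simp add: lin_zero)
  next
    case (Suc j)
    have "(y ^ i - (l \<cdot> z) ^ i) * z ^ (Suc M - i) \<in> lin {y'} (j + (Suc M - i))"
      using power_diff_lin[of y "l \<cdot> z" j] assms A_scale[of z 1 l] A_power1[of z "Suc M - i"]
      unfolding Suc y'_def by (intro lin_mult) auto
    moreover have "(l \<cdot> z) ^ i = (l ^ i) \<cdot> z ^ i"
      by (induction i) (simp_all add: scale_mult_right flip: scale_mult)
    then have "(l \<cdot> z) ^ i * z ^ (Suc M - i) = (l ^ i) \<cdot> z ^ Suc M"
      using M that by (simp flip: scale_mult power_add)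
    moreover have "j + (Suc M - i) = M" using Suc M that by simp
    ultimately show ?thesis by (simp add: algebra_simps)
  qed
  have "(\<Sum>i\<le>d. \<gamma> i \<cdot> (y ^ i * z ^ (Suc M - i) - (l ^ i) \<cdot> z ^ Suc M)) \<in> lin {y'} M"
    by (intro lin_sum lin_scale pw) auto
  also have "(\<Sum>i\<le>d. \<gamma> i \<cdot> (y ^ i * z ^ (Suc M - i) - (l ^ i) \<cdot> z ^ Suc M))
      = (\<Sum>i\<le>d. \<gamma> i \<cdot> (y ^ i * z ^ (Suc M - i))) - poly p l \<cdot> z ^ Suc M"
    by (simp add: p_def poly_sum poly_monom scale_right_diff_distrib sum_subtractf scale_sum_left)
  finally have 1: "(\<Sum>i\<le>d. \<gamma> i \<cdot> (y ^ i * z ^ (Suc M - i))) - poly p l \<cdot> z ^ Suc M \<in> lin {y'} M" .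
  have "poly p l \<cdot> z ^ Suc M \<in> lin ?Z M"
    using lin_diff[OF subsetD[OF lin_mono rel] subsetD[OF lin_mono 1], of ?Z] by simp
  then have "inverse (poly p l) \<cdot> poly p l \<cdot> z ^ Suc M \<in> lin ?Z M" by (rule lin_scale)
  then have zM: "z ^ Suc M \<in> lin ?Z M" using l by simp
  have "lin (insert u (insert y (insert z Y))) m \<subseteq> lin (insert z ?Z) m" for m
  proof
    fix x assume "x \<in> lin (insert u (insert y (insert z Y))) m"
    then show "x \<in> lin (insert z ?Z) m"
    proof (induction rule: lin_induct)
      case zero
      then show ?case by (rule lin_zero)
    next
      case (add w a x)
      have "w * a \<in> lin (insert z ?Z) m"
      proof (cases "w = y")
        case True
        have "w * a = y' * a + z * (l \<cdot> a)"
          unfolding y'_def True by (simp add: algebra_simps scale_mult_right flip: scale_mult)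
        then show ?thesis using add by (auto intro!: lin_add lin_base A_scale)
      next
        case False
        then show ?thesis using add by (intro lin_base) auto
      qed
      then show ?case using add lin_add by blast
    qed
  qed
  then have "red (insert z ?Z)" using assms(6) unfolding red_def by blast
  then have "red ?Z" using red_drop zM assms y' by (metis insert_subset)
  then show ?thesis using y' by blast
qed

lemma exists_nonzero: "\<exists>u\<in>A 1. u \<noteq> 0"
proof (rule ccontr)
  assume neg: "\<not> ?thesis"
  then have G: "x = 0" if "x \<in> G" for x using G_A that by auto
  \<comment> \<open>Large enough for \<open>d m + e0 > 0\<close>, so that \<open>A m\<close> cannot
    be zero.\<close>
  define m where "m = Suc (m0 + nat \<bar>e0\<bar>)"
  have "a = 0" if "a \<in> A m" for a
    using that unfolding m_def A_Suc by (induction rule: lin_induct) (use G in force)+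
  then have "A m \<subseteq> span {}" by auto
  then have "dim (A m) \<le> 0" using A_dim_le[of "{}" m] by simp
  then have "int d * int m + e0 \<le> 0" using dim_A[of m] by (simp add: m_def)
  moreover have "int d * int m \<ge> 1 * int m" using d_pos by (intro mult_right_mono) auto
  ultimately show False by (auto simp: m_def)
qed

lemma noether_pair: "\<exists>u v. u \<in> A 1 \<and> v \<in> A 1 \<and> u \<noteq> 0 \<and> red {u, v}"
proof -
  obtain u where u: "u \<in> A 1" "u \<noteq> 0" using exists_nonzero by blast
  have "\<exists>v\<in>A 1. red {u, v}" if "finite Y" "Y \<subseteq> A 1" "red (insert u Y)" for Y
    using that
  proof (induction "card Y" arbitrary: Y rule: less_induct)
    case less
    show ?case
    proof (cases "\<exists>y z. y \<in> Y \<and> z \<in> Y \<and> y \<noteq> z")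
      case True
      then obtain y z where yz: "y \<in> Y" "z \<in> Y" "y \<noteq> z" by blast
      define Y' where "Y' = Y - {y, z}"
      have "insert u (insert y (insert z Y')) = insert u Y" using yz by (auto simp: Y'_def)
      then obtain y' where y': "y' \<in> A 1" "red (insert u (insert y' Y'))"
        using red_step[of u y z Y'] u yz less.prems by (auto simp: Y'_def)
      have "card Y' = card Y - 2"
        using yz less.prems unfolding Y'_def by (subst card_Diff_subset) auto
      moreover have "card {y, z} \<le> card Y" using yz less.prems(1) by (intro card_mono) auto
      ultimately have "card (insert y' Y') < card Y"
        using yz card_insert_le_m1[of "card Y - 1" Y' y'] less.prems(1) card_insert_if[of Y' y']
        by (auto simp: Y'_def split: if_splits)
      moreover have "finite (insert y' Y')" "insert y' Y' \<subseteq> A 1"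
        using less.prems y' by (auto simp: Y'_def)
      ultimately show ?thesis using less.hyps y'(2) by blast
    next
      case False
      then consider "Y = {}" | y where "Y = {y}" by blast
      then show ?thesis
      proof cases
        case 1
        with less.prems u show ?thesis by (intro bexI[of _ u]) simp_all
      next
        case 2
        with less.prems show ?thesis by (intro bexI[of _ y]) simp_all
      qed
    qed
  qed
  moreover have "red (insert u G)" using red_mono[OF red_G] by blast
  ultimately show ?thesis using u finite_G G_A by blast
qed

end

lemma (in vector_space) independent_unionI:
  assumes "finite B" "independent B" "finite C"
    and "\<And>\<gamma>. (\<Sum>c\<in>C. scale (\<gamma> c) c) \<in> span B \<Longrightarrow> \<forall>c\<in>C. \<gamma> c = 0"
  shows "independent (B \<union> C)" "B \<inter> C = {}"
proof -
  show disj: "B \<inter> C = {}"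
  proof (rule ccontr)
    assume "B \<inter> C \<noteq> {}"
    then obtain x where x: "x \<in> B" "x \<in> C" by blast
    have "(\<Sum>c\<in>C. scale (if c = x then 1 else 0) c) = (\<Sum>c\<in>C. if c = x then x else 0)"
      by (intro sum.cong) auto
    also have "\<dots> = x" using x assms(3) by simp
    finally show False using assms(4)[of "\<lambda>c. if c = x then 1 else 0"] x span_base[of x B] by auto
  qed
  show "independent (B \<union> C)"
  proof (subst independent_if_scalars_zero)
    fix \<gamma> x assume eq: "(\<Sum>x\<in>B \<union> C. scale (\<gamma> x) x) = 0" and x: "x \<in> B \<union> C"
    have s: "(\<Sum>x\<in>B. scale (\<gamma> x) x) + (\<Sum>x\<in>C. scale (\<gamma> x) x) = 0"
      using eq sum.union_disjoint[OF assms(1,3) disj, of "\<lambda>x. scale (\<gamma> x) x"] by simp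
    then have "(\<Sum>x\<in>C. scale (\<gamma> x) x) = - (\<Sum>x\<in>B. scale (\<gamma> x) x)"
      by (simp add: eq_neg_iff_add_eq_0 add.commute)
    also have "\<dots> \<in> span B" by (intro span_neg span_sum span_scale span_base)
    finally have C: "\<forall>c\<in>C. \<gamma> c = 0" by (rule assms(4))
    then have "(\<Sum>x\<in>B. scale (\<gamma> x) x) = 0" using s by simp
    then have "\<forall>x\<in>B. \<gamma> x = 0" using assms(1,2) independentD by fast
    with C x show "\<gamma> x = 0" by blast
  qed (use assms in auto)
qed

context graded_domain
begin

section \<open>A lower bound for the Hilbert function in every degree\<close>

lemma A_indep_card_le:
  assumes "independent C" "C \<subseteq> A m"
  shows "card C \<le> dim (A m)" "finite C"
  using A_basis[of m] independent_span_bound assms by metis+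

text \<open>Finiteness over \<open>u\<close> alone would make multiplication by \<open>u\<close>
  surjective in large degrees and stop the growth of the Hilbert function.\<close>

lemma not_red_single:
  assumes "u \<in> A 1"
  shows "\<not> red {u}"
proof
  assume "red {u}"
  then obtain m1 where m1: "\<And>m. m \<ge> m1 \<Longrightarrow> A (Suc m) \<subseteq> lin {u} m" by (auto simp: red_def)
  define m where "m = max m0 m1"
  obtain B where B: "finite B" "span B = A m" "card B = dim (A m)" by (rule A_basis)
  have "A (Suc m) \<subseteq> span ((*) u ` B)"
  proof
    fix x assume "x \<in> A (Suc m)"
    then obtain a where "a \<in> A m" "x = u * a"
      using m1[of m] by (auto simp: m_def lin_single dest!: subsetD)
    then show "x \<in> span ((*) u ` B)"
      using B(2) by (auto intro!: mult_mem_span[of a B] intro: span_base)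
  qed
  then have "dim (A (Suc m)) \<le> card ((*) u ` B)" using B by (intro A_dim_le) auto
  also have "\<dots> \<le> dim (A m)" using card_image_le[OF B(1), of "(*) u"] B(3) by simp
  finally show False using dim_Suc[of m] d_pos by (simp add: m_def)
qed

lemma power_not_lin:
  assumes "u \<in> A 1" "v \<in> A 1" "red {u, v}"
  shows "v ^ Suc q \<notin> lin {u} q"
proof
  assume "v ^ Suc q \<in> lin {u} q"
  then have "red {u}" using red_drop[of v "{u}" q] assms by (simp add: insert_commute)
  then show False using not_red_single assms by blast
qed

lemma power_not_mult:
  assumes "u \<in> A 1" "v \<in> A 1" "red {u, v}" "b \<in> A q" "v ^ Suc q = u * b"
  shows False
  using power_not_lin[OF assms(1-3), of q] assms(4,5) by (auto simp: lin_single)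

lemma v_nonzero:
  assumes "u \<in> A 1" "v \<in> A 1" "red {u, v}"
  shows "v \<noteq> 0"
  using power_not_lin[OF assms, of 0] lin_zero by auto

text \<open>Cancelling the lowest power of \<open>u\<close> leaves a nonzero multiple of a power of
  \<open>v\<close> plus a multiple of \<open>u\<close>. So a power of \<open>v\<close> would lie in
  the ideal of \<open>u\<close>, and \<open>A\<close> would be finite over \<open>u\<close>
  alone.\<close>

lemma binary_independent:
  assumes "u \<in> A 1" "v \<in> A 1" "u \<noteq> 0" "red {u, v}"
    and rel: "(\<Sum>i\<le>M. \<gamma> i \<cdot> (u ^ i * v ^ (M - i))) = 0" and "i \<le> M"
  shows "\<gamma> i = 0"
proof (rule ccontr)
  assume neg: "\<gamma> i \<noteq> 0"
  have "\<exists>j. \<gamma> j \<noteq> 0 \<and> (\<forall>l<j. \<not> \<gamma> l \<noteq> 0)"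
    using exists_least_iff[of "\<lambda>j. \<gamma> j \<noteq> 0"] neg by blast
  then obtain j where j1: "\<gamma> j \<noteq> 0" "\<And>l. l < j \<Longrightarrow> \<gamma> l = 0" by blast
  then have "\<not> i < j" using neg by blast
  then have "j \<le> M" using assms(6) by simp
  note j = j1(1) this j1(2)
  define w where "w = (\<Sum>i\<in>{j<..M}. \<gamma> i \<cdot> (u ^ (i - Suc j) * v ^ (M - i)))"
  have "(\<Sum>i\<le>M. \<gamma> i \<cdot> (u ^ i * v ^ (M - i))) = (\<Sum>i\<in>insert j {j<..M}. \<gamma> i \<cdot> (u ^ i * v ^ (M - i)))"
  proof (intro sum.mono_neutral_right ballI)
    fix l assume "l \<in> {..M} - insert j {j<..M}"
    then have "l < j" by auto
    then show "\<gamma> l \<cdot> (u ^ l * v ^ (M - l)) = 0" using j(3) by simp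
  qed (use j in auto)
  also have "\<dots> = \<gamma> j \<cdot> (u ^ j * v ^ (M - j)) + (\<Sum>i\<in>{j<..M}. \<gamma> i \<cdot> (u ^ i * v ^ (M - i)))"
    by simp
  also have "(\<Sum>i\<in>{j<..M}. \<gamma> i \<cdot> (u ^ i * v ^ (M - i))) = u ^ j * (u * w)"
    unfolding w_def sum_distrib_left
  proof (intro sum.cong refl)
    fix i assume "i \<in> {j<..M}"
    then have "i = j + Suc (i - Suc j)" by simp
    then have "u ^ i = u ^ (j + Suc (i - Suc j))" by (rule arg_cong)
    then have "u ^ i = u ^ j * (u * u ^ (i - Suc j))" by (simp only: power_add power_Suc)
    then show "\<gamma> i \<cdot> (u ^ i * v ^ (M - i)) = u ^ j * (u * (\<gamma> i \<cdot> (u ^ (i - Suc j) * v ^ (M - i))))"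
      by (simp add: scale_mult_right mult.assoc)
  qed
  also have "\<gamma> j \<cdot> (u ^ j * v ^ (M - j)) + u ^ j * (u * w) = u ^ j * (\<gamma> j \<cdot> v ^ (M - j) + u * w)"
    by (simp add: distrib_left scale_mult_right)
  finally have eq0: "u ^ j * (\<gamma> j \<cdot> v ^ (M - j) + u * w) = 0" using rel by simp
  show False
  proof (cases "j = M")
    case True
    then have "u ^ j * (\<gamma> j \<cdot> 1) = 0" using eq0 by (simp add: w_def)
    moreover have "u ^ j \<in> A j" using A_power1 assms(1) by simp
    ultimately have "u ^ j = 0 \<or> \<gamma> j \<cdot> 1 = 0" using dom A_scale[OF A_one] by blast
    then have "\<gamma> j \<cdot> 1 = 0" using power_nonzero[OF assms(1,3)] by blast
    then show False using j by simp
  next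
    case False
    then obtain q where q: "M - j = Suc q" using j(2) by (cases "M - j") auto
    have wA: "w \<in> A q"
      unfolding w_def using assms(1,2) q j(2)
      by (intro A_sum A_scale A_mult'[OF A_power1 A_power1]) auto
    have "\<gamma> j \<cdot> v ^ (M - j) + u * w \<in> A (Suc q)"
      using A_mult[OF assms(1) wA] A_power1[of v "Suc q"] assms(2) q by (intro A_add A_scale) auto
    moreover have "u ^ j \<in> A j" using A_power1 assms(1) by simp
    ultimately have "\<gamma> j \<cdot> v ^ Suc q + u * w = 0"
      using dom eq0 power_nonzero[OF assms(1,3)] unfolding q by blast
    then have "\<gamma> j \<cdot> v ^ Suc q = u * (- w)" by (simp add: eq_neg_iff_add_eq_0)
    then have "inverse (\<gamma> j) \<cdot> \<gamma> j \<cdot> v ^ Suc q = u * (inverse (\<gamma> j) \<cdot> - w)"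
      by (simp only: scale_mult_right)
    then have "v ^ Suc q = u * (inverse (\<gamma> j) \<cdot> - w)" using j by simp
    moreover have "inverse (\<gamma> j) \<cdot> - w \<in> A q" using wA A_scale A_neg by blast
    ultimately show False using power_not_mult assms by blast
  qed
qed

text \<open>The degree \<open>m\<close> part of the \<open>v\<close>-torsion of \<open>A\<close> modulo \<open>u\<close>.\<close>

definition tors :: "'r \<Rightarrow> 'r \<Rightarrow> nat \<Rightarrow> 'r set" where
  "tors u v m = {a \<in> A m. \<exists>j. \<exists>b\<in>A (m + j). v ^ Suc j * a = u * b}"

text \<open>Independence in the degree \<open>m\<close> part of \<open>A\<close> modulo the
  \<open>v\<close>-saturation of the ideal of \<open>u\<close>. Geometrically this quotient is the
  coordinate ring of the hyperplane section \<open>u = 0\<close>, on which multiplication by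
  \<open>v\<close> is injective.\<close>

definition relindep :: "'r \<Rightarrow> 'r \<Rightarrow> nat \<Rightarrow> 'r set \<Rightarrow> bool" where
  "relindep u v m C \<longleftrightarrow> finite C \<and> C \<subseteq> A m \<and>
     (\<forall>\<gamma>. (\<Sum>c\<in>C. \<gamma> c \<cdot> c) \<in> tors u v m \<longrightarrow> (\<forall>c\<in>C. \<gamma> c = 0))"

lemma tors_scale: "a \<in> tors u v m \<Longrightarrow> c \<cdot> a \<in> tors u v m"
  unfolding tors_def by (auto simp: scale_mult_right A_scale) (metis A_scale scale_mult_right)

lemma tors_mult:
  assumes "a \<in> tors u v m" "x \<in> A l"
  shows "a * x \<in> tors u v (m + l)"
proof -
  from assms obtain j b where "a \<in> A m" "b \<in> A (m + j)" "v ^ Suc j * a = u * b"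
    by (auto simp: tors_def)
  then have "a * x \<in> A (m + l)" "b * x \<in> A (m + l + j)" "v ^ Suc j * (a * x) = u * (b * x)"
    using assms(2) by (auto simp del: power_Suc simp flip: mult.assoc intro: A_mult A_mult')
  then show ?thesis unfolding tors_def by blast
qed

lemma tors_raise:
  assumes "v \<in> A 1" "a \<in> A m" "b \<in> A (m + j)" "v ^ Suc j * a = u * b"
  shows "\<exists>b'\<in>A (m + (i + j)). v ^ Suc (i + j) * a = u * b'"
proof (rule bexI[of _ "v ^ i * b"])
  show "v ^ Suc (i + j) * a = u * (v ^ i * b)"
  proof -
    have "v ^ Suc (i + j) * a = v ^ i * (v ^ Suc j * a)" by (simp add: power_add ac_simps)
    then show ?thesis unfolding assms(4) by (simp add: ac_simps)
  qed
  show "v ^ i * b \<in> A (m + (i + j))"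
    using A_power1[of v i] assms by (intro A_mult'[OF _ assms(3)]) auto
qed

lemma tors_add:
  assumes "v \<in> A 1" "a \<in> tors u v m" "b \<in> tors u v m"
  shows "a + b \<in> tors u v m"
proof -
  from assms obtain i j x y where
    "a \<in> A m" "x \<in> A (m + i)" "v ^ Suc i * a = u * x"
    "b \<in> A m" "y \<in> A (m + j)" "v ^ Suc j * b = u * y"
    by (auto simp: tors_def simp del: power_Suc)
  moreover from this obtain x' y' where
    "x' \<in> A (m + (j + i))" "v ^ Suc (j + i) * a = u * x'"
    "y' \<in> A (m + (i + j))" "v ^ Suc (i + j) * b = u * y'"
    using tors_raise[OF assms(1)] by meson
  ultimately have "a + b \<in> A m" "x' + y' \<in> A (m + (i + j))" "v ^ Suc (i + j) * (a + b) = u * (x' + y')"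
    by (auto simp: A_add distrib_left add.commute)
  then show ?thesis unfolding tors_def by blast
qed

lemma tors_zero: "0 \<in> tors u v m"
  unfolding tors_def using A_zero by force

lemma tors_base:
  assumes "v \<in> A 1" "b \<in> A m" "u \<in> A 1"
  shows "u * b \<in> tors u v (Suc m)"
proof -
  have "v ^ Suc 0 * (u * b) = u * (v * b)" by (simp add: ac_simps)
  moreover have "v * b \<in> A (Suc m + 0)" using A_mult[OF assms(1,2)] by simp
  ultimately show ?thesis using A_mult[OF assms(3,2)] unfolding tors_def
    by (intro CollectI conjI exI[of _ 0] bexI[of _ "v * b"]) auto
qed

lemma tors_cancel:
  assumes "a \<in> A m" "v * a \<in> tors u v (Suc m)"
  shows "a \<in> tors u v m"
proof -
  from assms obtain j b where "b \<in> A (Suc m + j)" "v ^ Suc j * (v * a) = u * b"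
    by (auto simp: tors_def)
  then have "b \<in> A (m + Suc j)" "v ^ Suc (Suc j) * a = u * b" by (auto simp: ac_simps)
  with assms(1) show ?thesis unfolding tors_def by blast
qed

end

context graded_domain
begin

lemma relindep_grow:
  assumes "u \<in> A 1" "v \<in> A 1" "u \<noteq> 0" "red {u, v}" "relindep u v m C"
  shows "relindep u v (Suc m) ((*) v ` C)" "card ((*) v ` C) = card C"
proof -
  have v0: "v \<noteq> 0" using v_nonzero assms by blast
  have C: "finite C" "C \<subseteq> A m"
    and ind: "\<And>\<gamma>. (\<Sum>c\<in>C. \<gamma> c \<cdot> c) \<in> tors u v m \<Longrightarrow> \<forall>c\<in>C. \<gamma> c = 0"
    using assms(5) by (auto simp: relindep_def)
  have inj: "inj_on ((*) v) C"
  proof (rule inj_onI)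
    fix x y assume xy: "x \<in> C" "y \<in> C" "v * x = v * y"
    have "x - y \<in> A m" using xy C A_diff by blast
    moreover have "v * (x - y) = 0" using xy(3) by (simp add: right_diff_distrib)
    ultimately have "x - y = 0" using dom[OF assms(2)] v0 by blast
    then show "x = y" by simp
  qed
  then show "card ((*) v ` C) = card C" by (rule card_image)
  show "relindep u v (Suc m) ((*) v ` C)"
    unfolding relindep_def
  proof (intro conjI allI impI)
    show "(*) v ` C \<subseteq> A (Suc m)" using A_mult[OF assms(2)] C(2) by auto
  next
    fix \<gamma> assume "(\<Sum>c\<in>(*) v ` C. \<gamma> c \<cdot> c) \<in> tors u v (Suc m)"
    also have "(\<Sum>c\<in>(*) v ` C. \<gamma> c \<cdot> c) = v * (\<Sum>c\<in>C. \<gamma> (v * c) \<cdot> c)"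
      by (simp add: sum.reindex[OF inj] sum_distrib_left scale_mult_right)
    finally have "(\<Sum>c\<in>C. \<gamma> (v * c) \<cdot> c) \<in> tors u v m"
    proof (rule tors_cancel[rotated])
      show "(\<Sum>c\<in>C. \<gamma> (v * c) \<cdot> c) \<in> A m" using C(2) by (intro A_sum A_scale) auto
    qed
    then show "\<forall>c\<in>(*) v ` C. \<gamma> c = 0" using ind[of "\<lambda>c. \<gamma> (v * c)"] by auto
  qed (use C in simp)
qed

lemma relindep_span:
  assumes "v \<in> A 1" "relindep u v m C" "a \<in> A m" "\<not> (\<exists>C'. relindep u v m C' \<and> card C' = Suc (card C))"
  shows "\<exists>s\<in>span C. \<exists>t\<in>tors u v m. a = s + t"
proof (cases "a \<in> C")
  case True
  then show ?thesis using span_base[of a C] tors_zero by force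
next
  case False
  have C: "finite C" "C \<subseteq> A m"
    and ind: "\<And>\<gamma>. (\<Sum>c\<in>C. \<gamma> c \<cdot> c) \<in> tors u v m \<Longrightarrow> \<forall>c\<in>C. \<gamma> c = 0"
    using assms(2) by (auto simp: relindep_def)
  have "card (insert a C) = Suc (card C)" using False C by simp
  then have "\<not> relindep u v m (insert a C)" using assms(4) by blast
  then obtain \<gamma> where \<gamma>: "(\<Sum>c\<in>insert a C. \<gamma> c \<cdot> c) \<in> tors u v m" "\<exists>c\<in>insert a C. \<gamma> c \<noteq> 0"
    using C assms(3) unfolding relindep_def by auto
  have eq: "(\<Sum>c\<in>insert a C. \<gamma> c \<cdot> c) = \<gamma> a \<cdot> a + (\<Sum>c\<in>C. \<gamma> c \<cdot> c)" using False C by simp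
  have "\<gamma> a \<noteq> 0"
  proof
    assume "\<gamma> a = 0"
    then show False using ind[of \<gamma>] \<gamma> eq by auto
  qed
  define t where "t = inverse (\<gamma> a) \<cdot> (\<Sum>c\<in>insert a C. \<gamma> c \<cdot> c)"
  define s where "s = - (inverse (\<gamma> a) \<cdot> (\<Sum>c\<in>C. \<gamma> c \<cdot> c))"
  have "s \<in> span C" unfolding s_def by (intro span_neg span_scale span_sum span_base)
  moreover have "t \<in> tors u v m" unfolding t_def by (rule tors_scale[OF \<gamma>(1)])
  moreover have "a = s + t" using \<open>\<gamma> a \<noteq> 0\<close> unfolding s_def t_def eq by (simp add: scale_right_distrib)
  ultimately show ?thesis by blast
qed

text \<open>A torsion element outside \<open>u A m\<close> would make multiplication by
  \<open>v\<close> lose a dimension: \<open>A (Suc (Suc m))\<close> would be spanned by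
  \<open>u A (Suc m)\<close> and the \<open>v\<close>-multiples of only \<open>d - 1\<close> further
  elements, against the growth by \<open>d\<close>.\<close>

lemma tors_eventually:
  assumes "u \<in> A 1" "v \<in> A 1" "u \<noteq> 0" "red {u, v}"
  obtains m1 where "\<And>m a. m \<ge> m1 \<Longrightarrow> a \<in> tors u v (Suc m) \<Longrightarrow> \<exists>b\<in>A m. a = u * b"
proof -
  obtain m2 where m2: "\<And>m. m \<ge> m2 \<Longrightarrow> A (Suc m) \<subseteq> lin {u, v} m"
    using assms(4) by (auto simp: red_def)
  define m1 where "m1 = max m0 m2"
  have step: "\<exists>c\<in>A m. a = u * c" if m: "m \<ge> m1" and a: "a \<in> A (Suc m)" "v * a = u * b" "b \<in> A (Suc m)" for m a b
  proof (rule ccontr)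
    assume neg: "\<not> ?thesis"
    obtain B where B: "finite B" "independent B" "span B = A m" "card B = dim (A m)" by (rule A_basis)
    have BA: "B \<subseteq> A m" using B(3) span_superset by blast
    note uB = independent_mult[OF B(2,1) BA assms(1,3)]
    have "a \<notin> span ((*) u ` B)"
    proof
      assume "a \<in> span ((*) u ` B)"
      then obtain \<gamma> where "a = (\<Sum>b\<in>B. \<gamma> b \<cdot> (u * b))" using span_family[OF B(1)] by blast
      then have "a = u * (\<Sum>b\<in>B. \<gamma> b \<cdot> b)" by (simp add: sum_distrib_left scale_mult_right)
      moreover have "(\<Sum>b\<in>B. \<gamma> b \<cdot> b) \<in> A m" using BA by (intro A_sum A_scale) auto
      ultimately show False using neg by blast
    qed
    then have ind: "independent (insert a ((*) u ` B))" and nin: "a \<notin> (*) u ` B"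
      using uB(2) independent_insert span_base by auto
    have sub: "insert a ((*) u ` B) \<subseteq> A (Suc m)" using A_mult[OF assms(1)] BA a(1) by auto
    obtain E where E: "insert a ((*) u ` B) \<subseteq> E" "E \<subseteq> A (Suc m)" "independent E" "A (Suc m) \<subseteq> span E"
      using maximal_independent_subset_extend[OF sub ind] by blast
    have E': "card E \<le> dim (A (Suc m))" "finite E" using A_indep_card_le[OF E(3,2)] by auto
    define R where "R = E - insert a ((*) u ` B)"
    have cR: "card R + Suc (dim (A m)) = card E"
    proof -
      have "card (insert a ((*) u ` B)) = Suc (dim (A m))"
        using nin B(1,4) card_image[OF uB(1)] by simp
      then show ?thesis using E(1) E'(2) B(1) card_mono[OF E'(2) E(1)]
        unfolding R_def by (subst card_Diff_subset) auto
    qed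
    let ?S = "(*) u ` E \<union> (*) v ` R"
    have uA: "u * x \<in> span ?S" if "x \<in> A (Suc m)" for x
      using that E(4) by (intro mult_mem_span[of x E]) (auto intro: span_base)
    have "v * x \<in> span ?S" if "x \<in> A (Suc m)" for x
    proof (rule mult_mem_span[of x E])
      show "x \<in> span E" using that E(4) by blast
      fix s assume "s \<in> E"
      then consider "s = a" | y where "s = u * y" "y \<in> B" | "s \<in> R" unfolding R_def by blast
      then show "v * s \<in> span ?S"
      proof cases
        case 1
        then show ?thesis using a uA by simp
      next
        case 2
        then have "v * s = u * (v * y)" by (simp add: ac_simps)
        moreover have "v * y \<in> A (Suc m)" using A_mult[OF assms(2)] 2 BA by auto
        ultimately show ?thesis using uA by simp
      next
        case 3
        then show ?thesis by (intro span_base) auto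
      qed
    qed
    with uA have gen: "z * x \<in> span ?S" if "z \<in> {u, v}" "x \<in> A (Suc m)" for x z
      using that by blast
    have "A (Suc (Suc m)) \<subseteq> lin {u, v} (Suc m)" using m2 m unfolding m1_def by simp
    also have "\<dots> \<subseteq> span ?S" unfolding lin_def
    proof (intro span_minimal subspace_span subsetI)
      fix x assume "x \<in> {z * a |z a. z \<in> {u, v} \<and> a \<in> A (Suc m)}"
      then obtain z b where "x = z * b" "z \<in> {u, v}" "b \<in> A (Suc m)" by blast
      then show "x \<in> span ?S" using gen by simp
    qed
    finally have "dim (A (Suc (Suc m))) \<le> card ?S"
      using E'(2) by (intro A_dim_le) (auto simp: R_def)
    also have "\<dots> \<le> card E + card R"
      using E'(2) card_Un_le[of "(*) u ` E" "(*) v ` R"] card_image_le[of E "(*) u"] card_image_le[of R "(*) v"]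
      by (auto simp: R_def)
    finally have "dim (A (Suc (Suc m))) \<le> card E + card R" .
    moreover have "dim (A (Suc (Suc m))) = dim (A (Suc m)) + d" "dim (A (Suc m)) = dim (A m) + d"
      using dim_Suc[of "Suc m"] dim_Suc[of m] m unfolding m1_def by auto
    ultimately show False using cR E'(1) by linarith
  qed
  have "\<exists>b\<in>A m. a = u * b" if m: "m \<ge> m1" and a: "a \<in> tors u v (Suc m)" for m a
  proof -
    from a obtain j b where aA: "a \<in> A (Suc m)" and b: "b \<in> A (Suc m + j)" "v ^ Suc j * a = u * b"
      by (auto simp: tors_def)
    from b show ?thesis
    proof (induction j arbitrary: b)
      case 0
      then show ?case using step[OF m aA, of b] by simp
    next
      case (Suc j)
      have "v ^ Suc j * a \<in> A (Suc (m + Suc j))"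
        using A_power1[of v "Suc j"] assms(2) by (intro A_mult'[OF _ aA]) auto
      moreover have "v * (v ^ Suc j * a) = u * b" using Suc.prems(2) by (simp add: mult.assoc)
      moreover have "b \<in> A (Suc (m + Suc j))" using Suc.prems(1) by simp
      ultimately obtain c where "c \<in> A (m + Suc j)" "v ^ Suc j * a = u * c"
        using step[of "m + Suc j" "v ^ Suc j * a" b] m by auto
      then show ?case using Suc.IH[of c] by simp
    qed
  qed
  then show ?thesis using that by blast
qed

text \<open>If the rank did not grow from degree \<open>m\<close> to \<open>Suc m\<close>,
  multiplication by \<open>v\<close> would be surjective modulo torsion in this degree, hence in all
  later ones, because \<open>A\<close> is generated in degree one. In large degrees torsion means
  divisibility by \<open>u\<close>, and the Hilbert function would grow by at most
  \<open>card C < d\<close>.\<close>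

lemma relindep_extend:
  assumes "u \<in> A 1" "v \<in> A 1" "u \<noteq> 0" "red {u, v}" "relindep u v m C" "card C < d"
  shows "\<exists>C'. relindep u v (Suc m) C' \<and> card C' = Suc (card C)"
proof (rule ccontr)
  assume neg: "\<not> ?thesis"
  note vC = relindep_grow[OF assms(1-5)]
  have CA: "finite C" "C \<subseteq> A m" using assms(5) by (auto simp: relindep_def)
  have spanC: "s \<in> A m" if "s \<in> span C" for s
    using that span_minimal[OF CA(2) subspace_A] by blast
  have one: "\<exists>s\<in>span C. \<exists>t\<in>tors u v (Suc m). a = v * s + t" if "a \<in> A (Suc m)" for a
  proof -
    obtain s t where st: "s \<in> span ((*) v ` C)" "t \<in> tors u v (Suc m)" "a = s + t"
      using relindep_span[OF assms(2) vC(1) \<open>a \<in> A (Suc m)\<close>] neg vC(2) by auto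
    obtain \<gamma> where "s = (\<Sum>c\<in>C. \<gamma> c \<cdot> (v * c))" using span_family[OF CA(1) st(1)] by blast
    then have "s = v * (\<Sum>c\<in>C. \<gamma> c \<cdot> c)" by (simp add: sum_distrib_left scale_mult_right)
    moreover have "(\<Sum>c\<in>C. \<gamma> c \<cdot> c) \<in> span C" by (intro span_sum span_scale span_base)
    ultimately show ?thesis using st by blast
  qed
  have all: "\<exists>s\<in>span C. \<exists>t\<in>tors u v (Suc m + i). a = v ^ Suc i * s + t" if "a \<in> A (Suc m + i)" for i a
    using that
  proof (induction i arbitrary: a)
    case 0
    then show ?case using one by simp
  next
    case (Suc i)
    then have "a \<in> lin G (Suc m + i)" by (simp add: A_Suc)
    then show ?case
    proof (induction rule: lin_induct)
      case zero
      show ?case using span_zero tors_zero by (intro bexI[of _ 0] bexI[of _ 0]) auto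
    next
      case (add z b x)
      then obtain s' t' where x: "s' \<in> span C" "t' \<in> tors u v (Suc m + Suc i)" "x = v ^ Suc (Suc i) * s' + t'"
        by blast
      obtain s t where b: "s \<in> span C" "t \<in> tors u v (Suc m + i)" "b = v ^ Suc i * s + t"
        using Suc.IH add.hyps(2) by blast
      have zA: "z \<in> A 1" using G_A add.hyps(1) by blast
      have "s * z \<in> A (Suc m)" using A_mult[OF spanC[OF b(1)] zA] by simp
      then obtain s2 t2 where s2: "s2 \<in> span C" "t2 \<in> tors u v (Suc m)" "s * z = v * s2 + t2"
        using one by blast
      have "t2 * v ^ Suc i \<in> tors u v (Suc m + Suc i)"
        using A_power1[of v "Suc i"] assms(2) by (intro tors_mult[OF s2(2)]) simp
      moreover have "t * z \<in> tors u v (Suc m + Suc i)" using tors_mult[OF b(2) zA] by simp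
      ultimately have T: "(t2 * v ^ Suc i + t * z) + t' \<in> tors u v (Suc m + Suc i)"
        using x(2) tors_add[OF assms(2)] by blast
      have "z * b = v ^ Suc i * (s * z) + t * z" unfolding b(3) by (simp add: algebra_simps)
      also have "\<dots> = v ^ Suc (Suc i) * s2 + (t2 * v ^ Suc i + t * z)"
        unfolding s2(3) by (simp add: algebra_simps)
      finally have "z * b + x = v ^ Suc (Suc i) * (s2 + s') + ((t2 * v ^ Suc i + t * z) + t')"
        unfolding x(3) by (simp add: algebra_simps)
      with T span_add[OF s2(1) x(1)] show ?case by blast
    qed
  qed
  obtain m1 where m1: "\<And>m a. m \<ge> m1 \<Longrightarrow> a \<in> tors u v (Suc m) \<Longrightarrow> \<exists>b\<in>A m. a = u * b"
    using tors_eventually[OF assms(1-4)] by blast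
  \<comment> \<open>Far enough both for torsion to be divisible by \<open>u\<close> and for the
    Hilbert function to be linear.\<close>
  define i where "i = m1 + m0"
  obtain B where B: "finite B" "span B = A (m + i)" "card B = dim (A (m + i))" by (rule A_basis)
  let ?S = "(*) (v ^ Suc i) ` C \<union> (*) u ` B"
  have "A (Suc (m + i)) \<subseteq> span ?S"
  proof
    fix a assume "a \<in> A (Suc (m + i))"
    then obtain s t where st: "s \<in> span C" "t \<in> tors u v (Suc (m + i))" "a = v ^ Suc i * s + t"
      using all[of a i] by auto
    obtain b where "b \<in> A (m + i)" "t = u * b" using m1[OF _ st(2)] by (auto simp: i_def)
    then have "t \<in> span ?S"
      using B(2) by (auto intro!: mult_mem_span[of b B] intro: span_base)
    moreover have "v ^ Suc i * s \<in> span ?S"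
      by (rule mult_mem_span[OF st(1)]) (rule span_base, blast)
    ultimately show "a \<in> span ?S" unfolding st(3) by (intro span_add)
  qed
  then have "dim (A (Suc (m + i))) \<le> card ?S" using B CA by (intro A_dim_le) auto
  also have "\<dots> \<le> card C + dim (A (m + i))"
    using card_Un_le[of "(*) (v ^ Suc i) ` C" "(*) u ` B"] card_image_le[OF CA(1), of "(*) (v ^ Suc i)"]
      card_image_le[OF B(1), of "(*) u"] B(3) by linarith
  finally show False using dim_Suc[of "m + i"] assms(6) by (simp add: i_def)
qed

lemma relindep_card:
  assumes "u \<in> A 1" "v \<in> A 1" "u \<noteq> 0" "red {u, v}"
  shows "\<exists>C. relindep u v m C \<and> card C = min d (Suc m)"
proof (induction m)
  case 0
  have "relindep u v 0 {1}"
    unfolding relindep_def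
  proof (intro conjI allI impI)
    fix \<gamma> assume "(\<Sum>c\<in>{1}. \<gamma> c \<cdot> c) \<in> tors u v 0"
    then obtain j b where b: "b \<in> A j" "v ^ Suc j * (\<gamma> 1 \<cdot> 1) = u * b" by (auto simp: tors_def)
    show "\<forall>c\<in>{1}. \<gamma> c = 0"
    proof (rule ccontr)
      assume "\<not> ?thesis"
      then have g: "\<gamma> 1 \<noteq> 0" by simp
      have "\<gamma> 1 \<cdot> v ^ Suc j = u * b" using b(2) by (simp only: scale_mult_right mult_1_right)
      then have "inverse (\<gamma> 1) \<cdot> \<gamma> 1 \<cdot> v ^ Suc j = u * (inverse (\<gamma> 1) \<cdot> b)" by (simp only: scale_mult_right)
      then have "v ^ Suc j = u * (inverse (\<gamma> 1) \<cdot> b)" using g by simp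
      then show False using power_not_mult[OF assms(1,2,4) A_scale[OF b(1)]] by blast
    qed
  qed (use A_one in auto)
  then show ?case using d_pos by (intro exI[of _ "{1}"]) auto
next
  case (Suc m)
  then obtain C where C: "relindep u v m C" "card C = min d (Suc m)" by blast
  show ?case
  proof (cases "card C < d")
    case True
    with relindep_extend[OF assms C(1)] obtain C' where "relindep u v (Suc m) C'" "card C' = Suc (card C)"
      by blast
    then show ?thesis using C(2) True by (intro exI[of _ C']) auto
  next
    case False
    then show ?thesis using relindep_grow[OF assms C(1)] C(2)
      by (intro exI[of _ "(*) v ` C"]) auto
  qed
qed

lemma relindep_dim:
  assumes "u \<in> A 1" "v \<in> A 1" "u \<noteq> 0" "relindep u v (Suc m) C"
  shows "card C + dim (A m) \<le> dim (A (Suc m))"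
proof -
  obtain B where B: "finite B" "independent B" "span B = A m" "card B = dim (A m)" by (rule A_basis)
  have BA: "B \<subseteq> A m" using B(3) span_superset by blast
  note uB = independent_mult[OF B(2,1) BA assms(1,3)]
  have C: "finite C" "C \<subseteq> A (Suc m)"
    and ind: "\<And>\<gamma>. (\<Sum>c\<in>C. \<gamma> c \<cdot> c) \<in> tors u v (Suc m) \<Longrightarrow> \<forall>c\<in>C. \<gamma> c = 0"
    using assms(4) by (auto simp: relindep_def)
  have *: "\<forall>c\<in>C. \<gamma> c = 0" if in_span: "(\<Sum>c\<in>C. \<gamma> c \<cdot> c) \<in> span ((*) u ` B)" for \<gamma>
  proof -
    obtain g where "(\<Sum>c\<in>C. \<gamma> c \<cdot> c) = (\<Sum>b\<in>B. g b \<cdot> (u * b))" using span_family[OF B(1) in_span] by blast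
    then have "(\<Sum>c\<in>C. \<gamma> c \<cdot> c) = u * (\<Sum>b\<in>B. g b \<cdot> b)" by (simp add: sum_distrib_left scale_mult_right)
    moreover have "(\<Sum>b\<in>B. g b \<cdot> b) \<in> A m" using BA by (intro A_sum A_scale) auto
    ultimately show ?thesis using ind tors_base[OF assms(2) _ assms(1)] by simp
  qed
  have un: "independent ((*) u ` B \<union> C)" "(*) u ` B \<inter> C = {}"
    using independent_unionI[OF _ uB(2) C(1) *] B(1) by auto
  have "card ((*) u ` B \<union> C) \<le> dim (A (Suc m))"
    using A_mult[OF assms(1)] BA C(2) by (intro A_indep_card_le un) auto
  then show ?thesis using card_Un_disjoint[OF _ C(1) un(2)] B(1,4) card_image[OF uB(1)] by simp
qed

text \<open>The first difference of the Hilbert function dominates the Hilbert function of the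
  saturated hyperplane section, which grows strictly until it reaches \<open>d\<close>. Plane curves
  attain equality.\<close>

lemma dim_lower:
  assumes "u \<in> A 1" "v \<in> A 1" "u \<noteq> 0" "red {u, v}"
  shows "(\<Sum>j\<le>m. min d (Suc j)) \<le> dim (A m)"
proof (induction m)
  case 0
  have "independent {1}" by (simp add: independent_insert)
  then have "card {1::'r} \<le> dim (A 0)" using A_one by (intro A_indep_card_le) auto
  then show ?case by simp
next
  case (Suc m)
  obtain C where "relindep u v (Suc m) C" "card C = min d (Suc (Suc m))"
    using relindep_card[OF assms] by blast
  then show ?case using relindep_dim[OF assms(1-3)] Suc by force
qed

end

context graded_domain
begin

section \<open>Relations between three linear forms, and the zeros of a form\<close>

definition rel_pairs :: "nat \<Rightarrow> nat \<Rightarrow> (nat \<times> nat) set" where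
  "rel_pairs e M = (SIGMA c:{..e}. {..M - c})"

definition rel_val :: "'r \<Rightarrow> 'r \<Rightarrow> 'r \<Rightarrow> (nat \<Rightarrow> nat \<Rightarrow> 'k) \<Rightarrow> nat \<Rightarrow> nat \<Rightarrow> 'r" where
  "rel_val u v l \<gamma> e M = (\<Sum>c\<le>e. \<Sum>i\<le>M - c. \<gamma> c i \<cdot> (u ^ i * v ^ (M - c - i) * l ^ c))"

lemma exists_relation:
  assumes "u \<in> A 1" "v \<in> A 1" "l \<in> A 1"
  shows "\<exists>M\<ge>d. \<exists>\<gamma>. (\<exists>c\<le>d. \<exists>i\<le>M - c. \<gamma> c i \<noteq> 0) \<and> rel_val u v l \<gamma> d M = 0"
proof -
  \<comment> \<open>There are at least \<open>(d + 1) (M - d + 1) = d M + M + 1 - d^2\<close>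
    products, which exceeds \<open>d M + e0\<close> as soon as \<open>M\<close> is at least
    \<open>d^2\<close> plus the absolute value of \<open>e0\<close>.\<close>
  define M where "M = d * d + d + m0 + nat \<bar>e0\<bar>"
  have Md: "M \<ge> d" by (simp add: M_def)
  define J where "J = rel_pairs d M"
  define f where "f = (\<lambda>(c, i). u ^ i * v ^ (M - c - i) * l ^ c)"
  have fin: "finite J" by (simp add: J_def rel_pairs_def)
  have "f j \<in> A M" if "j \<in> J" for j
  proof -
    obtain c i where j: "j = (c, i)" "c \<le> d" "i \<le> M - c" using \<open>j \<in> J\<close> by (auto simp: J_def rel_pairs_def)
    show ?thesis unfolding f_def j using assms j(2,3) Md
      by (auto intro!: A_mult'[OF A_mult[OF A_power1 A_power1] A_power1])
  qed
  moreover have "dim (A M) < card J"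
  proof -
    have "card J = (\<Sum>c\<le>d. Suc (M - c))" by (simp add: J_def rel_pairs_def)
    moreover have "(\<Sum>c\<le>d. Suc (M - d)) \<le> (\<Sum>c\<le>d. Suc (M - c))" by (intro sum_mono) auto
    ultimately have 1: "card J \<ge> Suc d * Suc (M - d)" by simp
    have "int (Suc d * Suc (M - d)) = int d * int M + int M + (1 + int d) * (1 - int d)"
    proof -
      have "int (Suc d * Suc (M - d)) = (1 + int d) * (1 + (int M - int d))"
        unfolding of_nat_mult of_nat_Suc of_nat_diff[OF Md] ..
      then show ?thesis by (simp add: algebra_simps)
    qed
    also have "\<dots> > int d * int M + e0"
    proof -
      have "(1 + int d) * (1 - int d) = 1 - int d * int d" by (simp add: algebra_simps)
      moreover have "int M \<ge> int d * int d + \<bar>e0\<bar>" by (simp add: M_def)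
      ultimately show ?thesis by linarith
    qed
    also have "int d * int M + e0 = int (dim (A M))" using dim_A[of M] by (simp add: M_def)
    finally show ?thesis using 1 by linarith
  qed
  ultimately obtain \<gamma> where \<gamma>: "\<exists>j\<in>J. \<gamma> j \<noteq> 0" "(\<Sum>j\<in>J. \<gamma> j \<cdot> f j) = 0"
    using A_dependent_family[OF fin, of f M] by blast
  have "rel_val u v l (\<lambda>c i. \<gamma> (c, i)) d M = (\<Sum>j\<in>J. \<gamma> j \<cdot> f j)"
    unfolding rel_val_def J_def rel_pairs_def by (subst sum.Sigma) (auto simp: f_def intro!: sum.cong)
  moreover have "\<exists>c\<le>d. \<exists>i\<le>M - c. \<gamma> (c, i) \<noteq> 0" using \<gamma>(1) by (auto simp: J_def rel_pairs_def)
  ultimately show ?thesis using \<gamma>(2) Md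
    by (intro exI[of _ M] conjI) (auto intro!: exI[of _ "\<lambda>c i. \<gamma> (c, i)"])
qed

text \<open>A relation of least degree in \<open>l\<close> is separable, since the characteristic is zero.\<close>

lemma separable_relation:
  assumes "u \<in> A 1" "v \<in> A 1" "u \<noteq> 0" "red {u, v}" "l \<in> A 1"
  obtains e M \<gamma> where "0 < e" "e \<le> d" "e \<le> M" "rel_val u v l \<gamma> e M = 0"
    "(\<Sum>i\<le>M - e. \<gamma> e i \<cdot> (u ^ i * v ^ (M - e - i))) \<noteq> 0"
    "rel_val u v l (\<lambda>c i. of_nat (Suc c) * \<gamma> (Suc c) i) (e - 1) (M - 1) \<noteq> 0"
proof -
  define P where "P e \<longleftrightarrow> (\<exists>M \<gamma>. e \<le> M \<and> (\<exists>i\<le>M - e. \<gamma> e i \<noteq> 0) \<and> rel_val u v l \<gamma> e M = 0)" for e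
  obtain M \<gamma> where M: "M \<ge> d" and \<gamma>: "\<exists>c\<le>d. \<exists>i\<le>M - c. \<gamma> c i \<noteq> 0" "rel_val u v l \<gamma> d M = 0"
    using exists_relation[OF assms(1,2,5)] by blast
  define e where "e = Max {c. c \<le> d \<and> (\<exists>i\<le>M - c. \<gamma> c i \<noteq> 0)}"
  have fin: "finite {c. c \<le> d \<and> (\<exists>i\<le>M - c. \<gamma> c i \<noteq> 0)}"
    by (rule finite_subset[of _ "{..d}"]) auto
  have ne: "{c. c \<le> d \<and> (\<exists>i\<le>M - c. \<gamma> c i \<noteq> 0)} \<noteq> {}" using \<gamma>(1) by blast
  have e: "e \<le> d" "\<exists>i\<le>M - e. \<gamma> e i \<noteq> 0" using Max_in[OF fin ne] by (auto simp: e_def)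
  have z: "\<gamma> c i = 0" if "c \<le> d" "c > e" "i \<le> M - c" for c i
  proof (rule ccontr)
    assume "\<gamma> c i \<noteq> 0"
    then have "c \<le> e" unfolding e_def using that by (intro Max_ge fin) auto
    with that show False by simp
  qed
  have "rel_val u v l \<gamma> e M = rel_val u v l \<gamma> d M"
    unfolding rel_val_def using e(1) by (intro sum.mono_neutral_left) (auto simp: z)
  then have Pe: "P e" unfolding P_def using e M \<gamma>(2) by (intro exI[of _ M] exI[of _ \<gamma>]) auto
  have "\<exists>e'. P e' \<and> (\<forall>c<e'. \<not> P c)" using exists_least_iff[of P] Pe by blast
  then obtain e' where e': "P e'" "\<And>c. c < e' \<Longrightarrow> \<not> P c" by blast
  have "\<not> e < e'" using e'(2) Pe by blast
  then have e'd: "e' \<le> d" using e(1) by simp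
  obtain M' \<gamma>' where M': "e' \<le> M'" "rel_val u v l \<gamma>' e' M' = 0" and top: "\<exists>i\<le>M' - e'. \<gamma>' e' i \<noteq> 0"
    using e'(1) unfolding P_def by blast
  have e'pos: "0 < e'"
  proof (rule ccontr)
    assume "\<not> 0 < e'"
    then have "(\<Sum>i\<le>M'. \<gamma>' 0 i \<cdot> (u ^ i * v ^ (M' - i))) = 0" using M'(2) by (simp add: rel_val_def)
    then show False using binary_independent[OF assms(1-4)] top \<open>\<not> 0 < e'\<close> by auto
  qed
  have "(\<Sum>i\<le>M' - e'. \<gamma>' e' i \<cdot> (u ^ i * v ^ (M' - e' - i))) \<noteq> 0"
    using binary_independent[OF assms(1-4), of "\<gamma>' e'" "M' - e'"] top by blast
  moreover have "rel_val u v l (\<lambda>c i. of_nat (Suc c) * \<gamma>' (Suc c) i) (e' - 1) (M' - 1) \<noteq> 0"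
  proof
    assume "rel_val u v l (\<lambda>c i. of_nat (Suc c) * \<gamma>' (Suc c) i) (e' - 1) (M' - 1) = 0"
    moreover obtain i where "i \<le> M' - e'" "\<gamma>' e' i \<noteq> 0" using top by blast
    then have "i \<le> (M' - 1) - (e' - 1) \<and> of_nat (Suc (e' - 1)) * \<gamma>' (Suc (e' - 1)) i \<noteq> 0"
      using char_0[of "e' - 1"] e'pos M'(1) by simp
    then have "\<exists>i\<le>(M' - 1) - (e' - 1). of_nat (Suc (e' - 1)) * \<gamma>' (Suc (e' - 1)) i \<noteq> 0" by blast
    moreover have "e' - 1 \<le> M' - 1" using M'(1) by simp
    ultimately have "P (e' - 1)"
      unfolding P_def
      by (intro exI[of _ "M' - 1"] exI[of _ "\<lambda>c i. of_nat (Suc c) * \<gamma>' (Suc c) i"]) blast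
    then show False using e'(2)[of "e' - 1"] e'pos by simp
  qed
  ultimately show ?thesis using that e'pos e'd M' by blast
qed

text \<open>Multiplication by \<open>f\<close> embeds \<open>A l\<close> into the forms of degree \<open>l + m\<close> that vanish on \<open>P\<close>, and for
  large \<open>l\<close> the points of \<open>P\<close> impose independent conditions on these forms.\<close>

lemma zeros_le:
  fixes \<psi> :: "'p \<Rightarrow> 'r \<Rightarrow> 'l::field" and h :: "'k \<Rightarrow> 'l"
  assumes "finite P" "f \<in> A m" "f \<noteq> 0" "\<And>p. p \<in> P \<Longrightarrow> \<psi> p f = 0"
    and add: "\<And>p a b. \<psi> p (a + b) = \<psi> p a + \<psi> p b"
    and mult: "\<And>p a b. \<psi> p (a * b) = \<psi> p a * \<psi> p b"
    and scale: "\<And>p c a. \<psi> p (c \<cdot> a) = h c * \<psi> p a" and h: "\<And>c. h c = 0 \<Longrightarrow> c = 0"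
    and one: "\<And>p. \<psi> p 1 = 1"
    and sep: "\<And>p q. p \<in> P \<Longrightarrow> q \<in> P \<Longrightarrow> p \<noteq> q \<Longrightarrow> \<exists>l\<in>A 1. \<psi> q l = 0 \<and> \<psi> p l \<noteq> 0"
    and nz: "\<And>p. p \<in> P \<Longrightarrow> \<exists>l\<in>A 1. \<psi> p l \<noteq> 0"
  shows "card P \<le> d * m"
proof -
  have zero: "\<psi> p 0 = 0" for p
  proof -
    have "\<psi> p 0 = \<psi> p 0 + \<psi> p 0" using add[of p 0 0] unfolding add_0_left .
    then show ?thesis by (simp only: add_cancel_right_right)
  qed
  have sums: "\<psi> p (sum g S) = (\<Sum>s\<in>S. \<psi> p (g s))" for p S and g :: "'z \<Rightarrow> 'r"
    by (induction S rule: infinite_finite_induct) (simp_all add: add zero)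
  have prods: "\<psi> p (prod g S) = (\<Prod>s\<in>S. \<psi> p (g s))" for p S and g :: "'p \<Rightarrow> 'r"
    by (induction S rule: infinite_finite_induct) (simp_all add: mult one)
  have pow: "\<psi> p (a ^ i) = \<psi> p a ^ i" for p a i
    by (induction i) (simp_all add: mult one)
  obtain L where L: "\<And>p q. p \<in> P \<Longrightarrow> q \<in> P \<Longrightarrow> p \<noteq> q \<Longrightarrow> L p q \<in> A 1 \<and> \<psi> q (L p q) = 0 \<and> \<psi> p (L p q) \<noteq> 0"
    using sep by metis
  obtain W where W: "\<And>p. p \<in> P \<Longrightarrow> W p \<in> A 1 \<and> \<psi> p (W p) \<noteq> 0" using nz by metis
  define D where "D = card P + m + m0"
  \<comment> \<open>\<open>E p\<close> vanishes at every other point of \<open>P\<close> but not at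
    \<open>p\<close>, which makes the conditions imposed by the points independent in degree
    \<open>D\<close>; the power of \<open>W p\<close> only fills up the degree.\<close>
  define E where "E p = W p ^ (D - (card P - 1)) * (\<Prod>q\<in>P - {p}. L p q)" for p
  have prodA: "(\<Prod>q\<in>S. g q) \<in> A (card S)" if "finite S" "\<And>q. q \<in> S \<Longrightarrow> g q \<in> A 1" for S and g :: "'p \<Rightarrow> 'r"
    using that
  proof (induction S rule: finite_induct)
    case empty
    then show ?case by (simp add: A_one)
  next
    case (insert x S)
    then have "g x * prod g S \<in> A (1 + card S)" by (intro A_mult) auto
    then show ?case using insert by simp
  qed
  have EA: "E p \<in> A D" if "p \<in> P" for p
  proof -
    have "(\<Prod>q\<in>P - {p}. L p q) \<in> A (card (P - {p}))" using L that assms(1) by (intro prodA) auto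
    moreover have "card (P - {p}) = card P - 1" using that assms(1) by simp
    moreover have "W p ^ (D - (card P - 1)) \<in> A (D - (card P - 1))" using W[OF that] A_power1 by simp
    moreover have "D = D - (card P - 1) + (card P - 1)" by (simp add: D_def)
    ultimately show ?thesis unfolding E_def by (intro A_mult'[of _ "D - (card P - 1)" _ "card P - 1"]) auto
  qed
  have E0: "\<psi> q (E p) = 0" if "p \<in> P" "q \<in> P" "p \<noteq> q" for p q
  proof -
    have "(\<Prod>s\<in>P - {p}. \<psi> q (L p s)) = 0"
      using that L assms(1) by (intro prod_zero) (auto intro!: bexI[of _ q])
    then show ?thesis by (simp add: E_def mult prods)
  qed
  have E1: "\<psi> p (E p) \<noteq> 0" if "p \<in> P" for p
    using that W L assms(1) by (auto simp: E_def mult prods pow)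
  obtain B where B: "finite B" "independent B" "span B = A (D - m)" "card B = dim (A (D - m))" by (rule A_basis)
  have BA: "b \<in> A (D - m)" if "b \<in> B" for b using B(3) span_base that by blast
  define J where "J = Inl ` P \<union> Inr ` B"
  define g where "g = case_sum E (\<lambda>b. f * b)"
  have fin: "finite J" using B(1) assms(1) by (simp add: J_def)
  have cardJ: "card J = card P + card B"
    unfolding J_def using B(1) assms(1) by (subst card_Un_disjoint) (auto simp: card_image)
  have gA: "g j \<in> A D" if "j \<in> J" for j
    using that EA A_mult'[OF assms(2) BA, of _ D] by (auto simp: J_def g_def) (simp add: D_def)
  have "\<not> dim (A D) < card J"
  proof
    assume small: "dim (A D) < card J"
    obtain \<gamma> where \<gamma>: "\<exists>j\<in>J. \<gamma> j \<noteq> 0" "(\<Sum>j\<in>J. \<gamma> j \<cdot> g j) = 0"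
      using A_dependent_family[of J g D, OF fin gA small] by auto
    have "(\<Sum>j\<in>J. \<gamma> j \<cdot> g j) = (\<Sum>j\<in>Inl ` P. \<gamma> j \<cdot> g j) + (\<Sum>j\<in>Inr ` B. \<gamma> j \<cdot> g j)"
      unfolding J_def using B(1) assms(1) by (intro sum.union_disjoint) auto
    also have "(\<Sum>j\<in>Inl ` P. \<gamma> j \<cdot> g j) = (\<Sum>p\<in>P. \<gamma> (Inl p) \<cdot> E p)"
      by (subst sum.reindex) (auto simp: g_def)
    also have "(\<Sum>j\<in>Inr ` B. \<gamma> j \<cdot> g j) = f * (\<Sum>b\<in>B. \<gamma> (Inr b) \<cdot> b)"
      by (subst sum.reindex) (auto simp: g_def sum_distrib_left scale_mult_right)
    finally have eq: "(\<Sum>p\<in>P. \<gamma> (Inl p) \<cdot> E p) + f * (\<Sum>b\<in>B. \<gamma> (Inr b) \<cdot> b) = 0" using \<gamma>(2) by simp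
    have P0: "\<gamma> (Inl q) = 0" if "q \<in> P" for q
    proof -
      have "0 = \<psi> q ((\<Sum>p\<in>P. \<gamma> (Inl p) \<cdot> E p) + f * (\<Sum>b\<in>B. \<gamma> (Inr b) \<cdot> b))"
        unfolding eq zero ..
      also have "\<dots> = (\<Sum>p\<in>P. h (\<gamma> (Inl p)) * \<psi> q (E p))"
        using assms(4)[OF that] by (simp add: add mult sums scale)
      also have "\<dots> = (\<Sum>p\<in>P. if p = q then h (\<gamma> (Inl q)) * \<psi> q (E q) else 0)"
        using E0 that by (intro sum.cong) auto
      also have "\<dots> = h (\<gamma> (Inl q)) * \<psi> q (E q)" using that assms(1) by simp
      finally show ?thesis using E1[OF that] h by simp
    qed
    then have "f * (\<Sum>b\<in>B. \<gamma> (Inr b) \<cdot> b) = 0" using eq by simp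
    moreover have "(\<Sum>b\<in>B. \<gamma> (Inr b) \<cdot> b) \<in> A (D - m)" by (intro A_sum A_scale BA)
    ultimately have "(\<Sum>b\<in>B. \<gamma> (Inr b) \<cdot> b) = 0" using dom[OF assms(2)] assms(3) by blast
    then have "\<forall>b\<in>B. \<gamma> (Inr b) = 0" using B(1,2) independentD by fast
    with P0 \<gamma>(1) show False by (auto simp: J_def)
  qed
  then have "card P + dim (A (D - m)) \<le> dim (A D)" using cardJ B(4) by simp
  moreover have "int (dim (A D)) = int d * int D + e0" "int (dim (A (D - m))) = int d * int (D - m) + e0"
    using dim_A by (auto simp: D_def)
  ultimately have "int (card P) \<le> int d * int D - int d * int (D - m)" by linarith
  also have "\<dots> = int (d * m)" by (simp add: D_def of_nat_diff algebra_simps)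
  finally show ?thesis by linarith
qed

end

section \<open>Polynomial functions and prime sets of points\<close>

type_synonym pt = "nat \<Rightarrow> complex"

text \<open>Bounding the degree in each coordinate separately makes the definition recursive in the number
  of coordinates.\<close>

primrec polyfun :: "nat \<Rightarrow> nat \<Rightarrow> (pt \<Rightarrow> complex) set" where
  "polyfun 0 D = {\<lambda>x. c | c. True}"
| "polyfun (Suc i) D = {\<lambda>x. \<Sum>j\<le>D. c j x * x i ^ j | c. \<forall>j. c j \<in> polyfun i D}"

lemma polyfun_SucI: "(\<And>j. c j \<in> polyfun i D) \<Longrightarrow> f = (\<lambda>x. \<Sum>j\<le>D. c j x * x i ^ j) \<Longrightarrow> f \<in> polyfun (Suc i) D"
  by auto

lemma polyfun_SucE:
  assumes "f \<in> polyfun (Suc i) D"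
  obtains c where "\<And>j. c j \<in> polyfun i D" "f = (\<lambda>x. \<Sum>j\<le>D. c j x * x i ^ j)"
  using assms by auto

declare polyfun.simps(2) [simp del]

lemma sum_single_power: "k \<le> D \<Longrightarrow> (\<Sum>j\<le>D. (if j = k then a else 0) * T ^ j) = a * (T::complex) ^ k"
proof -
  assume "k \<le> D"
  have "(\<Sum>j\<le>D. (if j = k then a else 0) * T ^ j) = (\<Sum>j\<le>D. if j = k then a * T ^ k else 0)"
    by (intro sum.cong) auto
  with \<open>k \<le> D\<close> show ?thesis by simp
qed

lemma polyfun_const: "(\<lambda>x. c) \<in> polyfun i D"
proof (induction i arbitrary: c)
  case (Suc i)
  show ?case
    by (rule polyfun_SucI[where c = "\<lambda>j x. if j = 0 then c else 0"])
      (use Suc in \<open>simp_all add: sum_single_power\<close>)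
qed auto

lemma polyfun_add: "f \<in> polyfun i D \<Longrightarrow> g \<in> polyfun i D \<Longrightarrow> (\<lambda>x. f x + g x) \<in> polyfun i D"
proof (induction i arbitrary: f g)
  case (Suc i)
  obtain c c' where "\<And>j. c j \<in> polyfun i D" "f = (\<lambda>x. \<Sum>j\<le>D. c j x * x i ^ j)"
    "\<And>j. c' j \<in> polyfun i D" "g = (\<lambda>x. \<Sum>j\<le>D. c' j x * x i ^ j)"
    using Suc.prems by (elim polyfun_SucE) blast
  then show ?case using Suc.IH
    by (intro polyfun_SucI[where c = "\<lambda>j x. c j x + c' j x"]) (auto simp: sum.distrib algebra_simps)
qed auto

lemma polyfun_sum: "(\<And>s. s \<in> S \<Longrightarrow> f s \<in> polyfun i D) \<Longrightarrow> (\<lambda>x. \<Sum>s\<in>S. f s x) \<in> polyfun i D"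
  by (induction S rule: infinite_finite_induct) (auto intro: polyfun_const polyfun_add)

lemma polyfun_mono: "f \<in> polyfun i D \<Longrightarrow> D \<le> D' \<Longrightarrow> f \<in> polyfun i D'"
proof (induction i arbitrary: f)
  case (Suc i)
  obtain c where c: "\<And>j. c j \<in> polyfun i D" "f = (\<lambda>x. \<Sum>j\<le>D. c j x * x i ^ j)"
    using Suc.prems(1) by (rule polyfun_SucE) blast
  show ?case
  proof (rule polyfun_SucI[where c = "\<lambda>j x. if j \<le> D then c j x else 0"])
    show "(\<lambda>x. if j \<le> D then c j x else 0) \<in> polyfun i D'" for j
      using Suc.IH[OF c(1)[of j] Suc.prems(2)] polyfun_const[of 0] by (cases "j \<le> D") auto
    show "f = (\<lambda>x. \<Sum>j\<le>D'. (if j \<le> D then c j x else 0) * x i ^ j)"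
      unfolding c(2) using Suc.prems(2) by (intro ext sum.mono_neutral_cong_left) auto
  qed
qed auto

lemma polyfun_mult: "f \<in> polyfun i D \<Longrightarrow> g \<in> polyfun i D' \<Longrightarrow> (\<lambda>x. f x * g x) \<in> polyfun i (D + D')"
proof (induction i arbitrary: f g)
  case (Suc i)
  obtain c where c: "\<And>j. c j \<in> polyfun i D" "f = (\<lambda>x. \<Sum>j\<le>D. c j x * x i ^ j)"
    using Suc.prems(1) by (rule polyfun_SucE) blast
  obtain c' where c': "\<And>j. c' j \<in> polyfun i D'" "g = (\<lambda>x. \<Sum>j\<le>D'. c' j x * x i ^ j)"
    using Suc.prems(2) by (rule polyfun_SucE) blast
  define a where "a j = (\<lambda>x. if j \<le> D then c j x else 0)" for j
  define a' where "a' j = (\<lambda>x. if j \<le> D' then c' j x else 0)" for j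
  have a: "a j \<in> polyfun i D" for j unfolding a_def using c(1)[of j] polyfun_const[of 0] by (cases "j \<le> D") auto
  have a': "a' j \<in> polyfun i D'" for j unfolding a'_def using c'(1)[of j] polyfun_const[of 0] by (cases "j \<le> D'") auto
  show ?case
  proof (rule polyfun_SucI[where c = "\<lambda>r x. \<Sum>k\<le>r. a k x * a' (r - k) x"])
    show "(\<lambda>x. \<Sum>k\<le>r. a k x * a' (r - k) x) \<in> polyfun i (D + D')" for r
      by (intro polyfun_sum Suc.IH a a')
    have "f x = (\<Sum>j\<le>D. a j x * x i ^ j)" "g x = (\<Sum>j\<le>D'. a' j x * x i ^ j)" for x
      unfolding c(2) c'(2) by (auto simp: a_def a'_def intro!: sum.cong)
    moreover have "(\<Sum>j\<le>D. a j x * x i ^ j) * (\<Sum>j\<le>D'. a' j x * x i ^ j) =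
        (\<Sum>r\<le>D + D'. (\<Sum>k\<le>r. a k x * a' (r - k) x) * x i ^ r)" for x
      by (intro polynomial_product) (auto simp: a_def a'_def)
    ultimately show "(\<lambda>x. f x * g x) = (\<lambda>x. \<Sum>r\<le>D + D'. (\<Sum>k\<le>r. a k x * a' (r - k) x) * x i ^ r)"
      by simp
  qed
qed auto

lemma polyfun_lift: "f \<in> polyfun i D \<Longrightarrow> f \<in> polyfun (Suc i) D"
proof (rule polyfun_SucI[where c = "\<lambda>j x. if j = 0 then f x else 0"])
  assume f: "f \<in> polyfun i D"
  show "(\<lambda>x. if j = 0 then f x else 0) \<in> polyfun i D" for j
    using f polyfun_const[of 0] by (cases "j = 0") auto
qed (simp add: sum_single_power)

lemma polyfun_lift_le: "i \<le> k \<Longrightarrow> f \<in> polyfun i D \<Longrightarrow> f \<in> polyfun k D"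
  by (induction k rule: dec_induct) (auto intro: polyfun_lift)

lemma polyfun_var: "j < i \<Longrightarrow> (\<lambda>x. x j) \<in> polyfun i (Suc D)"
proof -
  assume "j < i"
  have "(\<lambda>x. x j) \<in> polyfun (Suc j) (Suc D)"
  proof (rule polyfun_SucI[where c = "\<lambda>l x. if l = 1 then 1 else 0"])
    show "(\<lambda>x::pt. x j) = (\<lambda>x. \<Sum>l\<le>Suc D. (if l = 1 then 1 else 0) * x j ^ l)"
    proof
      fix x :: pt
      show "x j = (\<Sum>l\<le>Suc D. (if l = 1 then 1 else 0) * x j ^ l)"
        using sum_single_power[of 1 "Suc D" 1 "x j"] by simp
    qed
  qed (rule polyfun_const)
  with \<open>j < i\<close> show ?thesis using polyfun_lift_le[of "Suc j" i] by simp
qed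

lemma polyfun_cong: "f \<in> polyfun i D \<Longrightarrow> (\<And>j. j < i \<Longrightarrow> x j = y j) \<Longrightarrow> f x = f y"
proof (induction i arbitrary: f)
  case (Suc i)
  obtain c where c: "\<And>j. c j \<in> polyfun i D" "f = (\<lambda>x. \<Sum>j\<le>D. c j x * x i ^ j)"
    using Suc.prems(1) by (rule polyfun_SucE) blast
  have "c j x = c j y" for j using Suc.IH[OF c(1)] Suc.prems(2) by simp
  then show ?case unfolding c(2) using Suc.prems(2) by simp
qed auto

definition polys :: "nat \<Rightarrow> (pt \<Rightarrow> complex) set" where
  "polys i = (\<Union>D. polyfun i D)"

lemma polysI: "f \<in> polyfun i D \<Longrightarrow> f \<in> polys i"
  by (auto simp: polys_def)

lemma polys_const: "(\<lambda>x. c) \<in> polys i"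
  using polyfun_const polysI by blast

lemma polys_var: "j < i \<Longrightarrow> (\<lambda>x. x j) \<in> polys i"
  using polyfun_var polysI by blast

lemma polys_add: "f \<in> polys i \<Longrightarrow> g \<in> polys i \<Longrightarrow> (\<lambda>x. f x + g x) \<in> polys i"
proof -
  assume "f \<in> polys i" "g \<in> polys i"
  then obtain D D' where "f \<in> polyfun i D" "g \<in> polyfun i D'" by (auto simp: polys_def)
  then have "f \<in> polyfun i (max D D')" "g \<in> polyfun i (max D D')" by (auto intro: polyfun_mono)
  then show ?thesis by (intro polysI polyfun_add)
qed

lemma polys_mult: "f \<in> polys i \<Longrightarrow> g \<in> polys i \<Longrightarrow> (\<lambda>x. f x * g x) \<in> polys i"
  using polyfun_mult polysI unfolding polys_def by blast

lemma polys_cmult: "f \<in> polys i \<Longrightarrow> (\<lambda>x. c * f x) \<in> polys i"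
  by (rule polys_mult[OF polys_const])

lemma polys_uminus: "f \<in> polys i \<Longrightarrow> (\<lambda>x. - f x) \<in> polys i"
  using polys_cmult[of f i "-1"] by simp

lemma polys_diff: "f \<in> polys i \<Longrightarrow> g \<in> polys i \<Longrightarrow> (\<lambda>x. f x - g x) \<in> polys i"
  using polys_add[OF _ polys_uminus, of f i g] by simp

lemma polys_sum: "(\<And>s. s \<in> S \<Longrightarrow> f s \<in> polys i) \<Longrightarrow> (\<lambda>x. \<Sum>s\<in>S. f s x) \<in> polys i"
  by (induction S rule: infinite_finite_induct) (auto intro: polys_const polys_add)

lemma polys_prod: "(\<And>s. s \<in> S \<Longrightarrow> f s \<in> polys i) \<Longrightarrow> (\<lambda>x. \<Prod>s\<in>S. f s x) \<in> polys i"
  by (induction S rule: infinite_finite_induct) (auto intro: polys_const polys_mult)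

lemma polys_power: "f \<in> polys i \<Longrightarrow> (\<lambda>x. f x ^ m) \<in> polys i"
  by (induction m) (auto intro: polys_const polys_mult)

lemma polys_lift: "i \<le> k \<Longrightarrow> f \<in> polys i \<Longrightarrow> f \<in> polys k"
  unfolding polys_def using polyfun_lift_le by blast

lemma polys_cong: "f \<in> polys i \<Longrightarrow> (\<And>j. j < i \<Longrightarrow> x j = y j) \<Longrightarrow> f x = f y"
  unfolding polys_def using polyfun_cong by blast

lemma polys_upd: "f \<in> polys i \<Longrightarrow> i \<le> j \<Longrightarrow> f (x(j := T)) = f x"
  by (rule polys_cong) auto

section \<open>Nonempty open conditions on affine space\<close>

lemma polys_line: "f \<in> polys i \<Longrightarrow> \<exists>p. \<forall>s. f (\<lambda>j. a j + s * b j) = poly p s"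
proof -
  assume "f \<in> polys i"
  then obtain D where "f \<in> polyfun i D" by (auto simp: polys_def)
  then show ?thesis
  proof (induction i arbitrary: f)
    case 0
    then obtain c where "f = (\<lambda>x. c)" by auto
    then show ?case by (intro exI[of _ "[:c:]"]) simp
  next
    case (Suc i)
    obtain c where c: "\<And>j. c j \<in> polyfun i D" "f = (\<lambda>x. \<Sum>j\<le>D. c j x * x i ^ j)"
      using Suc.prems by (rule polyfun_SucE) blast
    have "\<exists>p. \<forall>s. c j (\<lambda>j. a j + s * b j) = poly p s" for j by (rule Suc.IH[OF c(1)])
    then obtain p where "\<And>j s. c j (\<lambda>j. a j + s * b j) = poly (p j) s" by metis
    then show ?case unfolding c(2)
      by (intro exI[of _ "\<Sum>j\<le>D. p j * [:a i, b i:] ^ j"]) (simp add: poly_sum mult.commute)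
  qed
qed

text \<open>On the line that joins a point where \<open>w\<close> is nonzero to a point where the
  product of the others is, both become nonzero univariate polynomials, and so does their
  product.\<close>

lemma polys_common_nonzero:
  assumes "finite V" "\<And>v. v \<in> V \<Longrightarrow> v \<in> polys i \<and> (\<exists>x. v x \<noteq> 0)"
  shows "\<exists>x. \<forall>v\<in>V. v x \<noteq> 0"
proof -
  have "(\<exists>x. (\<Prod>v\<in>V. v x) \<noteq> 0)" using assms
  proof (induction V rule: finite_induct)
    case (insert w V)
    then obtain x where x: "(\<Prod>v\<in>V. v x) \<noteq> 0" by auto
    obtain y where y: "w y \<noteq> 0" using insert.prems by auto
    have "(\<lambda>x. \<Prod>v\<in>V. v x) \<in> polys i" using insert.prems by (intro polys_prod) auto
    then obtain p where p: "\<And>s. (\<Prod>v\<in>V. v (\<lambda>j. x j + s * (y j - x j))) = poly p s"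
      using polys_line[of _ i x "\<lambda>j. y j - x j"] by blast
    have "w \<in> polys i" using insert.prems by auto
    then obtain q where q: "\<And>s. w (\<lambda>j. x j + s * (y j - x j)) = poly q s"
      using polys_line[of _ i x "\<lambda>j. y j - x j"] by blast
    have "poly p 0 \<noteq> 0" "poly q 1 \<noteq> 0" using x y p[of 0] q[of 1] by auto
    then have "p * q \<noteq> 0" by auto
    then obtain s where "poly (p * q) s \<noteq> 0" using poly_all_0_iff_0 by blast
    then show ?case using p q insert.hyps by (intro exI[of _ "\<lambda>j. x j + s * (y j - x j)"]) auto
  qed auto
  with assms(1) show ?thesis by auto
qed

text \<open>The function \<open>v\<close> is the product of the pivots of a Gaussian elimination at \<open>x0\<close>.\<close>

lemma trivial_kernel_open:
  fixes a :: "'r \<Rightarrow> 'u \<Rightarrow> pt \<Rightarrow> complex"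
  assumes "finite U" "\<And>r u. r \<in> R \<Longrightarrow> u \<in> U \<Longrightarrow> a r u \<in> polys N"
    and "\<And>y. (\<And>r. r \<in> R \<Longrightarrow> (\<Sum>u\<in>U. a r u x0 * y u) = 0) \<Longrightarrow> \<forall>u\<in>U. y u = 0"
  shows "\<exists>v\<in>polys N. v x0 \<noteq> 0 \<and> (\<forall>x y. v x \<noteq> 0 \<longrightarrow> (\<forall>r\<in>R. (\<Sum>u\<in>U. a r u x * y u) = 0) \<longrightarrow> (\<forall>u\<in>U. y u = 0))"
  using assms
proof (induction U arbitrary: a rule: finite_induct)
  case empty
  then show ?case by (auto intro!: bexI[OF _ polys_const[of 1]])
next
  case (insert u0 U)
  have "\<exists>r0\<in>R. a r0 u0 x0 \<noteq> 0"
  proof (rule ccontr)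
    assume neg: "\<not> ?thesis"
    define y where "y u = (if u = u0 then 1 else (0::complex))" for u
    have "(\<Sum>u\<in>insert u0 U. a r u x0 * y u) = 0" if "r \<in> R" for r
      using neg that by (intro sum.neutral) (auto simp: y_def)
    then have "\<forall>u\<in>insert u0 U. y u = 0" by (rule insert.prems(2))
    then show False by (simp add: y_def)
  qed
  then obtain r0 where r0: "r0 \<in> R" "a r0 u0 x0 \<noteq> 0" by blast
  \<comment> \<open>Fraction-free elimination of the unknown \<open>u0\<close> by the pivot row
    \<open>r0\<close>: the new entries stay polynomial, and only the pivot has to be
    nonzero.\<close>
  define a' where "a' r u = (\<lambda>x. a r0 u0 x * a r u x - a r u0 x * a r0 u x)" for r u
  have a'sum: "(\<Sum>u\<in>U. a' r u x * y u) = a r0 u0 x * (\<Sum>u\<in>U. a r u x * y u) - a r u0 x * (\<Sum>u\<in>U. a r0 u x * y u)"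
    for r x y
    by (simp add: a'_def algebra_simps sum_subtractf sum_distrib_left)
  have "\<exists>v\<in>polys N. v x0 \<noteq> 0 \<and> (\<forall>x y. v x \<noteq> 0 \<longrightarrow> (\<forall>r\<in>R. (\<Sum>u\<in>U. a' r u x * y u) = 0) \<longrightarrow> (\<forall>u\<in>U. y u = 0))"
  proof (rule insert.IH)
    show "a' r u \<in> polys N" if "r \<in> R" "u \<in> U" for r u
      unfolding a'_def using insert.prems(1) that r0 by (intro polys_diff polys_mult) auto
    fix y assume y: "\<And>r. r \<in> R \<Longrightarrow> (\<Sum>u\<in>U. a' r u x0 * y u) = 0"
    define y' where "y' = y(u0 := - (\<Sum>u\<in>U. a r0 u x0 * y u) / a r0 u0 x0)"
    have "(\<Sum>u\<in>U. a r u x0 * y' u) = (\<Sum>u\<in>U. a r u x0 * y u)" for r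
      using insert.hyps(2) by (intro sum.cong) (auto simp: y'_def)
    moreover have "y' u0 = - (\<Sum>u\<in>U. a r0 u x0 * y u) / a r0 u0 x0" by (simp add: y'_def)
    ultimately have "(\<Sum>u\<in>insert u0 U. a r u x0 * y' u) = 0" if "r \<in> R" for r
    proof -
      let ?S = "\<lambda>r. \<Sum>u\<in>U. a r u x0 * y u"
      have "(\<Sum>u\<in>insert u0 U. a r u x0 * y' u) = a r u0 x0 * (- ?S r0 / a r0 u0 x0) + ?S r"
        using insert.hyps \<open>\<And>r. (\<Sum>u\<in>U. a r u x0 * y' u) = ?S r\<close> \<open>y' u0 = _\<close> by simp
      also have "\<dots> = (a r0 u0 x0 * ?S r - a r u0 x0 * ?S r0) / a r0 u0 x0"
        using r0(2) by (simp add: field_simps)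
      also have "\<dots> = 0" using y[OF that] unfolding a'sum by simp
      finally show ?thesis .
    qed
    then have "\<forall>u\<in>insert u0 U. y' u = 0" by (rule insert.prems(2))
    then show "\<forall>u\<in>U. y u = 0" using insert.hyps(2) by (auto simp: y'_def split: if_splits)
  qed
  then obtain v where v: "v \<in> polys N" "v x0 \<noteq> 0"
    "\<And>x y. v x \<noteq> 0 \<Longrightarrow> (\<forall>r\<in>R. (\<Sum>u\<in>U. a' r u x * y u) = 0) \<Longrightarrow> (\<forall>u\<in>U. y u = 0)" by blast
  have "\<forall>u\<in>insert u0 U. y u = 0"
    if "v x * a r0 u0 x \<noteq> 0" and y: "\<forall>r\<in>R. (\<Sum>u\<in>insert u0 U. a r u x * y u) = 0" for x y
  proof -
    have row: "a r u0 x * y u0 + (\<Sum>u\<in>U. a r u x * y u) = 0" if "r \<in> R" for r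
      using y that insert.hyps by simp
    have "(\<Sum>u\<in>U. a' r u x * y u) = 0" if "r \<in> R" for r
    proof -
      have "(\<Sum>u\<in>U. a r u x * y u) = - (a r u0 x * y u0)" "(\<Sum>u\<in>U. a r0 u x * y u) = - (a r0 u0 x * y u0)"
        using row[OF that] row[OF r0(1)] by (auto simp: eq_neg_iff_add_eq_0 add.commute)
      then show ?thesis unfolding a'sum by simp
    qed
    then have "\<forall>u\<in>U. y u = 0" using v(3) that(1) by auto
    moreover from this have "y u0 = 0" using row[OF r0(1)] that(1) by simp
    ultimately show ?thesis by simp
  qed
  moreover have "(\<lambda>x. v x * a r0 u0 x) \<in> polys N" using v(1) insert.prems(1) r0(1) by (intro polys_mult) auto
  ultimately show ?case using v(2) r0(2) by (intro bexI[of _ "\<lambda>x. v x * a r0 u0 x"]) auto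
qed

text \<open>The Zariski closure of the projection of \<open>Y\<close> to the first \<open>i\<close>
  coordinates, kept as a cylinder over the remaining ones.\<close>

definition closed_to :: "nat \<Rightarrow> pt set \<Rightarrow> pt set" where
  "closed_to i Y = {x. \<forall>f\<in>polys i. (\<forall>y\<in>Y. f y = 0) \<longrightarrow> f x = 0}"

text \<open>Coordinate \<open>i\<close>, the one that follows the first \<open>i\<close>, is
  transcendental over the functions of these on \<open>Y\<close>. Coefficients count modulo the
  functions that vanish on \<open>Y\<close>.\<close>

definition transc :: "nat \<Rightarrow> pt set \<Rightarrow> bool" where
  "transc i Y \<longleftrightarrow> (\<forall>D c. (\<forall>j. c j \<in> polys i) \<longrightarrow> (\<forall>x\<in>Y. (\<Sum>j\<le>D. c j x * x i ^ j) = 0) \<longrightarrow>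
     (\<forall>j\<le>D. \<forall>x\<in>Y. c j x = 0))"

text \<open>Polynomials in the next coordinate. Their coefficients live in the ring of all functions
  of a point, which has zero divisors; \<open>polyc\<close> records that they are polynomial
  functions, and division has to be pseudo-division.\<close>

definition polyc :: "nat \<Rightarrow> (pt \<Rightarrow> complex) poly set" where
  "polyc i = {p. \<forall>j. Polynomial.coeff p j \<in> polys i}"

definition ev :: "(pt \<Rightarrow> complex) poly \<Rightarrow> pt \<Rightarrow> complex \<Rightarrow> complex" where
  "ev p x w = poly p (\<lambda>_. w) x"

section \<open>Univariate polynomials over a ring of functions\<close>

lemma sum_apply: "(\<Sum>s\<in>S. f s) x = (\<Sum>s\<in>S. f s x)" for f :: "'z \<Rightarrow> 'a \<Rightarrow> 'b::comm_monoid_add"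
  by (induction S rule: infinite_finite_induct) auto

lemma power_apply: "(f ^ m) x = f x ^ m" for f :: "'a \<Rightarrow> 'b::comm_ring_1"
  by (induction m) auto

lemma ev_add: "ev (p + q) x w = ev p x w + ev q x w"
  and ev_mult: "ev (p * q) x w = ev p x w * ev q x w"
  and ev_diff: "ev (p - q) x w = ev p x w - ev q x w"
  and ev_smult: "ev (Polynomial.smult c p) x w = c x * ev p x w"
  and ev_0: "ev 0 x w = 0"
  by (simp_all add: ev_def)

lemma ev_sum: "(\<And>j. j > D \<Longrightarrow> Polynomial.coeff p j x = 0) \<Longrightarrow> ev p x w = (\<Sum>j\<le>D. Polynomial.coeff p j x * w ^ j)"
proof -
  assume z: "\<And>j. j > D \<Longrightarrow> Polynomial.coeff p j x = 0"
  have "ev p x w = (\<Sum>j\<le>Polynomial.degree p. Polynomial.coeff p j x * w ^ j)"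
    by (simp add: ev_def poly_altdef sum_apply power_apply)
  also have "\<dots> = (\<Sum>j\<le>max D (Polynomial.degree p). Polynomial.coeff p j x * w ^ j)"
    by (intro sum.mono_neutral_left) (auto simp: coeff_eq_0)
  also have "\<dots> = (\<Sum>j\<le>D. Polynomial.coeff p j x * w ^ j)"
    by (intro sum.mono_neutral_right) (auto simp: z)
  finally show ?thesis .
qed

lemma polys_zero: "0 \<in> polys i"
  using polys_const[of 0] by (simp add: zero_fun_def)

lemma polys_add': "f \<in> polys i \<Longrightarrow> g \<in> polys i \<Longrightarrow> f + g \<in> polys i"
  using polys_add[of f i g] by (simp add: plus_fun_def)

lemma polys_mult': "f \<in> polys i \<Longrightarrow> g \<in> polys i \<Longrightarrow> f * g \<in> polys i"
  using polys_mult[of f i g] by (simp add: times_fun_def)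

lemma polys_diff': "f \<in> polys i \<Longrightarrow> g \<in> polys i \<Longrightarrow> f - g \<in> polys i"
  using polys_diff[of f i g] by (simp add: fun_diff_def)

lemma polys_sum': "(\<And>s. s \<in> S \<Longrightarrow> f s \<in> polys i) \<Longrightarrow> sum f S \<in> polys i"
  by (induction S rule: infinite_finite_induct) (auto intro: polys_zero polys_add')

lemma polys_power': "f \<in> polys i \<Longrightarrow> f ^ m \<in> polys i"
  by (induction m) (auto intro: polys_mult' simp: one_fun_def polys_const)

lemma polyc_add: "p \<in> polyc i \<Longrightarrow> q \<in> polyc i \<Longrightarrow> p + q \<in> polyc i"
  and polyc_diff: "p \<in> polyc i \<Longrightarrow> q \<in> polyc i \<Longrightarrow> p - q \<in> polyc i"
  and polyc_mult: "p \<in> polyc i \<Longrightarrow> q \<in> polyc i \<Longrightarrow> p * q \<in> polyc i"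
  and polyc_smult: "c \<in> polys i \<Longrightarrow> p \<in> polyc i \<Longrightarrow> Polynomial.smult c p \<in> polyc i"
  and polyc_monom: "c \<in> polys i \<Longrightarrow> Polynomial.monom c j \<in> polyc i"
  and polyc_0: "0 \<in> polyc i"
  and polyc_coeff: "p \<in> polyc i \<Longrightarrow> Polynomial.coeff p j \<in> polys i"
  by (auto simp: polyc_def coeff_mult polys_zero intro!: polys_add' polys_diff' polys_mult' polys_sum')

lemma polyc_1: "1 \<in> polyc i"
  using polyc_monom[OF polys_const[of 1 i], of 0] by (simp add: monom_0 one_pCons one_fun_def)

lemma ev_polys: "p \<in> polyc i \<Longrightarrow> (\<lambda>x. ev p x (x i)) \<in> polys (Suc i)"
proof -
  assume p: "p \<in> polyc i"
  have "ev p x (x i) = (\<Sum>j\<le>Polynomial.degree p. Polynomial.coeff p j x * x i ^ j)" for x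
    by (rule ev_sum) (simp add: coeff_eq_0)
  moreover have "(\<lambda>x. \<Sum>j\<le>Polynomial.degree p. Polynomial.coeff p j x * x i ^ j) \<in> polys (Suc i)"
    by (intro polys_sum polys_mult polys_power polys_var polys_lift[of i "Suc i"] polyc_coeff[OF p]) auto
  ultimately show ?thesis by simp
qed

lemma polys_SucE:
  assumes "f \<in> polys (Suc i)"
  obtains p where "p \<in> polyc i" "f = (\<lambda>x. ev p x (x i))"
proof -
  obtain D where "f \<in> polyfun (Suc i) D" using assms by (auto simp: polys_def)
  then obtain c where c: "\<And>j. c j \<in> polyfun i D" "f = (\<lambda>x. \<Sum>j\<le>D. c j x * x i ^ j)"
    by (rule polyfun_SucE) blast
  define p where "p = (\<Sum>j\<le>D. Polynomial.monom (c j) j)"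
  have cf: "Polynomial.coeff p j = (if j \<le> D then c j else 0)" for j by (simp add: p_def coeff_sum)
  have "p \<in> polyc i" unfolding polyc_def using c(1) polysI polys_zero by (auto simp: cf)
  moreover have "ev p x w = (\<Sum>j\<le>D. c j x * w ^ j)" for x w
    by (subst ev_sum[where D = D]) (auto simp: cf)
  then have "f = (\<lambda>x. ev p x (x i))" unfolding c(2) by simp
  ultimately show ?thesis using that by blast
qed

text \<open>Degrees are nominal: \<open>e\<close> and \<open>n\<close> bound the places where
  coefficients may be nonzero, and the coefficient at \<open>e\<close> may be a zero divisor. The
  clause on \<open>h\<close> bounds the degree of the quotient, so that the minimality of a relation
  can be applied to it later.\<close>

lemma pseudo_division_subring:
  fixes p q :: "'r::comm_ring_1 poly"
  assumes R: "0 \<in> R" "1 \<in> R" "\<And>a b. a \<in> R \<Longrightarrow> b \<in> R \<Longrightarrow> a + b \<in> R"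
    "\<And>a b. a \<in> R \<Longrightarrow> b \<in> R \<Longrightarrow> a - b \<in> R" "\<And>a b. a \<in> R \<Longrightarrow> b \<in> R \<Longrightarrow> a * b \<in> R"
    and q: "\<And>j. Polynomial.coeff q j \<in> R" "\<And>j. j > e \<Longrightarrow> Polynomial.coeff q j = 0"
    and p: "\<And>j. Polynomial.coeff p j \<in> R" "\<And>j. j \<ge> n \<Longrightarrow> Polynomial.coeff p j = 0"
  shows "\<exists>k h r. (\<forall>j. Polynomial.coeff h j \<in> R) \<and> (\<forall>j. Polynomial.coeff r j \<in> R) \<and>
    Polynomial.smult (Polynomial.coeff q e ^ k) p = h * q + r \<and>
    (\<forall>j\<ge>e. Polynomial.coeff r j = 0) \<and> (\<forall>j. j + e \<ge> n \<longrightarrow> Polynomial.coeff h j = 0)"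
  using p
proof (induction n arbitrary: p)
  case 0
  then have "p = 0" by (intro poly_eqI) auto
  then show ?case by (intro exI[of _ 0]) (auto simp: R)
next
  case (Suc n)
  show ?case
  proof (cases "n < e")
    case True
    then have "\<forall>j\<ge>e. Polynomial.coeff p j = 0" using Suc.prems by auto
    then show ?thesis using Suc.prems(1) R
      by (intro exI[of _ 0] exI[of _ p]) auto
  next
    case False
    define a where "a = Polynomial.coeff q e"
    define m where "m = Polynomial.monom (Polynomial.coeff p n) (n - e)"
    define p' where "p' = Polynomial.smult a p - m * q"
    have aR: "a \<in> R" unfolding a_def by (rule q)
    have cp': "Polynomial.coeff p' j = a * Polynomial.coeff p j -
        (if n - e \<le> j then Polynomial.coeff p n * Polynomial.coeff q (j - (n - e)) else 0)" for j
      by (simp add: p'_def m_def coeff_monom_mult)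
    have p'R: "Polynomial.coeff p' j \<in> R" for j unfolding cp' using Suc.prems(1) aR R q by simp
    have "Polynomial.coeff p' j = 0" if "j \<ge> n" for j
    proof (cases "j = n")
      case True
      then have "j - (n - e) = e" using False by simp
      then show ?thesis using True by (simp add: cp' a_def)
    next
      case False2: False
      then have "j > n" using that by simp
      then show ?thesis using Suc.prems(2)[of j] q(2)[of "j - (n - e)"] False by (simp add: cp')
    qed
    from Suc.IH[OF p'R this] obtain k h r where
      *: "\<And>j. Polynomial.coeff h j \<in> R" "\<And>j. Polynomial.coeff r j \<in> R"
      "Polynomial.smult (Polynomial.coeff q e ^ k) p' = h * q + r"
      "\<And>j. j \<ge> e \<Longrightarrow> Polynomial.coeff r j = 0" "\<And>j. j + e \<ge> n \<Longrightarrow> Polynomial.coeff h j = 0"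
      by blast
    have akR: "a ^ k \<in> R" by (induction k) (auto simp: R aR)
    have "Polynomial.smult (a ^ Suc k) p = Polynomial.smult (a ^ k) (p' + m * q)"
      unfolding p'_def diff_add_cancel by (simp only: smult_smult power_Suc2)
    also have "\<dots> = h * q + r + Polynomial.smult (a ^ k) m * q"
      by (simp only: smult_add_right *(3)[folded a_def] mult_smult_left)
    also have "\<dots> = (h + Polynomial.smult (a ^ k) m) * q + r"
      by (simp add: algebra_simps)
    finally have "Polynomial.smult (Polynomial.coeff q e ^ Suc k) p = (h + Polynomial.smult (a ^ k) m) * q + r"
      unfolding a_def .
    moreover have "Polynomial.coeff (h + Polynomial.smult (a ^ k) m) j \<in> R" for j
      using *(1) akR Suc.prems(1) R by (simp add: m_def)
    moreover have "Polynomial.coeff (h + Polynomial.smult (a ^ k) m) j = 0" if "j + e \<ge> Suc n" for j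
      using that *(5)[of j] False by (auto simp: m_def)
    ultimately show ?thesis using *(2,4)
      by (intro exI[of _ "Suc k"] exI[of _ "h + Polynomial.smult (a ^ k) m"] exI[of _ r]) blast
  qed
qed

lemma pseudo_division:
  assumes "q \<in> polyc i" "\<forall>j>e. Polynomial.coeff q j = 0" "p \<in> polyc i"
    and "\<forall>j\<ge>n. Polynomial.coeff p j = 0"
  shows "\<exists>k h r. h \<in> polyc i \<and> r \<in> polyc i \<and> Polynomial.smult (Polynomial.coeff q e ^ k) p = h * q + r \<and>
    (\<forall>j\<ge>e. Polynomial.coeff r j = 0) \<and> (\<forall>j. j + e \<ge> n \<longrightarrow> Polynomial.coeff h j = 0)"
proof -
  have one: "1 \<in> polys i" using polys_const[of 1] by (simp add: one_fun_def)
  have "\<exists>k h r. (\<forall>j. Polynomial.coeff h j \<in> polys i) \<and> (\<forall>j. Polynomial.coeff r j \<in> polys i) \<and>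
    Polynomial.smult (Polynomial.coeff q e ^ k) p = h * q + r \<and>
    (\<forall>j\<ge>e. Polynomial.coeff r j = 0) \<and> (\<forall>j. j + e \<ge> n \<longrightarrow> Polynomial.coeff h j = 0)"
  proof (rule pseudo_division_subring)
    show "Polynomial.coeff q j \<in> polys i" "Polynomial.coeff p j \<in> polys i" for j
      by (rule polyc_coeff[OF assms(1)], rule polyc_coeff[OF assms(3)])
    show "\<And>j. j > e \<Longrightarrow> Polynomial.coeff q j = 0" using assms(2) by simp
    show "\<And>j. j \<ge> n \<Longrightarrow> Polynomial.coeff p j = 0" using assms(4) by simp
  qed (fact polys_zero one polys_add' polys_diff' polys_mult')+
  then show ?thesis unfolding polyc_def by simp
qed

text \<open>The vanishing ideal of \<open>Y\<close> in the first \<open>N\<close> coordinates is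
  prime. \<open>Y\<close> itself may fail to be closed; the points of its closure enter through
  \<open>closed_to N Y\<close>.\<close>

locale prime_set =
  fixes N :: nat and Y :: "pt set"
  assumes nonempty: "Y \<noteq> {}"
    and prime: "\<And>f g. f \<in> polys N \<Longrightarrow> g \<in> polys N \<Longrightarrow> (\<forall>x\<in>Y. f x * g x = 0) \<Longrightarrow>
      (\<forall>x\<in>Y. f x = 0) \<or> (\<forall>x\<in>Y. g x = 0)"
begin

section \<open>Relations of least degree on a prime set\<close>

definition nz :: "(pt \<Rightarrow> complex) \<Rightarrow> bool" where "nz f \<longleftrightarrow> (\<exists>y\<in>Y. f y \<noteq> 0)"

lemma nz_mult: "f \<in> polys i \<Longrightarrow> g \<in> polys i \<Longrightarrow> i \<le> N \<Longrightarrow> nz f \<Longrightarrow> nz g \<Longrightarrow> nz (\<lambda>x. f x * g x)"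
proof -
  assume "f \<in> polys i" "g \<in> polys i" "i \<le> N" and nz: "nz f" "nz g"
  then have "f \<in> polys N" "g \<in> polys N" using polys_lift by auto
  from prime[OF this] nz show ?thesis unfolding nz_def by auto
qed

lemma nz_power: "f \<in> polys i \<Longrightarrow> i \<le> N \<Longrightarrow> nz f \<Longrightarrow> nz (\<lambda>x. f x ^ m)"
proof (induction m)
  case (Suc m)
  then show ?case using nz_mult[of f i "\<lambda>x. f x ^ m"] polys_power by simp
qed (use nonempty in \<open>auto simp: nz_def\<close>)

lemma closed_toD: "x \<in> closed_to i Y \<Longrightarrow> f \<in> polys i \<Longrightarrow> \<not> nz f \<Longrightarrow> f x = 0"
  unfolding closed_to_def nz_def by blast

lemma transc_closed_to:
  assumes "transc i Y" "x \<in> closed_to i Y"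
  shows "x(i := w) \<in> closed_to (Suc i) Y"
  unfolding closed_to_def
proof (intro CollectI ballI impI)
  fix f assume "f \<in> polys (Suc i)" and van: "\<forall>y\<in>Y. f y = 0"
  then obtain p where p: "p \<in> polyc i" "f = (\<lambda>x. ev p x (x i))" by (elim polys_SucE)
  let ?D = "Polynomial.degree p"
  have e: "ev p x w = (\<Sum>j\<le>?D. Polynomial.coeff p j x * w ^ j)" for x w
    by (rule ev_sum) (simp add: coeff_eq_0)
  have "\<forall>j\<le>?D. \<forall>x\<in>Y. Polynomial.coeff p j x = 0"
    using assms(1) van p polyc_coeff[OF p(1)] unfolding transc_def p(2) e by blast
  then have z: "Polynomial.coeff p j x = 0" if "j \<le> ?D" for j
    using assms(2) that polyc_coeff[OF p(1)] unfolding closed_to_def by blast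
  have "Polynomial.coeff p j (x(i := w)) = Polynomial.coeff p j x" for j
    by (intro polys_upd[of _ i] polyc_coeff[OF p(1)]) auto
  then show "f (x(i := w)) = 0" unfolding p(2) e using z by (intro sum.neutral) auto
qed

definition zs :: "nat \<Rightarrow> (pt \<Rightarrow> complex) poly set" where
  "zs i = {p\<in>polyc i. \<forall>y\<in>Y. ev p y (y i) = 0}"

lemma zs_prime:
  assumes "i < N" "p \<in> polyc i" "q \<in> polyc i" "p * q \<in> zs i"
  shows "p \<in> zs i \<or> q \<in> zs i"
proof -
  have "\<forall>x\<in>Y. ev p x (x i) * ev q x (x i) = 0" using assms(4) by (simp add: zs_def ev_mult)
  moreover have "(\<lambda>x. ev p x (x i)) \<in> polys N" "(\<lambda>x. ev q x (x i)) \<in> polys N"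
    using assms(1) by (auto intro!: polys_lift[OF _ ev_polys] assms(2,3))
  ultimately show ?thesis using prime assms(2,3) unfolding zs_def by blast
qed

text \<open>Dropping the leading coefficients that vanish identically on \<open>Y\<close>.\<close>

lemma strip:
  assumes "p \<in> polyc i" "\<And>j. j > n \<Longrightarrow> Polynomial.coeff p j = 0" "nz (Polynomial.coeff p m)"
  obtains j q where "j \<le> n" "q \<in> polyc i" "nz (Polynomial.coeff q j)" "\<And>l. l > j \<Longrightarrow> Polynomial.coeff q l = 0"
    "p - q \<in> zs i"
proof -
  define S where "S = {j. nz (Polynomial.coeff p j)}"
  have S: "S \<subseteq> {..n}"
  proof
    fix j assume "j \<in> S"
    then show "j \<in> {..n}" using assms(2)[of j] by (cases "j \<le> n") (auto simp: S_def nz_def)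
  qed
  then have fin: "finite S" using finite_subset by blast
  define j where "j = Max S"
  have j: "j \<in> S" using assms(3) fin unfolding j_def by (intro Max_in) (auto simp: S_def)
  have above: "\<not> nz (Polynomial.coeff p l)" if "l > j" for l
    using that Max_ge[OF fin, of l] by (auto simp: j_def S_def)
  define q where "q = (\<Sum>l\<le>j. Polynomial.monom (Polynomial.coeff p l) l)"
  have cq: "Polynomial.coeff q l = (if l \<le> j then Polynomial.coeff p l else 0)" for l
    by (simp add: q_def coeff_sum)
  have q: "q \<in> polyc i" using assms(1) by (auto simp: polyc_def cq polys_zero)
  have "ev (p - q) y (y i) = 0" if "y \<in> Y" for y
  proof -
    have "Polynomial.coeff (p - q) l y = 0" for l
      using above[of l] that by (auto simp: cq nz_def)
    then show ?thesis by (subst ev_sum[of 0]) auto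
  qed
  then have "p - q \<in> zs i" using polyc_diff[OF assms(1) q] by (simp add: zs_def)
  moreover have "j \<le> n" using j S by auto
  ultimately show ?thesis using that[of j q] j q by (auto simp: S_def cq)
qed

lemma zs_add: "p \<in> zs i \<Longrightarrow> q \<in> zs i \<Longrightarrow> p + q \<in> zs i"
  by (simp add: zs_def ev_add polyc_add)

lemma zs_diff: "p \<in> zs i \<Longrightarrow> q \<in> zs i \<Longrightarrow> p - q \<in> zs i"
  by (simp add: zs_def ev_diff polyc_diff)

lemma zs_mult2: "p \<in> zs i \<Longrightarrow> q \<in> polyc i \<Longrightarrow> q * p \<in> zs i"
  by (simp add: zs_def ev_mult polyc_mult)

lemma zs_smult: "p \<in> zs i \<Longrightarrow> c \<in> polys i \<Longrightarrow> Polynomial.smult c p \<in> zs i"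
  by (simp add: zs_def ev_smult polyc_smult)

text \<open>A minimal polynomial of coordinate \<open>i\<close> over the function field of the
  projection, with denominators cleared; the last clause is the minimality of its degree. Degree
  zero is impossible, since the leading coefficient would be a relation that does not vanish on
  \<open>Y\<close>.\<close>

lemma algebraic_relation:
  assumes "\<not> transc i Y"
  obtains e \<Phi> where "e > 0" "\<Phi> \<in> zs i" "nz (Polynomial.coeff \<Phi> e)" "\<And>j. j > e \<Longrightarrow> Polynomial.coeff \<Phi> j = 0"
    "\<And>p j. p \<in> zs i \<Longrightarrow> (\<And>j. j \<ge> e \<Longrightarrow> Polynomial.coeff p j = 0) \<Longrightarrow> \<not> nz (Polynomial.coeff p j)"
proof -
  define Q where "Q e p \<longleftrightarrow> p \<in> zs i \<and> nz (Polynomial.coeff p e) \<and> (\<forall>j>e. Polynomial.coeff p j = 0)" for e p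
  obtain D c m y where c: "\<And>j. c j \<in> polys i" "\<forall>x\<in>Y. (\<Sum>j\<le>D. c j x * x i ^ j) = 0" and m: "m \<le> D" "y \<in> Y" "c m y \<noteq> 0"
    using assms unfolding transc_def by blast
  define p where "p = (\<Sum>j\<le>D. Polynomial.monom (c j) j)"
  have cf: "Polynomial.coeff p j = (if j \<le> D then c j else 0)" for j by (simp add: p_def coeff_sum)
  have pP: "p \<in> polyc i" unfolding polyc_def using c(1) polys_zero by (auto simp: cf)
  have "ev p x w = (\<Sum>j\<le>D. c j x * w ^ j)" for x w
    by (subst ev_sum[where D = D]) (auto simp: cf)
  then have pz: "p \<in> zs i" using c(2) pP by (simp add: zs_def)
  have "nz (Polynomial.coeff p m)" using m by (auto simp: nz_def cf)
  moreover have "Polynomial.coeff p j = 0" if "j > D" for j using that by (simp add: cf)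
  ultimately obtain j q where jq: "q \<in> polyc i" "nz (Polynomial.coeff q j)" "\<And>l. l > j \<Longrightarrow> Polynomial.coeff q l = 0" "p - q \<in> zs i"
    using strip[OF pP] by metis
  have "p - (p - q) \<in> zs i" using zs_diff pz jq(4) by blast
  then have "Q j q" using jq by (simp add: Q_def)
  then have ex: "\<exists>e. \<exists>q. Q e q" by blast
  obtain e where e: "\<exists>q. Q e q" "\<And>e'. e' < e \<Longrightarrow> \<not> (\<exists>q. Q e' q)"
    using ex exists_least_iff[of "\<lambda>e. \<exists>q. Q e q"] by blast
  obtain \<Phi> where \<Phi>: "Q e \<Phi>" using e(1) by blast
  have min: "\<not> nz (Polynomial.coeff p j)" if "p \<in> zs i" "\<And>j. j \<ge> e \<Longrightarrow> Polynomial.coeff p j = 0" for p j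
  proof
    assume nzj: "nz (Polynomial.coeff p j)"
    show False
    proof (cases e)
      case 0
      then show False using that(2)[of j] nzj by (simp add: nz_def)
    next
      case (Suc e')
      have pP: "p \<in> polyc i" using that(1) by (simp add: zs_def)
      have "\<And>j. j > e' \<Longrightarrow> Polynomial.coeff p j = 0" using that(2) Suc by simp
      from strip[OF pP this nzj] obtain l q where lq: "l \<le> e'" "q \<in> polyc i" "nz (Polynomial.coeff q l)"
        "\<And>l'. l' > l \<Longrightarrow> Polynomial.coeff q l' = 0" "p - q \<in> zs i" by blast
      have "p - (p - q) \<in> zs i" using zs_diff that(1) lq(5) by blast
      then have "Q l q" using lq by (simp add: Q_def)
      then show False using e(2)[of l] lq(1) Suc by auto
    qed
  qed
  have "e > 0"
  proof (rule ccontr)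
    assume "\<not> e > 0"
    then have "ev \<Phi> x w = Polynomial.coeff \<Phi> 0 x" for x w
      using \<Phi> by (subst ev_sum[where D = 0]) (auto simp: Q_def)
    then show False using \<Phi> \<open>\<not> e > 0\<close> by (auto simp: Q_def zs_def nz_def)
  qed
  then show ?thesis using that \<Phi> min unfolding Q_def by blast
qed

end

section \<open>Sections with a common jet\<close>

lemma underdetermined_system:
  fixes a :: "'c \<Rightarrow> 'u \<Rightarrow> complex"
  assumes "finite C" "finite U" "card C < card U"
  shows "\<exists>y. (\<exists>u\<in>U. y u \<noteq> 0) \<and> (\<forall>c\<in>C. (\<Sum>u\<in>U. a c u * y u) = 0)"
proof -
  interpret vs: vector_space "\<lambda>(k::complex) (f::'c \<Rightarrow> complex). (\<lambda>x. k * f x)"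
    by unfold_locales (auto simp: fun_eq_iff algebra_simps)
  define \<delta> where "\<delta> c = (\<lambda>x. if x = c then 1 else (0::complex))" for c :: 'c
  define f where "f u = (\<lambda>c. if c \<in> C then a c u else 0)" for u
  have "f u \<in> vs.span (\<delta> ` C)" for u
  proof -
    have "f u = (\<Sum>c\<in>C. (\<lambda>x. a c u * \<delta> c x))"
    proof
      fix x
      have "(\<Sum>c\<in>C. (\<lambda>x. a c u * \<delta> c x)) x = (\<Sum>c\<in>C. if x = c then a c u else 0)"
        unfolding sum_apply by (intro sum.cong) (auto simp: \<delta>_def)
      then show "f u x = (\<Sum>c\<in>C. (\<lambda>x. a c u * \<delta> c x)) x" using assms(1) by (simp add: f_def)
    qed
    then show ?thesis by (simp only:) (intro vs.span_sum vs.span_scale vs.span_base, auto)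
  qed
  moreover have "vs.dim (vs.span (\<delta> ` C)) \<le> card (\<delta> ` C)"
    using vs.dim_le_card'[of "\<delta> ` C"] assms(1) by simp
  then have "vs.dim (vs.span (\<delta> ` C)) < card U" using card_image_le[OF assms(1), of \<delta>] assms(3) by linarith
  ultimately obtain y where y: "\<exists>u\<in>U. y u \<noteq> 0" "(\<Sum>u\<in>U. (\<lambda>x. y u * f u x)) = 0"
    using vs.dependent_family[of "\<delta> ` C" U f] assms(1,2) by blast
  have "(\<Sum>u\<in>U. a c u * y u) = 0" if "c \<in> C" for c
  proof -
    have "(\<Sum>u\<in>U. a c u * y u) = (\<Sum>u\<in>U. (\<lambda>x. y u * f u x)) c"
      unfolding sum_apply f_def using that by (simp add: mult.commute)
    then show ?thesis using y(2) by simp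
  qed
  then show ?thesis using y(1) by blast
qed

lemma poly_taylor2:
  fixes Q :: "'s::idom poly"
  shows "\<exists>h. poly Q (w + \<delta>) = poly Q w + \<delta> * poly (pderiv Q) w + \<delta>\<^sup>2 * h"
proof (induction Q)
  case 0
  then show ?case by (intro exI[of _ 0]) simp
next
  case (pCons a Q)
  then obtain h where h: "poly Q (w + \<delta>) = poly Q w + \<delta> * poly (pderiv Q) w + \<delta>\<^sup>2 * h" by blast
  show ?case
    unfolding poly_pCons pderiv_pCons h
    by (rule exI[of _ "poly (pderiv Q) w + (w + \<delta>) * h"]) (simp add: algebra_simps power2_eq_square)
qed

lemma poly_diff_dvd:
  fixes Q :: "'s::idom poly"
  shows "(w' - w) dvd (poly Q w' - poly Q w)"
proof (induction Q)
  case (pCons a Q)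
  have "poly (pCons a Q) w' - poly (pCons a Q) w = w' * (poly Q w' - poly Q w) + (w' - w) * poly Q w"
    by (simp add: algebra_simps)
  then show ?case using pCons by (metis dvd_add dvd_mult dvd_triv_left)
qed simp

text \<open>The correction uses one fixed \<open>\<eta>\<close>, an inverse of the derivative only
  modulo \<open>z\<close>. Each step then gains a single factor \<open>z\<close> instead of doubling
  the order, but no true inverse and no completeness are required of the ring.\<close>

lemma newton_lift:
  fixes Q :: "'s::idom poly"
  assumes "z dvd poly Q W0" "z dvd 1 - \<eta> * poly (pderiv Q) W0"
  shows "\<exists>W. z dvd W - W0 \<and> z ^ Suc a dvd poly Q W"
proof (induction a)
  case 0
  then show ?case using assms(1) by (intro exI[of _ W0]) simp
next
  case (Suc a)
  then obtain W where W: "z dvd W - W0" "z ^ Suc a dvd poly Q W" by blast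
  define q where "q = poly Q W"
  define \<delta> where "\<delta> = - (\<eta> * q)"
  obtain h where h: "poly Q (W + \<delta>) = q + \<delta> * poly (pderiv Q) W + \<delta>\<^sup>2 * h"
    using poly_taylor2[of Q W \<delta>] unfolding q_def by blast
  have zq: "z dvd q" using W(2) unfolding q_def by (metis dvd_mult_left power_Suc)
  have 1: "z dvd 1 - \<eta> * poly (pderiv Q) W"
  proof -
    have "z dvd poly (pderiv Q) W - poly (pderiv Q) W0" using dvd_trans[OF W(1) poly_diff_dvd] .
    then have "z dvd (1 - \<eta> * poly (pderiv Q) W0) - \<eta> * (poly (pderiv Q) W - poly (pderiv Q) W0)"
      by (rule dvd_diff[OF assms(2) dvd_mult])
    then show ?thesis by (simp add: algebra_simps)
  qed
  have e: "poly Q (W + \<delta>) = q * (1 - \<eta> * poly (pderiv Q) W) + q * q * (\<eta>\<^sup>2 * h)"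
    unfolding h by (simp add: \<delta>_def algebra_simps power2_eq_square)
  have "z ^ Suc a * z dvd q * (1 - \<eta> * poly (pderiv Q) W)"
    using W(2) 1 unfolding q_def by (rule mult_dvd_mono)
  moreover have "z ^ Suc a * z dvd q * q * (\<eta>\<^sup>2 * h)"
    using mult_dvd_mono[OF W(2)[folded q_def] zq] by (rule dvd_mult2)
  ultimately have "z ^ Suc (Suc a) dvd poly Q (W + \<delta>)" unfolding e by (simp only: power_Suc2[of z "Suc a"] dvd_add)
  moreover have "z dvd (W + \<delta>) - W0"
  proof -
    have "z dvd (W - W0) + \<delta>" using W(1) zq unfolding \<delta>_def by (intro dvd_add) auto
    then show ?thesis by (simp add: algebra_simps)
  qed
  ultimately show ?case by blast
qed

lemma fps_X_dvd_iff: "fps_X dvd (f :: complex fps) \<longleftrightarrow> fps_nth f 0 = 0"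
proof
  assume "fps_X dvd f"
  then show "fps_nth f 0 = 0" by (auto elim!: dvdE)
next
  assume "fps_nth f 0 = 0"
  then have "f = fps_X * fps_shift 1 f" by (intro fps_ext) (auto simp: not_less_eq)
  then show "fps_X dvd f" by (metis dvd_triv_left)
qed

lemma fps_X_power_dvd_nth: "fps_X ^ q dvd (f :: complex fps) \<Longrightarrow> i < q \<Longrightarrow> fps_nth f i = 0"
  by (auto elim!: dvdE simp: fps_X_power_mult_nth)

lemma fps_X_power_dvdI: "(\<And>i. i < q \<Longrightarrow> fps_nth f i = 0) \<Longrightarrow> fps_X ^ q dvd (f :: complex fps)"
proof -
  assume "\<And>i. i < q \<Longrightarrow> fps_nth f i = 0"
  then have "f = fps_X ^ q * fps_shift q f" by (intro fps_ext) (auto simp: fps_X_power_mult_nth)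
  then show ?thesis by (metis dvd_triv_left)
qed

lemma fps_unit: "fps_nth (u :: complex fps) 0 \<noteq> 0 \<Longrightarrow> u * inverse u = 1"
  by (subst mult.commute) (rule inverse_mult_eq_1)

text \<open>Taylor's formula writes the value at \<open>w'\<close> as \<open>w' - w\<close> times a
  power series with nonzero constant term, so value and difference are divisible by the same powers
  of \<open>fps_X\<close>.\<close>

lemma fps_root_unique:
  fixes q :: "complex fps poly"
  assumes "poly q w = 0" "fps_X ^ e dvd poly q w'" "fps_X dvd w' - w" "fps_nth (poly (pderiv q) w) 0 \<noteq> 0"
  shows "fps_X ^ e dvd w' - w"
proof -
  define \<delta> where "\<delta> = w' - w"
  obtain h where h: "poly q (w + \<delta>) = poly q w + \<delta> * poly (pderiv q) w + \<delta>\<^sup>2 * h"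
    using poly_taylor2 by blast
  define c where "c = poly (pderiv q) w + \<delta> * h"
  have "fps_nth \<delta> 0 = 0" using assms(3) by (simp add: \<delta>_def fps_X_dvd_iff)
  then have "fps_nth c 0 \<noteq> 0" using assms(4) by (simp add: c_def)
  then have "c * inverse c = 1" by (rule fps_unit)
  moreover have "w + \<delta> = w'" by (simp add: \<delta>_def)
  then have "poly q w' = \<delta> * c"
    using h assms(1) by (simp add: c_def algebra_simps power2_eq_square)
  then have "fps_X ^ e dvd \<delta> * c" using assms(2) by simp
  then have "fps_X ^ e dvd \<delta> * c * inverse c" by (rule dvd_mult2)
  ultimately show ?thesis unfolding \<delta>_def[symmetric] by (simp add: mult.assoc)
qed

text \<open>The Taylor series at \<open>t0\<close>; \<open>fps_X\<close> stands for
  \<open>t - t0\<close>.\<close>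

definition expand :: "complex \<Rightarrow> complex poly \<Rightarrow> complex fps" where
  "expand t0 p = fps_of_poly (pcompose p [:t0, 1:])"

lemma expand_add: "expand t0 (p + q) = expand t0 p + expand t0 q"
  and expand_mult: "expand t0 (p * q) = expand t0 p * expand t0 q"
  and expand_diff: "expand t0 (p - q) = expand t0 p - expand t0 q"
  and expand_0: "expand t0 0 = 0"
  and expand_1: "expand t0 1 = 1"
  by (simp_all add: expand_def pcompose_add pcompose_mult pcompose_diff pcompose_1 fps_of_poly_add
      fps_of_poly_mult fps_of_poly_diff)

lemma expand_sum: "expand t0 (\<Sum>s\<in>S. f s) = (\<Sum>s\<in>S. expand t0 (f s))"
  by (induction S rule: infinite_finite_induct) (simp_all add: expand_add expand_0)

lemma expand_prod: "expand t0 (\<Prod>s\<in>S. f s) = (\<Prod>s\<in>S. expand t0 (f s))"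
  by (induction S rule: infinite_finite_induct) (simp_all add: expand_mult expand_1)

lemma expand_power: "expand t0 (p ^ k) = expand t0 p ^ k"
  by (induction k) (simp_all add: expand_mult expand_1)

lemma expand_of_nat: "expand t0 (of_nat k) = of_nat k"
  by (induction k) (simp_all add: expand_add expand_0 expand_1)

lemma expand_nth_0: "fps_nth (expand t0 p) 0 = poly p t0"
  by (simp add: expand_def poly_0_coeff_0[symmetric] poly_pcompose)

lemma expand_linear: "expand t0 [:- t0, 1:] = fps_X"
  by (simp add: expand_def pcompose_pCons fps_of_poly_pCons)

lemma expand_eq_0:
  assumes "fps_X ^ q dvd expand t0 p" "Polynomial.degree p < q"
  shows "p = 0"
proof -
  let ?p = "pcompose p [:t0, 1:]"
  have "Polynomial.coeff ?p i = 0" for i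
  proof (cases "i < q")
    case True
    then show ?thesis using fps_X_power_dvd_nth[OF assms(1)] by (simp add: expand_def)
  next
    case False
    then show ?thesis using assms(2) by (intro coeff_eq_0) (simp add: degree_pcompose)
  qed
  then have "?p = 0" by (intro poly_eqI) simp
  then show ?thesis by (simp add: pcompose_eq_0_iff)
qed

section \<open>Homogeneous relations and the branches they define\<close>

definition lf :: "nat \<Rightarrow> (nat \<Rightarrow> 'r::comm_ring_1) \<Rightarrow> (nat \<Rightarrow> 'r) \<Rightarrow> 'r" where
  "lf n U x = (\<Sum>i\<le>n. U i * x i)"

text \<open>A form of degree \<open>M\<close> in \<open>u\<close>, \<open>v\<close>, \<open>l\<close> whose degree in \<open>l\<close> is at most \<open>e\<close>; \<open>hder\<close> is its derivative
  with respect to \<open>l\<close> and \<open>htop\<close> its leading coefficient.\<close>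

definition hrel :: "(nat \<Rightarrow> nat \<Rightarrow> 'r::comm_ring_1) \<Rightarrow> nat \<Rightarrow> nat \<Rightarrow> 'r \<Rightarrow> 'r \<Rightarrow> 'r \<Rightarrow> 'r" where
  "hrel g e M u v l = (\<Sum>c\<le>e. \<Sum>a\<le>M - c. g c a * (u ^ a * v ^ (M - c - a) * l ^ c))"

definition hder :: "(nat \<Rightarrow> nat \<Rightarrow> 'r::comm_ring_1) \<Rightarrow> nat \<Rightarrow> nat \<Rightarrow> 'r \<Rightarrow> 'r \<Rightarrow> 'r \<Rightarrow> 'r" where
  "hder g e M = hrel (\<lambda>c a. of_nat (Suc c) * g (Suc c) a) (e - 1) (M - 1)"

definition htop :: "(nat \<Rightarrow> nat \<Rightarrow> 'r::comm_ring_1) \<Rightarrow> nat \<Rightarrow> nat \<Rightarrow> 'r \<Rightarrow> 'r \<Rightarrow> 'r" where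
  "htop g e M u v = (\<Sum>a\<le>M - e. g e a * (u ^ a * v ^ (M - e - a)))"

definition mval :: "nat \<Rightarrow> (nat \<Rightarrow> nat) \<Rightarrow> (nat \<Rightarrow> 'r::comm_ring_1) \<Rightarrow> 'r" where
  "mval n b x = (\<Prod>i\<le>n. x i ^ b i)"

definition parallel :: "(nat \<Rightarrow> complex poly) \<Rightarrow> (nat \<Rightarrow> complex poly) \<Rightarrow> bool" where
  "parallel x y \<longleftrightarrow> (\<forall>i j. x i * y j = x j * y i)"

definition hpoly :: "(nat \<Rightarrow> nat \<Rightarrow> 'r::comm_ring_1) \<Rightarrow> nat \<Rightarrow> nat \<Rightarrow> 'r \<Rightarrow> 'r poly" where
  "hpoly g e M u = (\<Sum>c\<le>e. Polynomial.monom (\<Sum>a\<le>M - c. g c a * u ^ a) c)"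

lemma poly_hpoly: "poly (hpoly g e M u) w = hrel g e M u 1 w"
  by (simp add: hpoly_def hrel_def poly_sum poly_monom sum_distrib_right mult.assoc)

lemma pderiv_sum': "pderiv (\<Sum>s\<in>S. f s) = (\<Sum>s\<in>S. pderiv (f s))"
  by (induction S rule: infinite_finite_induct) (simp_all add: pderiv_add)

lemma poly_pderiv_hpoly:
  fixes g :: "nat \<Rightarrow> nat \<Rightarrow> 'r::idom"
  shows "0 < e \<Longrightarrow> e \<le> M \<Longrightarrow> poly (pderiv (hpoly g e M u)) w = hder g e M u 1 w"
proof -
  assume e: "0 < e" "e \<le> M"
  then obtain e' M' where e': "e = Suc e'" "M = Suc M'" by (metis Suc_pred' le_trans not_less_eq_eq not_less_zero zero_less_Suc less_le_trans)
  have "poly (pderiv (hpoly g e M u)) w = (\<Sum>c\<le>e. of_nat c * (\<Sum>a\<le>M - c. g c a * u ^ a) * w ^ (c - 1))"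
    by (simp add: hpoly_def pderiv_sum' pderiv_monom poly_sum poly_monom)
  also have "\<dots> = (\<Sum>c\<le>e'. of_nat (Suc c) * (\<Sum>a\<le>M' - c. g (Suc c) a * u ^ a) * w ^ c)"
    unfolding e' by (subst sum.atMost_Suc_shift) simp
  also have "\<dots> = hder g e M u 1 w"
    unfolding hder_def hrel_def e' by (simp add: sum_distrib_left sum_distrib_right ac_simps)
  finally show ?thesis .
qed

lemma hrel_dehom:
  assumes "v * w = 1" "e \<le> M"
  shows "hrel g e M (u * w) 1 (l * w) = w ^ M * hrel g e M u v l"
proof -
  have "g c a * ((u * w) ^ a * 1 ^ (M - c - a) * (l * w) ^ c) = w ^ M * (g c a * (u ^ a * v ^ (M - c - a) * l ^ c))"
    if "c \<le> e" "a \<le> M - c" for c a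
  proof -
    have "w ^ M = w ^ a * w ^ c * w ^ (M - c - a)" using that assms(2) by (simp flip: power_add)
    then have "w ^ M * (u ^ a * v ^ (M - c - a) * l ^ c) = (u * w) ^ a * (l * w) ^ c * (v * w) ^ (M - c - a)"
      by (simp add: power_mult_distrib ac_simps)
    then have "w ^ M * (u ^ a * v ^ (M - c - a) * l ^ c) = (u * w) ^ a * (l * w) ^ c" using assms(1) by simp
    then show ?thesis by (simp only: mult.left_commute[of "w ^ M" "g c a"] power_one mult_1_right)
  qed
  then show ?thesis unfolding hrel_def sum_distrib_left by (intro sum.cong) auto
qed

lemma htop_dehom:
  assumes "v * w = 1"
  shows "htop g e M (u * w) 1 = w ^ (M - e) * htop g e M u v"
proof -
  have "g e a * ((u * w) ^ a * 1 ^ (M - e - a)) = w ^ (M - e) * (g e a * (u ^ a * v ^ (M - e - a)))" if "a \<le> M - e" for a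
  proof -
    have "w ^ (M - e) = w ^ a * w ^ (M - e - a)" using that by (simp only: power_add[symmetric] le_add_diff_inverse)
    then have "w ^ (M - e) * (u ^ a * v ^ (M - e - a)) = (u * w) ^ a * (v * w) ^ (M - e - a)"
      by (simp add: power_mult_distrib ac_simps)
    then have "w ^ (M - e) * (u ^ a * v ^ (M - e - a)) = (u * w) ^ a" using assms by simp
    then show ?thesis by (simp only: mult.left_commute[of "w ^ (M - e)" "g e a"] power_one mult_1_right)
  qed
  then show ?thesis unfolding htop_def sum_distrib_left by (intro sum.cong) auto
qed

text \<open>One statement for several homomorphisms: Taylor expansion, evaluation at
  \<open>t0\<close>, the constant term of a power series, evaluation of a polynomial with power
  series coefficients, and the embedding into the algebraic closure.\<close>

lemma hrel_hom:
  assumes "\<phi> 0 = 0" "\<phi> 1 = 1" "\<And>a b. \<phi> (a + b) = \<phi> a + \<phi> b" "\<And>a b. \<phi> (a * b) = \<phi> a * \<phi> b"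
  shows "\<phi> (hrel g e M u v l) = hrel (\<lambda>c a. \<phi> (g c a)) e M (\<phi> u) (\<phi> v) (\<phi> l)"
    and "\<phi> (hder g e M u v l) = hder (\<lambda>c a. \<phi> (g c a)) e M (\<phi> u) (\<phi> v) (\<phi> l)"
    and "\<phi> (htop g e M u v) = htop (\<lambda>c a. \<phi> (g c a)) e M (\<phi> u) (\<phi> v)"
    and "\<phi> (lf n U x) = lf n (\<lambda>i. \<phi> (U i)) (\<lambda>i. \<phi> (x i))"
    and "\<phi> (mval n b x) = mval n b (\<lambda>i. \<phi> (x i))"
proof -
  have s: "\<phi> (sum f S) = (\<Sum>s\<in>S. \<phi> (f s))" for f :: "'z \<Rightarrow> _" and S
    by (induction S rule: infinite_finite_induct) (simp_all add: assms)
  have pr: "\<phi> (prod f S) = (\<Prod>s\<in>S. \<phi> (f s))" for f :: "'z \<Rightarrow> _" and S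
    by (induction S rule: infinite_finite_induct) (simp_all add: assms)
  have p: "\<phi> (a ^ k) = \<phi> a ^ k" for a k by (induction k) (simp_all add: assms)
  have o: "\<phi> (of_nat k) = of_nat k" for k by (induction k) (simp_all add: assms)
  have r: "\<phi> (hrel g e M u v l) = hrel (\<lambda>c a. \<phi> (g c a)) e M (\<phi> u) (\<phi> v) (\<phi> l)" for g e M
    unfolding hrel_def s assms(4) p ..
  show "\<phi> (hrel g e M u v l) = hrel (\<lambda>c a. \<phi> (g c a)) e M (\<phi> u) (\<phi> v) (\<phi> l)" by (rule r)
  show "\<phi> (hder g e M u v l) = hder (\<lambda>c a. \<phi> (g c a)) e M (\<phi> u) (\<phi> v) (\<phi> l)"
    unfolding hder_def r assms(4) o ..
  show "\<phi> (htop g e M u v) = htop (\<lambda>c a. \<phi> (g c a)) e M (\<phi> u) (\<phi> v)"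
    unfolding htop_def s assms(4) p ..
  show "\<phi> (lf n U x) = lf n (\<lambda>i. \<phi> (U i)) (\<lambda>i. \<phi> (x i))" unfolding lf_def s assms(4) ..
  show "\<phi> (mval n b x) = mval n b (\<lambda>i. \<phi> (x i))" unfolding mval_def pr p ..
qed

lemmas expand_hom = hrel_hom[of "expand t0" for t0, OF expand_0 expand_1 expand_add expand_mult]

lemmas eval_hom = hrel_hom[of "\<lambda>p. poly p t0" for t0, OF poly_0 poly_1 poly_add poly_mult]

lemma pCons_0_dvd_iff: "[:0, 1:] dvd (p :: 'r::idom poly) \<longleftrightarrow> poly p 0 = 0"
  using poly_eq_0_iff_dvd[of p 0] by simp

lemma dvd_prod_diff:
  fixes f g :: "'i \<Rightarrow> 'r::comm_ring_1"
  assumes "\<And>i. i \<in> S \<Longrightarrow> t dvd f i - g i"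
  shows "t dvd (\<Prod>i\<in>S. f i) - (\<Prod>i\<in>S. g i)"
  using assms
proof (induction S rule: infinite_finite_induct)
  case (insert i S)
  have "f i * prod f S - g i * prod g S = (f i - g i) * prod f S + g i * (prod f S - prod g S)"
    by (simp add: algebra_simps)
  moreover have "t dvd (f i - g i) * prod f S + g i * (prod f S - prod g S)"
    using insert by (intro dvd_add dvd_mult dvd_mult2) auto
  ultimately show ?case using insert.hyps by simp
qed auto

lemma dvd_power_diff:
  fixes f g :: "'r::comm_ring_1"
  assumes "t dvd f - g"
  shows "t dvd f ^ k - g ^ k"
  using dvd_prod_diff[of "{..<k}" t "\<lambda>_. f" "\<lambda>_. g"] assms by simp

text \<open>\<open>W\<close> is the Taylor expansion, truncated at order \<open>N\<close>, of the branch through \<open>w\<close> of the algebraic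
  function defined by the relation. It is found by Newton's iteration.\<close>

lemma taylor_branch:
  fixes g :: "nat \<Rightarrow> nat \<Rightarrow> complex fps"
  assumes "0 < e" "e \<le> M" "hrel g e M u 1 w = 0" "fps_nth (hder g e M u 1 w) 0 \<noteq> 0"
  obtains W where "poly W 0 = w"
    "\<And>u' w' k. 0 < k \<Longrightarrow> fps_X ^ k dvd u' - u \<Longrightarrow> hrel g e M u' 1 w' = 0 \<Longrightarrow>
      fps_nth (hder g e M u' 1 w') 0 \<noteq> 0 \<Longrightarrow> fps_X dvd w' - w \<Longrightarrow>
      fps_X ^ (k * N) dvd poly W (u' - u) - w'"
proof -
  \<comment> \<open>The relation is moved to the base point: over polynomials in a new indeterminate
    \<open>z\<close>, \<open>Q\<close> is the relation at \<open>u + z\<close>, and Newton's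
    iteration runs along the powers of \<open>z\<close>.\<close>
  define g' where "g' c a = [:g c a:]" for c a
  define Q where "Q = hpoly g' e M [:u, 1:]"
  have ev: "poly (poly Q W) z = hrel g e M (u + z) 1 (poly W z)" for W z
  proof -
    have "poly (poly Q W) z = hrel (\<lambda>c a. poly (g' c a) z) e M (poly [:u, 1:] z) (poly 1 z) (poly W z)"
      unfolding Q_def poly_hpoly by (rule hrel_hom(1)) auto
    then show ?thesis by (simp add: g'_def)
  qed
  have evd: "poly (poly (pderiv Q) W) z = hder g e M (u + z) 1 (poly W z)" for W z
  proof -
    have "poly (poly (pderiv Q) W) z = hder (\<lambda>c a. poly (g' c a) z) e M (poly [:u, 1:] z) (poly 1 z) (poly W z)"
      unfolding Q_def poly_pderiv_hpoly[OF assms(1,2)] by (rule hrel_hom(2)) auto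
    then show ?thesis by (simp add: g'_def)
  qed
  define D where "D = hder g e M u 1 w"
  have "D * inverse D = 1" using assms(4) unfolding D_def by (rule fps_unit)
  then have "[:0, 1:] dvd 1 - [:inverse D:] * poly (pderiv Q) [:w:]"
    unfolding pCons_0_dvd_iff by (simp add: evd D_def[symmetric] mult.commute)
  moreover have "[:0, 1:] dvd poly Q [:w:]" unfolding pCons_0_dvd_iff by (simp add: ev assms(3))
  ultimately obtain W where W: "[:0, 1:] dvd W - [:w:]" "[:0, 1:] ^ Suc N dvd poly Q W"
    using newton_lift[of "[:0, 1:]" Q "[:w:]" "[:inverse D:]" N] by blast
  have W0: "poly W 0 = w" using W(1) unfolding pCons_0_dvd_iff by simp
  show ?thesis
  proof (rule that[OF W0])
    fix u' w' k
    assume k: "0 < k" and u': "fps_X ^ k dvd u' - u" and w': "hrel g e M u' 1 w' = 0"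
      "fps_nth (hder g e M u' 1 w') 0 \<noteq> 0" "fps_X dvd w' - w"
    obtain T where T: "poly Q W = [:0, 1:] ^ Suc N * T" using W(2) by (auto elim: dvdE)
    have "poly (poly Q W) (u' - u) = (u' - u) ^ Suc N * poly T (u' - u)"
      unfolding T by (simp add: poly_power)
    then have "poly (hpoly g e M u') (poly W (u' - u)) = (u' - u) ^ Suc N * poly T (u' - u)"
      unfolding ev poly_hpoly by simp
    \<comment> \<open>Substituting \<open>z = u' - u\<close>, a multiple of
      \<open>fps_X ^ k\<close>, turns order \<open>N\<close> in \<open>z\<close> into order
      \<open>k * N\<close> in \<open>fps_X\<close>.\<close>
    moreover have "(fps_X ^ k) ^ N dvd (u' - u) ^ N" using u' by (rule dvd_power_same)
    then have "fps_X ^ (k * N) dvd (u' - u) ^ N" by (simp add: power_mult)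
    ultimately have d: "fps_X ^ (k * N) dvd poly (hpoly g e M u') (poly W (u' - u))"
      by (simp add: mult.assoc dvd_mult dvd_mult2)
    have X1: "fps_X dvd u' - u" using u' k dvd_trans[OF dvd_power[of k fps_X]] by blast
    have "fps_X dvd poly W (u' - u) - poly W 0"
      using dvd_trans[OF X1] poly_diff_dvd[of "u' - u" 0 W] by simp
    then have "fps_X dvd (poly W (u' - u) - poly W 0) - (w' - w)" using w'(3) by (rule dvd_diff)
    then have "fps_X dvd poly W (u' - u) - w'" using W0 by simp
    \<comment> \<open>At the parameter \<open>u'\<close>, \<open>w'\<close> is a root of the
      relation and the truncated branch an approximate root with the same constant term. The
      derivative is nonzero there, so they agree up to the order of the error.\<close>
    then show "fps_X ^ (k * N) dvd poly W (u' - u) - w'"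
      by (rule fps_root_unique[rotated 2, where q = "hpoly g e M u'"])
        (use d w' in \<open>simp_all add: poly_hpoly poly_pderiv_hpoly[OF assms(1,2)]\<close>)
  qed
qed

lemma expand_const: "expand t0 [:c:] = fps_const c"
  by (simp add: expand_def fps_of_poly_const)

lemma expand_smult: "expand t0 (Polynomial.smult c p) = fps_const c * expand t0 p"
  using expand_mult[of t0 "[:c:]" p] by (simp add: expand_const)

lemma degree_mval_le:
  assumes "\<And>i. i \<le> n \<Longrightarrow> Polynomial.degree (x i) \<le> h"
  shows "Polynomial.degree (mval n b x) \<le> h * (\<Sum>i\<le>n. b i)"
proof -
  have "Polynomial.degree (mval n b x) \<le> (\<Sum>i\<le>n. Polynomial.degree (x i ^ b i))"
    unfolding mval_def using degree_prod_sum_le[of "{..n}" "\<lambda>i. x i ^ b i"] by (simp add: o_def)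
  also have "\<dots> \<le> (\<Sum>i\<le>n. h * b i)"
  proof (intro sum_mono)
    fix i assume "i \<in> {..n}"
    have "Polynomial.degree (x i ^ b i) \<le> Polynomial.degree (x i) * b i" by (rule degree_power_le)
    also have "\<dots> \<le> h * b i" using assms \<open>i \<in> {..n}\<close> by (intro mult_right_mono) auto
    finally show "Polynomial.degree (x i ^ b i) \<le> h * b i" .
  qed
  finally show ?thesis by (simp add: sum_distrib_left)
qed

text \<open>All that the fibre bound needs from the curve. The relations \<open>rel\<close> describe
  each coordinate as an algebraic function of \<open>U\<close> and \<open>V\<close> and yield the
  branches. The relations \<open>rel'\<close>, of degree at most \<open>d\<close>, are for the
  linear forms with coefficients \<open>c ^ i\<close> and bound the number of branches. The last
  assumption joins the supply of independent monomials to the count of zeros of their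
  combinations.\<close>

locale curve_data =
  fixes n d :: nat and Pts :: "(nat \<Rightarrow> complex poly) set" and U V :: "nat \<Rightarrow> complex poly"
    and e M :: "nat \<Rightarrow> nat" and g :: "nat \<Rightarrow> nat \<Rightarrow> nat \<Rightarrow> complex poly"
    and e' M' :: "nat \<Rightarrow> nat" and g' :: "nat \<Rightarrow> nat \<Rightarrow> nat \<Rightarrow> complex poly"
  assumes d_pos: "d > 0"
    and supp: "x \<in> Pts \<Longrightarrow> n < i \<Longrightarrow> x i = 0"
    and e: "i \<le> n \<Longrightarrow> 0 < e i" "i \<le> n \<Longrightarrow> e i \<le> M i"
    and rel: "x \<in> Pts \<Longrightarrow> i \<le> n \<Longrightarrow> hrel (g i) (e i) (M i) (lf n U x) (lf n V x) (x i) = 0"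
    and e': "e' c \<le> d" "e' c \<le> M' c"
    and rel': "x \<in> Pts \<Longrightarrow> hrel (g' c) (e' c) (M' c) (lf n U x) (lf n V x) (lf n (\<lambda>i. of_nat c ^ i) x) = 0"
    and mon: "\<exists>B. finite B \<and> (\<forall>b\<in>B. (\<Sum>i\<le>n. b i) = m) \<and> card B \<ge> (\<Sum>j\<le>m. min d (Suc j)) \<and>
      (\<forall>\<gamma> P. (\<exists>b\<in>B. \<gamma> b \<noteq> 0) \<longrightarrow> P \<subseteq> Pts \<longrightarrow> finite P \<longrightarrow> (\<forall>x\<in>P. \<forall>y\<in>P. x \<noteq> y \<longrightarrow> \<not> parallel x y) \<longrightarrow>
        (\<forall>x\<in>P. (\<Sum>b\<in>B. \<gamma> b * mval n b x) = 0) \<longrightarrow> card P \<le> d * m)"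
begin

text \<open>Excludes the values \<open>t0\<close> at which the denominator vanishes, some coordinate
  meets a branch point of its relation, or one of the relations that bound the number of branches
  loses its leading coefficient.\<close>

definition good :: "complex \<Rightarrow> nat \<Rightarrow> (nat \<Rightarrow> complex poly) \<Rightarrow> bool" where
  "good t0 L x \<longleftrightarrow> poly (lf n V x) t0 \<noteq> 0 \<and>
    (\<forall>i\<le>n. poly (hder (g i) (e i) (M i) (lf n U x) (lf n V x) (x i)) t0 \<noteq> 0) \<and>
    (\<forall>c\<le>L. poly (htop (g' c) (e' c) (M' c) (lf n U x) (lf n V x)) t0 \<noteq> 0)"

definition ivf :: "complex \<Rightarrow> (nat \<Rightarrow> complex poly) \<Rightarrow> complex fps" where
  "ivf t0 x = inverse (expand t0 (lf n V x))"

text \<open>The parameter of a branch: the quotient of the two linear forms along \<open>x\<close>.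
  The series \<open>crd\<close> are the affine coordinates in the same normalisation.\<close>

definition par :: "complex \<Rightarrow> (nat \<Rightarrow> complex poly) \<Rightarrow> complex fps" where
  "par t0 x = expand t0 (lf n U x) * ivf t0 x"

definition crd :: "complex \<Rightarrow> (nat \<Rightarrow> complex poly) \<Rightarrow> nat \<Rightarrow> complex fps" where
  "crd t0 x i = expand t0 (x i) * ivf t0 x"

section \<open>Bounding the fibres of the jet map\<close>

lemma ivf: "good t0 L x \<Longrightarrow> expand t0 (lf n V x) * ivf t0 x = 1"
  unfolding ivf_def good_def by (intro fps_unit) (simp add: expand_nth_0)

lemma ivf_nth: "good t0 L x \<Longrightarrow> fps_nth (ivf t0 x) 0 \<noteq> 0"
  using arg_cong[OF ivf, of t0 L x "\<lambda>f. fps_nth f 0"] by auto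

lemma crd_rel:
  assumes "good t0 L x" "x \<in> Pts" "i \<le> n"
  shows "hrel (\<lambda>c a. expand t0 (g i c a)) (e i) (M i) (par t0 x) 1 (crd t0 x i) = 0"
    and "fps_nth (hder (\<lambda>c a. expand t0 (g i c a)) (e i) (M i) (par t0 x) 1 (crd t0 x i)) 0 \<noteq> 0"
proof -
  show "hrel (\<lambda>c a. expand t0 (g i c a)) (e i) (M i) (par t0 x) 1 (crd t0 x i) = 0"
    unfolding par_def crd_def hrel_dehom[OF ivf[OF assms(1)] e(2)[OF assms(3)]]
    by (simp add: expand_hom(1)[symmetric] rel[OF assms(2,3)] expand_0)
  have le: "e i - 1 \<le> M i - 1" using e(2)[OF assms(3)] by simp
  have "hder (\<lambda>c a. expand t0 (g i c a)) (e i) (M i) (par t0 x) 1 (crd t0 x i)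
      = ivf t0 x ^ (M i - 1) * expand t0 (hder (g i) (e i) (M i) (lf n U x) (lf n V x) (x i))"
    unfolding expand_hom(2) unfolding hder_def par_def crd_def by (rule hrel_dehom[OF ivf[OF assms(1)] le])
  then show "fps_nth (hder (\<lambda>c a. expand t0 (g i c a)) (e i) (M i) (par t0 x) 1 (crd t0 x i)) 0 \<noteq> 0"
    using ivf_nth[OF assms(1)] assms(1,3) by (simp add: expand_nth_0 good_def fps_power_zeroth)
qed

lemma par_cong:
  assumes "good t0 L x" "good t0 L y" "[:- t0, 1:] ^ k dvd lf n U x * lf n V y - lf n U y * lf n V x"
  shows "fps_X ^ k dvd par t0 x - par t0 y"
proof -
  obtain r where "lf n U x * lf n V y - lf n U y * lf n V x = [:- t0, 1:] ^ k * r" using assms(3) by (auto elim: dvdE)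
  then have "expand t0 (lf n U x * lf n V y - lf n U y * lf n V x) = fps_X ^ k * expand t0 r"
    by (simp only: expand_mult expand_power expand_linear)
  then have "fps_X ^ k dvd (expand t0 (lf n U x) * expand t0 (lf n V y) - expand t0 (lf n U y) * expand t0 (lf n V x)) * (ivf t0 x * ivf t0 y)"
    by (simp add: expand_diff expand_mult)
  also have "(expand t0 (lf n U x) * expand t0 (lf n V y) - expand t0 (lf n U y) * expand t0 (lf n V x)) * (ivf t0 x * ivf t0 y)
      = par t0 x * (expand t0 (lf n V y) * ivf t0 y) - par t0 y * (expand t0 (lf n V x) * ivf t0 x)"
    by (simp add: par_def algebra_simps)
  finally show ?thesis using ivf[OF assms(1)] ivf[OF assms(2)] by simp
qed

text \<open>Siegel's lemma on one branch. Within the class every coordinate is, up to order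
  \<open>k * N\<close>, a fixed polynomial \<open>W i\<close> in the difference of parameters. The
  combination \<open>\<Psi>\<close> is built so that its value at any multiple of
  \<open>fps_X ^ k\<close> vanishes to order \<open>k * N\<close>, more than the degree of the
  form's value at a tuple.\<close>

lemma class_bound:
  assumes "k > 0" "P \<subseteq> Pts" "finite P" and np: "\<forall>x\<in>P. \<forall>y\<in>P. x \<noteq> y \<longrightarrow> \<not> parallel x y"
    and deg: "\<And>x i. x \<in> P \<Longrightarrow> i \<le> n \<Longrightarrow> Polynomial.degree (x i) \<le> h"
    and good: "\<And>x. x \<in> P \<Longrightarrow> good t0 L x"
    and jet: "\<And>x y. x \<in> P \<Longrightarrow> y \<in> P \<Longrightarrow> [:- t0, 1:] ^ k dvd lf n U x * lf n V y - lf n U y * lf n V x"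
    and cls: "\<And>x y i. x \<in> P \<Longrightarrow> y \<in> P \<Longrightarrow> i \<le> n \<Longrightarrow> fps_nth (crd t0 x i) 0 = fps_nth (crd t0 y i) 0"
    and m: "2 * (m * h) < k * ((\<Sum>j\<le>m. min d (Suc j)) - 1)"
  shows "card P \<le> d * m"
proof (cases "P = {}")
  case False
  then obtain s where s: "s \<in> P" by blast
  obtain B where B0: "finite B" "\<forall>b\<in>B. (\<Sum>i\<le>n. b i) = m" "card B \<ge> (\<Sum>j\<le>m. min d (Suc j))"
    and Bm0: "\<forall>\<gamma> P. (\<exists>b\<in>B. \<gamma> b \<noteq> 0) \<longrightarrow> P \<subseteq> Pts \<longrightarrow> finite P \<longrightarrow> (\<forall>x\<in>P. \<forall>y\<in>P. x \<noteq> y \<longrightarrow> \<not> parallel x y) \<longrightarrow>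
        (\<forall>x\<in>P. (\<Sum>b\<in>B. \<gamma> b * mval n b x) = 0) \<longrightarrow> card P \<le> d * m"
    using mon[of m] by (elim exE conjE) (rule that)
  have B: "finite B" "\<And>b. b \<in> B \<Longrightarrow> (\<Sum>i\<le>n. b i) = m" "card B \<ge> (\<Sum>j\<le>m. min d (Suc j))"
    using B0 by simp_all
  have Bm: "card P \<le> d * m" if "\<exists>b\<in>B. \<gamma> b \<noteq> 0" "\<forall>x\<in>P. (\<Sum>b\<in>B. \<gamma> b * mval n b x) = 0" for \<gamma>
    using Bm0[THEN spec, of \<gamma>, THEN spec, of P] that assms(2,3) np by simp
  define N where "N = card B"
  \<comment> \<open>The value of the form at a tuple has degree below \<open>T + m * h\<close>; this
    choice makes the bound equal to the vanishing order \<open>k * N\<close>.\<close>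
  define T where "T = k * N - m * h"
  have "k * ((\<Sum>j\<le>m. min d (Suc j)) - 1) \<le> k * (N - 1)" using B(3) unfolding N_def by (intro mult_left_mono) auto
  with m have m': "2 * (m * h) < k * (N - 1)" by linarith
  have N0: "N > 0" using m' by (cases N) auto
  have mhT: "T + m * h = k * N"
  proof -
    have "k * (N - 1) \<le> k * N" by (intro mult_left_mono) auto
    then show ?thesis using m' unfolding T_def by linarith
  qed
  have "\<exists>W. \<forall>i. i \<le> n \<longrightarrow> poly (W i) 0 = crd t0 s i \<and>
    (\<forall>x\<in>P. fps_X ^ (k * N) dvd poly (W i) (par t0 x - par t0 s) - crd t0 x i)"
  proof (rule choice, rule allI)
    fix i
    show "\<exists>W. i \<le> n \<longrightarrow> poly W 0 = crd t0 s i \<and>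
      (\<forall>x\<in>P. fps_X ^ (k * N) dvd poly W (par t0 x - par t0 s) - crd t0 x i)"
    proof (cases "i \<le> n")
      case True
      have sP: "s \<in> Pts" using s assms(2) by blast
      obtain W where W: "poly W 0 = crd t0 s i"
        "\<And>u' w' k. 0 < k \<Longrightarrow> fps_X ^ k dvd u' - par t0 s \<Longrightarrow> hrel (\<lambda>c a. expand t0 (g i c a)) (e i) (M i) u' 1 w' = 0 \<Longrightarrow>
          fps_nth (hder (\<lambda>c a. expand t0 (g i c a)) (e i) (M i) u' 1 w') 0 \<noteq> 0 \<Longrightarrow> fps_X dvd w' - crd t0 s i \<Longrightarrow>
          fps_X ^ (k * N) dvd poly W (u' - par t0 s) - w'"
        by (rule taylor_branch[OF e(1)[OF True] e(2)[OF True] crd_rel[OF good[OF s] sP True], where N = N]) blast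
      have "fps_X ^ (k * N) dvd poly W (par t0 x - par t0 s) - crd t0 x i" if x: "x \<in> P" for x
      proof (rule W(2)[OF assms(1)])
        show "fps_X ^ k dvd par t0 x - par t0 s" by (rule par_cong[OF good[OF x] good[OF s] jet[OF x s]])
        show "fps_X dvd crd t0 x i - crd t0 s i"
          unfolding fps_X_dvd_iff using cls[OF x s True] by simp
        have xP: "x \<in> Pts" using x assms(2) by blast
        show "hrel (\<lambda>c a. expand t0 (g i c a)) (e i) (M i) (par t0 x) 1 (crd t0 x i) = 0"
          "fps_nth (hder (\<lambda>c a. expand t0 (g i c a)) (e i) (M i) (par t0 x) 1 (crd t0 x i)) 0 \<noteq> 0"
          by (fact crd_rel[OF good[OF x] xP True])+
      qed
      then show ?thesis using W(1) by blast
    qed simp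
  qed
  then obtain W where W: "\<And>x i. x \<in> P \<Longrightarrow> i \<le> n \<Longrightarrow> fps_X ^ (k * N) dvd poly (W i) (par t0 x - par t0 s) - crd t0 x i"
    by blast
  define \<Phi> where "\<Phi> b = (\<Prod>i\<le>n. W i ^ b i)" for b :: "nat \<Rightarrow> nat"
  define I where "I = B \<times> {..<T}"
  \<comment> \<open>The conditions: the coefficient of the \<open>r\<close>-th power need only be
    divisible by \<open>fps_X ^ (k * (N - r))\<close>, since the power itself contributes the rest.
    They number \<open>k * N * (N + 1) / 2\<close>, against \<open>N * T\<close> unknowns.\<close>
  define C where "C = (SIGMA r:{..<N}. {..<k * (N - r)})"
  define a where "a = (\<lambda>(r, j) (b, l). fps_nth (expand t0 (Polynomial.monom 1 l) * Polynomial.coeff (\<Phi> b) r) j)"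
  have "card C < card I"
  proof -
    have "card C = (\<Sum>r<N. k * (N - r))" unfolding C_def by simp
    also have "\<dots> = k * (\<Sum>r<N. N - r)" by (simp add: sum_distrib_left)
    also have "(\<Sum>r<N. N - r) = (\<Sum>r<N. Suc r)"
      by (rule sum.reindex_bij_witness[of _ "\<lambda>r. N - 1 - r" "\<lambda>r. N - 1 - r"]) auto
    finally have "2 * card C = k * (2 * (\<Sum>r<N. Suc r))" by simp
    also have "2 * (\<Sum>r<N. Suc r) = N * (N + 1)" by (induction N) auto
    finally have c1: "2 * card C = N * (k * (N + 1))" by (simp add: algebra_simps)
    have "k * (N + 1) < 2 * T"
    proof -
      have "k * (N - 1) + k * (N + 1) = 2 * (k * N)" using N0 by (cases N) (auto simp: algebra_simps)
      then show ?thesis using m' mhT by linarith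
    qed
    then have "N * (k * (N + 1)) < N * (2 * T)" using N0 by simp
    then have "2 * card C < 2 * (N * T)" unfolding c1 by (simp only: mult.left_commute[of N 2])
    moreover have "card I = N * T" by (simp add: I_def card_cartesian_product N_def)
    ultimately show ?thesis by simp
  qed
  moreover have "finite C" "finite I" using B(1) by (auto simp: C_def I_def)
  ultimately obtain y where y: "\<exists>u\<in>I. y u \<noteq> 0" "\<And>c. c \<in> C \<Longrightarrow> (\<Sum>u\<in>I. a c u * y u) = 0"
    using underdetermined_system[of C I a] by blast
  define \<gamma> where "\<gamma> b = (\<Sum>l<T. Polynomial.smult (y (b, l)) (Polynomial.monom 1 l))" for b
  have c\<gamma>: "Polynomial.coeff (\<gamma> b) l = (if l < T then y (b, l) else 0)" for b l
  proof -
    have "Polynomial.coeff (\<gamma> b) l = (\<Sum>l'<T. if l' = l then y (b, l) else 0)"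
      unfolding \<gamma>_def coeff_sum by (intro sum.cong) auto
    then show ?thesis by simp
  qed
  have nz: "\<exists>b\<in>B. \<gamma> b \<noteq> 0"
  proof -
    obtain b l where "b \<in> B" "l < T" "y (b, l) \<noteq> 0" using y(1) by (auto simp: I_def)
    then have "Polynomial.coeff (\<gamma> b) l \<noteq> 0" by (simp add: c\<gamma>)
    then show ?thesis using \<open>b \<in> B\<close> by (intro bexI[of _ b]) auto
  qed
  define \<Psi> where "\<Psi> = (\<Sum>b\<in>B. Polynomial.smult (expand t0 (\<gamma> b)) (\<Phi> b))"
  have \<Psi>r: "fps_X ^ (k * (N - r)) dvd Polynomial.coeff \<Psi> r" if r: "r < N" for r
  proof (rule fps_X_power_dvdI)
    fix j assume j: "j < k * (N - r)"
    have "fps_nth (Polynomial.coeff \<Psi> r) j = (\<Sum>b\<in>B. \<Sum>l<T. y (b, l) * a (r, j) (b, l))"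
      by (simp add: \<Psi>_def coeff_sum fps_sum_nth \<gamma>_def expand_sum expand_smult sum_distrib_right a_def mult.assoc)
    also have "\<dots> = (\<Sum>u\<in>I. a (r, j) u * y u)"
      unfolding I_def sum.cartesian_product by (intro sum.cong) (auto simp: mult.commute)
    also have "\<dots> = 0" using r j by (intro y(2)) (simp add: C_def)
    finally show "fps_nth (Polynomial.coeff \<Psi> r) j = 0" .
  qed
  have "(\<Sum>b\<in>B. \<gamma> b * mval n b x) = 0" if x: "x \<in> P" for x
  proof -
    define \<zeta> where "\<zeta> = par t0 x - par t0 s"
    have \<zeta>: "fps_X ^ k dvd \<zeta>" unfolding \<zeta>_def by (rule par_cong[OF good[OF x] good[OF s] jet[OF x s]])
    have \<zeta>r: "fps_X ^ (k * r) dvd \<zeta> ^ r" for r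
      unfolding power_mult using \<zeta> by (rule dvd_power_same)
    have "fps_X ^ (k * N) dvd Polynomial.coeff \<Psi> r * \<zeta> ^ r" for r
    proof (cases "r < N")
      case True
      have "fps_X ^ (k * (N - r)) * fps_X ^ (k * r) dvd Polynomial.coeff \<Psi> r * \<zeta> ^ r"
        by (rule mult_dvd_mono[OF \<Psi>r[OF True] \<zeta>r])
      moreover have "k * (N - r) + k * r = k * N" using True by (metis add_mult_distrib2 le_add_diff_inverse2 less_imp_le)
      ultimately show ?thesis by (simp flip: power_add)
    next
      case False
      then have "fps_X ^ (k * N) dvd (fps_X ^ (k * r) :: complex fps)" by (intro le_imp_power_dvd mult_left_mono) auto
      then show ?thesis using \<zeta>r[of r] dvd_trans dvd_mult by blast
    qed
    then have 1: "fps_X ^ (k * N) dvd poly \<Psi> \<zeta>" unfolding poly_altdef by (intro dvd_sum) auto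
    have 2: "fps_X ^ (k * N) dvd poly (\<Phi> b) \<zeta> - mval n b (crd t0 x)" for b
      unfolding \<Phi>_def mval_def poly_prod poly_power \<zeta>_def
      using W[OF x] by (intro dvd_prod_diff dvd_power_diff) auto
    have "fps_X ^ (k * N) dvd (\<Sum>b\<in>B. expand t0 (\<gamma> b) * (poly (\<Phi> b) \<zeta> - mval n b (crd t0 x)))"
      using 2 by (intro dvd_sum dvd_mult) auto
    also have "(\<Sum>b\<in>B. expand t0 (\<gamma> b) * (poly (\<Phi> b) \<zeta> - mval n b (crd t0 x)))
        = poly \<Psi> \<zeta> - (\<Sum>b\<in>B. expand t0 (\<gamma> b) * mval n b (crd t0 x))"
      by (simp add: \<Psi>_def poly_sum right_diff_distrib sum_subtractf)
    finally have "fps_X ^ (k * N) dvd poly \<Psi> \<zeta> - (poly \<Psi> \<zeta> - (\<Sum>b\<in>B. expand t0 (\<gamma> b) * mval n b (crd t0 x)))"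
      by (rule dvd_diff[OF 1])
    then have 3: "fps_X ^ (k * N) dvd (\<Sum>b\<in>B. expand t0 (\<gamma> b) * mval n b (crd t0 x))" by simp
    have "mval n b (crd t0 x) = ivf t0 x ^ m * expand t0 (mval n b x)" if "b \<in> B" for b
    proof -
      have "mval n b (crd t0 x) = (\<Prod>i\<le>n. expand t0 (x i) ^ b i) * (\<Prod>i\<le>n. ivf t0 x ^ b i)"
        by (simp add: mval_def crd_def power_mult_distrib prod.distrib)
      also have "(\<Prod>i\<le>n. ivf t0 x ^ b i) = ivf t0 x ^ m" using B(2)[OF that] by (simp flip: power_sum)
      also have "(\<Prod>i\<le>n. expand t0 (x i) ^ b i) = expand t0 (mval n b x)"
        by (simp add: mval_def expand_prod expand_power)
      finally show ?thesis by (simp add: mult.commute)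
    qed
    then have "(\<Sum>b\<in>B. expand t0 (\<gamma> b) * mval n b (crd t0 x)) = (\<Sum>b\<in>B. ivf t0 x ^ m * expand t0 (\<gamma> b * mval n b x))"
      by (intro sum.cong) (auto simp: expand_mult)
    also have "\<dots> = ivf t0 x ^ m * expand t0 (\<Sum>b\<in>B. \<gamma> b * mval n b x)"
      by (simp add: expand_sum sum_distrib_left)
    \<comment> \<open>Multiplying by the \<open>m\<close>-th power of the denominator undoes the
      dehomogenisation and transfers the order to an honest polynomial.\<close>
    finally have "fps_X ^ (k * N) dvd expand t0 (lf n V x) ^ m * (ivf t0 x ^ m * expand t0 (\<Sum>b\<in>B. \<gamma> b * mval n b x))"
      using 3 by (simp add: dvd_mult)
    also have "expand t0 (lf n V x) ^ m * (ivf t0 x ^ m * expand t0 (\<Sum>b\<in>B. \<gamma> b * mval n b x))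
        = expand t0 (\<Sum>b\<in>B. \<gamma> b * mval n b x)"
      unfolding mult.assoc[symmetric] power_mult_distrib[symmetric] ivf[OF good[OF x]] by simp
    finally have dv: "fps_X ^ (k * N) dvd expand t0 (\<Sum>b\<in>B. \<gamma> b * mval n b x)" .
    have "Polynomial.degree (\<gamma> b * mval n b x) < k * N" if "b \<in> B" for b
    proof -
      have "T > 0" using y(1) by (auto simp: I_def)
      have "Polynomial.degree (\<gamma> b) \<le> T - 1" by (rule degree_le) (use \<open>T > 0\<close> in \<open>auto simp: c\<gamma>\<close>)
      then have "Polynomial.degree (\<gamma> b) < T" using \<open>T > 0\<close> by linarith
      moreover have "Polynomial.degree (mval n b x) \<le> h * m"
        using degree_mval_le[of n x h b] deg[OF x] B(2)[OF that] by simp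
      ultimately have "Polynomial.degree (\<gamma> b) + Polynomial.degree (mval n b x) < k * N"
        using mhT by (simp add: mult.commute)
      then show ?thesis using degree_mult_le[of "\<gamma> b" "mval n b x"] by linarith
    qed
    moreover have "B \<noteq> {}" using N0 by (auto simp: N_def)
    ultimately have "Polynomial.degree (\<Sum>b\<in>B. \<gamma> b * mval n b x) < k * N"
      using N0 assms(1) by (intro degree_sum_less) auto
    then show ?thesis by (rule expand_eq_0[OF dv])
  qed
  then show ?thesis using Bm nz by blast
qed simp

text \<open>For two distinct vectors of constant terms the linear forms with coefficients
  \<open>c ^ i\<close> take equal values for at most \<open>n\<close> numbers \<open>c\<close>, the
  roots of a polynomial of degree at most \<open>n\<close>. There are at most
  \<open>(d + 1)^2\<close> pairs, so some \<open>c \<le> L\<close> separates all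
  \<open>d + 1\<close> vectors; but the values are roots of one polynomial of degree at most
  \<open>d\<close>.\<close>

lemma classes_bound:
  assumes "finite P" "P \<subseteq> Pts" "card P = Suc d" "L \<ge> n * (Suc d * Suc d)"
    and good: "\<And>x. x \<in> P \<Longrightarrow> good t0 L x"
    and jet: "\<And>x y. x \<in> P \<Longrightarrow> y \<in> P \<Longrightarrow> [:- t0, 1:] dvd lf n U x * lf n V y - lf n U y * lf n V x"
  shows "\<exists>x\<in>P. \<exists>y\<in>P. x \<noteq> y \<and> (\<forall>i\<le>n. fps_nth (crd t0 x i) 0 = fps_nth (crd t0 y i) 0)"
proof (rule ccontr)
  assume neg: "\<not> ?thesis"
  define z where "z x i = fps_nth (crd t0 x i) 0" for x i
  define D where "D = (\<lambda>(x, y). \<Sum>i\<le>n. Polynomial.monom (z x i - z y i) i)"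
  define bad where "bad p = {c. poly (D p) (of_nat c :: complex) = 0}" for p
  have badc: "finite (bad (x, y)) \<and> card (bad (x, y)) \<le> n" if xy: "x \<in> P" "y \<in> P" "x \<noteq> y" for x y
  proof -
    obtain i where i: "i \<le> n" "z x i \<noteq> z y i" using neg xy unfolding z_def by blast
    have "Polynomial.coeff (D (x, y)) i = z x i - z y i" using i(1) by (simp add: D_def coeff_sum)
    then have D0: "D (x, y) \<noteq> 0" using i(2) by auto
    have dD: "Polynomial.degree (D (x, y)) \<le> n" by (rule degree_le) (simp add: D_def coeff_sum)
    have sub: "of_nat ` bad (x, y) \<subseteq> {r. poly (D (x, y)) r = 0}" by (auto simp: bad_def)
    have fin: "finite {r. poly (D (x, y)) r = 0}" using D0 by (rule poly_roots_finite)
    have inj: "inj_on (of_nat :: nat \<Rightarrow> complex) (bad (x, y))" by (auto simp: inj_on_def)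
    have "card (bad (x, y)) = card ((of_nat :: nat \<Rightarrow> complex) ` bad (x, y))" by (simp add: card_image[OF inj])
    also have "\<dots> \<le> card {r. poly (D (x, y)) r = 0}" by (rule card_mono[OF fin sub])
    also have "\<dots> \<le> n" using card_poly_roots_bound[OF D0] dD by linarith
    finally show ?thesis using finite_imageD[OF finite_subset[OF sub fin] inj] by blast
  qed
  define pairs where "pairs = {(x, y). x \<in> P \<and> y \<in> P \<and> x \<noteq> y}"
  have ps: "pairs \<subseteq> P \<times> P" by (auto simp: pairs_def)
  have fp: "finite pairs" using finite_subset[OF ps] assms(1) by blast
  have "card (\<Union>p\<in>pairs. bad p) \<le> (\<Sum>p\<in>pairs. card (bad p))" by (rule card_UN_le[OF fp])
  also have "\<dots> \<le> (\<Sum>p\<in>pairs. n)" using badc by (intro sum_mono) (auto simp: pairs_def)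
  also have "\<dots> \<le> (Suc d * Suc d) * n"
  proof -
    have "card pairs \<le> Suc d * Suc d"
      using card_mono[OF _ ps] assms(1,3) by (simp add: card_cartesian_product)
    from mult_right_mono[OF this, of n] show ?thesis by simp
  qed
  also have "\<dots> \<le> L" using assms(4) by (simp add: mult.commute)
  finally have "card (\<Union>p\<in>pairs. bad p) < card {..L}" by simp
  moreover have "finite (\<Union>p\<in>pairs. bad p)" using fp badc by (auto simp: pairs_def)
  ultimately have "\<not> {..L} \<subseteq> (\<Union>p\<in>pairs. bad p)" using card_mono[of "\<Union>p\<in>pairs. bad p" "{..L}"] by linarith
  then obtain c where c: "c \<le> L" "\<And>p. p \<in> pairs \<Longrightarrow> c \<notin> bad p" by blast
  define l where "l x = (\<Sum>i\<le>n. of_nat c ^ i * z x i)" for x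
  have injl: "inj_on l P"
  proof (rule inj_onI, rule ccontr)
    fix x y assume xy: "x \<in> P" "y \<in> P" "l x = l y" "x \<noteq> y"
    have "poly (D (x, y)) (of_nat c) = l x - l y"
      by (simp add: D_def l_def poly_sum poly_monom algebra_simps sum_subtractf)
    then have "c \<in> bad (x, y)" using xy(3) by (simp add: bad_def)
    then show False using c(2)[of "(x, y)"] xy by (auto simp: pairs_def)
  qed
  obtain s where s: "s \<in> P" using assms(3) by (metis card.empty ex_in_conv nat.distinct(1))
  define u0 where "u0 = fps_nth (par t0 s) 0"
  have u0: "fps_nth (par t0 x) 0 = u0" if "x \<in> P" for x
  proof -
    have "fps_X ^ 1 dvd par t0 x - par t0 s"
      using par_cong[OF good[OF that] good[OF s], of 1] jet[OF that s] by simp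
    then show ?thesis by (simp add: fps_X_dvd_iff u0_def)
  qed
  \<comment> \<open>All the sections share the value \<open>u0\<close> of the parameter at
    \<open>t0\<close>, so the relation for the separating form becomes a single polynomial over the
    complex numbers; \<open>good\<close> keeps its leading coefficient nonzero.\<close>
  define \<gamma> where "\<gamma> r a = poly (g' c r a) t0" for r a
  define R where "R = hpoly \<gamma> (e' c) (M' c) u0"
  have roots: "poly R (l x) = 0" if x: "x \<in> P" for x
  proof -
    have xP: "x \<in> Pts" using x assms(2) by blast
    have "hrel (\<lambda>r a. expand t0 (g' c r a)) (e' c) (M' c) (par t0 x) 1 (expand t0 (lf n (\<lambda>i. of_nat c ^ i) x) * ivf t0 x) = 0"
      unfolding par_def hrel_dehom[OF ivf[OF good[OF x]] e'(2)]
      by (simp add: expand_hom(1)[symmetric] rel'[OF xP] expand_0)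
    then have "0 = fps_nth (hrel (\<lambda>r a. expand t0 (g' c r a)) (e' c) (M' c) (par t0 x) 1 (expand t0 (lf n (\<lambda>i. of_nat c ^ i) x) * ivf t0 x)) 0"
      by simp
    also have "\<dots> = hrel (\<lambda>r a. fps_nth (expand t0 (g' c r a)) 0) (e' c) (M' c) (fps_nth (par t0 x) 0) (fps_nth 1 0)
        (fps_nth (expand t0 (lf n (\<lambda>i. of_nat c ^ i) x) * ivf t0 x) 0)"
      by (rule hrel_hom(1)) auto
    also have "expand t0 (lf n (\<lambda>i. of_nat c ^ i) x) * ivf t0 x = (\<Sum>i\<le>n. of_nat c ^ i * crd t0 x i)"
      by (simp add: lf_def expand_sum expand_mult expand_power expand_of_nat sum_distrib_right crd_def mult.assoc)
    also have "fps_nth (\<Sum>i\<le>n. of_nat c ^ i * crd t0 x i) 0 = l x"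
    proof -
      have "fps_nth (of_nat c ^ i :: complex fps) 0 = of_nat c ^ i" for i
        by (simp add: fps_power_zeroth fps_of_nat[symmetric])
      then show ?thesis by (simp add: fps_sum_nth l_def z_def)
    qed
    finally show ?thesis using u0[OF x] by (simp add: R_def poly_hpoly expand_nth_0 \<gamma>_def[abs_def])
  qed
  have "htop (\<lambda>r a. expand t0 (g' c r a)) (e' c) (M' c) (par t0 s) 1 =
      ivf t0 s ^ (M' c - e' c) * expand t0 (htop (g' c) (e' c) (M' c) (lf n U s) (lf n V s))"
    unfolding expand_hom(3) par_def by (rule htop_dehom[OF ivf[OF good[OF s]]])
  then have "fps_nth (htop (\<lambda>r a. expand t0 (g' c r a)) (e' c) (M' c) (par t0 s) 1) 0 \<noteq> 0"
    using ivf_nth[OF good[OF s]] good[OF s] c(1) by (simp add: expand_nth_0 good_def fps_power_zeroth)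
  also have "fps_nth (htop (\<lambda>r a. expand t0 (g' c r a)) (e' c) (M' c) (par t0 s) 1) 0
      = htop (\<lambda>r a. fps_nth (expand t0 (g' c r a)) 0) (e' c) (M' c) (fps_nth (par t0 s) 0) (fps_nth 1 0)"
    by (rule hrel_hom(3)) auto
  finally have top: "htop \<gamma> (e' c) (M' c) u0 1 \<noteq> 0" by (simp add: \<gamma>_def[abs_def] expand_nth_0 u0_def)
  have "Polynomial.coeff R (e' c) = htop \<gamma> (e' c) (M' c) u0 1"
    by (simp add: R_def hpoly_def coeff_sum htop_def)
  then have R0: "R \<noteq> 0" using top by auto
  have "Polynomial.degree R \<le> e' c"
    by (rule degree_le) (simp add: R_def hpoly_def coeff_sum)
  then have "card {r. poly R r = 0} \<le> d" using card_poly_roots_bound[OF R0] e'(1)[of c] by linarith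
  moreover have "card (l ` P) \<le> card {r. poly R r = 0}"
    using roots poly_roots_finite[OF R0] by (intro card_mono) auto
  ultimately show False using assms(3) by (simp add: card_image[OF injl])
qed

theorem fibre_bound:
  assumes "k > 0" "P \<subseteq> Pts" "finite P" and np: "\<forall>x\<in>P. \<forall>y\<in>P. x \<noteq> y \<longrightarrow> \<not> parallel x y"
    and deg: "\<And>x i. x \<in> P \<Longrightarrow> i \<le> n \<Longrightarrow> Polynomial.degree (x i) \<le> h"
    and "L \<ge> n * (Suc d * Suc d)"
    and good: "\<And>x. x \<in> P \<Longrightarrow> good t0 L x"
    and jet: "\<And>x y. x \<in> P \<Longrightarrow> y \<in> P \<Longrightarrow> [:- t0, 1:] ^ k dvd lf n U x * lf n V y - lf n U y * lf n V x"
    and m: "2 * (m * h) < k * ((\<Sum>j\<le>m. min d (Suc j)) - 1)"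
  shows "card P \<le> d * (d * m)"
proof -
  define z where "z x = (\<lambda>i. if i \<le> n then fps_nth (crd t0 x i) 0 else 0)" for x
  have "card (z ` P) \<le> d"
  proof (rule ccontr)
    assume "\<not> card (z ` P) \<le> d"
    then have "Suc d \<le> card (z ` P)" by simp
    then obtain S where S: "S \<subseteq> z ` P" "card S = Suc d" by (meson obtain_subset_with_card_n)
    then obtain P' where P': "P' \<subseteq> P" "inj_on z P'" "S = z ` P'" by (meson subset_image_inj)
    have "card P' = Suc d" using S(2) P' by (simp add: card_image)
    moreover have "[:- t0, 1:] dvd lf n U x * lf n V y - lf n U y * lf n V x" if "x \<in> P'" "y \<in> P'" for x y
      using jet[of x y] that P'(1) assms(1) dvd_trans[OF dvd_power[of k "[:- t0, 1:]"]] by blast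
    ultimately obtain x y where "x \<in> P'" "y \<in> P'" "x \<noteq> y" "\<forall>i\<le>n. fps_nth (crd t0 x i) 0 = fps_nth (crd t0 y i) 0"
      using classes_bound[of P' L t0] P'(1) assms(2,3,6) good finite_subset[OF P'(1)] by blast
    then have "z x = z y" by (auto simp: z_def)
    then show False using P'(2) \<open>x \<in> P'\<close> \<open>y \<in> P'\<close> \<open>x \<noteq> y\<close> by (auto simp: inj_on_def)
  qed
  have fib: "card {x \<in> P. z x = w} \<le> d * m" for w
  proof (rule class_bound[OF assms(1)])
    show "fps_nth (crd t0 x i) 0 = fps_nth (crd t0 y i) 0"
      if xy: "x \<in> {x \<in> P. z x = w}" "y \<in> {x \<in> P. z x = w}" "i \<le> n" for x y i
    proof -
      have "z x i = z y i" using xy by simp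
      then show ?thesis using xy(3) by (simp add: z_def)
    qed
  qed (use assms in auto)
  have "P = (\<Union>w\<in>z ` P. {x \<in> P. z x = w})" by auto
  then have "card P \<le> (\<Sum>w\<in>z ` P. card {x \<in> P. z x = w})"
    using card_UN_le[of "z ` P" "\<lambda>w. {x \<in> P. z x = w}"] assms(3) by simp
  also have "\<dots> \<le> (\<Sum>w\<in>z ` P. d * m)" by (intro sum_mono fib)
  also have "\<dots> \<le> d * (d * m)" using \<open>card (z ` P) \<le> d\<close> by simp
  finally show ?thesis .
qed

end

section \<open>Dimension of prime sets\<close>

context prime_set
begin

section \<open>Elimination and images of open sets under projection\<close>

lemma zs_polyc: "p \<in> zs i \<Longrightarrow> p \<in> polyc i" by (simp add: zs_def)

lemma zs_iff: "p - q \<in> zs i \<Longrightarrow> p \<in> polyc i \<Longrightarrow> q \<in> polyc i \<Longrightarrow> p \<in> zs i \<longleftrightarrow> q \<in> zs i"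
  by (auto simp: zs_def ev_diff)

lemma const_polyc: "c \<in> polys i \<Longrightarrow> [:c:] \<in> polyc i"
  using polyc_monom[of c i 0] by (simp add: monom_0)

lemma ev_const: "ev [:c:] x w = c x"
  by (simp add: ev_def)

text \<open>The resultant of the minimal relation \<open>\<Phi>\<close> and \<open>v\<close>, up to a factor: a combination of the
  two that does not involve the last coordinate.\<close>

lemma eliminant:
  assumes "i < N" "e > 0" "\<Phi> \<in> zs i" "nz (Polynomial.coeff \<Phi> e)" "\<And>j. j > e \<Longrightarrow> Polynomial.coeff \<Phi> j = 0"
    and min: "\<And>p j. p \<in> zs i \<Longrightarrow> (\<And>j. j \<ge> e \<Longrightarrow> Polynomial.coeff p j = 0) \<Longrightarrow> \<not> nz (Polynomial.coeff p j)"
    and "v \<in> polyc i" "v \<notin> zs i"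
  obtains b h where "b \<in> polys i" "nz b" "h \<in> polyc i" "[:b:] - h * v \<in> zs i"
proof -
  \<comment> \<open>\<open>Q f\<close>: modulo the relations, some multiple of \<open>v\<close> that
    is not itself a relation has degree \<open>f\<close>, with a leading coefficient that does not
    vanish identically on \<open>Y\<close>. The least such \<open>f\<close> turns out to be
    \<open>0\<close>.\<close>
  define Q where "Q f \<longleftrightarrow> (\<exists>q h. q \<in> polyc i \<and> h \<in> polyc i \<and> nz (Polynomial.coeff q f) \<and>
    (\<forall>j>f. Polynomial.coeff q j = 0) \<and> q \<notin> zs i \<and> q - h * v \<in> zs i)" for f
  have mk: "\<exists>f\<le>n. Q f" if qn: "q \<in> polyc i" "h \<in> polyc i" "q \<notin> zs i" "q - h * v \<in> zs i"
    and deg: "\<And>j. j > n \<Longrightarrow> Polynomial.coeff q j = 0" for q h n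
  proof -
    have "\<exists>m. nz (Polynomial.coeff q m)"
    proof (rule ccontr)
      assume neg: "\<not> ?thesis"
      have "ev q y (y i) = 0" if "y \<in> Y" for y
        using neg that by (subst ev_sum[of 0]) (auto simp: nz_def)
      then show False using qn by (simp add: zs_def)
    qed
    then obtain m where m: "nz (Polynomial.coeff q m)" by blast
    obtain f q' where q': "f \<le> n" "q' \<in> polyc i" "nz (Polynomial.coeff q' f)"
      "\<And>l. l > f \<Longrightarrow> Polynomial.coeff q' l = 0" "q - q' \<in> zs i"
      using strip[OF qn(1) deg m] by blast
    have "q' \<notin> zs i" using zs_iff[OF q'(5) qn(1) q'(2)] qn(3) by blast
    moreover have "(q - h * v) - (q - q') \<in> zs i" by (rule zs_diff[OF qn(4) q'(5)])
    then have "q' - h * v \<in> zs i" by simp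
    ultimately have "Q f" unfolding Q_def using q' qn(2) by blast
    with q'(1) show ?thesis by blast
  qed
  have "v - 1 * v \<in> zs i" by (simp add: zs_def polyc_0 ev_0)
  then have "\<exists>f. Q f" using mk[OF assms(7) polyc_1 assms(8), of "Polynomial.degree v"] coeff_eq_0 by blast
  then obtain f where f: "Q f" "\<And>g. g < f \<Longrightarrow> \<not> Q g" using exists_least_iff[of Q] by blast
  then obtain \<psi> h where \<psi>: "\<psi> \<in> polyc i" "h \<in> polyc i" "nz (Polynomial.coeff \<psi> f)"
    "\<And>j. j > f \<Longrightarrow> Polynomial.coeff \<psi> j = 0" "\<psi> \<notin> zs i" "\<psi> - h * v \<in> zs i"
    unfolding Q_def by blast
  have \<Phi>P: "\<Phi> \<in> polyc i" by (rule zs_polyc[OF assms(3)])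
  have nzc: "[:a ^ k:] \<notin> zs i" if "a \<in> polys i" "nz a" for a k
    using nz_power[OF that(1) less_imp_le[OF assms(1)] that(2), of k] by (auto simp: zs_def ev_const nz_def power_apply)
  have "f \<le> e"
  proof (rule ccontr)
    assume "\<not> f \<le> e"
    have "\<forall>j\<ge>Suc f. Polynomial.coeff \<psi> j = 0" "\<forall>j>e. Polynomial.coeff \<Phi> j = 0" using \<psi>(4) assms(5) by simp_all
    from pseudo_division[OF \<Phi>P this(2) \<psi>(1) this(1)] obtain k g r where
      d: "g \<in> polyc i" "r \<in> polyc i" "Polynomial.smult (Polynomial.coeff \<Phi> e ^ k) \<psi> = g * \<Phi> + r"
      "\<forall>j\<ge>e. Polynomial.coeff r j = 0" by (elim exE conjE) (rule that)
    let ?a = "Polynomial.coeff \<Phi> e ^ k"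
    have aP: "?a \<in> polys i" by (rule polys_power'[OF polyc_coeff[OF \<Phi>P]])
    have r: "r = [:?a:] * \<psi> - g * \<Phi>" using d(3) by (simp add: algebra_simps)
    have g\<Phi>: "g * \<Phi> \<in> zs i" by (rule zs_mult2[OF assms(3) d(1)])
    have "[:?a:] * \<psi> \<notin> zs i"
      using zs_prime[OF assms(1) const_polyc[OF aP] \<psi>(1)] \<psi>(5) nzc[OF polyc_coeff[OF \<Phi>P] assms(4)] by blast
    then have "r \<notin> zs i" using zs_add[OF _ g\<Phi>, of r] unfolding r by auto
    have "[:?a:] * (\<psi> - h * v) - g * \<Phi> \<in> zs i"
      by (intro zs_diff g\<Phi> zs_mult2 \<psi>(6) const_polyc aP)
    then have "r - ([:?a:] * h) * v \<in> zs i" unfolding r by (simp add: algebra_simps smult_diff_right)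
    moreover have "[:?a:] * h \<in> polyc i" by (intro polyc_mult const_polyc aP \<psi>(2))
    moreover have "\<And>j. j > e - 1 \<Longrightarrow> Polynomial.coeff r j = 0" using d(4) assms(2) by simp
    ultimately obtain l where "l \<le> e - 1" "Q l" using mk[OF d(2) _ \<open>r \<notin> zs i\<close>] by blast
    then show False using f(2)[of l] \<open>\<not> f \<le> e\<close> by auto
  qed
  have "f = 0"
  proof (rule ccontr)
    assume "f \<noteq> 0"
    have "\<forall>j\<ge>Suc e. Polynomial.coeff \<Phi> j = 0" "\<forall>j>f. Polynomial.coeff \<psi> j = 0" using \<psi>(4) assms(5) by simp_all
    from pseudo_division[OF \<psi>(1) this(2) \<Phi>P this(1)] obtain k g r where
      d: "g \<in> polyc i" "r \<in> polyc i" "Polynomial.smult (Polynomial.coeff \<psi> f ^ k) \<Phi> = g * \<psi> + r"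
      "\<forall>j\<ge>f. Polynomial.coeff r j = 0" "\<forall>j. j + f \<ge> Suc e \<longrightarrow> Polynomial.coeff g j = 0" by (elim exE conjE) (rule that)
    let ?b = "Polynomial.coeff \<psi> f ^ k"
    have bP: "?b \<in> polys i" by (rule polys_power'[OF polyc_coeff[OF \<psi>(1)]])
    have r: "r = [:?b:] * \<Phi> - g * \<psi>" using d(3) by (simp add: algebra_simps)
    have b\<Phi>: "[:?b:] * \<Phi> \<in> zs i" by (intro zs_mult2 assms(3) const_polyc bP)
    have "r \<in> zs i"
    proof (rule ccontr)
      assume "r \<notin> zs i"
      have "[:?b:] * \<Phi> - g * (\<psi> - h * v) \<in> zs i" by (intro zs_diff b\<Phi> zs_mult2 \<psi>(6) d(1))
      then have "r - (- (g * h)) * v \<in> zs i" unfolding r by (simp add: algebra_simps)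
      moreover have "- (g * h) \<in> polyc i" using polyc_diff[OF polyc_0 polyc_mult[OF d(1) \<psi>(2)]] by simp
      moreover have "\<And>j. j > f - 1 \<Longrightarrow> Polynomial.coeff r j = 0" using d(4) \<open>f \<noteq> 0\<close> by simp
      ultimately obtain l where "l \<le> f - 1" "Q l" using mk[OF d(2) _ \<open>r \<notin> zs i\<close>] by blast
      then show False using f(2)[of l] \<open>f \<noteq> 0\<close> by auto
    qed
    \<comment> \<open>Primality makes the quotient \<open>g\<close> a relation. Its degree is below
      \<open>e\<close>, so by minimality all its coefficients vanish on \<open>Y\<close>; but then
      so would the leading coefficient of \<open>\<Phi>\<close> times a power of that of
      \<open>\<psi>\<close>.\<close>
    then have "g * \<psi> \<in> zs i" using zs_diff[OF b\<Phi> \<open>r \<in> zs i\<close>] unfolding r by simp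
    then have "g \<in> zs i" using zs_prime[OF assms(1) d(1) \<psi>(1)] \<psi>(5) by blast
    moreover have "Polynomial.coeff g j = 0" if "j \<ge> e" for j using d(5) that \<open>f \<noteq> 0\<close> by simp
    ultimately have gz: "\<not> nz (Polynomial.coeff g j)" for j using min by blast
    have "Polynomial.coeff (g * \<psi>) e y = 0" if "y \<in> Y" for y
      using gz that unfolding coeff_mult nz_def by (auto simp: sum_apply)
    moreover have "Polynomial.coeff r e = 0" using d(4) \<open>f \<le> e\<close> by simp
    then have "Polynomial.coeff (g * \<psi>) e = ?b * Polynomial.coeff \<Phi> e"
      using arg_cong[OF d(3), of "\<lambda>p. Polynomial.coeff p e"] by simp
    ultimately have "\<not> nz (\<lambda>x. Polynomial.coeff \<psi> f x ^ k * Polynomial.coeff \<Phi> e x)"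
      unfolding nz_def by (simp add: power_apply)
    moreover have "nz (\<lambda>x. Polynomial.coeff \<psi> f x ^ k * Polynomial.coeff \<Phi> e x)"
      using assms(1) by (intro nz_mult[of _ i] polys_power polyc_coeff[OF \<psi>(1)] polyc_coeff[OF \<Phi>P] nz_power[of _ i] \<psi>(3) assms(4)) auto
    ultimately show False by blast
  qed
  have "\<psi> = [:Polynomial.coeff \<psi> 0:]"
    using \<psi>(4) \<open>f = 0\<close> by (intro poly_eqI) (auto simp: coeff_pCons split: nat.splits)
  then show ?thesis using that[of "Polynomial.coeff \<psi> 0" h] \<psi> \<open>f = 0\<close> polyc_coeff by metis
qed

text \<open>If coordinate \<open>i\<close> is transcendental, the whole line lies in the closure and
  a coefficient of \<open>v\<close> that is nonzero on \<open>Y\<close> suffices. If it is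
  algebraic, \<open>v'\<close> is the leading coefficient of the minimal relation times an eliminant
  \<open>b\<close> of \<open>v\<close>: the relation has a complex root, and there \<open>b\<close>
  is a multiple of the value of \<open>v\<close>.\<close>

lemma chevalley_step:
  assumes "i < N" "v \<in> polys (Suc i)" "nz v"
  obtains v' where "v' \<in> polys i" "nz v'"
    "\<And>x. x \<in> closed_to i Y \<Longrightarrow> v' x \<noteq> 0 \<Longrightarrow> \<exists>w. x(i := w) \<in> closed_to (Suc i) Y \<and> v (x(i := w)) \<noteq> 0"
proof -
  obtain p where p: "p \<in> polyc i" "v = (\<lambda>x. ev p x (x i))" using assms(2) by (rule polys_SucE)
  have pz: "p \<notin> zs i" using assms(3) p by (auto simp: zs_def nz_def)
  have upd: "ev q (x(i := w)) w = ev q x w" if "q \<in> polyc i" for q x w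
  proof -
    have "Polynomial.coeff q j (x(i := w)) = Polynomial.coeff q j x" for j
      by (intro polys_upd[of _ i] polyc_coeff[OF that]) auto
    moreover have "ev q y w = (\<Sum>j\<le>Polynomial.degree q. Polynomial.coeff q j y * w ^ j)" for y
      by (rule ev_sum) (simp add: coeff_eq_0)
    ultimately show ?thesis by simp
  qed
  show ?thesis
  proof (cases "transc i Y")
    case True
    have "\<exists>m. nz (Polynomial.coeff p m)"
    proof (rule ccontr)
      assume neg: "\<not> ?thesis"
      have "ev p y (y i) = 0" if "y \<in> Y" for y
        using neg that by (subst ev_sum[of 0]) (auto simp: nz_def)
      then show False using pz p(1) by (simp add: zs_def)
    qed
    then obtain m where m: "nz (Polynomial.coeff p m)" by blast
    show ?thesis
    proof (rule that)
      show "Polynomial.coeff p m \<in> polys i" by (rule polyc_coeff[OF p(1)])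
      show "nz (Polynomial.coeff p m)" by (rule m)
      fix x assume x: "x \<in> closed_to i Y" "Polynomial.coeff p m x \<noteq> 0"
      define P where "P = (\<Sum>j\<le>Polynomial.degree p. Polynomial.monom (Polynomial.coeff p j x) j)"
      have cP: "Polynomial.coeff P j = Polynomial.coeff p j x" for j
        by (auto simp: P_def coeff_sum coeff_eq_0)
      then have "P \<noteq> 0" using x(2) by (metis coeff_0)
      then obtain w where w: "poly P w \<noteq> 0" using poly_all_0_iff_0 by blast
      have "ev p x w = poly P w"
        by (subst ev_sum[where D = "Polynomial.degree p"]) (auto simp: coeff_eq_0 P_def poly_sum poly_monom)
      then have "v (x(i := w)) \<noteq> 0" using w upd[OF p(1)] unfolding p(2) by simp
      then show "\<exists>w. x(i := w) \<in> closed_to (Suc i) Y \<and> v (x(i := w)) \<noteq> 0"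
        using transc_closed_to[OF True x(1)] by blast
    qed
  next
    case False
    obtain e \<Phi> where \<Phi>: "e > 0" "\<Phi> \<in> zs i" "nz (Polynomial.coeff \<Phi> e)" "\<And>j. j > e \<Longrightarrow> Polynomial.coeff \<Phi> j = 0"
      "\<And>p j. p \<in> zs i \<Longrightarrow> (\<And>j. j \<ge> e \<Longrightarrow> Polynomial.coeff p j = 0) \<Longrightarrow> \<not> nz (Polynomial.coeff p j)"
      using algebraic_relation[OF False] by blast
    obtain b h where b: "b \<in> polys i" "nz b" "h \<in> polyc i" "[:b:] - h * p \<in> zs i"
      using eliminant[OF assms(1) \<Phi> p(1) pz] by blast
    have \<Phi>P: "\<Phi> \<in> polyc i" by (rule zs_polyc[OF \<Phi>(2)])
    let ?a = "Polynomial.coeff \<Phi> e"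
    have aP: "?a \<in> polys i" by (rule polyc_coeff[OF \<Phi>P])
    show ?thesis
    proof (rule that)
      show "(\<lambda>x. ?a x * b x) \<in> polys i" by (intro polys_mult aP b)
      show "nz (\<lambda>x. ?a x * b x)" using assms(1) by (intro nz_mult[of _ i] aP b \<Phi>(3)) auto
      fix x assume x: "x \<in> closed_to i Y" "?a x * b x \<noteq> 0"
      define P where "P = (\<Sum>j\<le>e. Polynomial.monom (Polynomial.coeff \<Phi> j x) j)"
      have cP: "Polynomial.coeff P j = (if j \<le> e then Polynomial.coeff \<Phi> j x else 0)" for j
        by (simp add: P_def coeff_sum)
      have "\<not> constant (poly P)"
      proof
        assume "constant (poly P)"
        then have "Polynomial.degree P = 0" by (simp add: constant_degree)
        moreover have "Polynomial.coeff P e \<noteq> 0" using x(2) by (simp add: cP)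
        ultimately show False using \<Phi>(1) le_degree[of P e] by simp
      qed
      then obtain w where w: "poly P w = 0" using fundamental_theorem_of_algebra by blast
      have "ev \<Phi> x w = poly P w"
        by (subst ev_sum[where D = e]) (auto simp: \<Phi>(4) P_def poly_sum poly_monom)
      then have \<Phi>w: "ev \<Phi> x w = 0" using w by simp
      \<comment> \<open>At the root \<open>w\<close> every relation vanishes: pseudo-division by the
        minimal one leaves a relation of smaller degree, whose coefficients vanish on
        \<open>Y\<close> and hence at \<open>x\<close>.\<close>
      have zw: "ev q x w = 0" if q: "q \<in> zs i" for q
      proof -
        have "\<forall>j\<ge>Suc (Polynomial.degree q). Polynomial.coeff q j = 0" "\<forall>j>e. Polynomial.coeff \<Phi> j = 0"
          using \<Phi>(4) by (auto simp: coeff_eq_0)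
        from pseudo_division[OF \<Phi>P this(2) zs_polyc[OF q] this(1)] obtain k g r where
          d: "g \<in> polyc i" "r \<in> polyc i" "Polynomial.smult (?a ^ k) q = g * \<Phi> + r"
          "\<forall>j\<ge>e. Polynomial.coeff r j = 0" by (elim exE conjE) (rule that)
        have "r = Polynomial.smult (?a ^ k) q - g * \<Phi>" using d(3) by simp
        also have "\<dots> \<in> zs i" by (intro zs_diff zs_smult q zs_mult2 \<Phi>(2) d(1) polys_power' aP)
        finally have "\<not> nz (Polynomial.coeff r j)" for j using \<Phi>(5)[of r j] d(4) by blast
        then have "Polynomial.coeff r j x = 0" for j
          using closed_toD[OF x(1) polyc_coeff[OF d(2)]] by blast
        then have "ev r x w = 0" by (subst ev_sum[of 0]) auto
        then have "?a x ^ k * ev q x w = 0"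
          using arg_cong[OF d(3), of "\<lambda>p. ev p x w"] \<Phi>w by (simp add: ev_smult ev_add ev_mult power_apply)
        then show ?thesis using x(2) by simp
      qed
      have "x(i := w) \<in> closed_to (Suc i) Y"
        unfolding closed_to_def
      proof (intro CollectI ballI impI)
        fix f assume f: "f \<in> polys (Suc i)" "\<forall>y\<in>Y. f y = 0"
        then obtain q where q: "q \<in> polyc i" "f = (\<lambda>x. ev q x (x i))" by (elim polys_SucE)
        then have "q \<in> zs i" using f(2) by (simp add: zs_def)
        then show "f (x(i := w)) = 0" using zw[of q] upd[OF q(1)] unfolding q(2) by simp
      qed
      moreover have "v (x(i := w)) \<noteq> 0"
      proof
        assume "v (x(i := w)) = 0"
        then have "ev p x w = 0" using upd[OF p(1)] unfolding p(2) by simp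
        moreover have "b x - ev h x w * ev p x w = 0"
          using zw[OF b(4)] by (simp add: ev_diff ev_mult ev_const)
        ultimately show False using x(2) by simp
      qed
      ultimately show "\<exists>w. x(i := w) \<in> closed_to (Suc i) Y \<and> v (x(i := w)) \<noteq> 0" by blast
    qed
  qed
qed

text \<open>The image of a nonempty open part of the closure under a projection contains a nonempty
  open part of the closure of the image. Coordinates outside the range \<open>k\<close> to
  \<open>n - 1\<close> are kept, so that the lifted point can be controlled beyond
  \<open>n\<close>.\<close>

lemma chevalley:
  assumes "k \<le> n" "n \<le> N" "v \<in> polys n" "nz v"
  obtains v' where "v' \<in> polys k" "nz v'"
    "\<And>x. x \<in> closed_to k Y \<Longrightarrow> v' x \<noteq> 0 \<Longrightarrow> \<exists>x'. x' \<in> closed_to n Y \<and> v x' \<noteq> 0 \<and> (\<forall>j. j < k \<or> j \<ge> n \<longrightarrow> x' j = x j)"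
proof -
  have "\<exists>v'. v' \<in> polys k \<and> nz v' \<and> (\<forall>x. x \<in> closed_to k Y \<longrightarrow> v' x \<noteq> 0 \<longrightarrow>
      (\<exists>x'. x' \<in> closed_to n Y \<and> v x' \<noteq> 0 \<and> (\<forall>j. j < k \<or> j \<ge> n \<longrightarrow> x' j = x j)))"
    using assms
  proof (induction n arbitrary: v rule: dec_induct)
    case base
    then show ?case by blast
  next
    case (step n)
    obtain v1 where v1: "v1 \<in> polys n" "nz v1"
      "\<And>x. x \<in> closed_to n Y \<Longrightarrow> v1 x \<noteq> 0 \<Longrightarrow> \<exists>w. x(n := w) \<in> closed_to (Suc n) Y \<and> v (x(n := w)) \<noteq> 0"
      using chevalley_step[of n v] step.prems by auto
    obtain v' where v': "v' \<in> polys k" "nz v'" "\<And>x. x \<in> closed_to k Y \<Longrightarrow> v' x \<noteq> 0 \<Longrightarrow>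
        \<exists>x'. x' \<in> closed_to n Y \<and> v1 x' \<noteq> 0 \<and> (\<forall>j. j < k \<or> j \<ge> n \<longrightarrow> x' j = x j)"
      using step.IH[of v1] step.prems(1) v1 by auto
    have "\<exists>x'. x' \<in> closed_to (Suc n) Y \<and> v x' \<noteq> 0 \<and> (\<forall>j. j < k \<or> j \<ge> Suc n \<longrightarrow> x' j = x j)"
      if x: "x \<in> closed_to k Y" "v' x \<noteq> 0" for x
    proof -
      obtain x' where x': "x' \<in> closed_to n Y" "v1 x' \<noteq> 0" "\<forall>j. j < k \<or> j \<ge> n \<longrightarrow> x' j = x j"
        using v'(3)[OF x] by blast
      obtain w where w: "x'(n := w) \<in> closed_to (Suc n) Y" "v (x'(n := w)) \<noteq> 0"
        using v1(3)[OF x'(1,2)] by blast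
      then show ?thesis using x'(3) step.hyps by (intro exI[of _ "x'(n := w)"]) auto
    qed
    then show ?case using v'(1,2) by blast
  qed
  then show ?thesis using that by blast
qed

end

section \<open>Growth of polynomial functions and transcendence degree\<close>

lemma vector_space_fun: "vector_space (\<lambda>(c::complex) (f::'p \<Rightarrow> complex). (\<lambda>x. c * f x))"
  by unfold_locales (auto simp: fun_eq_iff algebra_simps)

interpretation cfun: vector_space "\<lambda>(c::complex) (f::'p \<Rightarrow> complex). (\<lambda>x. c * f x)"
  by (rule vector_space_fun)

lemma span_times:
  assumes "g \<in> cfun.span B" "\<And>b. b \<in> B \<Longrightarrow> (\<lambda>x. b x * m x) \<in> cfun.span B'"
  shows "(\<lambda>x. g x * m x) \<in> cfun.span B'"
  using assms(1)
proof (induction rule: cfun.span_induct_alt)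
  case base
  have "(\<lambda>x. 0 x * m x) = 0" by (auto simp: fun_eq_iff)
  then show ?case by (metis cfun.span_zero)
next
  case (step c y z)
  have "(\<lambda>x. ((\<lambda>x. c * y x) + z) x * m x) = (\<lambda>x. c * (y x * m x)) + (\<lambda>x. z x * m x)"
    by (simp add: fun_eq_iff algebra_simps)
  moreover have "(\<lambda>x. c * (y x * m x)) \<in> cfun.span B'"
    using cfun.span_scale[OF assms(2)[OF step(1)], of c] by simp
  then have "(\<lambda>x. c * (y x * m x)) + (\<lambda>x. z x * m x) \<in> cfun.span B'"
    by (rule cfun.span_add) (rule step(2))
  ultimately show ?case by simp
qed

lemma span_lsum:
  "(\<And>j. j \<in> J \<Longrightarrow> f j \<in> cfun.span B) \<Longrightarrow> (\<lambda>x. \<Sum>j\<in>J. f j x) \<in> cfun.span B"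
proof -
  assume "\<And>j. j \<in> J \<Longrightarrow> f j \<in> cfun.span B"
  then have "sum f J \<in> cfun.span B" by (intro cfun.span_sum) auto
  moreover have "sum f J = (\<lambda>x. \<Sum>j\<in>J. f j x)" by (simp add: fun_eq_iff sum_apply)
  ultimately show ?thesis by simp
qed

definition exps :: "nat \<Rightarrow> nat \<Rightarrow> nat list set" where
  "exps r D = {l. set l \<subseteq> {..D} \<and> length l = r}"

context prime_set
begin

text \<open>The transcendence degree of the function field of the projection to the first
  \<open>i\<close> coordinates: the counted coordinates form a transcendence basis.\<close>

definition tdim :: "nat \<Rightarrow> nat" where
  "tdim i = card {j. j < i \<and> transc j Y}"

lemma tdim_Suc: "tdim (Suc i) = (if transc i Y then Suc (tdim i) else tdim i)"
proof -
  have "{j. j < Suc i \<and> transc j Y} = (if transc i Y then insert i {j. j < i \<and> transc j Y} else {j. j < i \<and> transc j Y})"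
    by (auto simp: less_Suc_eq)
  then show ?thesis by (simp add: tdim_def)
qed

lemma tdim_le: "tdim i \<le> i"
  using card_mono[of "{..<i}" "{j. j < i \<and> transc j Y}"] by (auto simp: tdim_def)

text \<open>Pseudo-division by a relation of degree \<open>e\<close>, with the degrees of the
  coefficients under control: each step removes one power of the coordinate at the price of a factor
  \<open>c e\<close> and of \<open>\<delta>\<close> in the degree.\<close>

lemma reduce_power:
  assumes rel: "\<forall>y\<in>Y. (\<Sum>j\<le>e. c j y * y i ^ j) = 0" and c: "\<And>j. c j \<in> polyfun i \<delta>"
    and f: "\<And>j. f j \<in> polyfun i D"
  shows "\<exists>f'. (\<forall>j. f' j \<in> polyfun i (D + n * \<delta>)) \<and>
    (\<forall>y\<in>Y. c e y ^ n * (\<Sum>j<e + n. f j y * y i ^ j) = (\<Sum>j<e. f' j y * y i ^ j))"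
  using f
proof (induction n arbitrary: f D)
  case 0
  then show ?case by (intro exI[of _ f]) auto
next
  case (Suc n)
  define g where "g j = (\<lambda>x. c e x * f j x - (if n \<le> j then f (e + n) x * c (j - n) x else 0))" for j
  have "g j \<in> polyfun i (D + \<delta>)" for j
  proof -
    have "(\<lambda>x. c e x * f j x) \<in> polyfun i (D + \<delta>)"
      using polyfun_mult[OF c[of e] Suc.prems[of j]] by (simp add: add.commute)
    moreover have "(\<lambda>x. f (e + n) x * c (j - n) x) \<in> polyfun i (D + \<delta>)"
      using polyfun_mult[OF Suc.prems c] .
    then have "(\<lambda>x. (- 1) * (f (e + n) x * c (j - n) x)) \<in> polyfun i (0 + (D + \<delta>))"
      by (rule polyfun_mult[OF polyfun_const])
    ultimately show ?thesis
      using polyfun_add[of "\<lambda>x. c e x * f j x" i "D + \<delta>" "\<lambda>x. (- 1) * (f (e + n) x * c (j - n) x)"]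
      by (cases "n \<le> j") (auto simp: g_def)
  qed
  from Suc.IH[of g "D + \<delta>", OF this] obtain f' where f': "\<And>j. f' j \<in> polyfun i (D + \<delta> + n * \<delta>)"
    "\<And>y. y \<in> Y \<Longrightarrow> c e y ^ n * (\<Sum>j<e + n. g j y * y i ^ j) = (\<Sum>j<e. f' j y * y i ^ j)" by blast
  have "c e y ^ Suc n * (\<Sum>j<e + Suc n. f j y * y i ^ j) = (\<Sum>j<e. f' j y * y i ^ j)" if y: "y \<in> Y" for y
  proof -
    have "(\<Sum>j<e + n. (if n \<le> j then f (e + n) y * c (j - n) y else 0) * y i ^ j)
        = (\<Sum>j\<in>{n..<e + n}. f (e + n) y * c (j - n) y * y i ^ j)"
      by (intro sum.mono_neutral_cong_right) auto
    also have "\<dots> = (\<Sum>j<e. f (e + n) y * c j y * y i ^ (j + n))"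
      by (rule sum.reindex_bij_witness[of _ "\<lambda>j. j + n" "\<lambda>j. j - n"]) auto
    also have "\<dots> = f (e + n) y * y i ^ n * (\<Sum>j<e. c j y * y i ^ j)"
      by (simp add: sum_distrib_left power_add ac_simps)
    also have "(\<Sum>j<e. c j y * y i ^ j) = - (c e y * y i ^ e)"
      using rel y by (simp add: lessThan_Suc_atMost[symmetric] eq_neg_iff_add_eq_0)
    finally have s: "(\<Sum>j<e + n. (if n \<le> j then f (e + n) y * c (j - n) y else 0) * y i ^ j)
        = - (c e y * (f (e + n) y * y i ^ (e + n)))" by (simp add: power_add ac_simps)
    have "(\<Sum>j<e + n. g j y * y i ^ j) = c e y * (\<Sum>j<e + n. f j y * y i ^ j)
        - (\<Sum>j<e + n. (if n \<le> j then f (e + n) y * c (j - n) y else 0) * y i ^ j)"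
      unfolding g_def by (simp only: left_diff_distrib sum_subtractf sum_distrib_left mult.assoc)
    also have "\<dots> = c e y * (\<Sum>j<e + Suc n. f j y * y i ^ j)"
      unfolding s by (simp add: distrib_left)
    finally show ?thesis using f'(2)[OF y] by (simp add: mult.assoc mult.left_commute)
  qed
  then show ?case using f'(1) by (intro exI[of _ f']) (auto simp: algebra_simps)
qed

text \<open>A transcendental coordinate multiplies the count by \<open>D + 1\<close>, an algebraic
  one by the degree of its relation. As relations need not be monic, functions are represented only
  after multiplication by some \<open>a\<close> that depends on \<open>D\<close>; primality cancels
  it later.\<close>

lemma growth_upper:
  assumes "i \<le> N"
  shows "\<exists>C. \<forall>D. \<exists>a B. a \<in> polys i \<and> nz a \<and> finite B \<and> card B \<le> C * (D + 1) ^ tdim i \<and>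
    (\<forall>f\<in>polyfun i D. \<exists>g\<in>cfun.span B. \<forall>y\<in>Y. a y * f y = g y)"
  using assms
proof (induction i)
  case 0
  have "(\<lambda>x. c) \<in> cfun.span {\<lambda>x. 1}" for c
    using cfun.span_scale[OF cfun.span_base[of "\<lambda>x. 1" "{\<lambda>x. 1}"], of c] by simp
  then have "\<exists>g\<in>cfun.span {\<lambda>x. 1}. \<forall>y\<in>Y. 1 * f y = g y" if "f \<in> polyfun 0 D" for f D
    using that by (intro bexI[of _ f]) auto
  moreover have "nz (\<lambda>x. 1)" "card {\<lambda>x::pt. 1 :: complex} \<le> 1 * (D + 1) ^ tdim 0" for D
    using nonempty by (auto simp: nz_def)
  ultimately show ?case using polys_const[of 1 0]
    by (intro exI[of _ 1] allI exI[of _ "\<lambda>x. 1"] exI[of _ "{\<lambda>x. 1}"]) blast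
next
  case (Suc i)
  then obtain C where C: "\<And>D. \<exists>a B. a \<in> polys i \<and> nz a \<and> finite B \<and> card B \<le> C * (D + 1) ^ tdim i \<and>
    (\<forall>f\<in>polyfun i D. \<exists>g\<in>cfun.span B. \<forall>y\<in>Y. a y * f y = g y)" by auto
  show ?case
  proof (cases "transc i Y")
    case True
    show ?thesis
    proof (intro exI[of _ C] allI)
      fix D
      obtain a B where aB: "a \<in> polys i" "nz a" "finite B" "card B \<le> C * (D + 1) ^ tdim i"
        "\<And>f. f \<in> polyfun i D \<Longrightarrow> \<exists>g\<in>cfun.span B. \<forall>y\<in>Y. a y * f y = g y" using C[of D] by blast
      define B' where "B' = (\<lambda>(b, j) x. b x * x i ^ j) ` (B \<times> {..D})"
      have "card B' \<le> card B * (D + 1)"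
        unfolding B'_def using card_image_le[of "B \<times> {..D}" "\<lambda>(b, j) x. b x * x i ^ j"] aB(3)
        by (simp add: card_cartesian_product)
      also have "\<dots> \<le> C * (D + 1) ^ tdim i * (D + 1)" using aB(4) by (rule mult_right_mono) simp
      finally have "card B' \<le> C * (D + 1) ^ tdim (Suc i)" using True by (simp add: tdim_Suc ac_simps)
      moreover have "\<exists>g\<in>cfun.span B'. \<forall>y\<in>Y. a y * f y = g y" if f: "f \<in> polyfun (Suc i) D" for f
      proof -
        obtain c where c: "\<And>j. c j \<in> polyfun i D" "f = (\<lambda>x. \<Sum>j\<le>D. c j x * x i ^ j)"
          using f by (rule polyfun_SucE) blast
        obtain g where g: "\<And>j. g j \<in> cfun.span B" "\<And>j y. y \<in> Y \<Longrightarrow> a y * c j y = g j y"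
          using aB(5)[OF c(1)] by metis
        have "(\<lambda>x. \<Sum>j\<le>D. g j x * x i ^ j) \<in> cfun.span B'"
          by (intro span_lsum span_times[OF g(1)] cfun.span_base) (auto simp: B'_def)
        moreover have "a y * f y = (\<Sum>j\<le>D. g j y * y i ^ j)" if "y \<in> Y" for y
          unfolding c(2) sum_distrib_left by (intro sum.cong) (auto simp: g(2)[OF that, symmetric])
        ultimately show ?thesis by (intro bexI[of _ "\<lambda>x. \<Sum>j\<le>D. g j x * x i ^ j"]) auto
      qed
      ultimately show "\<exists>a B. a \<in> polys (Suc i) \<and> nz a \<and> finite B \<and> card B \<le> C * (D + 1) ^ tdim (Suc i) \<and>
        (\<forall>f\<in>polyfun (Suc i) D. \<exists>g\<in>cfun.span B. \<forall>y\<in>Y. a y * f y = g y)"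
        using aB(1-3) polys_lift[of i "Suc i" a]
        by (intro exI[of _ a] exI[of _ B']) (auto simp: B'_def)
    qed
  next
    case False
    obtain e \<Phi> where "e > 0" and \<Phi>: "\<Phi> \<in> zs i" "nz (Polynomial.coeff \<Phi> e)" "\<And>j. j > e \<Longrightarrow> Polynomial.coeff \<Phi> j = 0"
      and "\<And>p j. p \<in> zs i \<Longrightarrow> (\<And>j. j \<ge> e \<Longrightarrow> Polynomial.coeff p j = 0) \<Longrightarrow> \<not> nz (Polynomial.coeff p j)"
      using algebraic_relation[OF False] by blast
    have \<Phi>P: "\<Phi> \<in> polyc i" by (rule zs_polyc[OF \<Phi>(1)])
    define c where "c = Polynomial.coeff \<Phi>"
    have rel: "\<forall>y\<in>Y. (\<Sum>j\<le>e. c j y * y i ^ j) = 0"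
    proof
      fix y assume "y \<in> Y"
      then have "ev \<Phi> y (y i) = 0" using \<Phi>(1) by (simp add: zs_def)
      moreover have "ev \<Phi> y (y i) = (\<Sum>j\<le>e. c j y * y i ^ j)"
        unfolding c_def by (rule ev_sum) (simp add: \<Phi>(3))
      ultimately show "(\<Sum>j\<le>e. c j y * y i ^ j) = 0" by simp
    qed
    have cP: "c j \<in> polys i" for j unfolding c_def by (rule polyc_coeff[OF \<Phi>P])
    have "\<forall>j. \<exists>\<delta>. c j \<in> polyfun i \<delta>" using cP by (simp add: polys_def)
    from choice[OF this] obtain \<delta>0 where "\<forall>j. c j \<in> polyfun i (\<delta>0 j)" ..
    then have \<delta>0: "\<And>j. c j \<in> polyfun i (\<delta>0 j)" by simp
    define \<delta> where "\<delta> = Max (\<delta>0 ` {..Suc e})"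
    have c\<delta>: "c j \<in> polyfun i \<delta>" for j
    proof (cases "j \<le> e")
      case True
      then have "\<delta>0 j \<le> \<delta>" unfolding \<delta>_def by (intro Max_ge) auto
      then show ?thesis using \<delta>0 polyfun_mono by blast
    next
      case False
      then have "c j = (\<lambda>x. 0)" by (auto simp: c_def \<Phi>(3) fun_eq_iff)
      then show ?thesis by (simp add: polyfun_const)
    qed
    show ?thesis
    proof (intro exI[of _ "e * (C * (1 + \<delta>) ^ tdim i)"] allI)
      fix D
      \<comment> \<open>The \<open>D + 1\<close> reduction steps raise the degree of the
        coefficients by \<open>\<delta>\<close> each; since
        \<open>D' + 1 = (1 + \<delta>) (D + 1)\<close>, this costs only a constant factor.\<close>
      define D' where "D' = D + (D + 1) * \<delta>"
      obtain a B where aB: "a \<in> polys i" "nz a" "finite B" "card B \<le> C * (D' + 1) ^ tdim i"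
        "\<And>f. f \<in> polyfun i D' \<Longrightarrow> \<exists>g\<in>cfun.span B. \<forall>y\<in>Y. a y * f y = g y" using C[of D'] by blast
      define B' where "B' = (\<lambda>(b, j) x. b x * x i ^ j) ` (B \<times> {..<e})"
      have "card B' \<le> card B * e"
        unfolding B'_def using card_image_le[of "B \<times> {..<e}" "\<lambda>(b, j) x. b x * x i ^ j"] aB(3)
        by (simp add: card_cartesian_product)
      also have "\<dots> \<le> C * (D' + 1) ^ tdim i * e" using aB(4) by (rule mult_right_mono) simp
      also have "D' + 1 = (1 + \<delta>) * (D + 1)" by (simp add: D'_def algebra_simps)
      also have "C * ((1 + \<delta>) * (D + 1)) ^ tdim i * e = e * (C * (1 + \<delta>) ^ tdim i) * (D + 1) ^ tdim i"
        unfolding power_mult_distrib by (simp only: ac_simps)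
      finally have "card B' \<le> e * (C * (1 + \<delta>) ^ tdim i) * (D + 1) ^ tdim (Suc i)"
        using False by (simp only: tdim_Suc if_False)
      moreover have "\<exists>g\<in>cfun.span B'. \<forall>y\<in>Y. (a y * c e y ^ (D + 1)) * f y = g y" if f: "f \<in> polyfun (Suc i) D" for f
      proof -
        obtain h where h: "\<And>j. h j \<in> polyfun i D" "f = (\<lambda>x. \<Sum>j\<le>D. h j x * x i ^ j)"
          using f by (rule polyfun_SucE) blast
        define h' where "h' j = (\<lambda>x. if j \<le> D then h j x else 0)" for j
        have h': "h' j \<in> polyfun i D" for j
          unfolding h'_def using h(1)[of j] polyfun_const[of 0] by (cases "j \<le> D") auto
        from reduce_power[OF rel c\<delta>, of h' D "D + 1", OF h'] obtain f' where
          f': "\<And>j. f' j \<in> polyfun i D'"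
            "\<And>y. y \<in> Y \<Longrightarrow> c e y ^ (D + 1) * (\<Sum>j<e + (D + 1). h' j y * y i ^ j) = (\<Sum>j<e. f' j y * y i ^ j)"
          unfolding D'_def by blast
        have fh: "f y = (\<Sum>j<e + (D + 1). h' j y * y i ^ j)" for y
          unfolding h(2) by (intro sum.mono_neutral_cong_left) (auto simp: h'_def)
        obtain g where g: "\<And>j. g j \<in> cfun.span B" "\<And>j y. y \<in> Y \<Longrightarrow> a y * f' j y = g j y"
        proof -
          have "\<forall>j. \<exists>g. g \<in> cfun.span B \<and> (\<forall>y\<in>Y. a y * f' j y = g y)" using aB(5)[OF f'(1)] by blast
          from choice[OF this] show ?thesis using that by blast
        qed
        have "(\<lambda>x. \<Sum>j<e. g j x * x i ^ j) \<in> cfun.span B'"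
          by (intro span_lsum span_times[OF g(1)] cfun.span_base) (auto simp: B'_def)
        moreover have "(a y * c e y ^ (D + 1)) * f y = (\<Sum>j<e. g j y * y i ^ j)" if "y \<in> Y" for y
        proof -
          have "(a y * c e y ^ (D + 1)) * f y = a y * (\<Sum>j<e. f' j y * y i ^ j)"
            unfolding f'(2)[OF that, symmetric] fh[of y] by (simp only: mult.assoc)
          also have "\<dots> = (\<Sum>j<e. g j y * y i ^ j)"
            unfolding sum_distrib_left by (intro sum.cong) (auto simp: g(2)[OF that, symmetric])
          finally show ?thesis .
        qed
        ultimately show ?thesis by (intro bexI[of _ "\<lambda>x. \<Sum>j<e. g j x * x i ^ j"]) auto
      qed
      moreover have "(\<lambda>y. a y * c e y ^ (D + 1)) \<in> polys (Suc i)"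
        by (intro polys_lift[of i "Suc i"] polys_mult polys_power cP aB(1)) auto
      moreover have "nz (\<lambda>y. a y * c e y ^ (D + 1))"
        using Suc.prems \<Phi>(2) by (intro nz_mult[of _ i] aB polys_power cP nz_power[of _ i]) (auto simp: c_def)
      ultimately show "\<exists>a B. a \<in> polys (Suc i) \<and> nz a \<and> finite B \<and> card B \<le> e * (C * (1 + \<delta>) ^ tdim i) * (D + 1) ^ tdim (Suc i) \<and>
        (\<forall>f\<in>polyfun (Suc i) D. \<exists>g\<in>cfun.span B. \<forall>y\<in>Y. a y * f y = g y)"
        using aB(3) by (intro exI[of _ "\<lambda>y. a y * c e y ^ (D + 1)"] exI[of _ B']) (auto simp: B'_def)
    qed
  qed
qed

text \<open>The family \<open>M D\<close> stands for the monomials with exponents up to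
  \<open>D\<close> in \<open>r\<close> algebraically independent functions: there are
  \<open>(D + 1) ^ r\<close> of them, of degree linear in \<open>D\<close>, more than the upper
  bound allows for \<open>r > tdim N\<close>.\<close>

lemma dim_le_tdim:
  fixes M :: "nat \<Rightarrow> nat list \<Rightarrow> pt \<Rightarrow> complex"
  assumes M: "\<And>D l. l \<in> exps r D \<Longrightarrow> M D l \<in> polyfun N (E * D)"
    and indep: "\<And>D c. (\<forall>y\<in>Y. (\<Sum>l\<in>exps r D. c l * M D l y) = 0) \<Longrightarrow> \<forall>l\<in>exps r D. c l = 0"
  shows "r \<le> tdim N"
proof (rule ccontr)
  assume "\<not> r \<le> tdim N"
  then have r: "r \<ge> Suc (tdim N)" by simp
  obtain C where C: "\<And>D. \<exists>a B. a \<in> polys N \<and> nz a \<and> finite B \<and> card B \<le> C * (D + 1) ^ tdim N \<and>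
    (\<forall>f\<in>polyfun N D. \<exists>g\<in>cfun.span B. \<forall>y\<in>Y. a y * f y = g y)"
    using growth_upper[of N] by auto
  \<comment> \<open>With this \<open>D\<close> the upper bound for degree \<open>E * D\<close> is at
    most \<open>D * (D + 1) ^ tdim N\<close>, hence less than \<open>(D + 1) ^ r\<close>.\<close>
  define D where "D = C * (E + 1) ^ tdim N"
  obtain a B where aB: "a \<in> polys N" "nz a" "finite B" "card B \<le> C * (E * D + 1) ^ tdim N"
    "\<And>f. f \<in> polyfun N (E * D) \<Longrightarrow> \<exists>g\<in>cfun.span B. \<forall>y\<in>Y. a y * f y = g y" using C[of "E * D"] by blast
  have fin: "finite (exps r D)" unfolding exps_def by (rule finite_lists_length_eq) simp
  have "\<forall>l\<in>exps r D. \<exists>g\<in>cfun.span B. \<forall>y\<in>Y. a y * M D l y = g y" using aB(5) M by blast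
  then obtain g where g: "\<And>l. l \<in> exps r D \<Longrightarrow> g l \<in> cfun.span B"
    "\<And>l y. l \<in> exps r D \<Longrightarrow> y \<in> Y \<Longrightarrow> a y * M D l y = g l y" by metis
  have "cfun.dim (cfun.span B) \<le> card B" using cfun.dim_le_card'[OF aB(3)] by simp
  also have "\<dots> \<le> C * (E * D + 1) ^ tdim N" by (rule aB(4))
  also have "\<dots> \<le> C * ((E + 1) * (D + 1)) ^ tdim N"
    by (intro mult_left_mono power_mono) (auto simp: algebra_simps)
  also have "\<dots> = (C * (E + 1) ^ tdim N) * (D + 1) ^ tdim N" by (simp only: power_mult_distrib mult.assoc)
  also have "\<dots> = D * (D + 1) ^ tdim N" by (simp only: D_def[symmetric])
  also have "\<dots> < (D + 1) ^ Suc (tdim N)" by simp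
  also have "\<dots> \<le> (D + 1) ^ r" using r by (intro power_increasing) auto
  also have "\<dots> = card (exps r D)" unfolding exps_def by (subst card_lists_length_eq) auto
  finally obtain \<gamma> where \<gamma>: "\<exists>l\<in>exps r D. \<gamma> l \<noteq> 0" "(\<Sum>l\<in>exps r D. (\<lambda>x. \<gamma> l * g l x)) = 0"
    using cfun.dependent_family[OF aB(3) fin, of g] g(1) by blast
  have "a y * (\<Sum>l\<in>exps r D. \<gamma> l * M D l y) = 0" if "y \<in> Y" for y
  proof -
    have "a y * (\<Sum>l\<in>exps r D. \<gamma> l * M D l y) = (\<Sum>l\<in>exps r D. \<gamma> l * (a y * M D l y))"
      by (simp add: sum_distrib_left ac_simps)
    also have "\<dots> = (\<Sum>l\<in>exps r D. (\<lambda>x. \<gamma> l * g l x)) y"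
      unfolding sum_apply using g(2) that by (intro sum.cong) auto
    finally show ?thesis using \<gamma>(2) by simp
  qed
  moreover have "(\<lambda>y. \<Sum>l\<in>exps r D. \<gamma> l * M D l y) \<in> polys N"
    using M by (intro polys_sum polys_cmult polysI) auto
  ultimately have "\<forall>y\<in>Y. (\<Sum>l\<in>exps r D. \<gamma> l * M D l y) = 0"
    using prime[OF aB(1)] aB(2) unfolding nz_def by blast
  then show False using indep \<gamma>(1) by blast
qed

text \<open>A transcendental step after the first \<open>k\<close> coordinates would put a cofinite subset of a line
  into some fibre.\<close>

lemma finite_fibres_algebraic:
  assumes "k \<le> i" "i < N" "v \<in> polys N" "nz v"
    and fin: "\<And>\<alpha>. finite {x \<in> closed_to N Y. v x \<noteq> 0 \<and> (\<forall>j<k. x j = \<alpha> j) \<and> (\<forall>j\<ge>N. x j = 0)}"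
    and supp: "\<And>y j. y \<in> Y \<Longrightarrow> j \<ge> N \<Longrightarrow> y j = 0"
  shows "\<not> transc i Y"
proof
  assume tr: "transc i Y"
  obtain v' where v': "v' \<in> polys (Suc i)" "nz v'" "\<And>x. x \<in> closed_to (Suc i) Y \<Longrightarrow> v' x \<noteq> 0 \<Longrightarrow>
      \<exists>x'. x' \<in> closed_to N Y \<and> v x' \<noteq> 0 \<and> (\<forall>j. j < Suc i \<or> j \<ge> N \<longrightarrow> x' j = x j)"
    using chevalley[of "Suc i" N v] assms(2-4) by auto
  obtain y where y: "y \<in> Y" "v' y \<noteq> 0" using v'(2) by (auto simp: nz_def)
  have yc: "y \<in> closed_to i Y" using y(1) by (auto simp: closed_to_def)
  obtain p where p: "\<And>s. v' (\<lambda>j. (y(i := 0)) j + s * (if j = i then 1 else 0)) = poly p s"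
    using polys_line[OF v'(1), of "y(i := 0)" "\<lambda>j. if j = i then 1 else 0"] by blast
  have eq: "(\<lambda>j. (y(i := 0)) j + s * (if j = i then 1 else 0)) = y(i := s)" for s by auto
  have p': "v' (y(i := s)) = poly p s" for s using p[of s] unfolding eq .
  have "p \<noteq> 0" using p'[of "y i"] y(2) by auto
  then have "finite {s. poly p s = 0}" by (rule poly_roots_finite)
  then have inf: "infinite {s. poly p s \<noteq> 0}"
    using infinite_UNIV_char_0[where 'a = complex] finite_Collect_not[of "\<lambda>s. poly p s = 0"] by simp
  have "\<exists>x'. x' \<in> closed_to N Y \<and> v x' \<noteq> 0 \<and> (\<forall>j. j < Suc i \<or> j \<ge> N \<longrightarrow> x' j = (y(i := s)) j)"
    if "poly p s \<noteq> 0" for s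
    using v'(3)[OF transc_closed_to[OF tr yc, of s]] that p' by simp
  then obtain T where T: "\<And>s. poly p s \<noteq> 0 \<Longrightarrow> T s \<in> closed_to N Y \<and> v (T s) \<noteq> 0 \<and>
      (\<forall>j. j < Suc i \<or> j \<ge> N \<longrightarrow> T s j = (y(i := s)) j)" by metis
  have "T ` {s. poly p s \<noteq> 0} \<subseteq> {x \<in> closed_to N Y. v x \<noteq> 0 \<and> (\<forall>j<k. x j = y j) \<and> (\<forall>j\<ge>N. x j = 0)}"
    using T supp[OF y(1)] assms(1,2) by auto
  moreover have "inj_on T {s. poly p s \<noteq> 0}"
  proof (rule inj_onI)
    fix s s' assume "s \<in> {s. poly p s \<noteq> 0}" "s' \<in> {s. poly p s \<noteq> 0}" "T s = T s'"
    then show "s = s'" using T[of s] T[of s'] by auto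
  qed
  moreover have "finite {x \<in> closed_to N Y. v x \<noteq> 0 \<and> (\<forall>j<k. x j = y j) \<and> (\<forall>j\<ge>N. x j = 0)}" by (rule fin)
  ultimately have "finite {s. poly p s \<noteq> 0}" using finite_subset finite_imageD by blast
  then show False using inf by blast
qed

lemma tdim_eq: "k \<le> n \<Longrightarrow> (\<And>i. k \<le> i \<Longrightarrow> i < n \<Longrightarrow> \<not> transc i Y) \<Longrightarrow> tdim n = tdim k"
  by (induction n rule: dec_induct) (auto simp: tdim_Suc)

lemma tdim_full: "tdim k = k \<Longrightarrow> closed_to k Y = UNIV"
proof (induction k)
  case 0
  then show ?case using nonempty by (auto simp: closed_to_def polys_def)
next
  case (Suc k)
  have t: "transc k Y" "tdim k = k" using Suc.prems tdim_le[of k] by (auto simp: tdim_Suc split: if_splits)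
  have "x \<in> closed_to (Suc k) Y" for x
    using transc_closed_to[OF t(1), of x "x k"] Suc.IH[OF t(2)] by simp
  then show ?case by blast
qed

text \<open>Finite fibres over the first \<open>k\<close> coordinates make the later ones algebraic,
  so \<open>r \<le> tdim N = tdim k \<le> k\<close>. In case of equality the first \<open>k\<close>
  coordinates are independent, the projection is dominant, and its image fills a nonempty open
  set.\<close>

lemma finite_fibres_dim:
  fixes M :: "nat \<Rightarrow> nat list \<Rightarrow> pt \<Rightarrow> complex"
  assumes "k \<le> N" "v \<in> polys N" "nz v"
    and fin: "\<And>\<alpha>. finite {x \<in> closed_to N Y. v x \<noteq> 0 \<and> (\<forall>j<k. x j = \<alpha> j) \<and> (\<forall>j\<ge>N. x j = 0)}"
    and supp: "\<And>y j. y \<in> Y \<Longrightarrow> j \<ge> N \<Longrightarrow> y j = 0"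
    and M: "\<And>D l. l \<in> exps r D \<Longrightarrow> M D l \<in> polyfun N (E * D)"
    and indep: "\<And>D c. (\<forall>y\<in>Y. (\<Sum>l\<in>exps r D. c l * M D l y) = 0) \<Longrightarrow> \<forall>l\<in>exps r D. c l = 0"
  shows "r \<le> k"
    and "r = k \<Longrightarrow> \<exists>Q\<in>polys k. (\<exists>x. Q x \<noteq> 0) \<and>
      (\<forall>\<alpha>. Q \<alpha> \<noteq> 0 \<longrightarrow> (\<exists>x\<in>closed_to N Y. v x \<noteq> 0 \<and> (\<forall>j<k. x j = \<alpha> j) \<and> (\<forall>j\<ge>N. x j = 0)))"
proof -
  have eq: "tdim N = tdim k"
  proof (rule tdim_eq[OF assms(1)])
    fix i assume "k \<le> i" "i < N"
    then show "\<not> transc i Y"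
      by (rule finite_fibres_algebraic[of k i v, OF _ _ assms(2,3)]) (rule fin, rule supp)
  qed
  have "r \<le> tdim N" by (rule dim_le_tdim[OF M indep])
  then show "r \<le> k" using eq tdim_le[of k] by simp
  show "\<exists>Q\<in>polys k. (\<exists>x. Q x \<noteq> 0) \<and>
      (\<forall>\<alpha>. Q \<alpha> \<noteq> 0 \<longrightarrow> (\<exists>x\<in>closed_to N Y. v x \<noteq> 0 \<and> (\<forall>j<k. x j = \<alpha> j) \<and> (\<forall>j\<ge>N. x j = 0)))" if "r = k"
  proof -
    have "tdim k = k" using \<open>r \<le> tdim N\<close> eq tdim_le[of k] that by simp
    then have full: "closed_to k Y = UNIV" by (rule tdim_full)
    obtain v' where v': "v' \<in> polys k" "nz v'" "\<And>x. x \<in> closed_to k Y \<Longrightarrow> v' x \<noteq> 0 \<Longrightarrow>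
        \<exists>x'. x' \<in> closed_to N Y \<and> v x' \<noteq> 0 \<and> (\<forall>j. j < k \<or> j \<ge> N \<longrightarrow> x' j = x j)"
      using chevalley[of k N v] assms(1-3) by auto
    have "\<exists>x\<in>closed_to N Y. v x \<noteq> 0 \<and> (\<forall>j<k. x j = \<alpha> j) \<and> (\<forall>j\<ge>N. x j = 0)" if "v' \<alpha> \<noteq> 0" for \<alpha>
    proof -
      define \<alpha>' where "\<alpha>' j = (if j < k then \<alpha> j else 0)" for j
      have "v' \<alpha>' = v' \<alpha>" by (rule polys_cong[OF v'(1)]) (simp add: \<alpha>'_def)
      then have "v' \<alpha>' \<noteq> 0" using \<open>v' \<alpha> \<noteq> 0\<close> by simp
      then obtain x' where "x' \<in> closed_to N Y" "v x' \<noteq> 0" "\<forall>j. j < k \<or> j \<ge> N \<longrightarrow> x' j = \<alpha>' j"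
        using v'(3)[of \<alpha>'] full by blast
      then show ?thesis using assms(1) by (intro bexI[of _ x']) (auto simp: \<alpha>'_def)
    qed
    then show ?thesis using v'(1,2) unfolding nz_def by blast
  qed
qed

end

section \<open>Forms and the Zariski topology\<close>

definition mon :: "('i \<Rightarrow>\<^sub>0 nat) \<Rightarrow> ('i \<Rightarrow> 'b::comm_semiring_1) \<Rightarrow> 'b" where
  "mon e v = (\<Prod>i\<in>Poly_Mapping.keys e. v i ^ Poly_Mapping.lookup e i)"

definition mdeg :: "('i \<Rightarrow>\<^sub>0 nat) \<Rightarrow> nat" where
  "mdeg e = (\<Sum>i\<in>Poly_Mapping.keys e. Poly_Mapping.lookup e i)"

lemma mon_superset: "finite S \<Longrightarrow> Poly_Mapping.keys e \<subseteq> S \<Longrightarrow> mon e v = (\<Prod>i\<in>S. v i ^ Poly_Mapping.lookup e i)"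
  unfolding mon_def by (rule prod.mono_neutral_left) (auto simp: not_in_keys_iff_lookup_eq_zero)

lemma mdeg_superset: "finite S \<Longrightarrow> Poly_Mapping.keys e \<subseteq> S \<Longrightarrow> mdeg e = (\<Sum>i\<in>S. Poly_Mapping.lookup e i)"
  unfolding mdeg_def by (rule sum.mono_neutral_left) (auto simp: not_in_keys_iff_lookup_eq_zero)

lemma mon_add: "mon (e + e') v = mon e v * mon e' v"
proof -
  let ?S = "Poly_Mapping.keys e \<union> Poly_Mapping.keys e'"
  have "mon (e + e') v = (\<Prod>i\<in>?S. v i ^ Poly_Mapping.lookup (e + e') i)"
    using keys_add[of e e'] by (intro mon_superset) auto
  also have "\<dots> = (\<Prod>i\<in>?S. v i ^ Poly_Mapping.lookup e i) * (\<Prod>i\<in>?S. v i ^ Poly_Mapping.lookup e' i)"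
    by (simp add: lookup_add power_add prod.distrib)
  also have "\<dots> = mon e v * mon e' v"
    using mon_superset[of ?S e v] mon_superset[of ?S e' v] by simp
  finally show ?thesis .
qed

lemma mdeg_add: "mdeg (e + e') = mdeg e + mdeg e'"
proof -
  let ?S = "Poly_Mapping.keys e \<union> Poly_Mapping.keys e'"
  have "mdeg (e + e') = (\<Sum>i\<in>?S. Poly_Mapping.lookup (e + e') i)"
    using keys_add[of e e'] by (intro mdeg_superset) auto
  also have "\<dots> = mdeg e + mdeg e'"
    using mdeg_superset[of ?S e] mdeg_superset[of ?S e'] by (simp add: lookup_add sum.distrib)
  finally show ?thesis .
qed

lemma mon_0 [simp]: "mon 0 v = 1" and mdeg_0 [simp]: "mdeg 0 = 0"
  by (simp_all add: mon_def mdeg_def)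

lemma mon_single [simp]: "mon (Poly_Mapping.single i k) v = v i ^ k"
  using mon_superset[of "{i}" "Poly_Mapping.single i k" v] by simp

lemma mdeg_single [simp]: "mdeg (Poly_Mapping.single i k) = k"
  using mdeg_superset[of "{i}" "Poly_Mapping.single i k"] by simp

lemma mon_scale: "mon e (\<lambda>i. c * v i) = c ^ mdeg e * mon e v"
  by (simp add: mon_def mdeg_def power_mult_distrib prod.distrib power_sum)

lemma mpoly_eval_eq: "mpoly_eval \<phi> f v = (\<Sum>e\<in>Poly_Mapping.keys f. \<phi> (Poly_Mapping.lookup f e) * mon e v)"
  by (simp add: mpoly_eval_def mon_def)

lemma forms_iff: "f \<in> forms I m \<longleftrightarrow> (\<forall>e\<in>Poly_Mapping.keys f. Poly_Mapping.keys e \<subseteq> I \<and> mdeg e = m)"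
  by (simp add: forms_def mdeg_def)

text \<open>Instantiated by the embedding into the algebraic closure, for the curve, and by the
  identity of the complex numbers, for the space of tuples.\<close>

locale coeff_hom =
  fixes \<phi> :: "'a::field \<Rightarrow> 'b::field"
  assumes hom_0: "\<phi> 0 = 0" and hom_1: "\<phi> 1 = 1" and hom_add: "\<phi> (a + b) = \<phi> a + \<phi> b"
    and hom_mult: "\<phi> (a * b) = \<phi> a * \<phi> b"
begin

lemma eval_superset:
  "finite S \<Longrightarrow> Poly_Mapping.keys f \<subseteq> S \<Longrightarrow> mpoly_eval \<phi> f v = (\<Sum>e\<in>S. \<phi> (Poly_Mapping.lookup f e) * mon e v)"
  unfolding mpoly_eval_eq by (rule sum.mono_neutral_left) (auto simp: not_in_keys_iff_lookup_eq_zero hom_0)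

lemma eval_0 [simp]: "mpoly_eval \<phi> 0 v = 0"
  by (simp add: mpoly_eval_eq)

lemma eval_add: "mpoly_eval \<phi> (f + g) v = mpoly_eval \<phi> f v + mpoly_eval \<phi> g v"
proof -
  let ?S = "Poly_Mapping.keys f \<union> Poly_Mapping.keys g"
  have "mpoly_eval \<phi> (f + g) v = (\<Sum>e\<in>?S. \<phi> (Poly_Mapping.lookup (f + g) e) * mon e v)"
    using keys_add[of f g] by (intro eval_superset) auto
  also have "\<dots> = mpoly_eval \<phi> f v + mpoly_eval \<phi> g v"
    using eval_superset[of ?S f v] eval_superset[of ?S g v]
    by (simp add: lookup_add hom_add distrib_right sum.distrib)
  finally show ?thesis .
qed

lemma eval_sum: "mpoly_eval \<phi> (\<Sum>s\<in>S. f s) v = (\<Sum>s\<in>S. mpoly_eval \<phi> (f s) v)"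
  by (induction S rule: infinite_finite_induct) (simp_all add: eval_add)

lemma eval_single [simp]: "mpoly_eval \<phi> (Poly_Mapping.single e c) v = \<phi> c * mon e v"
  using eval_superset[of "{e}" "Poly_Mapping.single e c" v] by simp

lemma mpoly_sum_singles: "f = (\<Sum>e\<in>Poly_Mapping.keys f. Poly_Mapping.single e (Poly_Mapping.lookup f e))"
proof (rule poly_mapping_eqI)
  fix e
  have "Poly_Mapping.lookup (\<Sum>e\<in>Poly_Mapping.keys f. Poly_Mapping.single e (Poly_Mapping.lookup f e)) e
      = (\<Sum>e'\<in>Poly_Mapping.keys f. if e' = e then Poly_Mapping.lookup f e else 0)"
    unfolding lookup_sum by (intro sum.cong) (auto simp: lookup_single when_def)
  then show "Poly_Mapping.lookup f e = Poly_Mapping.lookup (\<Sum>e\<in>Poly_Mapping.keys f. Poly_Mapping.single e (Poly_Mapping.lookup f e)) e"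
    by (simp add: not_in_keys_iff_lookup_eq_zero)
qed

lemma eval_mult: "mpoly_eval \<phi> (f * g) v = mpoly_eval \<phi> f v * mpoly_eval \<phi> g v"
proof -
  let ?F = "Poly_Mapping.keys f" and ?G = "Poly_Mapping.keys g"
  have "f * g = (\<Sum>e\<in>?F. Poly_Mapping.single e (Poly_Mapping.lookup f e)) * (\<Sum>e\<in>?G. Poly_Mapping.single e (Poly_Mapping.lookup g e))"
    using mpoly_sum_singles[of f] mpoly_sum_singles[of g] by simp
  also have "\<dots> = (\<Sum>e\<in>?F. \<Sum>e'\<in>?G. Poly_Mapping.single (e + e') (Poly_Mapping.lookup f e * Poly_Mapping.lookup g e'))"
    by (simp add: sum_product mult_single)
  finally have "mpoly_eval \<phi> (f * g) v = (\<Sum>e\<in>?F. \<Sum>e'\<in>?G. (\<phi> (Poly_Mapping.lookup f e) * mon e v) * (\<phi> (Poly_Mapping.lookup g e') * mon e' v))"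
    by (simp add: eval_sum hom_mult mon_add ac_simps)
  also have "\<dots> = mpoly_eval \<phi> f v * mpoly_eval \<phi> g v"
    by (simp add: mpoly_eval_eq sum_product)
  finally show ?thesis .
qed

lemma eval_scale: "mpoly_eval \<phi> (mpoly_scale c f) v = \<phi> c * mpoly_eval \<phi> f v"
  by (simp add: mpoly_scale_def eval_mult)

lemma eval_homogeneous: "f \<in> forms I m \<Longrightarrow> mpoly_eval \<phi> f (\<lambda>i. c * v i) = c ^ m * mpoly_eval \<phi> f v"
  unfolding mpoly_eval_eq sum_distrib_left
  by (intro sum.cong) (auto simp: forms_iff mon_scale)

lemma vanishes_at_class:
  assumes "f \<in> forms I m"
  shows "vanishes_at \<phi> f (proj_class v) \<longleftrightarrow> mpoly_eval \<phi> f v = 0"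
proof
  assume "vanishes_at \<phi> f (proj_class v)"
  moreover have "v \<in> proj_class v" unfolding proj_class_def by (auto intro!: exI[of _ 1])
  ultimately show "mpoly_eval \<phi> f v = 0" by (simp add: vanishes_at_def)
next
  assume "mpoly_eval \<phi> f v = 0"
  then show "vanishes_at \<phi> f (proj_class v)"
    using eval_homogeneous[OF assms] by (auto simp: vanishes_at_def proj_class_def)
qed

end

lemma forms_0: "0 \<in> forms I m"
  by (simp add: forms_iff)

lemma forms_add: "f \<in> forms I m \<Longrightarrow> g \<in> forms I m \<Longrightarrow> f + g \<in> forms I m"
  using keys_add[of f g] by (force simp: forms_iff)

lemma forms_mult: "f \<in> forms I m \<Longrightarrow> g \<in> forms I l \<Longrightarrow> f * g \<in> forms I (m + l)"
  unfolding forms_iff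
proof
  fix e assume fg: "\<forall>e\<in>Poly_Mapping.keys f. Poly_Mapping.keys e \<subseteq> I \<and> mdeg e = m"
    "\<forall>e\<in>Poly_Mapping.keys g. Poly_Mapping.keys e \<subseteq> I \<and> mdeg e = l" and "e \<in> Poly_Mapping.keys (f * g)"
  then obtain a b where "e = a + b" "a \<in> Poly_Mapping.keys f" "b \<in> Poly_Mapping.keys g"
    using keys_mult[of f g] by blast
  then show "Poly_Mapping.keys e \<subseteq> I \<and> mdeg e = m + l"
    using fg keys_add[of a b] by (auto simp: mdeg_add dest!: subsetD)
qed

lemma forms_single: "Poly_Mapping.keys e \<subseteq> I \<Longrightarrow> mdeg e = m \<Longrightarrow> Poly_Mapping.single e c \<in> forms I m"
  by (simp add: forms_iff)

lemma forms_scale: "f \<in> forms I m \<Longrightarrow> mpoly_scale c f \<in> forms I m"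
  using forms_mult[OF forms_single[of 0 I 0 c]] by (simp add: mpoly_scale_def)

lemma forms_sum: "(\<And>s. s \<in> S \<Longrightarrow> f s \<in> forms I m) \<Longrightarrow> (\<Sum>s\<in>S. f s) \<in> forms I m"
  by (induction S rule: infinite_finite_induct) (auto intro: forms_0 forms_add)

lemma subspace_forms: "mpoly.subspace (forms I m)"
  by (auto simp: mpoly.subspace_def forms_0 forms_add forms_scale)

lemma forms_power:
  fixes f :: "('i, 'a::comm_ring_1) mpoly"
  assumes "f \<in> forms I m"
  shows "f ^ k \<in> forms I (m * k)"
proof (induction k)
  case 0
  have "(Poly_Mapping.single 0 1 :: ('i, 'a) mpoly) \<in> forms I 0" by (rule forms_single) auto
  then show ?case by simp
next
  case (Suc k)
  then show ?case using forms_mult[OF assms, of "f ^ k" "m * k"] by simp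
qed

definition mvar :: "'i \<Rightarrow> ('i, 'a::comm_ring_1) mpoly" where
  "mvar i = Poly_Mapping.single (Poly_Mapping.single i 1) 1"

lemma mvar_forms: "i \<in> I \<Longrightarrow> mvar i \<in> forms I 1"
  unfolding mvar_def by (rule forms_single) auto

lemma (in coeff_hom) eval_var [simp]: "mpoly_eval \<phi> (mvar i) v = v i"
  by (simp add: mvar_def hom_1)

lemma proj_class_self: "v \<in> proj_class v"
  unfolding proj_class_def by (auto intro!: exI[of _ 1])

lemma proj_class_eq: "w \<in> proj_class v \<Longrightarrow> proj_class w = proj_class v"
proof -
  assume "w \<in> proj_class v"
  then obtain c where c: "c \<noteq> 0" "w = (\<lambda>i. c * v i)" by (auto simp: proj_class_def)
  show ?thesis
  proof (intro subset_antisym subsetI)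
    fix x assume "x \<in> proj_class w"
    then obtain d where d: "d \<noteq> 0" "x = (\<lambda>i. d * w i)" by (auto simp: proj_class_def)
    then have "x = (\<lambda>i. (d * c) * v i)" by (simp add: c(2) mult.assoc)
    then show "x \<in> proj_class v" using c(1) d(1) unfolding proj_class_def by (intro CollectI exI[of _ "d * c"]) simp
  next
    fix x assume "x \<in> proj_class v"
    then obtain d where d: "d \<noteq> 0" "x = (\<lambda>i. d * v i)" by (auto simp: proj_class_def)
    then have "x = (\<lambda>i. (d / c) * w i)" using c by simp
    then show "x \<in> proj_class w" using c(1) d(1) unfolding proj_class_def by (intro CollectI exI[of _ "d / c"]) simp
  qed
qed

context coeff_hom
begin

section \<open>Closed and irreducible sets in the Zariski topology\<close>

lemma topspace_zariski: "topspace (zariski \<phi> I) = proj_space I"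
proof -
  have "p \<in> \<Union>{{p \<in> proj_space I. \<not> vanishes_at \<phi> f p} | f. \<exists>m. f \<in> forms I m}" if p: "p \<in> proj_space I" for p
  proof -
    obtain v i where v: "p = proj_class v" "i \<in> I" "v i \<noteq> 0" using p by (auto simp: proj_space_def)
    have "\<not> vanishes_at \<phi> (mvar i) p"
      unfolding v(1) using v(3) vanishes_at_class[OF mvar_forms[OF v(2)]] by simp
    then show ?thesis using p mvar_forms[OF v(2)] by blast
  qed
  then show ?thesis unfolding zariski_def topology_generated_by_topspace by auto
qed

lemma openin_basic: "f \<in> forms I m \<Longrightarrow> openin (zariski \<phi> I) {p \<in> proj_space I. \<not> vanishes_at \<phi> f p}"
  unfolding zariski_def by (rule topology_generated_by_Basis) blast

lemma closedin_basic:
  assumes "f \<in> forms I m"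
  shows "closedin (zariski \<phi> I) {p \<in> proj_space I. vanishes_at \<phi> f p}"
proof -
  have "topspace (zariski \<phi> I) - {p \<in> proj_space I. vanishes_at \<phi> f p} = {p \<in> proj_space I. \<not> vanishes_at \<phi> f p}"
    by (auto simp: topspace_zariski)
  then show ?thesis using openin_basic[OF assms] by (auto simp: closedin_def topspace_zariski)
qed

lemma vanishes_at_mult:
  assumes "f \<in> forms I m" "g \<in> forms I l" "p \<in> proj_space I"
  shows "vanishes_at \<phi> (f * g) p \<longleftrightarrow> vanishes_at \<phi> f p \<or> vanishes_at \<phi> g p"
proof -
  obtain v where v: "p = proj_class v" using assms(3) by (auto simp: proj_space_def)
  show ?thesis unfolding v vanishes_at_class[OF forms_mult[OF assms(1,2)]]
    vanishes_at_class[OF assms(1)] vanishes_at_class[OF assms(2)] by (simp add: eval_mult)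
qed

text \<open>The generating open sets are stable under intersection, because the forms can be
  multiplied; so they are a base and not merely a subbase.\<close>

lemma basic_open_base:
  assumes "openin (zariski \<phi> I) W" "p \<in> W"
  shows "\<exists>f m. f \<in> forms I m \<and> \<not> vanishes_at \<phi> f p \<and> {q \<in> proj_space I. \<not> vanishes_at \<phi> f q} \<subseteq> W"
proof -
  have "generate_topology_on {{p \<in> proj_space I. \<not> vanishes_at \<phi> f p} | f. \<exists>m. f \<in> forms I m} W"
    using assms(1) unfolding zariski_def by (rule openin_topology_generated_by)
  then show ?thesis using assms(2)
  proof (induction arbitrary: p)
    case (Int a b)
    from Int.IH(1)[of p] Int.prems obtain f m where f: "f \<in> forms I m" "\<not> vanishes_at \<phi> f p"
      "{q \<in> proj_space I. \<not> vanishes_at \<phi> f q} \<subseteq> a" by blast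
    from Int.IH(2)[of p] Int.prems obtain g l where g: "g \<in> forms I l" "\<not> vanishes_at \<phi> g p"
      "{q \<in> proj_space I. \<not> vanishes_at \<phi> g q} \<subseteq> b" by blast
    have "openin (zariski \<phi> I) a" using Int.hyps(1) unfolding zariski_def openin_topology_generated_by_iff .
    then have p: "p \<in> proj_space I" using Int.prems openin_subset topspace_zariski by blast
    show ?case
      using vanishes_at_mult[OF f(1) g(1)] f g p forms_mult[OF f(1) g(1)]
      by (intro exI[of _ "f * g"] exI[of _ "m + l"]) auto
  next
    case (UN K)
    then obtain k where "k \<in> K" "p \<in> k" by blast
    then show ?case using UN.IH[of k p] by blast
  next
    case (Basis s)
    then show ?case by blast
  qed simp
qed

lemma closed_separate:
  assumes "closedin (subtopology (zariski \<phi> I) S) Y" "p \<in> S" "p \<in> proj_space I" "p \<notin> Y"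
  obtains f m where "f \<in> forms I m" "\<not> vanishes_at \<phi> f p" "\<And>q. q \<in> Y \<Longrightarrow> vanishes_at \<phi> f q"
proof -
  obtain Z where Z: "closedin (zariski \<phi> I) Z" "Y = Z \<inter> S" using assms(1) by (auto simp: closedin_subtopology)
  have "openin (zariski \<phi> I) (proj_space I - Z)" using Z(1) topspace_zariski by (metis closedin_def)
  moreover have "p \<in> proj_space I - Z" using assms Z by blast
  ultimately obtain f m where f: "f \<in> forms I m" "\<not> vanishes_at \<phi> f p"
    "{q \<in> proj_space I. \<not> vanishes_at \<phi> f q} \<subseteq> proj_space I - Z" using basic_open_base by blast
  have "Y \<subseteq> proj_space I" using Z closedin_subset topspace_zariski by blast
  then have "vanishes_at \<phi> f q" if "q \<in> Y" for q using that f(3) Z(2) by blast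
  then show ?thesis using that f(1,2) by blast
qed

lemma irreducible_forms:
  assumes "irreducible_in (zariski \<phi> I) S" "f \<in> forms I m" "g \<in> forms I l"
    and "\<And>p. p \<in> S \<Longrightarrow> vanishes_at \<phi> (f * g) p"
  shows "(\<forall>p\<in>S. vanishes_at \<phi> f p) \<or> (\<forall>p\<in>S. vanishes_at \<phi> g p)"
proof -
  have sub: "S \<subseteq> proj_space I" using assms(1) topspace_zariski by (auto simp: irreducible_in_def)
  let ?A = "{p \<in> proj_space I. vanishes_at \<phi> f p}" and ?B = "{p \<in> proj_space I. vanishes_at \<phi> g p}"
  have "S \<subseteq> ?A \<union> ?B" using assms(4) sub vanishes_at_mult[OF assms(2,3)] by blast
  then have "S \<subseteq> ?A \<or> S \<subseteq> ?B"
    using assms(1) closedin_basic[OF assms(2)] closedin_basic[OF assms(3)] unfolding irreducible_in_def by blast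
  then show ?thesis by blast
qed

end

lemma irreducible_in_subtopology:
  "irreducible_in (subtopology T S) Y \<longleftrightarrow> irreducible_in T Y \<and> Y \<subseteq> S"
proof (cases "Y \<subseteq> S \<and> Y \<subseteq> topspace T")
  case True
  have "(\<forall>A B. closedin (subtopology T S) A \<and> closedin (subtopology T S) B \<and> Y \<subseteq> A \<union> B \<longrightarrow> Y \<subseteq> A \<or> Y \<subseteq> B)
    \<longleftrightarrow> (\<forall>A B. closedin T A \<and> closedin T B \<and> Y \<subseteq> A \<union> B \<longrightarrow> Y \<subseteq> A \<or> Y \<subseteq> B)" (is "?L \<longleftrightarrow> ?R")
  proof
    assume L: ?L
    show ?R
    proof (intro allI impI)
      fix A B assume AB: "closedin T A \<and> closedin T B \<and> Y \<subseteq> A \<union> B"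
      then have "closedin (subtopology T S) (A \<inter> S)" "closedin (subtopology T S) (B \<inter> S)"
        by (auto simp: closedin_subtopology)
      moreover have "Y \<subseteq> (A \<inter> S) \<union> (B \<inter> S)" using AB True by blast
      ultimately show "Y \<subseteq> A \<or> Y \<subseteq> B" using L by blast
    qed
  next
    assume R: ?R
    show ?L
    proof (intro allI impI)
      fix A B assume AB: "closedin (subtopology T S) A \<and> closedin (subtopology T S) B \<and> Y \<subseteq> A \<union> B"
      then obtain A' B' where "closedin T A'" "A = A' \<inter> S" "closedin T B'" "B = B' \<inter> S"
        by (auto simp: closedin_subtopology)
      moreover from this have "Y \<subseteq> A' \<union> B'" using AB by blast
      ultimately show "Y \<subseteq> A \<or> Y \<subseteq> B" using R True by blast
    qed
  qed
  then show ?thesis using True by (auto simp: irreducible_in_def)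
next
  case False
  then show ?thesis by (auto simp: irreducible_in_def)
qed

lemma irreducible_component_closed:
  assumes "S \<in> irreducible_components T"
  shows "closedin T S" "irreducible_in T S"
proof -
  have S: "irreducible_in T S" "\<And>S'. irreducible_in T S' \<Longrightarrow> S \<subseteq> S' \<Longrightarrow> S' = S"
    using assms by (auto simp: irreducible_components_def)
  have sub: "S \<subseteq> topspace T" using S(1) by (simp add: irreducible_in_def)
  have "irreducible_in T (T closure_of S)"
    unfolding irreducible_in_def
  proof (intro conjI allI impI)
    show "T closure_of S \<subseteq> topspace T" by (rule closure_of_subset_topspace)
    show "T closure_of S \<noteq> {}" using S(1) closure_of_subset[OF sub] by (auto simp: irreducible_in_def)
    fix A B assume AB: "closedin T A \<and> closedin T B \<and> T closure_of S \<subseteq> A \<union> B"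
    then have "S \<subseteq> A \<or> S \<subseteq> B" using S(1) closure_of_subset[OF sub] unfolding irreducible_in_def by blast
    then show "T closure_of S \<subseteq> A \<or> T closure_of S \<subseteq> B" using AB closure_of_minimal by metis
  qed
  then have "T closure_of S = S" using S(2) closure_of_subset[OF sub] by blast
  then show "closedin T S" by (metis closedin_closure_of)
  show "irreducible_in T S" by (rule S(1))
qed

text \<open>Serves to identify the Hilbert function, defined as a difference of two dimensions, with
  the dimension of a space of functions on the cone.\<close>

lemma (in vector_space) rank_nullity:
  fixes scale2 :: "'a \<Rightarrow> 'c::ab_group_add \<Rightarrow> 'c" and T :: "'b \<Rightarrow> 'c"
  assumes "vector_space scale2" "subspace S" "finite E" "S \<subseteq> span E"
    and add: "\<And>x y. T (x + y) = T x + T y" and scl: "\<And>c x. T (scale c x) = scale2 c (T x)"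
  shows "vector_space.dim scale2 (T ` S) + dim {x \<in> S. T x = 0} = dim S"
proof -
  interpret v2: vector_space scale2 by (rule assms(1))
  have T0: "T 0 = 0" using add[of 0 0] by simp
  have Tsum: "T (\<Sum>x\<in>A. f x) = (\<Sum>x\<in>A. T (f x))" for A and f :: "'z \<Rightarrow> 'b"
    by (induction A rule: infinite_finite_induct) (simp_all add: add T0)
  have fin: "finite B" if "independent B" "B \<subseteq> S" for B
    using independent_span_bound[OF assms(3) that(1)] that(2) assms(4) by blast
  let ?K = "{x \<in> S. T x = 0}"
  have subK: "subspace ?K" using assms(2) by (auto simp: subspace_def add scl T0)
  obtain B0 where B0: "B0 \<subseteq> ?K" "independent B0" "?K \<subseteq> span B0"
    using maximal_independent_subset[of ?K] by blast
  obtain B where B: "B0 \<subseteq> B" "B \<subseteq> S" "independent B" "S \<subseteq> span B"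
    using maximal_independent_subset_extend[of B0 S] B0 by blast
  have finB: "finite B" by (rule fin[OF B(3,2)])
  define C where "C = B - B0"
  have ker: "\<forall>c\<in>C. \<gamma> c = 0" if T_zero: "(\<Sum>c\<in>C. scale2 (\<gamma> c) (T c)) = 0" for \<gamma>
  proof -
    have "(\<Sum>c\<in>C. scale (\<gamma> c) c) \<in> S"
      using B(2) by (intro subspace_sum[OF assms(2)] subspace_scale[OF assms(2)]) (auto simp: C_def)
    moreover have "T (\<Sum>c\<in>C. scale (\<gamma> c) c) = 0" using T_zero by (simp add: Tsum scl)
    ultimately have "(\<Sum>c\<in>C. scale (\<gamma> c) c) \<in> span B0" using B0(3) by blast
    moreover have "finite B0" using finB B(1) finite_subset by blast
    ultimately obtain \<delta> where \<delta>: "(\<Sum>c\<in>C. scale (\<gamma> c) c) = (\<Sum>b\<in>B0. scale (\<delta> b) b)"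
      using span_family[of B0 "\<Sum>c\<in>C. scale (\<gamma> c) c" "\<lambda>b. b"] by auto
    define \<epsilon> where "\<epsilon> b = (if b \<in> B0 then - \<delta> b else \<gamma> b)" for b
    have "(\<Sum>b\<in>B. scale (\<epsilon> b) b) = (\<Sum>b\<in>C. scale (\<epsilon> b) b) + (\<Sum>b\<in>B0. scale (\<epsilon> b) b)"
      unfolding C_def by (rule sum.subset_diff[OF B(1) finB])
    also have "(\<Sum>b\<in>C. scale (\<epsilon> b) b) = (\<Sum>c\<in>C. scale (\<gamma> c) c)"
      by (intro sum.cong) (auto simp: \<epsilon>_def C_def)
    also have "(\<Sum>b\<in>B0. scale (\<epsilon> b) b) = - (\<Sum>b\<in>B0. scale (\<delta> b) b)"
      by (simp add: \<epsilon>_def sum_negf)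
    finally have "(\<Sum>b\<in>B. scale (\<epsilon> b) b) = 0" using \<delta> by simp
    then have "\<forall>b\<in>B. \<epsilon> b = 0" using B(3) finB independentD by fast
    then show ?thesis by (auto simp: C_def \<epsilon>_def)
  qed
  have injC: "inj_on T C"
  proof (rule inj_onI, rule ccontr)
    fix x y assume xy: "x \<in> C" "y \<in> C" "T x = T y" "x \<noteq> y"
    define \<gamma> where "\<gamma> c = (if c = x then 1 else if c = y then - 1 else (0::'a))" for c
    have "(\<Sum>c\<in>C. scale2 (\<gamma> c) (T c)) = (\<Sum>c\<in>{x, y}. scale2 (\<gamma> c) (T c))"
      using xy finB by (intro sum.mono_neutral_right) (auto simp: \<gamma>_def C_def)
    also have "\<dots> = 0" using xy by (simp add: \<gamma>_def)
    finally show False using ker[of \<gamma>] xy(1) by (auto simp: \<gamma>_def)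
  qed
  have finC: "finite C" using finB by (simp add: C_def)
  have indT: "v2.independent (T ` C)"
  proof (subst v2.independent_if_scalars_zero)
    fix \<gamma> x assume s: "(\<Sum>x\<in>T ` C. scale2 (\<gamma> x) x) = 0" and x: "x \<in> T ` C"
    have "(\<Sum>c\<in>C. scale2 (\<gamma> (T c)) (T c)) = 0" using s by (simp add: sum.reindex[OF injC])
    then show "\<gamma> x = 0" using ker[of "\<lambda>c. \<gamma> (T c)"] x by auto
  qed (use finC in auto)
  have spanT: "T ` S \<subseteq> v2.span (T ` C)"
  proof
    fix z assume "z \<in> T ` S"
    then obtain x where x: "x \<in> S" "z = T x" by blast
    obtain \<gamma> where "x = (\<Sum>b\<in>B. scale (\<gamma> b) b)"
      using span_family[of B x "\<lambda>b. b"] finB B(4) x(1) by auto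
    then have "z = (\<Sum>b\<in>B. scale2 (\<gamma> b) (T b))" by (simp add: x(2) Tsum scl)
    also have "\<dots> = (\<Sum>b\<in>C. scale2 (\<gamma> b) (T b))"
      using finB B0(1) by (intro sum.mono_neutral_right) (auto simp: C_def)
    also have "\<dots> \<in> v2.span (T ` C)" by (intro v2.span_sum v2.span_scale v2.span_base) auto
    finally show "z \<in> v2.span (T ` C)" .
  qed
  have "T ` C \<subseteq> T ` S" using B(2) by (auto simp: C_def)
  then have "v2.dim (T ` S) = card (T ` C)" by (intro v2.dim_unique[OF _ spanT indT refl])
  also have "\<dots> = card C" by (rule card_image[OF injC])
  finally have d1: "v2.dim (T ` S) = card C" .
  have d2: "dim ?K = card B0" by (rule dim_unique[OF B0(1,3,2) refl])
  have d3: "dim S = card B" by (rule dim_unique[OF B(2,4,3) refl])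
  have "card B0 \<le> card B" by (rule card_mono[OF finB B(1)])
  then show ?thesis using d1 d2 d3 card_Diff_subset[OF finite_subset[OF B(1) finB] B(1)] by (simp add: C_def)
qed

lemma coeff_hom_ac: "coeff_hom (to_ac :: 'a::field \<Rightarrow> 'a alg_closure)"
  by unfold_locales simp_all

lemma coeff_hom_id: "coeff_hom (id :: complex \<Rightarrow> complex)"
  by unfold_locales simp_all

interpretation ac: coeff_hom "to_ac :: 'a::field \<Rightarrow> 'a alg_closure" by (rule coeff_hom_ac)
interpretation cx: coeff_hom "id :: complex \<Rightarrow> complex" by (rule coeff_hom_id)

lemma eval_prod: "mpoly_eval (id :: complex \<Rightarrow> complex) (\<Prod>s\<in>S. f s) v = (\<Prod>s\<in>S. mpoly_eval id (f s) v)"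
proof -
  have "mpoly_eval (id :: complex \<Rightarrow> complex) (Poly_Mapping.single 0 1) v = 1" unfolding cx.eval_single by simp
  then have 1: "mpoly_eval (id :: complex \<Rightarrow> complex) 1 v = 1" by (simp only: single_one)
  show ?thesis by (induction S rule: infinite_finite_induct) (simp_all only: prod.infinite prod.empty prod.insert 1 cx.eval_mult not_False_eq_True)
qed

lemma mpoly_eval_power: "mpoly_eval (id :: complex \<Rightarrow> complex) (F ^ m) v = mpoly_eval id F v ^ m"
  using eval_prod[of "\<lambda>_. F" "{..<m}" v] by simp

lemma finite_monomials: "finite {e :: 'i \<Rightarrow>\<^sub>0 nat. Poly_Mapping.keys e \<subseteq> I \<and> mdeg e = m}" if "finite I"
proof -
  have "inj_on Poly_Mapping.lookup {e :: 'i \<Rightarrow>\<^sub>0 nat. Poly_Mapping.keys e \<subseteq> I \<and> mdeg e = m}"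
    by (auto simp: inj_on_def intro: poly_mapping_eqI)
  moreover have "Poly_Mapping.lookup ` {e :: 'i \<Rightarrow>\<^sub>0 nat. Poly_Mapping.keys e \<subseteq> I \<and> mdeg e = m} \<subseteq>
      {f. \<forall>x. (x \<in> I \<longrightarrow> f x \<in> {..m}) \<and> (x \<notin> I \<longrightarrow> f x = 0)}"
  proof clarsimp
    fix e :: "'i \<Rightarrow>\<^sub>0 nat" and x
    assume e: "Poly_Mapping.keys e \<subseteq> I"
    have "Poly_Mapping.lookup e x \<le> mdeg e"
    proof (cases "x \<in> Poly_Mapping.keys e")
      case True
      then show ?thesis unfolding mdeg_def by (intro member_le_sum) auto
    qed (simp add: not_in_keys_iff_lookup_eq_zero)
    then show "(x \<in> I \<longrightarrow> Poly_Mapping.lookup e x \<le> mdeg e) \<and> (x \<notin> I \<longrightarrow> Poly_Mapping.lookup e x = 0)"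
      using e by (auto simp flip: not_in_keys_iff_lookup_eq_zero)
  qed
  moreover have "finite {f. \<forall>x. (x \<in> I \<longrightarrow> f x \<in> {..m}) \<and> (x \<notin> I \<longrightarrow> f x = (0::nat))}"
    by (rule finite_set_of_finite_funs[OF that]) simp
  ultimately show ?thesis using finite_subset finite_imageD by blast
qed

lemma forms_finite_span:
  fixes I :: "'i set"
  assumes "finite I"
  shows "\<exists>E. finite E \<and> (forms I m :: ('i, 'a::field) mpoly set) \<subseteq> mpoly.span E"
proof (intro exI conjI subsetI)
  let ?E = "(\<lambda>e. Poly_Mapping.single e (1::'a)) ` {e :: 'i \<Rightarrow>\<^sub>0 nat. Poly_Mapping.keys e \<subseteq> I \<and> mdeg e = m}"
  show "finite ?E" using finite_monomials[OF assms] by simp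
  fix f :: "('i, 'a) mpoly" assume f: "f \<in> forms I m"
  have "f = (\<Sum>e\<in>Poly_Mapping.keys f. mpoly_scale (Poly_Mapping.lookup f e) (Poly_Mapping.single e 1))"
    using ac.mpoly_sum_singles[of f] by (simp add: mpoly_scale_def mult_single)
  also have "\<dots> \<in> mpoly.span ?E"
    using f by (intro mpoly.span_sum mpoly.span_scale mpoly.span_base) (auto simp: forms_iff)
  finally show "f \<in> mpoly.span ?E" .
qed

section \<open>The coordinate ring of a curve\<close>

type_synonym rfun = "complex poly fract"

lemma common_denominator:
  fixes a :: "'j \<Rightarrow> rfun"
  assumes "finite J"
  shows "\<exists>q b. q \<noteq> 0 \<and> (\<forall>j\<in>J. to_fract q * a j = to_fract (b j))"
  using assms
proof (induction J rule: finite_induct)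
  case empty
  show ?case by (intro exI[of _ 1]) auto
next
  case (insert i J)
  then obtain q b where qb: "q \<noteq> 0" "\<forall>j\<in>J. to_fract q * a j = to_fract (b j)" by blast
  obtain r s where rs: "a i = Fract r s" "s \<noteq> 0" by (cases "a i") auto
  have s: "to_fract s * a i = to_fract r"
    unfolding rs(1) Fract_conv_to_fract using rs(2) by simp
  define b' where "b' j = (if j = i then q * r else s * b j)" for j
  have "to_fract (q * s) * a j = to_fract (b' j)" if "j \<in> insert i J" for j
  proof (cases "j = i")
    case True
    then show ?thesis using s by (simp add: b'_def mult.assoc)
  next
    case False
    then have "to_fract q * a j = to_fract (b j)" using that qb(2) by simp
    then have "to_fract s * (to_fract q * a j) = to_fract s * to_fract (b j)" by simp
    then show ?thesis using False by (simp add: b'_def ac_simps)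
  qed
  then show ?case using qb(1) rs(2) by (intro exI[of _ "q * s"] exI[of _ b']) auto
qed

lemma of_nat_rfun: "(of_nat k :: rfun) = to_fract (of_nat k)"
  by (induction k) simp_all

lemma (in graded_algebra) A_prod:
  "finite S \<Longrightarrow> (\<And>i. i \<in> S \<Longrightarrow> f i \<in> A (k i)) \<Longrightarrow> (\<Prod>i\<in>S. f i) \<in> A (\<Sum>i\<in>S. k i)"
proof (induction S rule: finite_induct)
  case empty
  then show ?case by (simp add: A_one)
next
  case (insert x S)
  then have "f x * prod f S \<in> A (k x + sum k S)" by (intro A_mult) auto
  then show ?case using insert.hyps by simp
qed

lemma (in graded_algebra) red_scale:
  assumes "red {u, v}" "c \<noteq> 0" "c' \<noteq> 0"
  shows "red {c \<cdot> u, c' \<cdot> v}"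
proof -
  have "lin {u, v} m \<subseteq> lin {c \<cdot> u, c' \<cdot> v} m" for m
  proof
    fix x assume "x \<in> lin {u, v} m"
    then show "x \<in> lin {c \<cdot> u, c' \<cdot> v} m"
    proof (induction rule: lin_induct)
      case zero
      show ?case by (rule lin_zero)
    next
      case (add z a x)
      have "u * a = (c \<cdot> u) * (inverse c \<cdot> a)" "v * a = (c' \<cdot> v) * (inverse c' \<cdot> a)"
        using assms(2,3) by (simp_all add: scale_mult_right scale_mult[symmetric])
      moreover have "inverse c \<cdot> a \<in> A m" "inverse c' \<cdot> a \<in> A m" using add(2) A_scale by auto
      ultimately have "z * a \<in> lin {c \<cdot> u, c' \<cdot> v} m" using add(1) lin_base[of _ "{c \<cdot> u, c' \<cdot> v}"] by auto
      then show ?case using add(3) lin_add by blast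
    qed
  qed
  then show ?thesis using assms(1) unfolding red_def by blast
qed

definition vec :: "(nat \<Rightarrow> complex poly) \<Rightarrow> nat \<Rightarrow> rfun alg_closure" where
  "vec x = (\<lambda>i. to_ac (to_fract (x i)))"

definition scf :: "rfun \<Rightarrow> ('p \<Rightarrow> rfun alg_closure) \<Rightarrow> 'p \<Rightarrow> rfun alg_closure" where
  "scf c f = (\<lambda>v. to_ac c * f v)"

lemma scf_apply: "scf c f v = to_ac c * f v"
  by (simp add: scf_def)

locale curve =
  fixes n :: nat and C :: "(nat \<Rightarrow> rfun alg_closure) set set" and d :: nat
  assumes irr: "irreducible_projective_curve n C" and deg: "has_proj_degree n C d"
begin

definition cone :: "(nat \<Rightarrow> rfun alg_closure) set" where
  "cone = \<Union>C"

text \<open>Forms on the curve are viewed as functions on its affine cone. To get an algebra of total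
  functions, every vector is first retracted to the cone.\<close>

definition pr :: "(nat \<Rightarrow> rfun alg_closure) \<Rightarrow> nat \<Rightarrow> rfun alg_closure" where
  "pr v = (if v \<in> cone then v else (SOME v. v \<in> cone))"

definition xf :: "nat \<Rightarrow> (nat \<Rightarrow> rfun alg_closure) \<Rightarrow> rfun alg_closure" where
  "xf i = (\<lambda>v. pr v i)"

definition evf :: "(nat, rfun) mpoly \<Rightarrow> (nat \<Rightarrow> rfun alg_closure) \<Rightarrow> rfun alg_closure" where
  "evf f = (\<lambda>v. mpoly_eval to_ac f (pr v))"

lemma C_sub: "C \<subseteq> proj_space {..n}"
  using irr closedin_subset[of "zariski to_ac {..n}" C]
  by (simp add: irreducible_projective_curve_def ac.topspace_zariski)

lemma cone_class: "v \<in> cone \<Longrightarrow> proj_class v \<in> C"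
proof -
  assume "v \<in> cone"
  then obtain p where p: "p \<in> C" "v \<in> p" by (auto simp: cone_def)
  then obtain w where "p = proj_class w" using C_sub by (auto simp: proj_space_def)
  then show ?thesis using p proj_class_eq by metis
qed

lemma class_cone: "proj_class v \<in> C \<Longrightarrow> v \<in> cone"
  using proj_class_self by (auto simp: cone_def)

lemma cone_nonempty: "cone \<noteq> {}"
proof -
  obtain p where "p \<in> C" using irr by (auto simp: irreducible_projective_curve_def irreducible_in_def)
  moreover from this obtain w where "p = proj_class w" using C_sub by (auto simp: proj_space_def)
  ultimately show ?thesis using class_cone by auto
qed

lemma pr_cone: "pr v \<in> cone"
  using cone_nonempty by (auto simp: pr_def some_in_eq)

lemma pr_id: "v \<in> cone \<Longrightarrow> pr v = v"
  by (simp add: pr_def)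

lemma cone_nonzero: "v \<in> cone \<Longrightarrow> \<exists>i\<le>n. v i \<noteq> 0"
proof -
  assume "v \<in> cone"
  then have "proj_class v \<in> proj_space {..n}" using cone_class C_sub by blast
  then obtain w where w: "proj_class v = proj_class w" "\<exists>i\<in>{..n}. w i \<noteq> 0" by (auto simp: proj_space_def)
  then have "w \<in> proj_class v" using proj_class_self by auto
  then show ?thesis using w(2) by (auto simp: proj_class_def)
qed

lemma vector_space_scf: "vector_space (scf :: rfun \<Rightarrow> ('p \<Rightarrow> rfun alg_closure) \<Rightarrow> _)"
  by unfold_locales (auto simp: scf_def fun_eq_iff algebra_simps)

sublocale ga: graded_algebra scf "xf ` {..n}"
  by (rule graded_algebra.intro[OF vector_space_scf]) (unfold_locales, auto simp: scf_def fun_eq_iff)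

lemma evf_add: "evf (f + g) = evf f + evf g"
  and evf_scale: "evf (mpoly_scale c f) = scf c (evf f)"
  and evf_mult: "evf (f * g) = evf f * evf g"
  by (auto simp: evf_def fun_eq_iff ac.eval_add ac.eval_mult ac.eval_scale scf_def)

lemma evf_single: "evf (Poly_Mapping.single e c) = scf c (\<Prod>i\<in>Poly_Mapping.keys e. xf i ^ Poly_Mapping.lookup e i)"
proof
  fix v
  have "(\<Prod>i\<in>S. xf i ^ Poly_Mapping.lookup e i) v = (\<Prod>i\<in>S. pr v i ^ Poly_Mapping.lookup e i)" for S
    by (induction S rule: infinite_finite_induct) (simp_all add: xf_def power_apply)
  then show "evf (Poly_Mapping.single e c) v = scf c (\<Prod>i\<in>Poly_Mapping.keys e. xf i ^ Poly_Mapping.lookup e i) v"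
    by (simp add: evf_def scf_def mon_def)
qed

lemma evf_sum: "evf (\<Sum>s\<in>S. f s) = (\<Sum>s\<in>S. evf (f s))"
proof -
  have "evf 0 = 0" by (auto simp: evf_def fun_eq_iff)
  then show ?thesis by (induction S rule: infinite_finite_induct) (simp_all add: evf_add)
qed

lemma A_eq: "ga.A m = evf ` forms {..n} m"
proof (intro subset_antisym subsetI)
  fix a assume "a \<in> evf ` forms {..n} m"
  then obtain f where f: "a = evf f" "f \<in> forms {..n} m" by blast
  have "a = (\<Sum>e\<in>Poly_Mapping.keys f. evf (Poly_Mapping.single e (Poly_Mapping.lookup f e)))"
    using ac.mpoly_sum_singles[of f] by (simp add: f(1) flip: evf_sum)
  also have "\<dots> \<in> ga.A m"
    unfolding evf_single
  proof (intro ga.A_sum ga.A_scale)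
    fix e assume "e \<in> Poly_Mapping.keys f"
    then have e: "Poly_Mapping.keys e \<subseteq> {..n}" "mdeg e = m" using f(2) by (auto simp: forms_iff)
    have "(\<Prod>i\<in>Poly_Mapping.keys e. xf i ^ Poly_Mapping.lookup e i) \<in> ga.A (\<Sum>i\<in>Poly_Mapping.keys e. Poly_Mapping.lookup e i)"
      using e(1) ga.G_A by (intro ga.A_prod ga.A_power1) auto
    then show "(\<Prod>i\<in>Poly_Mapping.keys e. xf i ^ Poly_Mapping.lookup e i) \<in> ga.A m" using e(2) by (simp add: mdeg_def)
  qed
  finally show "a \<in> ga.A m" .
next
  have sub: "ga.subspace (evf ` forms {..n} m)" for m
    unfolding ga.subspace_def
  proof (intro conjI ballI allI)
    have "0 = evf 0" by (auto simp: evf_def fun_eq_iff)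
    then show "0 \<in> evf ` forms {..n} m" using forms_0 by (rule image_eqI)
  next
    fix x y assume "x \<in> evf ` forms {..n} m" "y \<in> evf ` forms {..n} m"
    then obtain f g where fg: "x = evf f" "y = evf g" "f \<in> forms {..n} m" "g \<in> forms {..n} m" by blast
    have "x + y = evf (f + g)" by (simp only: fg evf_add)
    then show "x + y \<in> evf ` forms {..n} m" using forms_add[OF fg(3,4)] by (rule image_eqI)
  next
    fix c x assume "x \<in> evf ` forms {..n} m"
    then obtain f where f: "x = evf f" "f \<in> forms {..n} m" by blast
    have "scf c x = evf (mpoly_scale c f)" by (simp only: f evf_scale)
    then show "scf c x \<in> evf ` forms {..n} m" using forms_scale[OF f(2)] by (rule image_eqI)
  qed
  fix a assume "a \<in> ga.A m"
  then show "a \<in> evf ` forms {..n} m"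
  proof (induction m arbitrary: a)
    case 0
    have "evf 1 = 1" by (auto simp: evf_def fun_eq_iff mpoly_eval_eq)
    moreover have "(1 :: (nat, rfun) mpoly) \<in> forms {..n} 0" using forms_single[of 0 "{..n}" 0 "1::rfun"] by simp
    ultimately have "1 \<in> evf ` forms {..n} 0" by (metis image_eqI)
    then have "ga.A 0 \<subseteq> evf ` forms {..n} 0" unfolding ga.A.simps by (intro ga.span_minimal sub) auto
    then show ?case using 0 by blast
  next
    case (Suc m)
    have "{x * a | x a. x \<in> xf ` {..n} \<and> a \<in> ga.A m} \<subseteq> evf ` forms {..n} (Suc m)"
    proof
      fix z assume "z \<in> {x * a | x a. x \<in> xf ` {..n} \<and> a \<in> ga.A m}"
      then obtain i b where z: "z = xf i * b" and i: "i \<in> {..n}" "b \<in> ga.A m" by blast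
      then obtain f where f: "b = evf f" "f \<in> forms {..n} m" using Suc.IH by blast
      have "xf i = evf (mvar i)" by (simp add: evf_def xf_def)
      then have "xf i * b = evf (mvar i * f)" by (simp add: evf_mult f(1))
      moreover have "mvar i * f \<in> forms {..n} (Suc m)" using forms_mult[OF mvar_forms[OF i(1)] f(2)] by simp
      ultimately show "z \<in> evf ` forms {..n} (Suc m)" unfolding z by (rule image_eqI)
    qed
    then have "ga.A (Suc m) \<subseteq> evf ` forms {..n} (Suc m)" unfolding ga.A.simps by (intro ga.span_minimal sub)
    then show ?case using Suc.prems by blast
  qed
qed

lemma evf_zero_iff:
  assumes "f \<in> forms {..n} m"
  shows "evf f = 0 \<longleftrightarrow> (\<forall>p\<in>C. vanishes_at to_ac f p)"
proof
  assume z: "evf f = 0"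
  show "\<forall>p\<in>C. vanishes_at to_ac f p"
  proof
    fix p assume p: "p \<in> C"
    then obtain w where w: "p = proj_class w" using C_sub by (auto simp: proj_space_def)
    then have "pr w = w" using class_cone p by (simp add: pr_id)
    then have "mpoly_eval to_ac f w = 0" using fun_cong[OF z, of w] by (simp add: evf_def)
    then show "vanishes_at to_ac f p" unfolding w ac.vanishes_at_class[OF assms] .
  qed
next
  assume van: "\<forall>p\<in>C. vanishes_at to_ac f p"
  show "evf f = 0"
  proof
    fix v
    have "vanishes_at to_ac f (proj_class (pr v))" using van cone_class[OF pr_cone] by blast
    then show "evf f v = 0 v" unfolding ac.vanishes_at_class[OF assms] by (simp add: evf_def)
  qed
qed

lemma A_dom:
  assumes "a \<in> ga.A m" "b \<in> ga.A l" "a * b = 0"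
  shows "a = 0 \<or> b = 0"
proof -
  obtain f g where fg: "a = evf f" "f \<in> forms {..n} m" "b = evf g" "g \<in> forms {..n} l"
    using assms(1,2) unfolding A_eq by blast
  have "evf (f * g) = 0" using assms(3) fg by (simp add: evf_mult)
  then have "\<forall>p\<in>C. vanishes_at to_ac (f * g) p" using evf_zero_iff[OF forms_mult[OF fg(2,4)]] by simp
  moreover have "irreducible_in (zariski to_ac {..n}) C" using irr by (simp add: irreducible_projective_curve_def)
  ultimately have "(\<forall>p\<in>C. vanishes_at to_ac f p) \<or> (\<forall>p\<in>C. vanishes_at to_ac g p)"
    using ac.irreducible_forms[OF _ fg(2,4)] by blast
  then show ?thesis using evf_zero_iff[OF fg(2)] evf_zero_iff[OF fg(4)] fg(1,3) by blast
qed

lemma dim_A_hilbert: "ga.dim (ga.A m) = hilbert_function n C m"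
proof -
  obtain E where E: "finite E" "(forms {..n} m :: (nat, rfun) mpoly set) \<subseteq> mpoly.span E"
    using forms_finite_span[of "{..n}" m] by auto
  have "ga.dim (evf ` forms {..n} m) + mpoly.dim {f \<in> forms {..n} m. evf f = 0} = mpoly.dim (forms {..n} m :: (nat, rfun) mpoly set)"
    by (rule mpoly.rank_nullity[OF vector_space_scf subspace_forms E evf_add evf_scale])
  moreover have "{f \<in> forms {..n} m. evf f = 0} = {f \<in> forms {..n} m. \<forall>p\<in>C. vanishes_at to_ac f p}"
    using evf_zero_iff by blast
  ultimately show ?thesis by (simp add: A_eq hilbert_function_def)
qed

lemma hilbert_linear: "d > 0 \<and> (\<exists>e0 m0. \<forall>m\<ge>m0. int (ga.dim (ga.A m)) = int d * int m + e0)"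
proof -
  obtain P :: "rat poly" where P: "\<forall>\<^sub>F m in sequentially. of_nat (hilbert_function n C m) = poly P (of_nat m)"
    "ereal (real (Polynomial.degree P)) = krull_dim (subtopology (zariski (to_ac :: rfun \<Rightarrow> _) {..n}) C)"
    "of_nat d = fact (Polynomial.degree P) * Polynomial.lead_coeff P"
    using deg by (auto simp: has_proj_degree_def)
  have "ereal (real (Polynomial.degree P)) = 1" using irr P(2) by (simp add: irreducible_projective_curve_def)
  then have d1: "Polynomial.degree P = 1" by (metis ereal_eq_1(1) of_nat_eq_1_iff)
  then have lc: "Polynomial.coeff P 1 = of_nat d" using P(3) by simp
  have "Polynomial.coeff P 1 \<noteq> 0" using d1 by (metis degree_0 leading_coeff_0_iff zero_neq_one)
  then have "d > 0" using lc by (cases d) auto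
  have ev: "poly P x = Polynomial.coeff P 0 + of_nat d * x" for x
    using lc d1 by (simp add: poly_altdef)
  obtain m0 where m0: "\<And>m. m \<ge> m0 \<Longrightarrow> (of_nat (hilbert_function n C m) :: rat) = Polynomial.coeff P 0 + of_nat d * of_nat m"
    using P(1) unfolding eventually_sequentially ev by blast
  \<comment> \<open>The Hilbert polynomial has rational coefficients. That its constant term is an
    integer is read off from a single value, the slope \<open>d\<close> being one already.\<close>
  define e0 where "e0 = int (hilbert_function n C m0) - int d * int m0"
  have "int (ga.dim (ga.A m)) = int d * int m + e0" if "m \<ge> m0" for m
  proof -
    have "(of_int (int (hilbert_function n C m)) :: rat) = of_int (int d * int m + e0)"
      using m0[OF that] m0[of m0] by (simp add: e0_def)
    then have "int (hilbert_function n C m) = int d * int m + e0" by (simp only: of_int_eq_iff)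
    then show ?thesis by (simp add: dim_A_hilbert)
  qed
  then show ?thesis using \<open>d > 0\<close> by blast
qed

end

definition (in curve) Pts :: "(nat \<Rightarrow> complex poly) set" where
  "Pts = {x. (\<forall>i>n. x i = 0) \<and> vec x \<in> cone}"

text \<open>The constants \<open>e0\<close> and \<open>m0\<close> are known only to exist. Fixing
  them as parameters makes \<open>graded_domain\<close> available as a sublocale;
  \<open>good_curve_data\<close> discharges them again.\<close>

locale curve_dim = curve +
  fixes e0 :: int and m0 :: nat
  assumes dim_eventually: "m \<ge> m0 \<Longrightarrow> int (ga.dim (ga.A m)) = int d * int m + e0"
begin

sublocale gd: graded_domain scf "xf ` {..n}" d e0 m0
proof
  fix a b m l assume "a \<in> ga.A m" "b \<in> ga.A l" "a * b = 0"
  then show "a = 0 \<or> b = 0" by (rule A_dom)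
next
  show "d > 0" using hilbert_linear by blast
next
  fix j show "of_nat (Suc j) \<noteq> (0 :: rfun)" unfolding of_nat_rfun by (simp del: of_nat_Suc)
qed (rule dim_eventually)

section \<open>Curve data with polynomial coefficients\<close>

abbreviation Phi :: "complex poly \<Rightarrow> rfun alg_closure" where
  "Phi q \<equiv> to_ac (to_fract q)"

lemmas Phi_hom = hrel_hom[of "\<lambda>q. Phi q", simplified]

lemma Phi_sum: "Phi (\<Sum>s\<in>S. f s) = (\<Sum>s\<in>S. Phi (f s))"
  by (induction S rule: infinite_finite_induct) simp_all

lemma xf_vec: "x \<in> Pts \<Longrightarrow> xf i (vec x) = Phi (x i)"
  by (simp add: xf_def pr_id Pts_def vec_def)

text \<open>Evaluation at \<open>vec x\<close> is a ring homomorphism, and two tuples that are not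
  proportional are separated by the linear form belonging to a nonzero 2 by 2 minor.\<close>

lemma zeros_pts:
  assumes f: "f \<in> ga.A m" "f \<noteq> 0" and P: "finite P" "P \<subseteq> Pts"
    and par: "\<forall>x\<in>P. \<forall>y\<in>P. x \<noteq> y \<longrightarrow> \<not> parallel x y" and z: "\<And>x. x \<in> P \<Longrightarrow> f (vec x) = 0"
  shows "card P \<le> d * m"
proof (rule gd.zeros_le[where \<psi> = "\<lambda>x f. f (vec x)" and h = to_ac, OF P(1) f])
  show "f (vec p) = 0" if "p \<in> P" for p using z that by simp
  show "\<exists>l\<in>ga.A 1. l (vec q) = 0 \<and> l (vec p) \<noteq> 0" if pq: "p \<in> P" "q \<in> P" "p \<noteq> q" for p q
  proof -
    have Pts: "p \<in> Pts" "q \<in> Pts" using pq P by auto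
    obtain i j where ij: "p i * q j \<noteq> p j * q i" using par pq unfolding parallel_def by blast
    have le: "i \<le> n" "j \<le> n"
      using ij Pts by (auto simp: Pts_def not_le[symmetric] intro: ccontr)
    define l where "l = scf (to_fract (q j)) (xf i) - scf (to_fract (q i)) (xf j)"
    have "l \<in> ga.A 1" unfolding l_def using le by (intro ga.A_diff ga.A_scale ga.G_A) auto
    moreover have "l (vec q) = 0" by (simp add: l_def scf_def xf_vec[OF Pts(2)])
    moreover have "l (vec p) = Phi (q j * p i - q i * p j)" by (simp add: l_def scf_def xf_vec[OF Pts(1)])
    then have "l (vec p) \<noteq> 0" using ij by (simp del: to_fract_diff add: mult.commute)
    ultimately show ?thesis by blast
  qed
  show "\<exists>l\<in>ga.A 1. l (vec p) \<noteq> 0" if p: "p \<in> P" for p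
  proof -
    have Pts: "p \<in> Pts" using p P by auto
    then obtain i where i: "i \<le> n" "vec p i \<noteq> 0" using cone_nonzero[of "vec p"] by (auto simp: Pts_def)
    have "xf i (vec p) = vec p i" using xf_vec[OF Pts, of i] by (simp only: vec_def)
    then have "xf i (vec p) \<noteq> 0" using i(2) by simp
    moreover have "xf i \<in> ga.A 1" using i by (intro ga.G_A) auto
    ultimately show ?thesis by blast
  qed
qed (auto simp: scf_def)

lemma clear_linear:
  assumes "a \<in> ga.A 1"
  shows "\<exists>q U. q \<noteq> 0 \<and> (\<forall>x\<in>Pts. scf (to_fract q) a (vec x) = Phi (lf n U x))"
proof -
  have "ga.A 1 \<subseteq> ga.span (xf ` {..n})"
  proof -
    have "{x * a | x a. x \<in> xf ` {..n} \<and> a \<in> ga.A 0} \<subseteq> ga.span (xf ` {..n})"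
    proof
      fix z assume "z \<in> {x * a | x a. x \<in> xf ` {..n} \<and> a \<in> ga.A 0}"
      then obtain x a where z: "z = x * a" "x \<in> xf ` {..n}" "a \<in> ga.span {1}" by (auto simp: ga.A.simps)
      then show "z \<in> ga.span (xf ` {..n})"
        unfolding z(1) by (intro ga.mult_mem_span[OF z(3)]) (auto intro: ga.span_base)
    qed
    then have "ga.A (Suc 0) \<subseteq> ga.span (xf ` {..n})" unfolding ga.A.simps(2) by (rule ga.span_minimal) (rule ga.subspace_span)
    then show ?thesis by simp
  qed
  then have "a \<in> ga.span (xf ` {..n})" using assms by blast
  then obtain \<gamma> where \<gamma>: "a = (\<Sum>i\<in>{..n}. scf (\<gamma> i) (xf i))"
    using ga.span_family[of "{..n}" a xf] by auto
  obtain q U where q: "q \<noteq> 0" "\<forall>i\<in>{..n}. to_fract q * \<gamma> i = to_fract (U i)"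
    using common_denominator[of "{..n}" \<gamma>] by auto
  have "scf (to_fract q) a (vec x) = Phi (lf n U x)" if x: "x \<in> Pts" for x
  proof -
    have "scf (to_fract q) a (vec x) = (\<Sum>i\<le>n. to_ac (to_fract q * \<gamma> i) * Phi (x i))"
      by (simp add: scf_def \<gamma> sum_apply xf_vec[OF x] sum_distrib_left mult.assoc)
    also have "\<dots> = (\<Sum>i\<le>n. Phi (U i) * Phi (x i))" using q(2) by (intro sum.cong) auto
    also have "\<dots> = Phi (lf n U x)" unfolding lf_def Phi_sum to_fract_mult to_ac_mult ..
    finally show ?thesis .
  qed
  then show ?thesis using q(1) by blast
qed

lemma scf_sum_apply: "(\<Sum>c\<in>S. \<Sum>a\<in>T c. scf (\<gamma> c a) (f c a)) p = (\<Sum>c\<in>S. \<Sum>a\<in>T c. to_ac (\<gamma> c a) * f c a p)"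
  by (simp add: sum_apply scf_def)

lemma rel_val_apply:
  "gd.rel_val u v l \<gamma> e M p = hrel (\<lambda>c a. to_ac (\<gamma> c a)) e M (u p) (v p) (l p)"
  unfolding gd.rel_val_def hrel_def scf_sum_apply times_fun_apply power_apply ..

lemma rel_val_A:
  assumes "u \<in> ga.A 1" "v \<in> ga.A 1" "l \<in> ga.A 1" "e \<le> M"
  shows "gd.rel_val u v l \<gamma> e M \<in> ga.A M"
  unfolding gd.rel_val_def
proof (intro ga.A_sum ga.A_scale)
  fix c a assume ca: "c \<in> {..e}" "a \<in> {..M - c}"
  have "u ^ a * v ^ (M - c - a) * l ^ c \<in> ga.A (a + (M - c - a) + c)"
    using assms(1-3) by (intro ga.A_mult ga.A_power1) simp_all
  moreover have "a + (M - c - a) + c = M" using ca assms(4) by auto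
  ultimately show "u ^ a * v ^ (M - c - a) * l ^ c \<in> ga.A M" by (simp only:)
qed

lemma hrel_cong: "(\<And>c a. c \<le> e \<Longrightarrow> a \<le> M - c \<Longrightarrow> g c a = g' c a) \<Longrightarrow> hrel g e M u v l = hrel g' e M u v l"
  unfolding hrel_def by (intro sum.cong) auto

lemma hrel_smult: "hrel (\<lambda>c a. k * g c a) e M u v l = k * hrel g e M u v l"
  unfolding hrel_def by (simp add: sum_distrib_left mult.assoc)

text \<open>A separable relation with denominators cleared. Its derivative and its leading
  coefficient are exhibited as nonzero homogeneous elements, because the count of zeros then bounds
  the number of tuples at which they vanish.\<close>

lemma rel_data:
  assumes u: "u \<in> ga.A 1" "v \<in> ga.A 1" "u \<noteq> 0" "ga.red {u, v}" and l: "l \<in> ga.A 1"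
  shows "\<exists>e M g. 0 < e \<and> e \<le> d \<and> e \<le> M \<and>
    (\<exists>m D. D \<in> ga.A m \<and> D \<noteq> 0 \<and> (\<forall>p. D p = hder (\<lambda>c a. Phi (g c a)) e M (u p) (v p) (l p))) \<and>
    (\<exists>m T. T \<in> ga.A m \<and> T \<noteq> 0 \<and> (\<forall>p. T p = htop (\<lambda>c a. Phi (g c a)) e M (u p) (v p))) \<and>
    (\<forall>p. hrel (\<lambda>c a. Phi (g c a)) e M (u p) (v p) (l p) = 0)"
proof -
  obtain e M \<gamma> where e: "0 < e" "e \<le> d" "e \<le> M" and rel: "gd.rel_val u v l \<gamma> e M = 0"
    and top: "(\<Sum>i\<le>M - e. scf (\<gamma> e i) (u ^ i * v ^ (M - e - i))) \<noteq> 0"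
    and der: "gd.rel_val u v l (\<lambda>c i. of_nat (Suc c) * \<gamma> (Suc c) i) (e - 1) (M - 1) \<noteq> 0"
    by (rule gd.separable_relation[OF u l])
  obtain q b where q: "q \<noteq> 0" "\<forall>j\<in>{..e} \<times> {..M}. to_fract q * (\<lambda>(c, i). \<gamma> c i) j = to_fract (b j)"
    using common_denominator[of "{..e} \<times> {..M}" "\<lambda>(c, i). \<gamma> c i"] by auto
  define g where "g c i = b (c, i)" for c i
  have g: "Phi (g c i) = Phi q * to_ac (\<gamma> c i)" if "c \<le> e" "i \<le> M" for c i
  proof -
    have "to_fract q * \<gamma> c i = to_fract (g c i)" using q(2) that by (auto simp: g_def)
    then show ?thesis by (metis to_ac_mult)
  qed
  have on: "to_ac (of_nat k :: rfun) = of_nat k" for k by simp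
  define D where "D = scf (to_fract q) (gd.rel_val u v l (\<lambda>c i. of_nat (Suc c) * \<gamma> (Suc c) i) (e - 1) (M - 1))"
  define T where "T = scf (to_fract q) (\<Sum>i\<le>M - e. scf (\<gamma> e i) (u ^ i * v ^ (M - e - i)))"
  have D0: "D \<noteq> 0" and T0: "T \<noteq> 0"
    unfolding D_def T_def using der top q(1) by (simp_all only: ga.scale_eq_0_iff) simp_all
  have DA: "D \<in> ga.A (M - 1)" unfolding D_def using e by (intro ga.A_scale rel_val_A u l) auto
  have TA: "T \<in> ga.A (M - e)" unfolding T_def
  proof (intro ga.A_scale ga.A_sum)
    fix i assume i: "i \<in> {..M - e}"
    have "u ^ i * v ^ (M - e - i) \<in> ga.A (i + (M - e - i))"
      using u by (intro ga.A_mult ga.A_power1) simp_all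
    then show "u ^ i * v ^ (M - e - i) \<in> ga.A (M - e)" using i by (simp only: atMost_iff le_add_diff_inverse)
  qed
  have Dp: "D p = hder (\<lambda>c a. Phi (g c a)) e M (u p) (v p) (l p)" for p
  proof -
    have "D p = hrel (\<lambda>c a. Phi q * to_ac (of_nat (Suc c) * \<gamma> (Suc c) a)) (e - 1) (M - 1) (u p) (v p) (l p)"
      unfolding D_def scf_apply rel_val_apply hrel_smult ..
    also have "\<dots> = hder (\<lambda>c a. Phi (g c a)) e M (u p) (v p) (l p)"
      unfolding hder_def
    proof (rule hrel_cong)
      fix c a assume "c \<le> e - 1" "a \<le> M - 1 - c"
      then have "Phi (g (Suc c) a) = Phi q * to_ac (\<gamma> (Suc c) a)" using e by (intro g) auto
      then show "Phi q * to_ac (of_nat (Suc c) * \<gamma> (Suc c) a) = of_nat (Suc c) * Phi (g (Suc c) a)"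
        by (simp only: to_ac_mult on mult.left_commute)
    qed
    finally show ?thesis .
  qed
  have Tp: "T p = htop (\<lambda>c a. Phi (g c a)) e M (u p) (v p)" for p
  proof -
    have "T p = (\<Sum>i\<le>M - e. Phi q * (to_ac (\<gamma> e i) * (u p ^ i * v p ^ (M - e - i))))"
      unfolding T_def by (simp add: scf_def sum_apply power_apply sum_distrib_left)
    also have "\<dots> = htop (\<lambda>c a. Phi (g c a)) e M (u p) (v p)"
      unfolding htop_def by (intro sum.cong) (auto simp: g)
    finally show ?thesis .
  qed
  have "hrel (\<lambda>c a. Phi (g c a)) e M (u p) (v p) (l p) = 0" for p
  proof -
    have "hrel (\<lambda>c a. Phi (g c a)) e M (u p) (v p) (l p) = hrel (\<lambda>c a. Phi q * to_ac (\<gamma> c a)) e M (u p) (v p) (l p)"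
      by (rule hrel_cong) (use e in \<open>auto intro!: g\<close>)
    also have "\<dots> = Phi q * gd.rel_val u v l \<gamma> e M p" unfolding hrel_smult rel_val_apply ..
    finally show ?thesis by (simp add: rel)
  qed
  then show ?thesis
    using e DA D0 Dp TA T0 Tp by (intro exI[of _ e] exI[of _ M] exI[of _ g]) blast
qed

lemma mons_exponents: "a \<in> ga.mons m \<Longrightarrow> \<exists>b. (\<Sum>i\<le>n. b i) = m \<and> a = (\<Prod>i\<le>n. xf i ^ b i)"
proof (induction m arbitrary: a)
  case 0
  then have "a = 1" by (simp only: ga.mons.simps singleton_iff)
  moreover have "(\<Prod>i\<le>n. xf i ^ 0) = 1" unfolding power_0 prod.neutral_const ..
  ultimately show ?case by (intro exI[of _ "\<lambda>_. 0"]) (simp only: sum.neutral_const simp_thms)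
next
  case (Suc m)
  then obtain x a' where a: "a = x * a'" "x \<in> xf ` {..n}" "a' \<in> ga.mons m" by auto
  then obtain i where i: "i \<le> n" "x = xf i" by auto
  obtain b where b: "(\<Sum>i\<le>n. b i) = m" "a' = (\<Prod>i\<le>n. xf i ^ b i)" using Suc.IH[OF a(3)] by blast
  define b' where "b' = b(i := Suc (b i))"
  have "(\<Sum>j\<le>n. b' j) = Suc m"
  proof -
    have "(\<Sum>j\<le>n. b' j) = b' i + (\<Sum>j\<in>{..n} - {i}. b' j)" using i by (intro sum.remove) auto
    moreover have "(\<Sum>j\<le>n. b j) = b i + (\<Sum>j\<in>{..n} - {i}. b j)" using i by (intro sum.remove) auto
    moreover have "(\<Sum>j\<in>{..n} - {i}. b' j) = (\<Sum>j\<in>{..n} - {i}. b j)" by (intro sum.cong) (auto simp: b'_def)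
    ultimately show ?thesis using b(1) by (simp add: b'_def)
  qed
  moreover have "a = (\<Prod>j\<le>n. xf j ^ b' j)"
  proof -
    have "(\<Prod>j\<le>n. xf j ^ b' j) = xf i ^ b' i * (\<Prod>j\<in>{..n} - {i}. xf j ^ b' j)" using i by (intro prod.remove) auto
    moreover have "(\<Prod>j\<le>n. xf j ^ b j) = xf i ^ b i * (\<Prod>j\<in>{..n} - {i}. xf j ^ b j)" using i by (intro prod.remove) auto
    moreover have "(\<Prod>j\<in>{..n} - {i}. xf j ^ b' j) = (\<Prod>j\<in>{..n} - {i}. xf j ^ b j)" by (intro prod.cong) (auto simp: b'_def)
    ultimately show ?thesis unfolding a(1) i(2) b(2) by (simp add: b'_def mult.assoc)
  qed
  ultimately show ?case by blast
qed

lemma prod_apply: "(\<Prod>i\<in>S. f i) p = (\<Prod>i\<in>S. f i p)" for f :: "'z \<Rightarrow> 'p \<Rightarrow> 'b::comm_monoid_mult"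
  by (induction S rule: infinite_finite_induct) simp_all

text \<open>A basis of \<open>A m\<close> is taken among the monomials. Independence over the
  function field makes a nontrivial combination with polynomial coefficients a nonzero form, to
  which the count of zeros applies.\<close>

lemma mon_exists:
  "\<exists>B. finite B \<and> (\<forall>b\<in>B. (\<Sum>i\<le>n. b i) = m) \<and> card B \<ge> (\<Sum>j\<le>m. min d (Suc j)) \<and>
      (\<forall>\<gamma> P. (\<exists>b\<in>B. \<gamma> b \<noteq> 0) \<longrightarrow> P \<subseteq> Pts \<longrightarrow> finite P \<longrightarrow> (\<forall>x\<in>P. \<forall>y\<in>P. x \<noteq> y \<longrightarrow> \<not> parallel x y) \<longrightarrow>
        (\<forall>x\<in>P. (\<Sum>b\<in>B. \<gamma> b * mval n b x) = 0) \<longrightarrow> card P \<le> d * m)"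
proof -
  obtain u v where uv: "u \<in> ga.A 1" "v \<in> ga.A 1" "u \<noteq> 0" "ga.red {u, v}" using gd.noether_pair by blast
  obtain B where B: "finite B" "ga.independent B" "ga.span B = ga.A m" "card B = ga.dim (ga.A m)" "B \<subseteq> ga.mons m"
    using gd.A_basis by blast
  have "\<forall>a\<in>B. \<exists>b. (\<Sum>i\<le>n. b i) = m \<and> a = (\<Prod>i\<le>n. xf i ^ b i)" using mons_exponents B(5) by blast
  from bchoice[OF this] obtain \<beta> where \<beta>: "\<And>a. a \<in> B \<Longrightarrow> (\<Sum>i\<le>n. \<beta> a i) = m"
    "\<And>a. a \<in> B \<Longrightarrow> a = (\<Prod>i\<le>n. xf i ^ \<beta> a i)" by blast
  have inj: "inj_on \<beta> B"
  proof (rule inj_onI)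
    fix a b assume ab: "a \<in> B" "b \<in> B" "\<beta> a = \<beta> b"
    show "a = b" using \<beta>(2)[OF ab(1)] \<beta>(2)[OF ab(2)] unfolding ab(3) by (rule trans[OF _ sym])
  qed
  show ?thesis
  proof (intro exI[of _ "\<beta> ` B"] conjI allI impI)
    show "finite (\<beta> ` B)" using B(1) by simp
    show "\<forall>b\<in>\<beta> ` B. (\<Sum>i\<le>n. b i) = m" using \<beta>(1) by blast
    show "card (\<beta> ` B) \<ge> (\<Sum>j\<le>m. min d (Suc j))"
      using gd.dim_lower[OF uv, of m] B(4) by (simp add: card_image[OF inj])
  next
    fix \<gamma> P
    assume \<gamma>: "\<exists>b\<in>\<beta> ` B. \<gamma> b \<noteq> 0" and P: "P \<subseteq> Pts" "finite P"
      and par: "\<forall>x\<in>P. \<forall>y\<in>P. x \<noteq> y \<longrightarrow> \<not> parallel x y"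
      and z: "\<forall>x\<in>P. (\<Sum>b\<in>\<beta> ` B. \<gamma> b * mval n b x) = 0"
    define f where "f = (\<Sum>a\<in>B. scf (to_fract (\<gamma> (\<beta> a))) a)"
    have "f \<in> ga.A m" unfolding f_def B(3)[symmetric] by (intro ga.span_sum ga.span_scale ga.span_base)
    moreover have "f \<noteq> 0"
    proof
      assume "f = 0"
      then have "\<forall>a\<in>B. to_fract (\<gamma> (\<beta> a)) = 0"
        using B(1,2) unfolding f_def by (auto dest: ga.independentD)
      then show False using \<gamma> by auto
    qed
    moreover have "f (vec x) = 0" if x: "x \<in> P" for x
    proof -
      have xP: "x \<in> Pts" using x P by auto
      have m: "a (vec x) = Phi (mval n (\<beta> a) x)" if a: "a \<in> B" for a
      proof -
        have "a (vec x) = (\<Prod>i\<le>n. xf i ^ \<beta> a i) (vec x)" using \<beta>(2)[OF a] by (rule fun_cong)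
        then show ?thesis unfolding prod_apply power_apply xf_vec[OF xP] Phi_hom(5)[unfolded mval_def] mval_def .
      qed
      have "f (vec x) = (\<Sum>a\<in>B. Phi (\<gamma> (\<beta> a)) * Phi (mval n (\<beta> a) x))"
        unfolding f_def sum_apply scf_apply by (intro sum.cong) (auto simp: m)
      also have "\<dots> = Phi (\<Sum>b\<in>\<beta> ` B. \<gamma> b * mval n b x)"
        unfolding sum.reindex[OF inj] o_def Phi_sum to_fract_mult to_ac_mult ..
      finally show ?thesis using z x by simp
    qed
    ultimately show "card P \<le> d * m" using zeros_pts[of f m P] P par by blast
  qed
qed

text \<open>Besides the data, a bound for the degenerate tuples: they are zeros of finitely many
  nonzero forms, so pairwise non-proportional ones are at most \<open>K\<close> in number. Only the
  relations with \<open>c \<le> L\<close> are counted, hence \<open>K\<close> depends on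
  \<open>L\<close>.\<close>

lemma curve_data_exists:
  "\<exists>U V e M g e' M' g'. curve_data n d Pts U V e M g e' M' g' \<and>
    (\<forall>L. \<exists>K. \<forall>P. finite P \<longrightarrow> P \<subseteq> Pts \<longrightarrow> (\<forall>x\<in>P. \<forall>y\<in>P. x \<noteq> y \<longrightarrow> \<not> parallel x y) \<longrightarrow>
      (\<forall>x\<in>P. lf n V x = 0 \<or> (\<exists>i\<le>n. hder (g i) (e i) (M i) (lf n U x) (lf n V x) (x i) = 0) \<or>
        (\<exists>c\<le>L. htop (g' c) (e' c) (M' c) (lf n U x) (lf n V x) = 0)) \<longrightarrow> card P \<le> K)"
proof -
  obtain u v where uv: "u \<in> ga.A 1" "v \<in> ga.A 1" "u \<noteq> 0" "ga.red {u, v}" using gd.noether_pair by blast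
  obtain q U where q: "q \<noteq> 0" "\<forall>x\<in>Pts. scf (to_fract q) u (vec x) = Phi (lf n U x)" using clear_linear[OF uv(1)] by blast
  obtain r V where r: "r \<noteq> 0" "\<forall>x\<in>Pts. scf (to_fract r) v (vec x) = Phi (lf n V x)" using clear_linear[OF uv(2)] by blast
  define u' where "u' = scf (to_fract q) u"
  define v' where "v' = scf (to_fract r) v"
  have uv': "u' \<in> ga.A 1" "v' \<in> ga.A 1" unfolding u'_def v'_def using uv ga.A_scale by blast+
  have red': "ga.red {u', v'}" unfolding u'_def v'_def using q(1) r(1) by (intro ga.red_scale[OF uv(4)]) simp_all
  have u0: "u' \<noteq> 0" unfolding u'_def using uv(3) q(1) by (simp only: ga.scale_eq_0_iff to_fract_eq_0_iff simp_thms)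
  have v0: "v' \<noteq> 0" using gd.v_nonzero[OF uv' red'] .
  define R where "R l e M g \<longleftrightarrow> 0 < e \<and> e \<le> d \<and> e \<le> M \<and>
    (\<exists>m D. D \<in> ga.A m \<and> D \<noteq> 0 \<and> (\<forall>p. D p = hder (\<lambda>c a. Phi (g c a)) e M (u' p) (v' p) (l p))) \<and>
    (\<exists>m T. T \<in> ga.A m \<and> T \<noteq> 0 \<and> (\<forall>p. T p = htop (\<lambda>c a. Phi (g c a)) e M (u' p) (v' p))) \<and>
    (\<forall>p. hrel (\<lambda>c a. Phi (g c a)) e M (u' p) (v' p) (l p) = 0)" for l e M g
  have R: "\<exists>e M g. R l e M g" if "l \<in> ga.A 1" for l
    unfolding R_def by (rule rel_data[OF uv' u0 red' \<open>l \<in> ga.A 1\<close>])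
  have xfA: "xf i \<in> ga.A 1" if "i \<le> n" for i using \<open>i \<le> n\<close> by (intro ga.G_A) auto
  have "\<forall>i. \<exists>t. i \<le> n \<longrightarrow> R (xf i) (fst t) (fst (snd t)) (snd (snd t))"
  proof
    fix i show "\<exists>t. i \<le> n \<longrightarrow> R (xf i) (fst t) (fst (snd t)) (snd (snd t))"
    proof (cases "i \<le> n")
      case True
      obtain e M g where "R (xf i) e M g" using R[OF xfA[OF True]] by blast
      then show ?thesis by (intro exI[of _ "(e, M, g)"]) simp
    qed simp
  qed
  from choice[OF this] obtain F where F: "\<And>i. i \<le> n \<Longrightarrow> R (xf i) (fst (F i)) (fst (snd (F i))) (snd (snd (F i)))" by blast
  \<comment> \<open>Coefficients \<open>c ^ i\<close>: two distinct vectors of length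
    \<open>n + 1\<close> have equal values under at most \<open>n\<close> of these forms, so a small
    \<open>c\<close> separates finitely many vectors.\<close>
  define lam where "lam c = (\<Sum>i\<le>n. scf (to_fract (of_nat c ^ i)) (xf i))" for c :: nat
  have lamA: "lam c \<in> ga.A 1" for c unfolding lam_def by (intro ga.A_sum ga.A_scale xfA) auto
  have "\<forall>c. \<exists>t. R (lam c) (fst t) (fst (snd t)) (snd (snd t))"
  proof
    fix c
    obtain e M g where "R (lam c) e M g" using R[OF lamA] by blast
    then show "\<exists>t. R (lam c) (fst t) (fst (snd t)) (snd (snd t))" by (intro exI[of _ "(e, M, g)"]) simp
  qed
  from choice[OF this] obtain F' where F': "\<And>c. R (lam c) (fst (F' c)) (fst (snd (F' c))) (snd (snd (F' c)))" by blast
  define e M g where "e i = fst (F i)" and "M i = fst (snd (F i))" and "g i = snd (snd (F i))" for i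
  define e' M' g' where "e' i = fst (F' i)" and "M' i = fst (snd (F' i))" and "g' i = snd (snd (F' i))" for i
  have F: "R (xf i) (e i) (M i) (g i)" if "i \<le> n" for i using F[OF \<open>i \<le> n\<close>] by (simp add: e_def M_def g_def)
  have F': "R (lam c) (e' c) (M' c) (g' c)" for c using F'[of c] by (simp add: e'_def M'_def g'_def)
  have ux: "u' (vec x) = Phi (lf n U x)" and vx: "v' (vec x) = Phi (lf n V x)" if "x \<in> Pts" for x
    using q(2) r(2) \<open>x \<in> Pts\<close> by (simp_all add: u'_def v'_def)
  have lamx: "lam c (vec x) = Phi (lf n (\<lambda>i. of_nat c ^ i) x)" if x: "x \<in> Pts" for c x
    unfolding lam_def lf_def sum_apply scf_apply xf_vec[OF x] Phi_sum to_fract_mult to_ac_mult ..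
  have Phi0: "Phi a = 0 \<longleftrightarrow> a = 0" for a by simp
  have cd: "curve_data n d Pts U V e M g e' M' g'"
  proof
    show "d > 0" by (rule gd.d_pos)
    show "x i = 0" if "x \<in> Pts" "n < i" for x i using that by (simp add: Pts_def)
    show "0 < e i" "e i \<le> M i" if "i \<le> n" for i using F[OF that] by (simp_all add: R_def)
    show "e' c \<le> d" "e' c \<le> M' c" for c using F'[of c] by (simp_all add: R_def)
    show "hrel (g i) (e i) (M i) (lf n U x) (lf n V x) (x i) = 0" if x: "x \<in> Pts" and i: "i \<le> n" for x i
    proof -
      have "hrel (\<lambda>c a. Phi (g i c a)) (e i) (M i) (u' (vec x)) (v' (vec x)) (xf i (vec x)) = 0"
        using F[OF i] by (simp only: R_def simp_thms)
      then show ?thesis unfolding ux[OF x] vx[OF x] xf_vec[OF x] Phi_hom(1)[symmetric] Phi0 .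
    qed
    show "hrel (g' c) (e' c) (M' c) (lf n U x) (lf n V x) (lf n (\<lambda>i. of_nat c ^ i) x) = 0" if x: "x \<in> Pts" for x c
    proof -
      have "hrel (\<lambda>b a. Phi (g' c b a)) (e' c) (M' c) (u' (vec x)) (v' (vec x)) (lam c (vec x)) = 0"
        using F'[of c] by (simp only: R_def simp_thms)
      then show ?thesis unfolding ux[OF x] vx[OF x] lamx[OF x] Phi_hom(1)[symmetric] Phi0 .
    qed
  qed (rule mon_exists)
  have bd: "\<exists>K. \<forall>P. finite P \<longrightarrow> P \<subseteq> Pts \<longrightarrow> (\<forall>x\<in>P. \<forall>y\<in>P. x \<noteq> y \<longrightarrow> \<not> parallel x y) \<longrightarrow>
      (\<forall>x\<in>P. lf n V x = 0 \<or> (\<exists>i\<le>n. hder (g i) (e i) (M i) (lf n U x) (lf n V x) (x i) = 0) \<or>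
        (\<exists>c\<le>L. htop (g' c) (e' c) (M' c) (lf n U x) (lf n V x) = 0)) \<longrightarrow> card P \<le> K" for L
  proof -
    have "\<forall>i. \<exists>t. i \<le> n \<longrightarrow> snd t \<in> ga.A (fst t) \<and> snd t \<noteq> 0 \<and>
        (\<forall>p. snd t p = hder (\<lambda>c a. Phi (g i c a)) (e i) (M i) (u' p) (v' p) (xf i p))"
    proof
      fix i show "\<exists>t. i \<le> n \<longrightarrow> snd t \<in> ga.A (fst t) \<and> snd t \<noteq> 0 \<and>
        (\<forall>p. snd t p = hder (\<lambda>c a. Phi (g i c a)) (e i) (M i) (u' p) (v' p) (xf i p))"
      proof (cases "i \<le> n")
        case True
        then obtain m D where "D \<in> ga.A m" "D \<noteq> 0"
          "\<forall>p. D p = hder (\<lambda>c a. Phi (g i c a)) (e i) (M i) (u' p) (v' p) (xf i p)"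
          using F[OF True] unfolding R_def by (elim exE conjE)
        then show ?thesis by (intro exI[of _ "(m, D)"]) (simp only: fst_conv snd_conv simp_thms)
      qed simp
    qed
    from choice[OF this] obtain D where D: "\<And>i. i \<le> n \<Longrightarrow> snd (D i) \<in> ga.A (fst (D i))" "\<And>i. i \<le> n \<Longrightarrow> snd (D i) \<noteq> 0"
      "\<And>i p. i \<le> n \<Longrightarrow> snd (D i) p = hder (\<lambda>c a. Phi (g i c a)) (e i) (M i) (u' p) (v' p) (xf i p)" by blast
    have "\<forall>c. \<exists>t. snd t \<in> ga.A (fst t) \<and> snd t \<noteq> 0 \<and>
        (\<forall>p. snd t p = htop (\<lambda>b a. Phi (g' c b a)) (e' c) (M' c) (u' p) (v' p))"
    proof
      fix c
      obtain m T where "T \<in> ga.A m" "T \<noteq> 0"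
          "\<forall>p. T p = htop (\<lambda>b a. Phi (g' c b a)) (e' c) (M' c) (u' p) (v' p)"
        using F'[of c] unfolding R_def by (elim exE conjE)
      then show "\<exists>t. snd t \<in> ga.A (fst t) \<and> snd t \<noteq> 0 \<and>
        (\<forall>p. snd t p = htop (\<lambda>b a. Phi (g' c b a)) (e' c) (M' c) (u' p) (v' p))"
        by (intro exI[of _ "(m, T)"]) (simp only: fst_conv snd_conv simp_thms)
    qed
    from choice[OF this] obtain T where T: "\<And>c. snd (T c) \<in> ga.A (fst (T c))" "\<And>c. snd (T c) \<noteq> 0"
      "\<And>c p. snd (T c) p = htop (\<lambda>b a. Phi (g' c b a)) (e' c) (M' c) (u' p) (v' p)" by blast
    define K where "K = d * 1 + (\<Sum>i\<le>n. d * fst (D i)) + (\<Sum>c\<le>L. d * fst (T c))"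
    have "card P \<le> K"
      if P: "finite P" "P \<subseteq> Pts" "\<forall>x\<in>P. \<forall>y\<in>P. x \<noteq> y \<longrightarrow> \<not> parallel x y"
        and bad: "\<forall>x\<in>P. lf n V x = 0 \<or> (\<exists>i\<le>n. hder (g i) (e i) (M i) (lf n U x) (lf n V x) (x i) = 0) \<or>
        (\<exists>c\<le>L. htop (g' c) (e' c) (M' c) (lf n U x) (lf n V x) = 0)" for P
    proof -
      define PV where "PV = {x \<in> P. lf n V x = 0}"
      define PD where "PD i = {x \<in> P. hder (g i) (e i) (M i) (lf n U x) (lf n V x) (x i) = 0}" for i
      define PT where "PT c = {x \<in> P. htop (g' c) (e' c) (M' c) (lf n U x) (lf n V x) = 0}" for c
      have sub: "card Q \<le> d * m" if Q: "Q \<subseteq> P" and f: "f \<in> ga.A m" "f \<noteq> 0" and z: "\<And>x. x \<in> Q \<Longrightarrow> f (vec x) = 0" for Q f m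
      proof (rule zeros_pts[OF f])
        show "finite Q" using P(1) Q finite_subset by blast
        show "Q \<subseteq> Pts" using P(2) Q by blast
        show "\<forall>x\<in>Q. \<forall>y\<in>Q. x \<noteq> y \<longrightarrow> \<not> parallel x y" using P(3) Q by blast
      qed (rule z)
      have "card PV \<le> d * 1"
      proof (rule sub[OF _ uv'(2) v0])
        fix x assume x: "x \<in> PV"
        then have "x \<in> Pts" using P(2) by (auto simp: PV_def)
        then show "v' (vec x) = 0" using x by (simp add: vx PV_def)
      qed (auto simp: PV_def)
      moreover have "card (PD i) \<le> d * fst (D i)" if i: "i \<le> n" for i
      proof (rule sub[OF _ D(1,2)[OF i]])
        fix x assume x: "x \<in> PD i"
        then have xP: "x \<in> Pts" using P(2) by (auto simp: PD_def)
        have "snd (D i) (vec x) = Phi (hder (g i) (e i) (M i) (lf n U x) (lf n V x) (x i))"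
          unfolding D(3)[OF i] ux[OF xP] vx[OF xP] xf_vec[OF xP] Phi_hom(2) ..
        then show "snd (D i) (vec x) = 0" using x by (simp add: PD_def)
      qed (auto simp: PD_def)
      moreover have "card (PT c) \<le> d * fst (T c)" for c
      proof (rule sub[OF _ T(1,2)])
        fix x assume x: "x \<in> PT c"
        then have xP: "x \<in> Pts" using P(2) by (auto simp: PT_def)
        have "snd (T c) (vec x) = Phi (htop (g' c) (e' c) (M' c) (lf n U x) (lf n V x))"
          unfolding T(3) ux[OF xP] vx[OF xP] Phi_hom(3) ..
        then show "snd (T c) (vec x) = 0" using x by (simp add: PT_def)
      qed (auto simp: PT_def)
      ultimately have "card PV \<le> d * 1" "(\<Sum>i\<le>n. card (PD i)) \<le> (\<Sum>i\<le>n. d * fst (D i))"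
        "(\<Sum>c\<le>L. card (PT c)) \<le> (\<Sum>c\<le>L. d * fst (T c))" by (auto intro!: sum_mono)
      moreover have "P \<subseteq> PV \<union> (\<Union>i\<le>n. PD i) \<union> (\<Union>c\<le>L. PT c)"
        using bad by (auto simp: PV_def PD_def PT_def)
      then have "card P \<le> card (PV \<union> (\<Union>i\<le>n. PD i) \<union> (\<Union>c\<le>L. PT c))"
        using P(1) by (intro card_mono) (auto simp: PV_def PD_def PT_def)
      moreover have "\<dots> \<le> card PV + card (\<Union>i\<le>n. PD i) + card (\<Union>c\<le>L. PT c)"
        using card_Un_le[of "PV \<union> (\<Union>i\<le>n. PD i)" "\<Union>c\<le>L. PT c"] card_Un_le[of PV "\<Union>i\<le>n. PD i"] by linarith
      moreover have "card (\<Union>i\<le>n. PD i) \<le> (\<Sum>i\<le>n. card (PD i))" by (rule card_UN_le) simp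
      moreover have "card (\<Union>c\<le>L. PT c) \<le> (\<Sum>c\<le>L. card (PT c))" by (rule card_UN_le) simp
      ultimately show ?thesis unfolding K_def by linarith
    qed
    then show ?thesis by (intro exI[of _ K]) blast
  qed
  show ?thesis by (intro exI conjI, rule cd, rule allI, rule bd)
qed

end

context curve
begin

lemma degree_pos: "d > 0"
  using hilbert_linear by blast

lemma good_curve_data:
  "\<exists>U V e M g e' M' g'. curve_data n d Pts U V e M g e' M' g' \<and>
    (\<forall>L. \<exists>K. \<forall>P. finite P \<longrightarrow> P \<subseteq> Pts \<longrightarrow> (\<forall>x\<in>P. \<forall>y\<in>P. x \<noteq> y \<longrightarrow> \<not> parallel x y) \<longrightarrow>
      (\<forall>x\<in>P. lf n V x = 0 \<or> (\<exists>i\<le>n. hder (g i) (e i) (M i) (lf n U x) (lf n V x) (x i) = 0) \<or>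
        (\<exists>c\<le>L. htop (g' c) (e' c) (M' c) (lf n U x) (lf n V x) = 0)) \<longrightarrow> card P \<le> K)"
proof -
  obtain e0 m0 where "\<And>m. m \<ge> m0 \<Longrightarrow> int (ga.dim (ga.A m)) = int d * int m + e0" using hilbert_linear by blast
  then interpret curve_dim n C d e0 m0 by unfold_locales
  show ?thesis by (rule curve_data_exists)
qed

end

section \<open>Charts on the space of sections\<close>

lemma polys_induct [consumes 1, case_names const coord add mult]:
  assumes "f \<in> polys N" and const: "\<And>c. P (\<lambda>x. c)" and coord: "\<And>j. j < N \<Longrightarrow> P (\<lambda>x. x j)"
    and add: "\<And>f g. P f \<Longrightarrow> P g \<Longrightarrow> P (\<lambda>x. f x + g x)" and mult: "\<And>f g. P f \<Longrightarrow> P g \<Longrightarrow> P (\<lambda>x. f x * g x)"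
  shows "P f"
proof -
  have sum: "P (\<lambda>x. \<Sum>j\<le>D. h j x)" if "\<And>j. P (h j)" for h :: "nat \<Rightarrow> pt \<Rightarrow> complex" and D :: nat
    by (induction D) (simp_all add: add \<open>\<And>j. P (h j)\<close>)
  have pow: "P (\<lambda>x. h x ^ j)" if "P h" for h :: "pt \<Rightarrow> complex" and j :: nat
    by (induction j) (simp_all add: const mult \<open>P h\<close>)
  obtain D where "f \<in> polyfun N D" using assms(1) by (auto simp: polys_def)
  have "i \<le> N \<Longrightarrow> f \<in> polyfun i D \<Longrightarrow> P f" for i f
  proof (induction i arbitrary: f)
    case 0
    then show ?case using const by auto
  next
    case (Suc i)
    obtain c where c: "\<And>j. c j \<in> polyfun i D" "f = (\<lambda>x. \<Sum>j\<le>D. c j x * x i ^ j)"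
      using Suc.prems(2) by (rule polyfun_SucE) blast
    have "P (c j)" for j using Suc.IH[OF _ c(1)] Suc.prems(1) by simp
    then show ?case unfolding c(2) using Suc.prems by (intro sum mult pow coord) auto
  qed
  then show ?thesis using \<open>f \<in> polyfun N D\<close> by blast
qed

lemma dvd_of_expand:
  assumes "fps_X ^ k dvd expand t0 p"
  shows "[:- t0, 1:] ^ k dvd p"
proof -
  define q where "q = pcompose p [:t0, 1:]"
  have "Polynomial.coeff q j = 0" if "j < k" for j
    using fps_X_power_dvd_nth[OF assms that] by (simp add: expand_def q_def)
  then have "Polynomial.monom 1 k dvd q" by (simp add: monom_1_dvd_iff')
  then obtain r where "q = Polynomial.monom 1 k * r" by (elim dvdE)
  then have "pcompose q [:- t0, 1:] = pcompose (Polynomial.monom 1 k) [:- t0, 1:] * pcompose r [:- t0, 1:]"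
    by (simp add: pcompose_mult)
  moreover have "pcompose q [:- t0, 1:] = p"
    unfolding q_def pcompose_assoc[symmetric] by (simp add: pcompose_pCons)
  moreover have "pcompose (Polynomial.monom 1 k) [:- t0, 1:] = [:- t0, 1:] ^ k"
    by (induction k) (simp_all add: monom_Suc pcompose_pCons monom_0)
  ultimately show ?thesis by (metis dvd_triv_left)
qed

lemma poly_sum_monom_lt:
  assumes "p = 0 \<or> Polynomial.degree p < b"
  shows "(\<Sum>j<b. Polynomial.monom (Polynomial.coeff p j) j) = p"
proof (rule poly_eqI)
  fix m
  have "Polynomial.coeff (\<Sum>j<b. Polynomial.monom (Polynomial.coeff p j) j) m = (\<Sum>j<b. if j = m then Polynomial.coeff p m else 0)"
    by (simp add: coeff_sum cong: if_cong)
  also have "\<dots> = (if m < b then Polynomial.coeff p m else 0)" by simp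
  also have "\<dots> = Polynomial.coeff p m" using assms by (auto simp: coeff_eq_0)
  finally show "Polynomial.coeff (\<Sum>j<b. Polynomial.monom (Polynomial.coeff p j) j) m = Polynomial.coeff p m" .
qed

definition cvec :: "(nat \<Rightarrow> complex poly) \<Rightarrow> nat \<times> nat \<Rightarrow> complex" where
  "cvec x = (\<lambda>(i, j). Polynomial.coeff (x i) j)"

lemma coeff_point_eq: "coeff_point x = proj_class (cvec x)"
  by (simp add: coeff_point_def cvec_def)

definition primitive :: "nat \<Rightarrow> (nat \<Rightarrow> complex poly) \<Rightarrow> bool" where
  "primitive n x \<longleftrightarrow> (\<forall>q. (\<forall>i\<le>n. q dvd x i) \<longrightarrow> is_unit q)"

text \<open>Write the quotient of \<open>x i0\<close> by \<open>y i0\<close> as a reduced fraction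
  \<open>a / c\<close>; then \<open>a\<close> divides every \<open>x j\<close> and is a unit, so the
  factor of proportionality is a polynomial.\<close>

lemma primitive_multiple:
  assumes prim: "primitive n x" and par: "\<And>i j. x i * y j = x j * y i" and supp: "\<And>i. i > n \<Longrightarrow> x i = 0"
    and y: "y i0 \<noteq> 0" and x: "x i0 \<noteq> 0"
  shows "\<exists>c. c \<noteq> 0 \<and> (\<forall>j. y j = c * x j)"
proof -
  define r where "r = to_fract (x i0) / to_fract (y i0)"
  obtain a c where ac: "quot_of_fract r = (a, c)" by (cases "quot_of_fract r") auto
  have c0: "c \<noteq> 0" using snd_quot_of_fract_nonzero[of r] ac by simp
  have cop: "coprime a c" using coprime_quot_of_fract[of r] ac by simp
  have "r = to_fract a / to_fract c"
    using quot_to_fract_quot_of_fract[of r] ac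
    by (simp add: quot_to_fract_def to_fract_def c0 One_fract_def)
  then have "to_fract (x i0 * c) = to_fract (a * y i0)" using y c0 by (simp add: r_def field_simps)
  then have xc: "x i0 * c = a * y i0" by (simp only: to_fract_eq_iff)
  have eq: "a * y j = c * x j" for j
  proof -
    have "y i0 * (a * y j) = y i0 * (c * x j)" using xc par[of i0 j] by (metis mult.assoc mult.commute)
    then show ?thesis using y by simp
  qed
  have "a dvd x j" for j using eq[of j] cop by (metis coprime_dvd_mult_right_iff dvd_triv_left)
  then have "is_unit a" using prim by (simp add: primitive_def)
  then obtain a' where a': "1 = a * a'" by (elim dvdE)
  have "y j = (a' * c) * x j" for j
  proof -
    have "y j = a' * (a * y j)" using a' by (metis mult.assoc mult.commute mult_1)
    then show ?thesis by (simp add: eq mult.assoc)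
  qed
  moreover have "a' * c \<noteq> 0" using a' c0 by auto
  ultimately show ?thesis by blast
qed

context curve
begin

section \<open>Points of bounded height as primitive tuples\<close>

definition sections :: "nat \<Rightarrow> (nat \<Rightarrow> complex poly) set" where
  "sections b = {x \<in> Pts. (\<forall>i\<le>n. Polynomial.degree (x i) < b) \<and> primitive n x}"

lemma Pts_scale:
  assumes "x \<in> Pts" "c \<noteq> 0"
  shows "(\<lambda>i. Polynomial.smult c (x i)) \<in> Pts"
proof -
  have "vec (\<lambda>i. Polynomial.smult c (x i)) = (\<lambda>i. to_ac (to_fract [:c:]) * vec x i)"
  proof
    fix i
    have "Polynomial.smult c (x i) = [:c:] * x i" by simp
    then show "vec (\<lambda>i. Polynomial.smult c (x i)) i = to_ac (to_fract [:c:]) * vec x i"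
      unfolding vec_def by (simp only: to_fract_mult to_ac_mult)
  qed
  then have "vec (\<lambda>i. Polynomial.smult c (x i)) \<in> proj_class (vec x)"
    using assms(2) unfolding proj_class_def by (intro CollectI exI[of _ "to_ac (to_fract [:c:])"]) simp
  then have "proj_class (vec (\<lambda>i. Polynomial.smult c (x i))) = proj_class (vec x)" by (rule proj_class_eq)
  then have "proj_class (vec (\<lambda>i. Polynomial.smult c (x i))) \<in> C"
    using cone_class[of "vec x"] assms(1) by (simp add: Pts_def)
  then show ?thesis using assms(1) class_cone by (simp add: Pts_def)
qed

lemma sections_scale:
  assumes "x \<in> sections b" "c \<noteq> 0"
  shows "(\<lambda>i. Polynomial.smult c (x i)) \<in> sections b"
  using assms Pts_scale[of x c] by (simp add: sections_def primitive_def dvd_smult_iff)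

lemma coeff_point_scale: "c \<noteq> 0 \<Longrightarrow> coeff_point (\<lambda>i. Polynomial.smult c (x i)) = coeff_point x"
proof -
  assume "c \<noteq> 0"
  then have "cvec (\<lambda>i. Polynomial.smult c (x i)) \<in> proj_class (cvec x)"
    unfolding proj_class_def by (intro CollectI exI[of _ c]) (auto simp: cvec_def)
  then show ?thesis unfolding coeff_point_eq by (rule proj_class_eq)
qed

lemma Pts_nonzero: "x \<in> Pts \<Longrightarrow> \<exists>i\<le>n. x i \<noteq> 0"
  using cone_nonzero[of "vec x"] by (auto simp: Pts_def vec_def)

lemma points_below_iff:
  "(\<exists>p\<in>points_below n C b. coprime_rep n p x) \<longleftrightarrow> x \<in> sections b"
proof
  assume "\<exists>p\<in>points_below n C b. coprime_rep n p x"
  then obtain p where p: "p \<in> rational_points n C" "height n p < b" "coprime_rep n p x"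
    by (auto simp: points_below_def)
  have x: "p = proj_class (\<lambda>i. to_fract (x i))" "\<forall>i>n. x i = 0" "primitive n x"
    using p(3) by (auto simp: coprime_rep_def primitive_def)
  have "(\<lambda>i. to_fract (x i)) \<in> p" unfolding x(1) by (rule proj_class_self)
  moreover have "\<forall>v\<in>p. proj_class (\<lambda>i. to_ac (v i)) \<in> C" using p(1) by (simp add: rational_points_def)
  ultimately have "proj_class (vec x) \<in> C" unfolding vec_def by (rule bspec[rotated])
  moreover have "Polynomial.degree (x i) < b" if "i \<le> n" for i
  proof -
    have "Polynomial.degree (x i) \<le> Max ((\<lambda>i. Polynomial.degree (x i)) ` {..n})" using that by (intro Max_ge) auto
    then show ?thesis using p(2) unfolding height_eq[OF p(3)] by (rule le_less_trans)
  qed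
  ultimately show "x \<in> sections b" using x class_cone by (simp add: sections_def Pts_def)
next
  assume x: "x \<in> sections b"
  define p where "p = proj_class (\<lambda>i. to_fract (x i))"
  have rep: "coprime_rep n p x" using x by (auto simp: coprime_rep_def p_def sections_def primitive_def Pts_def)
  have "x \<in> Pts" using x by (simp add: sections_def)
  then have "p \<in> proj_space {..n}"
    unfolding p_def proj_space_def using Pts_nonzero[of x]
    by (intro CollectI exI[of _ "\<lambda>i. to_fract (x i)"]) (auto simp: Pts_def)
  moreover have "proj_class (\<lambda>i. to_ac (v i)) \<in> C" if vp: "v \<in> p" for v
  proof -
    obtain c where c: "c \<noteq> 0" "v = (\<lambda>i. c * to_fract (x i))" using vp by (auto simp: p_def proj_class_def)
    have "(\<lambda>i. to_ac (v i)) \<in> proj_class (vec x)"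
      unfolding proj_class_def using c by (intro CollectI exI[of _ "to_ac c"]) (auto simp: vec_def)
    then have "proj_class (\<lambda>i. to_ac (v i)) = proj_class (vec x)" by (rule proj_class_eq)
    then show ?thesis using cone_class[of "vec x"] \<open>x \<in> Pts\<close> by (simp add: Pts_def)
  qed
  moreover have "height n p < b"
    unfolding height_eq[OF rep] using x by (subst Max_less_iff) (auto simp: sections_def)
  ultimately have "p \<in> points_below n C b" by (simp add: points_below_def rational_points_def)
  then show "\<exists>p\<in>points_below n C b. coprime_rep n p x" using rep by blast
qed

lemma bounded_height_space_eq:
  "bounded_height_space n C b = subtopology (zariski id ({..n} \<times> {..<b})) (coeff_point ` sections b)"
  unfolding bounded_height_space_def points_below_iff by (simp add: image_def conj_commute Bex_def)

lemma cvec_supp: "x \<in> sections b \<Longrightarrow> ij \<notin> {..n} \<times> {..<b} \<Longrightarrow> cvec x ij = 0"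
proof -
  assume x: "x \<in> sections b" and ij: "ij \<notin> {..n} \<times> {..<b}"
  obtain i j where [simp]: "ij = (i, j)" by (cases ij)
  show ?thesis
  proof (cases "i \<le> n")
    case True
    then have "Polynomial.degree (x i) < b" "b \<le> j" using x ij by (auto simp: sections_def)
    then show ?thesis by (simp add: cvec_def coeff_eq_0)
  next
    case False
    then show ?thesis using x by (simp add: cvec_def sections_def Pts_def)
  qed
qed

lemma sections_proj: "coeff_point ` sections b \<subseteq> proj_space ({..n} \<times> {..<b})"
proof clarify
  fix x assume x: "x \<in> sections b"
  then have "x \<in> Pts" by (simp add: sections_def)
  then obtain i where i: "i \<le> n" "x i \<noteq> 0" using Pts_nonzero by blast
  then have "cvec x (i, Polynomial.degree (x i)) \<noteq> 0" by (simp add: cvec_def)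
  moreover have "(i, Polynomial.degree (x i)) \<in> {..n} \<times> {..<b}" using x i by (auto simp: sections_def)
  ultimately show "coeff_point x \<in> proj_space ({..n} \<times> {..<b})"
    unfolding proj_space_def coeff_point_eq using cvec_supp[OF x]
    by (intro CollectI exI[of _ "cvec x"]) blast
qed

lemma parallel_sections:
  assumes "x \<in> sections b" "y \<in> sections b" "parallel x y"
  shows "\<exists>c. c \<noteq> 0 \<and> (\<forall>i. y i = Polynomial.smult c (x i))"
proof -
  have Pts: "x \<in> Pts" "y \<in> Pts" using assms by (auto simp: sections_def)
  obtain j where j: "y j \<noteq> 0" using Pts_nonzero[OF Pts(2)] by blast
  obtain i where i: "x i \<noteq> 0" using Pts_nonzero[OF Pts(1)] by blast
  have par: "x i * y j = x j * y i" for i j using assms(3) by (auto simp: parallel_def)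
  have xj: "x j \<noteq> 0" using par[of i j] i j by auto
  obtain q where q: "q \<noteq> 0" "\<And>i. y i = q * x i"
    using primitive_multiple[of n x y j, OF _ par _ j xj] assms(1) by (auto simp: sections_def Pts_def)
  have "is_unit q" using assms(2) q(2) by (simp add: sections_def primitive_def)
  then obtain c where "q = [:c:]" "c \<noteq> 0" by (auto simp: is_unit_poly_iff dvd_field_iff)
  then show ?thesis using q(2) by (intro exI[of _ c]) simp
qed

end

text \<open>\<open>\<alpha>\<close> is the \<open>k\<close>-jet of \<open>p / q\<close> at
  \<open>t0\<close>, stated without division so that the conditions are polynomial in all the
  data.\<close>

definition pjets :: "complex \<Rightarrow> nat \<Rightarrow> complex poly \<Rightarrow> complex poly \<Rightarrow> pt \<Rightarrow> bool" where
  "pjets t0 k p q \<alpha> \<longleftrightarrow> (\<forall>j<k. (\<Sum>i\<le>j. \<alpha> i * fps_nth (expand t0 q) (j - i)) = fps_nth (expand t0 p) j)"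

lemma pjets_parallel:
  assumes "pjets t0 k p q \<alpha>" "pjets t0 k p' q' \<alpha>"
  shows "[:- t0, 1:] ^ k dvd p * q' - p' * q"
proof (rule dvd_of_expand)
  define a where "a = Abs_fps \<alpha>"
  have nth: "fps_nth (a * expand t0 q) j = (\<Sum>i\<le>j. \<alpha> i * fps_nth (expand t0 q) (j - i))" for q j
    by (simp add: a_def fps_mult_nth atLeast0AtMost)
  have dvd: "fps_X ^ k dvd expand t0 p - a * expand t0 q" if "pjets t0 k p q \<alpha>" for p q
    using that unfolding pjets_def nth[symmetric] by (intro fps_X_power_dvdI) simp
  have "expand t0 (p * q' - p' * q) = (expand t0 p - a * expand t0 q) * expand t0 q' - (expand t0 p' - a * expand t0 q') * expand t0 q"
    by (simp add: expand_diff expand_mult algebra_simps)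
  then show "fps_X ^ k dvd expand t0 (p * q' - p' * q)"
    using dvd[OF assms(1)] dvd[OF assms(2)] by simp
qed

locale chart = curve n C d + cd: curve_data n d "curve.Pts n C" U V e M g e' M' g'
  for n C d U V e M g e' M' g' +
  fixes b k :: nat and t0 :: complex
begin

abbreviation Idx :: "(nat \<times> nat) set" where "Idx \<equiv> {..n} \<times> {..<b}"

definition N :: nat where "N = k + Suc n * b"

text \<open>A vector \<open>w\<close> encodes a tuple of polynomials together with the \<open>k\<close>-jet at \<open>t0\<close> of the quotient of
  its values under the linear forms \<open>U\<close> and \<open>V\<close>: the first \<open>k\<close> entries are the coefficients of the jet, and
  the entry with index \<open>k + i b + j\<close> is the coefficient of \<open>t\<^sup>j\<close> in the \<open>i\<close>-th polynomial.\<close>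

definition tup :: "pt \<Rightarrow> nat \<Rightarrow> complex poly" where
  "tup w i = (if i \<le> n then \<Sum>j<b. Polynomial.monom (w (k + i * b + j)) j else 0)"

definition lam :: "(nat \<Rightarrow> complex poly) \<Rightarrow> complex" where
  "lam x = poly (lf n V x) t0"

definition jets :: "pt \<Rightarrow> (nat \<Rightarrow> complex poly) \<Rightarrow> bool" where
  "jets \<alpha> x \<longleftrightarrow> pjets t0 k (lf n U x) (lf n V x) \<alpha>"

definition enc :: "(nat \<Rightarrow> complex poly) \<Rightarrow> pt" where
  "enc x m = (if m < k then fps_nth (expand t0 (lf n U x) * inverse (expand t0 (lf n V x))) m
    else if m < N then Polynomial.coeff (x ((m - k) div b)) ((m - k) mod b) else 0)"

text \<open>Requiring \<open>lam = 1\<close> singles out one vector in each projective class on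
  which \<open>lam\<close> does not vanish, and so turns this open part of projective space into an
  affine set.\<close>

definition normal :: "pt \<Rightarrow> bool" where
  "normal w \<longleftrightarrow> lam (tup w) = 1 \<and> jets w (tup w)"

lemma idx_bound: "i \<le> n \<Longrightarrow> j < b \<Longrightarrow> k + i * b + j < N"
proof -
  assume "i \<le> n" "j < b"
  then have "i * b + j < Suc i * b" "Suc i * b \<le> Suc n * b" by (auto intro!: mult_le_mono1)
  then have "i * b + j < Suc n * b" by (rule less_le_trans)
  then show ?thesis by (simp only: N_def add.assoc nat_add_left_cancel_less)
qed

lemma coeff_tup: "Polynomial.coeff (tup w i) j = (if i \<le> n \<and> j < b then w (k + i * b + j) else 0)"
proof -
  have "Polynomial.coeff (\<Sum>j'<b. Polynomial.monom (w (k + i * b + j')) j') j = (\<Sum>j'<b. if j' = j then w (k + i * b + j) else 0)"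
    unfolding coeff_sum by (intro sum.cong) auto
  also have "\<dots> = (if j < b then w (k + i * b + j) else 0)" by simp
  finally show ?thesis by (simp add: tup_def)
qed

lemma cvec_tup: "cvec (tup w) (i, j) = (if i \<le> n \<and> j < b then w (k + i * b + j) else 0)"
  by (simp add: cvec_def coeff_tup)

lemma tup_enc:
  assumes "\<And>i. i > n \<Longrightarrow> x i = 0" "\<And>i. i \<le> n \<Longrightarrow> Polynomial.degree (x i) < b"
  shows "tup (enc x) = x"
proof
  fix i
  show "tup (enc x) i = x i"
  proof (rule poly_eqI)
    fix j
    show "Polynomial.coeff (tup (enc x) i) j = Polynomial.coeff (x i) j"
    proof (cases "i \<le> n \<and> j < b")
      case True
      then have "(i * b + j) div b = i" "(i * b + j) mod b = j" by auto
      then show ?thesis using True idx_bound[of i j] by (simp add: coeff_tup enc_def add.assoc)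
    next
      case False
      then have "Polynomial.coeff (x i) j = 0" using assms[of i] by (cases "i \<le> n") (auto intro!: coeff_eq_0)
      then show ?thesis using False by (auto simp: coeff_tup)
    qed
  qed
qed

lemma jets_enc: "lam x \<noteq> 0 \<Longrightarrow> jets (enc x) x"
  unfolding jets_def pjets_def
proof (intro allI impI)
  fix j assume lam: "lam x \<noteq> 0" and j: "j < k"
  let ?u = "expand t0 (lf n U x)" and ?v = "expand t0 (lf n V x)"
  have "?v * inverse ?v = 1" using lam by (intro fps_unit) (simp add: expand_nth_0 lam_def)
  then have "?u = (?u * inverse ?v) * ?v" by (simp add: mult.assoc mult.commute[of "inverse ?v"])
  then have "fps_nth ?u j = fps_nth ((?u * inverse ?v) * ?v) j" by (rule arg_cong)
  also have "\<dots> = (\<Sum>i\<le>j. fps_nth (?u * inverse ?v) i * fps_nth ?v (j - i))"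
    by (subst fps_mult_nth) (simp add: atLeast0AtMost)
  also have "\<dots> = (\<Sum>i\<le>j. enc x i * fps_nth ?v (j - i))"
    using j by (intro sum.cong) (auto simp: enc_def)
  finally show "(\<Sum>i\<le>j. enc x i * fps_nth ?v (j - i)) = fps_nth ?u j" ..
qed

lemma linear_tup:
  assumes "\<And>p q. ll (p + q) = ll p + ll q" "\<And>c p. ll (Polynomial.smult c p) = c * ll p"
  shows "ll (tup w i) = (if i \<le> n then \<Sum>j<b. w (k + i * b + j) * ll (Polynomial.monom 1 j) else (0::complex))"
proof -
  have 0: "ll 0 = 0" using assms(2)[of 0 0] by simp
  have s: "ll (\<Sum>j<b. f j) = (\<Sum>j<b. ll (f j))" for f by (induction b) (simp_all add: 0 assms(1))
  have m: "ll (Polynomial.monom c j) = c * ll (Polynomial.monom 1 j)" for c j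
    using assms(2)[of c "Polynomial.monom 1 j"] by (simp add: smult_monom)
  show ?thesis by (auto simp: tup_def 0 s intro!: sum.cong m)
qed

lemma linear_tup_polys:
  assumes "\<And>p q. ll (p + q) = ll p + ll q" "\<And>c p. ll (Polynomial.smult c p) = c * ll p"
  shows "(\<lambda>w. ll (tup w i)) \<in> polys N"
proof (cases "i \<le> n")
  case True
  then have "(\<lambda>w. \<Sum>j<b. w (k + i * b + j) * ll (Polynomial.monom 1 j)) \<in> polys N"
    using idx_bound[OF True] by (intro polys_sum polys_mult polys_var polys_const) auto
  then show ?thesis unfolding linear_tup[OF assms] using True by simp
next
  case False
  then show ?thesis unfolding linear_tup[OF assms] using polys_const[of 0] by simp
qed

section \<open>Polynomial functions on a chart as values of forms\<close>

lemma coeff_tup_polys: "(\<lambda>w. Polynomial.coeff (tup w i) j) \<in> polys N"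
  by (rule linear_tup_polys) simp_all

lemma lf_nth_polys: "(\<lambda>w. fps_nth (expand t0 (lf n W (tup w))) j) \<in> polys N"
proof -
  have "(\<lambda>w. fps_nth (expand t0 (W i * tup w i)) j) \<in> polys N" for i
    by (rule linear_tup_polys) (simp_all add: distrib_left expand_add expand_smult)
  then have "(\<lambda>w. \<Sum>i\<le>n. fps_nth (expand t0 (W i * tup w i)) j) \<in> polys N" by (intro polys_sum)
  then show ?thesis by (simp add: lf_def expand_sum fps_sum_nth)
qed

lemma poly_tup_polys: "(\<lambda>w. poly (tup w i) t0) \<in> polys N"
  by (rule linear_tup_polys) simp_all

lemma lf_tup_polys: "(\<lambda>w. poly (lf n W (tup w)) t0) \<in> polys N"
  using lf_nth_polys[of W 0] by (simp add: expand_nth_0)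

definition Lam :: "(nat \<times> nat, complex) mpoly" where
  "Lam = (\<Sum>i\<le>n. \<Sum>j<b. mpoly_scale (poly (V i * Polynomial.monom 1 j) t0) (mvar (i, j)))"

lemma Lam_form: "Lam \<in> forms Idx 1"
  unfolding Lam_def by (intro forms_sum forms_scale mvar_forms) auto

lemma Lam_eval: "mpoly_eval id Lam (cvec (tup w)) = lam (tup w)"
proof -
  have "poly (V i * tup w i) t0 = (\<Sum>j<b. w (k + i * b + j) * poly (V i * Polynomial.monom 1 j) t0)" if "i \<le> n" for i
  proof -
    have "(\<lambda>p. poly (V i * p) t0) (tup w i) = (if i \<le> n then \<Sum>j<b. w (k + i * b + j) * (\<lambda>p. poly (V i * p) t0) (Polynomial.monom 1 j) else 0)"
      by (rule linear_tup) (simp_all add: algebra_simps)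
    then show ?thesis using that by simp
  qed
  then have "lam (tup w) = (\<Sum>i\<le>n. \<Sum>j<b. w (k + i * b + j) * poly (V i * Polynomial.monom 1 j) t0)"
    unfolding lam_def lf_def poly_sum by (intro sum.cong) auto
  also have "\<dots> = mpoly_eval id Lam (cvec (tup w))"
    unfolding Lam_def cx.eval_sum cx.eval_scale cx.eval_var by (intro sum.cong) (auto simp: cvec_tup mult.commute)
  finally show ?thesis ..
qed

text \<open>\<open>Lam\<close> is 1 on normalised vectors, so its powers bring forms to a common
  degree without changing their values there, and every polynomial function becomes the value of a
  form. This is how irreducibility in projective space turns into primality in the chart.\<close>

definition homog :: "(pt \<Rightarrow> complex) \<Rightarrow> bool" where
  "homog f \<longleftrightarrow> (\<exists>m F. F \<in> forms Idx m \<and> (\<forall>w. normal w \<longrightarrow> mpoly_eval id F (cvec (tup w)) = f w))"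

lemma homog_cong: "homog f \<Longrightarrow> (\<And>w. normal w \<Longrightarrow> f w = h w) \<Longrightarrow> homog h"
  unfolding homog_def by (elim exE conjE, intro exI conjI, assumption) simp

lemma homog_const: "homog (\<lambda>w. c)"
  unfolding homog_def
  by (intro exI[of _ 0] exI[of _ "Poly_Mapping.single 0 c"] conjI allI impI forms_single) simp_all

lemma homog_mult: "homog f \<Longrightarrow> homog h \<Longrightarrow> homog (\<lambda>w. f w * h w)"
proof -
  assume "homog f" "homog h"
  then obtain m F l G where "F \<in> forms Idx m" "\<And>w. normal w \<Longrightarrow> mpoly_eval id F (cvec (tup w)) = f w"
    "G \<in> forms Idx l" "\<And>w. normal w \<Longrightarrow> mpoly_eval id G (cvec (tup w)) = h w" unfolding homog_def by blast
  then show ?thesis unfolding homog_def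
    by (intro exI[of _ "m + l"] exI[of _ "F * G"] conjI forms_mult) (simp_all add: cx.eval_mult)
qed

lemma homog_add: "homog f \<Longrightarrow> homog h \<Longrightarrow> homog (\<lambda>w. f w + h w)"
proof -
  assume "homog f" "homog h"
  then obtain m F l G where FG: "F \<in> forms Idx m" "\<And>w. normal w \<Longrightarrow> mpoly_eval id F (cvec (tup w)) = f w"
    "G \<in> forms Idx l" "\<And>w. normal w \<Longrightarrow> mpoly_eval id G (cvec (tup w)) = h w" unfolding homog_def by blast
  have L: "Lam ^ l \<in> forms Idx l" "Lam ^ m \<in> forms Idx m" using forms_power[OF Lam_form] by (metis mult_1)+
  then have "F * Lam ^ l \<in> forms Idx (m + l)" "G * Lam ^ m \<in> forms Idx (m + l)"
    using forms_mult[OF FG(1) L(1)] forms_mult[OF FG(3) L(2)] by (simp_all only: add.commute[of l m])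
  then have "F * Lam ^ l + G * Lam ^ m \<in> forms Idx (m + l)" by (rule forms_add)
  moreover have "mpoly_eval id (F * Lam ^ l + G * Lam ^ m) (cvec (tup w)) = f w + h w" if "normal w" for w
    using FG(2,4)[OF that] that by (simp add: cx.eval_add cx.eval_mult mpoly_eval_power Lam_eval normal_def)
  ultimately show ?thesis unfolding homog_def by (intro exI conjI allI impI)
qed

lemma homog_sum: "finite S \<Longrightarrow> (\<And>s. s \<in> S \<Longrightarrow> homog (f s)) \<Longrightarrow> homog (\<lambda>w. \<Sum>s\<in>S. f s w)"
  by (induction S rule: finite_induct) (simp_all add: homog_const homog_add)

lemma homog_coord: "i \<le> n \<Longrightarrow> j < b \<Longrightarrow> homog (\<lambda>w. w (k + i * b + j))"
  unfolding homog_def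
  by (intro exI[of _ 1] exI[of _ "mvar (i, j)"] conjI allI impI mvar_forms) (simp_all add: cvec_tup)

lemma homog_linear:
  assumes "\<And>p q. ll (p + q) = ll p + ll q" "\<And>c p. ll (Polynomial.smult c p) = c * ll p"
  shows "homog (\<lambda>w. ll (tup w i))"
proof (cases "i \<le> n")
  case True
  then have "homog (\<lambda>w. \<Sum>j<b. w (k + i * b + j) * ll (Polynomial.monom 1 j))"
    by (intro homog_sum homog_mult homog_coord homog_const) auto
  then show ?thesis unfolding linear_tup[OF assms] using True by simp
next
  case False
  then show ?thesis unfolding linear_tup[OF assms] using homog_const[of 0] by simp
qed

lemma homog_lf_nth: "homog (\<lambda>w. fps_nth (expand t0 (lf n W (tup w))) j)"
proof -
  have "homog (\<lambda>w. fps_nth (expand t0 (W i * tup w i)) j)" for i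
    by (rule homog_linear) (simp_all add: distrib_left expand_add expand_smult)
  then have "homog (\<lambda>w. \<Sum>i\<le>n. fps_nth (expand t0 (W i * tup w i)) j)" by (intro homog_sum) auto
  then show ?thesis by (simp add: lf_def expand_sum fps_sum_nth)
qed

text \<open>The jet entries are not coordinates of the projective space. Since the denominator has
  the value 1 at \<open>t0\<close>, the recursion for the quotient series determines them from the
  coefficients of the tuple without division.\<close>

lemma homog_jet: "i < k \<Longrightarrow> homog (\<lambda>w. w i)"
proof (induction i rule: less_induct)
  case (less i)
  have "homog (\<lambda>w. fps_nth (expand t0 (lf n U (tup w))) i + (- 1) * (\<Sum>s<i. w s * fps_nth (expand t0 (lf n V (tup w))) (i - s)))"
    using less by (intro homog_add homog_mult homog_sum homog_const homog_lf_nth less.IH) auto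
  then show ?case
  proof (rule homog_cong)
    fix w assume w: "normal w"
    then have "fps_nth (expand t0 (lf n V (tup w))) 0 = 1" by (simp add: normal_def lam_def expand_nth_0)
    moreover have "(\<Sum>s\<le>i. w s * fps_nth (expand t0 (lf n V (tup w))) (i - s)) = fps_nth (expand t0 (lf n U (tup w))) i"
      using w less.prems by (simp add: normal_def jets_def pjets_def)
    moreover have "(\<Sum>s\<le>i. w s * fps_nth (expand t0 (lf n V (tup w))) (i - s)) =
        (\<Sum>s<i. w s * fps_nth (expand t0 (lf n V (tup w))) (i - s)) + w i * fps_nth (expand t0 (lf n V (tup w))) (i - i)"
      unfolding lessThan_Suc_atMost[symmetric] by simp
    moreover have "w i * fps_nth (expand t0 (lf n V (tup w))) (i - i) = w i" using calculation(1) by simp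
    ultimately have "fps_nth (expand t0 (lf n U (tup w))) i = (\<Sum>s<i. w s * fps_nth (expand t0 (lf n V (tup w))) (i - s)) + w i"
      by metis
    then show "fps_nth (expand t0 (lf n U (tup w))) i + (- 1) * (\<Sum>s<i. w s * fps_nth (expand t0 (lf n V (tup w))) (i - s)) = w i"
      by simp
  qed
qed

lemma homog_polys: "f \<in> polys N \<Longrightarrow> homog f"
proof (induction rule: polys_induct)
  case (coord m)
  show ?case
  proof (cases "m < k")
    case True
    then show ?thesis by (rule homog_jet)
  next
    case False
    define i j where "i = (m - k) div b" and "j = (m - k) mod b"
    have "m - k < Suc n * b" using coord False by (simp add: N_def)
    moreover from this have "b > 0" by (cases b) auto
    ultimately have "i < Suc n" "j < b" by (simp_all add: i_def j_def less_mult_imp_div_less)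
    moreover have "m = k + i * b + j" using False by (simp add: i_def j_def)
    ultimately show ?thesis using homog_coord[of i j] by simp
  qed
next
  case (const c)
  show ?case by (rule homog_const)
next
  case (add f g)
  then show ?case by (rule homog_add)
next
  case (mult f g)
  then show ?case by (rule homog_mult)
qed

end

lemma polys_hrel:
  assumes "u \<in> polys N" "v \<in> polys N" "l \<in> polys N"
  shows "(\<lambda>w. hrel g e M (u w) (v w) (l w)) \<in> polys N"
  unfolding hrel_def by (intro polys_sum polys_mult polys_power polys_const assms)

lemma lf_smult: "lf n W (\<lambda>i. Polynomial.smult c (x i)) = Polynomial.smult c (lf n W x)"
proof -
  have "Polynomial.smult c p = [:c:] * p" for p by simp
  then show ?thesis by (simp only: lf_def sum_distrib_left mult.left_commute)
qed

definition pcoeffs :: "nat \<Rightarrow> (pt \<Rightarrow> complex poly) \<Rightarrow> bool" where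
  "pcoeffs N F \<longleftrightarrow> (\<forall>s. (\<lambda>w. Polynomial.coeff (F w) s) \<in> polys N)"

lemma pcoeffs_const: "pcoeffs N (\<lambda>w. p)"
  by (simp add: pcoeffs_def polys_const)

lemma pcoeffs_mult: "pcoeffs N F \<Longrightarrow> pcoeffs N G \<Longrightarrow> pcoeffs N (\<lambda>w. F w * G w)"
  unfolding pcoeffs_def coeff_mult by (intro allI polys_sum polys_mult) blast+

lemma pcoeffs_sum: "(\<And>s. s \<in> S \<Longrightarrow> pcoeffs N (F s)) \<Longrightarrow> pcoeffs N (\<lambda>w. \<Sum>s\<in>S. F s w)"
  unfolding pcoeffs_def coeff_sum by (intro allI polys_sum) blast

lemma pcoeffs_power: "pcoeffs N F \<Longrightarrow> pcoeffs N (\<lambda>w. F w ^ m)"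
  by (induction m) (simp_all add: pcoeffs_const[of _ 1] pcoeffs_mult)

lemma pcoeffs_prod: "finite S \<Longrightarrow> (\<And>s. s \<in> S \<Longrightarrow> pcoeffs N (F s)) \<Longrightarrow> pcoeffs N (\<lambda>w. \<Prod>s\<in>S. F s w)"
  by (induction S rule: finite_induct) (simp_all add: pcoeffs_const[of _ 1] pcoeffs_mult)

lemma mon_vec: "mon e (vec x) = to_ac (to_fract (mon e x))"
proof -
  have "to_ac (to_fract (\<Prod>i\<in>S. f i)) = (\<Prod>i\<in>S. to_ac (to_fract (f i)))" for S and f :: "nat \<Rightarrow> complex poly"
    by (induction S rule: infinite_finite_induct) simp_all
  moreover have "to_ac (to_fract (p ^ m)) = to_ac (to_fract p) ^ m" for p :: "complex poly" and m
    by (induction m) simp_all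
  ultimately show ?thesis by (simp only: mon_def vec_def)
qed

context chart
begin

text \<open>The part of \<open>Y\<close> in the chart, encoded together with its jets. On it the
  first \<open>k\<close> entries are determined by the others, so \<open>hat Y\<close> is the graph
  of the jet map, and projection to the first \<open>k\<close> coordinates is that map.\<close>

definition hat :: "(nat \<times> nat \<Rightarrow> complex) set set \<Rightarrow> pt set" where
  "hat Y = {w. (\<forall>m\<ge>N. w m = 0) \<and> tup w \<in> sections b \<and> coeff_point (tup w) \<in> Y \<and> normal w}"

lemma sections_tup: "x \<in> sections b \<Longrightarrow> tup (enc x) = x"
  by (rule tup_enc) (auto simp: sections_def Pts_def)

lemma lam_smult: "lam (\<lambda>i. Polynomial.smult c (x i)) = c * lam x"
  by (simp add: lam_def lf_smult)

lemma hat_exists: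
  assumes "x \<in> sections b" "coeff_point x \<in> Y" "lam x \<noteq> 0"
  shows "\<exists>w\<in>hat Y. \<exists>c. c \<noteq> 0 \<and> tup w = (\<lambda>i. Polynomial.smult c (x i))"
proof -
  define c where "c = 1 / lam x"
  define x' where "x' = (\<lambda>i. Polynomial.smult c (x i))"
  have c0: "c \<noteq> 0" using assms(3) by (simp add: c_def)
  have x': "x' \<in> sections b" unfolding x'_def using assms(1) c0 by (rule sections_scale)
  have t: "tup (enc x') = x'" using x' by (rule sections_tup)
  have l: "lam x' = 1" unfolding x'_def lam_smult using assms(3) by (simp add: c_def)
  have "coeff_point x' \<in> Y" unfolding x'_def coeff_point_scale[OF c0] by (rule assms(2))
  moreover have "normal (enc x')" unfolding normal_def t using l jets_enc[of x'] by simp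
  moreover have "\<forall>m\<ge>N. enc x' m = 0" by (simp add: enc_def N_def)
  ultimately have "enc x' \<in> hat Y" using x' by (simp add: hat_def t)
  then show ?thesis using t c0 unfolding x'_def by blast
qed

lemma form_polys: "(\<lambda>w. mpoly_eval id F (cvec (tup w))) \<in> polys N"
proof -
  have "(\<lambda>w. cvec (tup w) p) \<in> polys N" for p
    by (cases p) (simp add: cvec_def coeff_tup_polys)
  then show ?thesis unfolding mpoly_eval_eq mon_def
    by (intro polys_sum polys_mult polys_prod polys_power polys_const)
qed

text \<open>For fixed \<open>t0\<close>, goodness is an open condition on the coefficients of the
  tuple.\<close>

lemma good_polys: "\<exists>f\<in>polys N. \<forall>w. f w \<noteq> 0 \<longleftrightarrow> cd.good t0 L (tup w)"
proof -
  let ?u = "\<lambda>w. poly (lf n U (tup w)) t0" and ?v = "\<lambda>w. poly (lf n V (tup w)) t0"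
  define f where "f = (\<lambda>w. ?v w *
    ((\<Prod>i\<le>n. poly (hder (g i) (e i) (M i) (lf n U (tup w)) (lf n V (tup w)) (tup w i)) t0) *
     (\<Prod>c\<le>L. poly (htop (g' c) (e' c) (M' c) (lf n U (tup w)) (lf n V (tup w))) t0)))"
  have "(\<lambda>w. poly (hder (g i) (e i) (M i) (lf n U (tup w)) (lf n V (tup w)) (tup w i)) t0) \<in> polys N" for i
    unfolding eval_hom(2) unfolding hder_def by (intro polys_hrel lf_tup_polys poly_tup_polys)
  moreover have "(\<lambda>w. poly (htop (g' c) (e' c) (M' c) (lf n U (tup w)) (lf n V (tup w))) t0) \<in> polys N" for c
    unfolding eval_hom(3) unfolding htop_def
    by (intro polys_sum polys_mult polys_power polys_const lf_tup_polys)
  ultimately have "f \<in> polys N"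
    unfolding f_def by (intro polys_mult polys_prod lf_tup_polys)
  moreover have "f w \<noteq> 0 \<longleftrightarrow> cd.good t0 L (tup w)" for w
    unfolding f_def cd.good_def by auto
  ultimately show ?thesis by blast
qed

text \<open>The normalisation \<open>lam x = 1\<close> forces proportional sections to be equal,
  which is what the fibre bound requires of distinct members.\<close>

lemma section_bound:
  assumes "k > 0" "L \<ge> n * (Suc d * Suc d)" "2 * (m * (b - 1)) < k * ((\<Sum>j\<le>m. min d (Suc j)) - 1)"
    and P: "finite P" "\<And>x. x \<in> P \<Longrightarrow> x \<in> sections b \<and> cd.good t0 L x \<and> lam x = 1 \<and> jets \<alpha> x"
  shows "card P \<le> d * (d * m)"
proof (rule cd.fibre_bound[where h = "b - 1" and k = k and L = L and ?t0.0 = t0])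
  show "P \<subseteq> Pts" using P(2) by (auto simp: sections_def)
  show "\<forall>x\<in>P. \<forall>y\<in>P. x \<noteq> y \<longrightarrow> \<not> parallel x y"
  proof (intro ballI impI notI)
    fix x y assume xy: "x \<in> P" "y \<in> P" "x \<noteq> y" "parallel x y"
    then obtain c where c: "\<And>i. y i = Polynomial.smult c (x i)"
      using parallel_sections[of x b y] P(2) by blast
    then have "y = (\<lambda>i. Polynomial.smult c (x i))" by blast
    then have "lam y = c * lam x" using lam_smult by simp
    then have "c = 1" using P(2) xy by simp
    then show False using c xy(3) by auto
  qed
  show "Polynomial.degree (x i) \<le> b - 1" if "x \<in> P" "i \<le> n" for x i
  proof -
    have "Polynomial.degree (x i) < b" using P(2)[OF that(1)] that(2) by (simp add: sections_def)
    then show ?thesis by simp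
  qed
  show "[:- t0, 1:] ^ k dvd lf n U x * lf n V y - lf n U y * lf n V x" if "x \<in> P" "y \<in> P" for x y
    using P(2)[OF that(1)] P(2)[OF that(2)] by (intro pjets_parallel) (auto simp: jets_def)
qed (use assms in auto)

end

text \<open>The section \<open>x0\<close> witnesses that \<open>Y\<close> meets the chart at
  \<open>t0\<close>, so that the part of \<open>Y\<close> in the chart is dense in
  \<open>Y\<close>.\<close>

locale component = chart +
  fixes Y :: "(nat \<times> nat \<Rightarrow> complex) set set" and x0 :: "nat \<Rightarrow> complex poly"
  assumes irrY: "irreducible_in (zariski id ({..n} \<times> {..<b})) Y"
    and Y_sub: "Y \<subseteq> coeff_point ` sections b"
    and x0: "x0 \<in> sections b" "coeff_point x0 \<in> Y" "lam x0 \<noteq> 0"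
begin

section \<open>The affine part of an irreducible set and its closure\<close>

lemma vanishes_point: "F \<in> forms Idx m \<Longrightarrow> vanishes_at id F (coeff_point x) \<longleftrightarrow> mpoly_eval id F (cvec x) = 0"
  unfolding coeff_point_eq by (rule cx.vanishes_at_class)

lemma Lam_section: "x \<in> sections b \<Longrightarrow> mpoly_eval id Lam (cvec x) = lam x"
  using Lam_eval[of "enc x"] by (simp add: sections_tup)

text \<open>A form that vanishes on the chart vanishes on \<open>Y\<close> after multiplication by
  \<open>Lam\<close>. As \<open>Lam\<close> is nonzero at \<open>x0\<close>, irreducibility removes
  this factor.\<close>

lemma vanishes_hat:
  assumes F: "F \<in> forms Idx m"
  shows "(\<forall>w\<in>hat Y. mpoly_eval id F (cvec (tup w)) = 0) \<longleftrightarrow> (\<forall>p\<in>Y. vanishes_at id F p)"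
proof
  assume "\<forall>p\<in>Y. vanishes_at id F p"
  then show "\<forall>w\<in>hat Y. mpoly_eval id F (cvec (tup w)) = 0"
    using vanishes_point[OF F] by (auto simp: hat_def)
next
  assume z: "\<forall>w\<in>hat Y. mpoly_eval id F (cvec (tup w)) = 0"
  have "vanishes_at id (F * Lam) p" if p: "p \<in> Y" for p
  proof -
    obtain x where x: "p = coeff_point x" "x \<in> sections b" using p Y_sub by auto
    have "mpoly_eval id F (cvec x) = 0 \<or> lam x = 0"
    proof (cases "lam x = 0")
      case False
      then obtain w c where w: "w \<in> hat Y" "c \<noteq> 0" "tup w = (\<lambda>i. Polynomial.smult c (x i))"
        using hat_exists[OF x(2), of Y] p x(1) by blast
      then have "coeff_point (tup w) = p" using coeff_point_scale x(1) by simp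
      then have "vanishes_at id F p" using z w(1) vanishes_point[OF F, of "tup w"] by simp
      then show ?thesis using vanishes_point[OF F] x(1) by simp
    qed simp
    then have "mpoly_eval id (F * Lam) (cvec x) = 0" using Lam_section[OF x(2)] by (auto simp: cx.eval_mult)
    then show ?thesis using vanishes_point[OF forms_mult[OF F Lam_form]] x(1) by simp
  qed
  then have "(\<forall>p\<in>Y. vanishes_at id F p) \<or> (\<forall>p\<in>Y. vanishes_at id Lam p)"
    by (rule cx.irreducible_forms[OF irrY F Lam_form])
  moreover have "\<not> vanishes_at id Lam (coeff_point x0)"
    using vanishes_point[OF Lam_form] Lam_section[OF x0(1)] x0(3) by simp
  ultimately show "\<forall>p\<in>Y. vanishes_at id F p" using x0(2) by blast
qed

sublocale ps: prime_set N "hat Y"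
proof
  show "hat Y \<noteq> {}" using hat_exists[OF x0] by blast
next
  fix f h assume "f \<in> polys N" "h \<in> polys N" and z: "\<forall>w\<in>hat Y. f w * h w = 0"
  then have "homog f" "homog h" using homog_polys by auto
  then obtain m F l G where F: "F \<in> forms Idx m" "\<And>w. normal w \<Longrightarrow> mpoly_eval id F (cvec (tup w)) = f w"
    and G: "G \<in> forms Idx l" "\<And>w. normal w \<Longrightarrow> mpoly_eval id G (cvec (tup w)) = h w"
    unfolding homog_def by blast
  have nrm: "normal w" if "w \<in> hat Y" for w using that by (simp add: hat_def)
  have "\<forall>w\<in>hat Y. mpoly_eval id (F * G) (cvec (tup w)) = 0"
    using z F(2)[OF nrm] G(2)[OF nrm] by (simp add: cx.eval_mult)
  then have "\<forall>p\<in>Y. vanishes_at id (F * G) p" using vanishes_hat[OF forms_mult[OF F(1) G(1)]] by blast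
  then have "(\<forall>p\<in>Y. vanishes_at id F p) \<or> (\<forall>p\<in>Y. vanishes_at id G p)"
    by (intro cx.irreducible_forms[OF irrY F(1) G(1)]) blast
  then show "(\<forall>w\<in>hat Y. f w = 0) \<or> (\<forall>w\<in>hat Y. h w = 0)"
    using vanishes_hat[OF F(1)] vanishes_hat[OF G(1)] F(2)[OF nrm] G(2)[OF nrm] by auto
qed

lemma closed_eq:
  assumes "w \<in> closed_to N (hat Y)" "f \<in> polys N" "\<And>w. w \<in> hat Y \<Longrightarrow> f w = 0"
  shows "f w = 0"
  using assms by (auto simp: closed_to_def)

lemma closed_normal:
  assumes w: "w \<in> closed_to N (hat Y)"
  shows "normal w"
proof -
  have "lam (tup w) + (- 1) = 0"
  proof (rule closed_eq[OF w])
    show "(\<lambda>w. lam (tup w) + (- 1)) \<in> polys N" unfolding lam_def by (intro polys_add polys_const lf_tup_polys)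
  qed (simp add: hat_def normal_def)
  then have "lam (tup w) = 1" by (simp add: eq_neg_iff_add_eq_0)
  moreover have "(\<Sum>i\<le>j. w i * fps_nth (expand t0 (lf n V (tup w))) (j - i)) - fps_nth (expand t0 (lf n U (tup w))) j = 0"
    if j: "j < k" for j
  proof (rule closed_eq[OF w])
    show "(\<lambda>w. (\<Sum>i\<le>j. w i * fps_nth (expand t0 (lf n V (tup w))) (j - i)) - fps_nth (expand t0 (lf n U (tup w))) j) \<in> polys N"
      using j by (intro polys_diff polys_sum polys_mult polys_var lf_nth_polys) (auto simp: N_def)
  qed (use j in \<open>simp add: hat_def normal_def jets_def pjets_def\<close>)
  ultimately show ?thesis by (simp add: normal_def jets_def pjets_def)
qed

lemma closed_form:
  assumes "w \<in> closed_to N (hat Y)" "F \<in> forms Idx m" "\<forall>p\<in>Y. vanishes_at id F p"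
  shows "mpoly_eval id F (cvec (tup w)) = 0"
proof (rule closed_eq[OF assms(1)])
  show "(\<lambda>w. mpoly_eval id F (cvec (tup w))) \<in> polys N" by (rule form_polys)
qed (use vanishes_hat[OF assms(2)] assms(3) in blast)

text \<open>An equation of the curve, evaluated at a tuple and expanded in powers of
  \<open>t\<close>, gives polynomial conditions on the coefficients. They hold on
  \<open>hat Y\<close>, hence on its closure; the tuple stays nonzero because \<open>lam\<close> is
  still 1.\<close>

lemma closed_Pts:
  assumes w: "w \<in> closed_to N (hat Y)"
  shows "tup w \<in> Pts"
proof (rule ccontr)
  assume "tup w \<notin> Pts"
  then have "proj_class (vec (tup w)) \<notin> C" using class_cone by (auto simp: Pts_def tup_def)
  moreover have "proj_class (vec (tup w)) \<in> proj_space {..n}"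
  proof -
    have "lam (tup w) = 1" using closed_normal[OF w] by (simp add: normal_def)
    then have "lf n V (tup w) \<noteq> 0" by (auto simp: lam_def)
    then obtain i where "i \<in> {..n}" "V i * tup w i \<noteq> 0" unfolding lf_def by (rule sum.not_neutral_contains_not_neutral)
    then have "\<exists>i\<in>{..n}. vec (tup w) i \<noteq> 0" by (intro bexI[of _ i]) (auto simp: vec_def)
    moreover have "\<forall>i. i \<notin> {..n} \<longrightarrow> vec (tup w) i = 0" by (simp add: vec_def tup_def)
    ultimately show ?thesis unfolding proj_space_def by blast
  qed
  moreover have "closedin (subtopology (zariski to_ac {..n}) UNIV) C"
    using irr by (simp add: irreducible_projective_curve_def)
  ultimately obtain f m where f: "f \<in> forms {..n} m" "\<not> vanishes_at to_ac f (proj_class (vec (tup w)))"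
    "\<And>q. q \<in> C \<Longrightarrow> vanishes_at to_ac f q"
    using ac.closed_separate[of "{..n}" UNIV C "proj_class (vec (tup w))"] by blast
  obtain q B where q: "q \<noteq> 0" "\<forall>e\<in>Poly_Mapping.keys f. to_fract q * Poly_Mapping.lookup f e = to_fract (B e)"
    using common_denominator[of "Poly_Mapping.keys f" "Poly_Mapping.lookup f"] by auto
  define R where "R = (\<lambda>w. \<Sum>e\<in>Poly_Mapping.keys f. B e * mon e (tup w))"
  have R: "to_ac (to_fract (R w)) = to_ac (to_fract q) * mpoly_eval to_ac f (vec (tup w))" for w
  proof -
    have s: "to_ac (to_fract (\<Sum>e\<in>S. h e)) = (\<Sum>e\<in>S. to_ac (to_fract (h e)))" for S and h :: "(nat \<Rightarrow>\<^sub>0 nat) \<Rightarrow> complex poly"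
      by (induction S rule: infinite_finite_induct) simp_all
    have "to_ac (to_fract (B e * mon e (tup w))) = to_ac (to_fract q) * (to_ac (Poly_Mapping.lookup f e) * mon e (vec (tup w)))"
      if "e \<in> Poly_Mapping.keys f" for e
    proof -
      have "to_ac (to_fract (B e)) = to_ac (to_fract q) * to_ac (Poly_Mapping.lookup f e)"
        using q(2) that by (metis to_ac_mult)
      then show ?thesis unfolding mon_vec to_fract_mult to_ac_mult by (simp only: mult.assoc)
    qed
    then show ?thesis unfolding R_def mpoly_eval_eq s sum_distrib_left by (intro sum.cong) auto
  qed
  have "pcoeffs N (\<lambda>w. tup w i)" for i by (simp add: pcoeffs_def coeff_tup_polys)
  then have "pcoeffs N R" unfolding R_def mon_def
    by (intro pcoeffs_sum pcoeffs_mult pcoeffs_const pcoeffs_prod pcoeffs_power) auto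
  have "Polynomial.coeff (R w) s = 0" for s
  proof (rule closed_eq[OF w])
    show "(\<lambda>w. Polynomial.coeff (R w) s) \<in> polys N" using \<open>pcoeffs N R\<close> by (simp add: pcoeffs_def)
    fix w' assume "w' \<in> hat Y"
    then have "vec (tup w') \<in> cone" by (simp add: hat_def sections_def Pts_def)
    then have "vanishes_at to_ac f (proj_class (vec (tup w')))" using f(3) cone_class by blast
    then have "to_ac (to_fract (R w')) = 0" unfolding ac.vanishes_at_class[OF f(1)] R by simp
    then show "Polynomial.coeff (R w') s = 0" by simp
  qed
  then have "R w = 0" by (simp add: poly_eq_iff)
  then have "mpoly_eval to_ac f (vec (tup w)) = 0" using R[of w] q(1) by simp
  then show False using f(2) unfolding ac.vanishes_at_class[OF f(1)] by simp
qed

end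

lemma polyfun_power:
  assumes "f \<in> polyfun N 1"
  shows "(\<lambda>w. f w ^ j) \<in> polyfun N j"
proof (induction j)
  case 0
  show ?case using polyfun_const[of 1] by simp
next
  case (Suc j)
  then show ?case using polyfun_mult[OF assms Suc] by simp
qed

lemma polyfun_prod:
  assumes "finite S" "\<And>s. s \<in> S \<Longrightarrow> f s \<in> polyfun N (D s)"
  shows "(\<lambda>w. \<Prod>s\<in>S. f s w) \<in> polyfun N (\<Sum>s\<in>S. D s)"
  using assms
proof (induction S rule: finite_induct)
  case empty
  show ?case using polyfun_const[of 1] by simp
next
  case (insert s S)
  then have "(\<lambda>w. f s w * (\<Prod>s\<in>S. f s w)) \<in> polyfun N (D s + sum D S)" by (intro polyfun_mult) auto
  then show ?case using insert.hyps by simp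
qed

lemma polys_if: "f \<in> polys N \<Longrightarrow> (\<lambda>w. if P then f w else 0) \<in> polys N"
  by (cases P) (simp_all add: polys_const)

lemma polyfun_cmult: "f \<in> polyfun N D \<Longrightarrow> (\<lambda>w. c * f w) \<in> polyfun N D"
  using polyfun_mult[OF polyfun_const[of c N 0], of f D] by simp

context component
begin

lemma form_polyfun:
  assumes F: "F \<in> forms Idx m"
  shows "(\<lambda>w. mpoly_eval id F (cvec (tup w))) \<in> polyfun N m"
proof -
  have crd: "(\<lambda>w. cvec (tup w) p) \<in> polyfun N 1" for p
  proof (cases p)
    case (Pair i j)
    show ?thesis
    proof (cases "i \<le> n \<and> j < b")
      case True
      then have "(\<lambda>w. w (k + i * b + j)) \<in> polyfun N (Suc 0)" using idx_bound by (intro polyfun_var) auto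
      then show ?thesis using True by (simp add: Pair cvec_tup)
    next
      case False
      then show ?thesis using polyfun_const[of 0 N 1] by (auto simp: Pair cvec_tup)
    qed
  qed
  show ?thesis unfolding mpoly_eval_eq
  proof (intro polyfun_sum polyfun_cmult)
    fix e assume "e \<in> Poly_Mapping.keys F"
    then have "mdeg e = m" using F by (simp add: forms_iff)
    moreover have "(\<lambda>w. mon e (cvec (tup w))) \<in> polyfun N (mdeg e)"
      unfolding mon_def mdeg_def by (intro polyfun_prod polyfun_power crd) simp
    ultimately show "(\<lambda>w. mon e (cvec (tup w))) \<in> polyfun N m" by simp
  qed
qed

lemma hat_degree: "w \<in> hat Y \<Longrightarrow> i \<le> n \<Longrightarrow> Polynomial.degree (tup w i) < b"
  by (simp add: hat_def sections_def)

text \<open>If \<open>x\<close> has the largest height \<open>H\<close> on the set and is primitive, then no nonzero tuple of height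
  less than \<open>H\<close> is proportional to \<open>x\<close>. This is an open condition, and it implies primitivity.\<close>

lemma primitive_open:
  "\<exists>v\<in>polys N. ps.nz v \<and> (\<forall>w\<in>closed_to N (hat Y). v w \<noteq> 0 \<longrightarrow> primitive n (tup w))"
proof -
  define Ds where "Ds = {j. \<exists>w\<in>hat Y. \<exists>i\<le>n. Polynomial.degree (tup w i) = j}"
  have "Ds \<subseteq> {..<b}" using hat_degree by (auto simp: Ds_def)
  then have fin: "finite Ds" using finite_subset by blast
  have ne: "Ds \<noteq> {}" using ps.nonempty by (auto simp: Ds_def)
  define H where "H = Max Ds"
  have "H \<in> Ds" unfolding H_def by (rule Max_in[OF fin ne])
  then obtain w1 i1 where w1: "w1 \<in> hat Y" "i1 \<le> n" "Polynomial.degree (tup w1 i1) = H" by (auto simp: Ds_def)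
  have ub: "Polynomial.degree (tup w i) \<le> H" if "w \<in> hat Y" "i \<le> n" for w i
    unfolding H_def using that by (intro Max_ge fin) (auto simp: Ds_def)
  have ubc: "Polynomial.degree (tup w i) \<le> H" if w: "w \<in> closed_to N (hat Y)" and i: "i \<le> n" for w i
  proof (rule degree_le, intro allI impI)
    fix s assume s: "H < s"
    show "Polynomial.coeff (tup w i) s = 0"
    proof (rule closed_eq[OF w coeff_tup_polys])
      fix w' assume "w' \<in> hat Y"
      then show "Polynomial.coeff (tup w' i) s = 0" using ub[OF _ i] s by (intro coeff_eq_0) (auto intro: le_less_trans)
    qed
  qed
  \<comment> \<open>The unknowns indexed by \<open>S\<close> are the coefficients of a tuple
    \<open>Z\<close> of height below \<open>H\<close>. The equations indexed by \<open>R\<close> say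
    that \<open>Z\<close> is proportional to \<open>tup w\<close>; they are linear in
    \<open>Z\<close>, with coefficients polynomial in \<open>w\<close>.\<close>
  define S where "S = {..n} \<times> {..<H}"
  define R where "R = {..n} \<times> {..n} \<times> (UNIV :: nat set)"
  define q where "q w i s' s = Polynomial.coeff (Polynomial.monom 1 s' * tup w i) s" for w i s' s
  define a where "a r u w = (if fst u = fst (snd r) then q w (fst r) (snd u) (snd (snd r)) else 0)
     - (if fst u = fst r then q w (fst (snd r)) (snd u) (snd (snd r)) else 0)"
    for r :: "nat \<times> nat \<times> nat" and u :: "nat \<times> nat" and w
  define Z where "Z y i = (if i \<le> n then \<Sum>s<H. Polynomial.monom (y (i, s)) s else 0)" for y :: "nat \<times> nat \<Rightarrow> complex" and i
  have q_polys: "(\<lambda>w. q w i s' s) \<in> polys N" for i s' s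
    unfolding q_def by (rule linear_tup_polys) (simp_all add: distrib_left)
  have half: "(\<Sum>u\<in>S. (if fst u = i' then q w i (snd u) s else 0) * y u) = Polynomial.coeff (Z y i' * tup w i) s"
    if "i' \<le> n" for w i i' s y
  proof -
    have "(\<Sum>u\<in>S. (if fst u = i' then q w i (snd u) s else 0) * y u) =
        (\<Sum>j\<le>n. \<Sum>s'<H. (if j = i' then q w i s' s else 0) * y (j, s'))"
      unfolding S_def sum.cartesian_product by (intro sum.cong) auto
    also have "\<dots> = (\<Sum>j\<le>n. if j = i' then \<Sum>s'<H. q w i s' s * y (i', s') else 0)"
      by (intro sum.cong) auto
    also have "\<dots> = (\<Sum>s'<H. q w i s' s * y (i', s'))" using that by simp
    also have "\<dots> = (\<Sum>s'<H. Polynomial.coeff (Polynomial.monom (y (i', s')) s' * tup w i) s)"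
    proof (intro sum.cong refl)
      fix s'
      have "Polynomial.monom (y (i', s')) s' * tup w i = Polynomial.smult (y (i', s')) (Polynomial.monom 1 s' * tup w i)"
        by (simp add: smult_monom flip: mult_smult_left)
      then show "q w i s' s * y (i', s') = Polynomial.coeff (Polynomial.monom (y (i', s')) s' * tup w i) s"
        by (simp add: q_def)
    qed
    also have "\<dots> = Polynomial.coeff (Z y i' * tup w i) s"
      using that by (simp add: Z_def sum_distrib_right coeff_sum)
    finally show ?thesis .
  qed
  have sys: "(\<forall>r\<in>R. (\<Sum>u\<in>S. a r u w * y u) = 0) \<longleftrightarrow> (\<forall>i\<le>n. \<forall>i'\<le>n. Z y i' * tup w i = Z y i * tup w i')" for w y
  proof -
    have key: "(\<Sum>u\<in>S. a (i, i', s) u w * y u) = Polynomial.coeff (Z y i' * tup w i - Z y i * tup w i') s"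
      if "i \<le> n" "i' \<le> n" for i i' s
      unfolding a_def fst_conv snd_conv left_diff_distrib sum_subtractf half[OF that(2)] half[OF that(1)] coeff_diff ..
    show ?thesis
    proof
      assume L: "\<forall>r\<in>R. (\<Sum>u\<in>S. a r u w * y u) = 0"
      show "\<forall>i\<le>n. \<forall>i'\<le>n. Z y i' * tup w i = Z y i * tup w i'"
      proof (intro allI impI)
        fix i i' assume i: "i \<le> n" "i' \<le> n"
        have "Z y i' * tup w i - Z y i * tup w i' = 0"
        proof (rule poly_eqI)
          fix s
          have "(i, i', s) \<in> R" using i by (simp add: R_def)
          then have "(\<Sum>u\<in>S. a (i, i', s) u w * y u) = 0" using L by (rule bspec[rotated])
          then show "Polynomial.coeff (Z y i' * tup w i - Z y i * tup w i') s = Polynomial.coeff 0 s"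
            unfolding key[OF i] coeff_0 .
        qed
        then show "Z y i' * tup w i = Z y i * tup w i'" by simp
      qed
    next
      assume E: "\<forall>i\<le>n. \<forall>i'\<le>n. Z y i' * tup w i = Z y i * tup w i'"
      show "\<forall>r\<in>R. (\<Sum>u\<in>S. a r u w * y u) = 0"
      proof
        fix r assume "r \<in> R"
        then obtain i i' s where r: "r = (i, i', s)" "i \<le> n" "i' \<le> n" by (auto simp: R_def)
        then have "Z y i' * tup w i = Z y i * tup w i'" using E by blast
        then show "(\<Sum>u\<in>S. a r u w * y u) = 0" unfolding r(1) key[OF r(2,3)] by simp
      qed
    qed
  qed
  have Z0: "y u = 0" if zz: "\<And>i. i \<le> n \<Longrightarrow> Z y i = 0" and uS: "u \<in> S" for y u
  proof -
    obtain i s where u: "u = (i, s)" "i \<le> n" "s < H" using uS by (auto simp: S_def)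
    have "Polynomial.coeff (Z y i) s = (\<Sum>s'<H. if s' = s then y (i, s) else 0)"
      using u(2) by (auto simp: Z_def coeff_sum intro!: sum.cong)
    then show ?thesis using zz[OF u(2)] u by simp
  qed
  have "\<exists>v\<in>polys N. v w1 \<noteq> 0 \<and>
      (\<forall>x y. v x \<noteq> 0 \<longrightarrow> (\<forall>r\<in>R. (\<Sum>u\<in>S. a r u x * y u) = 0) \<longrightarrow> (\<forall>u\<in>S. y u = 0))"
  proof (rule trivial_kernel_open)
    show "finite S" by (simp add: S_def)
    show "a r u \<in> polys N" for r u
    proof -
      have "(\<lambda>w. (if fst u = fst (snd r) then q w (fst r) (snd u) (snd (snd r)) else 0)
         - (if fst u = fst r then q w (fst (snd r)) (snd u) (snd (snd r)) else 0)) \<in> polys N"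
        by (intro polys_diff polys_if q_polys)
      then show ?thesis by (simp add: a_def[abs_def])
    qed
    fix y assume "\<And>r. r \<in> R \<Longrightarrow> (\<Sum>u\<in>S. a r u w1 * y u) = 0"
    then have "\<forall>r\<in>R. (\<Sum>u\<in>S. a r u w1 * y u) = 0" by (rule ballI)
    then have par: "Z y i' * tup w1 i = Z y i * tup w1 i'" if "i \<le> n" "i' \<le> n" for i i'
      unfolding sys using that by blast
    have par': "tup w1 i * Z y j = tup w1 j * Z y i" for i j
      using par[of i j] by (cases "i \<le> n"; cases "j \<le> n") (auto simp: Z_def tup_def mult.commute)
    show "\<forall>u\<in>S. y u = 0"
    proof (rule ccontr)
      assume "\<not> (\<forall>u\<in>S. y u = 0)"
      then obtain u where u: "u \<in> S" "y u \<noteq> 0" by blast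
      then have H: "H > 0" by (auto simp: S_def)
      have "\<not> (\<forall>i\<le>n. Z y i = 0)" using Z0[of y u] u by blast
      then obtain i0 where i0: "i0 \<le> n" "Z y i0 \<noteq> 0" by blast
      have x1: "tup w1 i1 \<noteq> 0" using w1(3) H by auto
      have "tup w1 i0 * Z y i1 \<noteq> 0" using par'[of i1 i0] x1 i0 by auto
      then have z1: "Z y i1 \<noteq> 0" by auto
      \<comment> \<open>A tuple proportional to a primitive one is a polynomial multiple of it, so
        its degree at \<open>i1\<close> is at least \<open>H\<close>.\<close>
      have "primitive n (tup w1)" using w1(1) by (simp add: hat_def sections_def)
      then obtain c where c: "c \<noteq> 0" "\<And>j. Z y j = c * tup w1 j"
        using primitive_multiple[of n "tup w1" "Z y" i1, OF _ par' _ z1 x1] by (auto simp: tup_def)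
      have "Polynomial.degree (Z y i1) \<ge> H" using c x1 w1(3) by (simp add: degree_mult_eq)
      moreover have "Polynomial.degree (Z y i1) < H"
        unfolding Z_def using w1(2) H
        by (auto intro!: degree_sum_less le_less_trans[OF degree_monom_le])
      ultimately show False by simp
    qed
  qed
  then obtain v where v: "v \<in> polys N" "v w1 \<noteq> 0"
    "\<And>x y. v x \<noteq> 0 \<Longrightarrow> (\<forall>r\<in>R. (\<Sum>u\<in>S. a r u x * y u) = 0) \<Longrightarrow> (\<forall>u\<in>S. y u = 0)" by blast
  have "primitive n (tup w)" if w: "w \<in> closed_to N (hat Y)" and vw: "v w \<noteq> 0" for w
    unfolding primitive_def
  proof (intro allI impI, rule ccontr)
    fix p assume p: "\<forall>i\<le>n. p dvd tup w i" and nu: "\<not> is_unit p"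
    have "tup w \<in> Pts" by (rule closed_Pts[OF w])
    then obtain i0 where i0: "i0 \<le> n" "tup w i0 \<noteq> 0" using Pts_nonzero by blast
    have p0: "p \<noteq> 0" using p i0 by auto
    then have dp: "Polynomial.degree p > 0" using nu is_unit_iff_degree by blast
    \<comment> \<open>Removing a nonconstant common factor would give a nonzero proportional tuple
      of height below \<open>H\<close>, that is, a nontrivial solution of the system.\<close>
    define z where "z i = (if i \<le> n then tup w i div p else 0)" for i
    have z: "tup w i = p * z i" if "i \<le> n" for i using p that by (auto simp: z_def)
    have dz: "z i = 0 \<or> Polynomial.degree (z i) < H" if i: "i \<le> n" for i
    proof (cases "z i = 0")
      case False
      then have "Polynomial.degree (tup w i) = Polynomial.degree p + Polynomial.degree (z i)"
        using z[OF i] p0 by (simp add: degree_mult_eq)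
      then show ?thesis using ubc[OF w i] dp by simp
    qed simp
    define y where "y u = Polynomial.coeff (z (fst u)) (snd u)" for u :: "nat \<times> nat"
    have Zy: "Z y i = z i" if i: "i \<le> n" for i
      using poly_sum_monom_lt[OF dz[OF i]] i by (simp add: Z_def y_def)
    have "\<forall>r\<in>R. (\<Sum>u\<in>S. a r u w * y u) = 0"
      unfolding sys using Zy z by (auto simp: ac_simps)
    then have y0: "\<forall>u\<in>S. y u = 0" by (rule v(3)[OF vw])
    have "z i0 = 0"
    proof (rule poly_eqI)
      fix s
      show "Polynomial.coeff (z i0) s = Polynomial.coeff 0 s"
      proof (cases "s < H")
        case True
        then show ?thesis using y0 i0 by (auto simp: S_def y_def)
      next
        case False
        then show ?thesis using dz[OF i0(1)] by (auto intro: coeff_eq_0)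
      qed
    qed
    then show False using z[OF i0(1)] i0(2) by simp
  qed
  moreover have "ps.nz v" unfolding ps.nz_def using v(2) w1(1) by blast
  ultimately show ?thesis using v(1) by blast
qed

end

section \<open>Chains of irreducible closed sets\<close>

lemma forms_one: "(1 :: ('i, 'a::comm_ring_1) mpoly) \<in> forms I 0"
  using forms_single[of 0 I 0 "1::'a"] by simp

lemma forms_prod:
  fixes f :: "'s \<Rightarrow> ('i, 'a::comm_ring_1) mpoly"
  shows "finite S \<Longrightarrow> (\<And>s. s \<in> S \<Longrightarrow> f s \<in> forms I (m s)) \<Longrightarrow> (\<Prod>s\<in>S. f s) \<in> forms I (\<Sum>s\<in>S. m s)"
proof (induction S rule: finite_induct)
  case empty
  show ?case by (simp add: forms_one)
next
  case (insert s S)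
  then have "f s * prod f S \<in> forms I (m s + sum m S)" by (intro forms_mult) auto
  then show ?case using insert.hyps by simp
qed

definition vanish_on :: "('i, complex) mpoly \<Rightarrow> ('i \<Rightarrow> complex) set set \<Rightarrow> bool" where
  "vanish_on F S \<longleftrightarrow> (\<forall>v. proj_class v \<in> S \<longrightarrow> mpoly_eval id F v = 0)"

lemma vanish_on_iff:
  assumes "F \<in> forms I m" "S \<subseteq> proj_space I"
  shows "vanish_on F S \<longleftrightarrow> (\<forall>p\<in>S. vanishes_at id F p)"
proof
  assume "vanish_on F S"
  show "\<forall>p\<in>S. vanishes_at id F p"
  proof
    fix p assume p: "p \<in> S"
    then obtain v where "p = proj_class v" using assms(2) by (auto simp: proj_space_def)
    then show "vanishes_at id F p" using \<open>vanish_on F S\<close> p cx.vanishes_at_class[OF assms(1)] by (simp add: vanish_on_def)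
  qed
next
  assume "\<forall>p\<in>S. vanishes_at id F p"
  then show "vanish_on F S" using cx.vanishes_at_class[OF assms(1)] by (auto simp: vanish_on_def)
qed

lemma irreducible_proj: "irreducible_in (zariski (id :: complex \<Rightarrow> complex) I) S \<Longrightarrow> S \<noteq> {} \<and> S \<subseteq> proj_space I"
  unfolding irreducible_in_def cx.topspace_zariski by blast

lemma irreducible_vanish_on:
  assumes irr: "irreducible_in (zariski id I) S" and F: "F \<in> forms I m" and G: "G \<in> forms I l"
    and z: "\<And>v. proj_class v \<in> S \<Longrightarrow> mpoly_eval id F v * mpoly_eval id G v = 0"
  shows "vanish_on F S \<or> vanish_on G S"
proof -
  have sub: "S \<subseteq> proj_space I" using irreducible_proj[OF irr] by simp
  have "vanish_on (F * G) S" using z by (simp add: vanish_on_def cx.eval_mult)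
  then have "\<And>p. p \<in> S \<Longrightarrow> vanishes_at id (F * G) p" using vanish_on_iff[OF forms_mult[OF F G] sub] by blast
  then have "(\<forall>p\<in>S. vanishes_at id F p) \<or> (\<forall>p\<in>S. vanishes_at id G p)" by (rule cx.irreducible_forms[OF irr F G])
  then show ?thesis using vanish_on_iff[OF F sub] vanish_on_iff[OF G sub] by blast
qed

text \<open>A monomial in the forms \<open>f i\<close>, homogenised by the linear form
  \<open>y\<close>: the factor for \<open>i\<close> always has degree \<open>E i * D\<close>, so all
  exponent lists with entries up to \<open>D\<close> give forms of one degree.\<close>

definition cmono :: "(nat \<Rightarrow> ('i, complex) mpoly) \<Rightarrow> (nat \<Rightarrow> nat) \<Rightarrow> ('i, complex) mpoly \<Rightarrow> nat \<Rightarrow> nat list \<Rightarrow> ('i, complex) mpoly" where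
  "cmono f E y D l = (\<Prod>i<length l. f i ^ (l ! i) * y ^ (E i * (D - l ! i)))"

lemma exps_Suc: "exps (Suc r) D = (\<lambda>(l, j). l @ [j]) ` (exps r D \<times> {..D})"
proof (intro subset_antisym subsetI)
  fix l assume l: "l \<in> exps (Suc r) D"
  then have "l \<noteq> []" by (auto simp: exps_def)
  then have "l = butlast l @ [last l]" by simp
  moreover have "last l \<in> {..D}" using l last_in_set[OF \<open>l \<noteq> []\<close>] unfolding exps_def by blast
  moreover have "butlast l \<in> exps r D"
    using l by (auto simp: exps_def dest: in_set_butlastD)
  ultimately show "l \<in> (\<lambda>(l, j). l @ [j]) ` (exps r D \<times> {..D})"
    by (intro image_eqI[of _ _ "(butlast l, last l)"]) auto
qed (auto simp: exps_def)

lemma sum_exps_Suc: "(\<Sum>l\<in>exps (Suc r) D. h l) = (\<Sum>j\<le>D. \<Sum>l\<in>exps r D. h (l @ [j]))"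
proof -
  have "(\<Sum>l\<in>exps (Suc r) D. h l) = (\<Sum>(l, j)\<in>exps r D \<times> {..D}. h (l @ [j]))"
    unfolding exps_Suc by (subst sum.reindex) (auto simp: inj_on_def intro!: sum.cong)
  also have "\<dots> = (\<Sum>l\<in>exps r D. \<Sum>j\<le>D. h (l @ [j]))" by (simp add: sum.cartesian_product)
  also have "\<dots> = (\<Sum>j\<le>D. \<Sum>l\<in>exps r D. h (l @ [j]))" by (rule sum.swap)
  finally show ?thesis .
qed

lemma cmono_snoc: "cmono f E y D (l @ [j]) = cmono f E y D l * (f (length l) ^ j * y ^ (E (length l) * (D - j)))"
  unfolding cmono_def by (simp add: nth_append)

lemma cmono_forms:
  assumes "\<And>i. i < r \<Longrightarrow> f i \<in> forms I (E i)" "y \<in> forms I 1" "l \<in> exps r D"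
  shows "cmono f E y D l \<in> forms I ((\<Sum>i<r. E i) * D)"
proof -
  have "f i ^ (l ! i) * y ^ (E i * (D - l ! i)) \<in> forms I (E i * D)" if i: "i < r" for i
  proof -
    have "l ! i \<in> set l" using assms(3) i by (simp add: exps_def)
    then have "l ! i \<le> D" using assms(3) by (auto simp: exps_def)
    then have "E i * (l ! i) + 1 * (E i * (D - l ! i)) = E i * D" by (simp flip: distrib_left)
    then show ?thesis using forms_mult[OF forms_power[OF assms(1)[OF i], of "l ! i"] forms_power[OF assms(2), of "E i * (D - l ! i)"]]
      by (simp only:)
  qed
  then have "cmono f E y D l \<in> forms I (\<Sum>i<r. E i * D)"
    unfolding cmono_def using assms(3) by (auto intro!: forms_prod simp: exps_def)
  then show ?thesis by (simp add: sum_distrib_right)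
qed

text \<open>Along a chain of irreducible closed sets, forms that vanish on one member but not on the next one
  become algebraically independent after dehomogenisation by \<open>y\<close>.\<close>

lemma chain_independent:
  assumes "\<And>i. i \<le> r \<Longrightarrow> irreducible_in (zariski id I) (Y i)" "\<And>i. i < r \<Longrightarrow> Y i \<subseteq> Y (Suc i)"
    and "\<And>i. i < r \<Longrightarrow> f i \<in> forms I (E i)" "\<And>i. i < r \<Longrightarrow> vanish_on (f i) (Y i)"
    and "\<And>i. i < r \<Longrightarrow> \<not> vanish_on (f i) (Y (Suc i))"
    and y: "y \<in> forms I 1" "\<not> vanish_on y (Y 0)"
    and "\<And>v. proj_class v \<in> Y r \<Longrightarrow> (\<Sum>l\<in>exps r D. c l * mpoly_eval id (cmono f E y D l) v) = 0"
  shows "\<forall>l\<in>exps r D. c l = 0"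
  using assms(1-5,8)
proof (induction r arbitrary: c)
  case 0
  have e: "exps 0 D = {[]}" by (auto simp: exps_def)
  have "Y 0 \<noteq> {}" "Y 0 \<subseteq> proj_space I" using irreducible_proj[OF 0(1)[of 0]] by simp_all
  then obtain p where p: "p \<in> Y 0" "p \<in> proj_space I" by blast
  then obtain v where v: "p = proj_class v" by (auto simp: proj_space_def)
  have one: "mpoly_eval id (cmono f E y D []) v = 1" using eval_prod[of "\<lambda>i. f i" "{}" v] by (simp only: cmono_def list.size lessThan_0 prod.empty)
  have "(\<Sum>l\<in>{[]}. c l * mpoly_eval id (cmono f E y D l) v) = 0" using 0(6)[of v] p(1) unfolding v e by blast
  then have "c [] * mpoly_eval id (cmono f E y D []) v = 0"
    by (simp only: sum.insert finite.emptyI sum.empty empty_iff not_False_eq_True add_0_right)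
  then show ?case unfolding one e by simp
next
  case (Suc r)
  have irr: "irreducible_in (zariski id I) (Y i)" if "i \<le> Suc r" for i using Suc.prems(1)[OF that] .
  have fr: "f r \<in> forms I (E r)" "vanish_on (f r) (Y r)" "\<not> vanish_on (f r) (Y (Suc r))" using Suc.prems(3-5)[of r] by auto
  have sub: "Y 0 \<subseteq> Y i" if "i \<le> Suc r" for i
    using that
  proof (induction i)
    case (Suc i)
    then show ?case using Suc.prems(1) \<open>\<And>i. i < Suc r \<Longrightarrow> Y i \<subseteq> Y (Suc i)\<close>[of i] by auto
  qed simp
  have yr: "\<not> vanish_on y (Y r)" using y(2) sub[of r] by (auto simp: vanish_on_def)
  define G where "G j = (\<Sum>l\<in>exps r D. mpoly_scale (c (l @ [j])) (cmono f E y D l))" for j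
  define m where "m = (\<Sum>i<r. E i) * D"
  have Gf: "G j \<in> forms I m" for j
    unfolding G_def m_def using Suc.prems(3) y(1) by (intro forms_sum forms_scale cmono_forms) auto
  have len: "length l = r" if "l \<in> exps r D" for l using that by (simp add: exps_def)
  have expand_sum: "(\<Sum>l\<in>exps (Suc r) D. c l * mpoly_eval id (cmono f E y D l) v) =
      (\<Sum>j\<le>D. mpoly_eval id (f r) v ^ j * (mpoly_eval id y v ^ (E r * (D - j)) * mpoly_eval id (G j) v))" for v
    unfolding sum_exps_Suc G_def cx.eval_sum cx.eval_scale sum_distrib_left
    by (intro sum.cong) (auto simp: cmono_snoc len cx.eval_mult mpoly_eval_power ac_simps)
  \<comment> \<open>The relation is a polynomial in \<open>f r\<close> with coefficients built from
    the \<open>G j\<close>. Once the lower ones are zero, \<open>f r ^ j\<close> is cancelled on the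
    larger set; restricting to \<open>Y r\<close>, where \<open>f r\<close> vanishes, leaves
    \<open>G j\<close> times a power of \<open>y\<close>, and that power is cancelled there.\<close>
  have "\<forall>l\<in>exps r D. c (l @ [j]) = 0" if "j \<le> D" for j
    using that
  proof (induction j rule: less_induct)
    case (less j)
    have G0: "mpoly_eval id (G j') v = 0" if "j' < j" for j' v
      unfolding G_def cx.eval_sum cx.eval_scale using less that by (intro sum.neutral) auto
    define H where "H = (\<Sum>i\<le>D - j. f r ^ i * (y ^ (E r * (D - j - i)) * G (j + i)))"
    have "H \<in> forms I (E r * (D - j) + m)"
      unfolding H_def
    proof (rule forms_sum)
      fix i assume "i \<in> {..D - j}"
      then have "i + (D - j - i) = D - j" by simp
      then have "E r * i + (1 * (E r * (D - j - i)) + m) = E r * (D - j) + m"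
        by (simp only: mult_1 add.assoc[symmetric] distrib_left[symmetric])
      then show "f r ^ i * (y ^ (E r * (D - j - i)) * G (j + i)) \<in> forms I (E r * (D - j) + m)"
        using forms_mult[OF forms_power[OF fr(1)] forms_mult[OF forms_power[OF y(1)] Gf]] by metis
    qed
    have Hev: "mpoly_eval id H v = (\<Sum>i\<le>D - j. mpoly_eval id (f r) v ^ i * (mpoly_eval id y v ^ (E r * (D - j - i)) * mpoly_eval id (G (j + i)) v))" for v
      by (simp add: H_def cx.eval_sum cx.eval_mult mpoly_eval_power)
    have "mpoly_eval id (f r ^ j) v * mpoly_eval id H v = 0" if "proj_class v \<in> Y (Suc r)" for v
    proof -
      let ?t = "\<lambda>j. mpoly_eval id (f r) v ^ j * (mpoly_eval id y v ^ (E r * (D - j)) * mpoly_eval id (G j) v)"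
      have "0 = (\<Sum>j\<le>D. ?t j)" using Suc.prems(6)[OF that] unfolding expand_sum by simp
      also have "\<dots> = (\<Sum>j\<in>{j..D}. ?t j)"
        using G0 by (intro sum.mono_neutral_right) (auto simp: not_le)
      also have "\<dots> = (\<Sum>i\<le>D - j. ?t (j + i))"
        by (rule sum.reindex_bij_witness[of _ "\<lambda>i. j + i" "\<lambda>i. i - j"]) (use less.prems in auto)
      also have "\<dots> = mpoly_eval id (f r ^ j) v * mpoly_eval id H v"
        unfolding Hev mpoly_eval_power sum_distrib_left by (intro sum.cong) (auto simp: power_add ac_simps)
      finally show ?thesis ..
    qed
    then have "vanish_on (f r ^ j) (Y (Suc r)) \<or> vanish_on H (Y (Suc r))"
      using irreducible_vanish_on[OF irr[of "Suc r"] forms_power[OF fr(1)] \<open>H \<in> _\<close>] by blast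
    moreover have "\<not> vanish_on (f r ^ j) (Y (Suc r))"
      using fr(3) unfolding vanish_on_def mpoly_eval_power by (metis power_not_zero)
    ultimately have HY: "vanish_on H (Y r)" using Suc.prems(2)[of r] by (auto simp: vanish_on_def)
    have "mpoly_eval id (y ^ (E r * (D - j))) v * mpoly_eval id (G j) v = 0" if v: "proj_class v \<in> Y r" for v
    proof -
      have f0: "mpoly_eval id (f r) v = 0" using fr(2) v by (simp add: vanish_on_def)
      have "0 = mpoly_eval id H v" using HY v by (simp add: vanish_on_def)
      also have "\<dots> = (\<Sum>i\<in>{0}. mpoly_eval id (f r) v ^ i * (mpoly_eval id y v ^ (E r * (D - j - i)) * mpoly_eval id (G (j + i)) v))"
        unfolding Hev by (intro sum.mono_neutral_right) (auto simp: f0)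
      finally show ?thesis by (simp add: mpoly_eval_power)
    qed
    then have "vanish_on (y ^ (E r * (D - j))) (Y r) \<or> vanish_on (G j) (Y r)"
      using irreducible_vanish_on[OF irr[of r] forms_power[OF y(1)] Gf] by auto
    moreover have "\<not> vanish_on (y ^ (E r * (D - j))) (Y r)"
      using yr unfolding vanish_on_def mpoly_eval_power by (metis power_not_zero)
    ultimately have Gz: "vanish_on (G j) (Y r)" by blast
    show ?case
    proof (rule Suc.IH)
      show "(\<Sum>l\<in>exps r D. c (l @ [j]) * mpoly_eval id (cmono f E y D l) v) = 0" if "proj_class v \<in> Y r" for v
        using Gz that by (simp add: vanish_on_def G_def cx.eval_sum cx.eval_scale)
    qed (use Suc.prems in auto)
  qed
  then show ?case unfolding exps_Suc by auto
qed

context component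
begin

section \<open>The dimension of one component\<close>

lemma chain_family:
  assumes "\<And>i. i \<le> r \<Longrightarrow> irreducible_in (zariski id Idx) (Yc i)" "\<And>i. i < r \<Longrightarrow> Yc i \<subseteq> Yc (Suc i)"
    and sep: "\<And>i. i < r \<Longrightarrow> \<exists>f m. f \<in> forms Idx m \<and> vanish_on f (Yc i) \<and> \<not> vanish_on f (Yc (Suc i))"
    and top: "Yc r = Y"
  shows "\<exists>E M. (\<forall>D. \<forall>l\<in>exps r D. M D l \<in> polyfun N (E * D)) \<and>
    (\<forall>D c. (\<forall>w\<in>hat Y. (\<Sum>l\<in>exps r D. c l * M D l w) = 0) \<longrightarrow> (\<forall>l\<in>exps r D. c l = 0))"
proof -
  have "\<forall>i. \<exists>t. i < r \<longrightarrow> fst t \<in> forms Idx (snd t) \<and> vanish_on (fst t) (Yc i) \<and> \<not> vanish_on (fst t) (Yc (Suc i))"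
  proof
    fix i show "\<exists>t. i < r \<longrightarrow> fst t \<in> forms Idx (snd t) \<and> vanish_on (fst t) (Yc i) \<and> \<not> vanish_on (fst t) (Yc (Suc i))"
    proof (cases "i < r")
      case True
      obtain f m where "f \<in> forms Idx m" "vanish_on f (Yc i)" "\<not> vanish_on f (Yc (Suc i))"
        using sep[OF True] by blast
      then show ?thesis by (intro exI[of _ "(f, m)"]) simp
    qed simp
  qed
  from choice[OF this] obtain t where t: "\<And>i. i < r \<Longrightarrow> fst (t i) \<in> forms Idx (snd (t i))"
    "\<And>i. i < r \<Longrightarrow> vanish_on (fst (t i)) (Yc i)" "\<And>i. i < r \<Longrightarrow> \<not> vanish_on (fst (t i)) (Yc (Suc i))" by blast
  define f where "f i = fst (t i)" for i
  define E where "E i = snd (t i)" for i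
  have f: "\<And>i. i < r \<Longrightarrow> f i \<in> forms Idx (E i)" "\<And>i. i < r \<Longrightarrow> vanish_on (f i) (Yc i)"
    "\<And>i. i < r \<Longrightarrow> \<not> vanish_on (f i) (Yc (Suc i))" using t by (simp_all add: f_def E_def)
  have "Yc 0 \<noteq> {}" "Yc 0 \<subseteq> proj_space Idx" using irreducible_proj[OF assms(1)[of 0]] by simp_all
  then obtain p where p: "p \<in> Yc 0" "p \<in> proj_space Idx" by blast
  then obtain v i where v: "p = proj_class v" "i \<in> Idx" "v i \<noteq> 0" by (auto simp: proj_space_def)
  define y :: "(nat \<times> nat, complex) mpoly" where "y = mvar i"
  have y: "y \<in> forms Idx 1" unfolding y_def using v(2) by (rule mvar_forms)
  have y0: "\<not> vanish_on y (Yc 0)" using p(1) v by (auto simp: vanish_on_def y_def)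
  define M where "M D l w = mpoly_eval id (cmono f E y D l) (cvec (tup w))" for D l w
  have "M D l \<in> polyfun N ((\<Sum>i<r. E i) * D)" if l: "l \<in> exps r D" for D l
    unfolding M_def[abs_def] by (rule form_polyfun[OF cmono_forms[OF f(1) y l]])
  moreover have "\<forall>l\<in>exps r D. c l = 0" if z: "\<forall>w\<in>hat Y. (\<Sum>l\<in>exps r D. c l * M D l w) = 0" for D c
  proof -
    define F where "F = (\<Sum>l\<in>exps r D. mpoly_scale (c l) (cmono f E y D l))"
    have F: "F \<in> forms Idx ((\<Sum>i<r. E i) * D)" unfolding F_def by (intro forms_sum forms_scale cmono_forms f y)
    have Fe: "mpoly_eval id F v = (\<Sum>l\<in>exps r D. c l * mpoly_eval id (cmono f E y D l) v)" for v
      by (simp add: F_def cx.eval_sum cx.eval_scale)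
    have "\<forall>w\<in>hat Y. mpoly_eval id F (cvec (tup w)) = 0" using z unfolding Fe M_def .
    then have "\<forall>p\<in>Y. vanishes_at id F p" using vanishes_hat[OF F] by blast
    then have "vanish_on F Y"
      using cx.vanishes_at_class[OF F] by (auto simp: vanish_on_def)
    then have van: "(\<Sum>l\<in>exps r D. c l * mpoly_eval id (cmono f E y D l) v) = 0" if "proj_class v \<in> Yc r" for v
      using that unfolding Fe[symmetric] top by (simp add: vanish_on_def)
    show ?thesis by (rule chain_independent[where I = Idx and Y = Yc and f = f and E = E and y = y]) (use assms(1,2) f y y0 van in auto)
  qed
  ultimately show ?thesis by (intro exI[of _ "\<Sum>i<r. E i"] exI[of _ M]) blast
qed

text \<open>The open condition \<open>v\<close> keeps those points of the closure of
  \<open>hat Y\<close> that are good, primitive and outside the zeros of \<open>Fs\<close>. They are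
  true sections, so the fibre bound makes the fibres of the jet map finite. The forms in
  \<open>Fs\<close> will be used to stay away from the other components.\<close>

lemma component_dim:
  assumes k: "k > 0" and L: "L \<ge> n * (Suc d * Suc d)" and m: "2 * (m * (b - 1)) < k * ((\<Sum>j\<le>m. min d (Suc j)) - 1)"
    and good: "cd.good t0 L x0"
    and Fs: "finite Fs" "\<And>F. F \<in> Fs \<Longrightarrow> \<exists>m. F \<in> forms Idx m \<and> \<not> vanish_on F Y"
    and chain: "\<And>i. i \<le> r \<Longrightarrow> irreducible_in (zariski id Idx) (Yc i)" "\<And>i. i < r \<Longrightarrow> Yc i \<subseteq> Yc (Suc i)"
      "\<And>i. i < r \<Longrightarrow> \<exists>f m. f \<in> forms Idx m \<and> vanish_on f (Yc i) \<and> \<not> vanish_on f (Yc (Suc i))" "Yc r = Y"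
  shows "r \<le> k"
    and "r = k \<Longrightarrow> \<exists>Q\<in>polys k. (\<exists>\<alpha>. Q \<alpha> \<noteq> 0) \<and> (\<forall>\<alpha>. Q \<alpha> \<noteq> 0 \<longrightarrow>
      (\<exists>x. x \<in> sections b \<and> cd.good t0 L x \<and> lam x = 1 \<and> jets \<alpha> x \<and>
        (\<forall>F m. F \<in> forms Idx m \<longrightarrow> vanish_on F Y \<longrightarrow> mpoly_eval id F (cvec x) = 0) \<and>
        (\<forall>F\<in>Fs. mpoly_eval id F (cvec x) \<noteq> 0)))"
proof -
  obtain vg where vg: "vg \<in> polys N" "\<And>w. vg w \<noteq> 0 \<longleftrightarrow> cd.good t0 L (tup w)" using good_polys[of L] by blast
  obtain vp where vp: "vp \<in> polys N" "ps.nz vp" "\<And>w. w \<in> closed_to N (hat Y) \<Longrightarrow> vp w \<noteq> 0 \<Longrightarrow> primitive n (tup w)"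
    using primitive_open by blast
  define ev where "ev F = (\<lambda>w. mpoly_eval id F (cvec (tup w)))" for F :: "(nat \<times> nat, complex) mpoly"
  have ev: "ev F \<in> polys N" for F unfolding ev_def by (rule form_polys)
  have nzF: "ps.nz (ev F)" if F: "F \<in> Fs" for F
  proof -
    obtain m where F': "F \<in> forms Idx m" "\<not> vanish_on F Y" using Fs(2)[OF F] by blast
    then have "\<not> (\<forall>p\<in>Y. vanishes_at id F p)" using cx.vanishes_at_class[OF F'(1)] by (auto simp: vanish_on_def)
    then show ?thesis using vanishes_hat[OF F'(1)] by (auto simp: ps.nz_def ev_def)
  qed
  have prodF: "(\<lambda>w. \<Prod>F\<in>S. ev F w) \<in> polys N \<and> ps.nz (\<lambda>w. \<Prod>F\<in>S. ev F w)" if "finite S" "S \<subseteq> Fs" for S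
    using that
  proof (induction S rule: finite_induct)
    case empty
    show ?case using polys_const[of 1] ps.nonempty by (auto simp: ps.nz_def)
  next
    case (insert F S)
    then have "(\<lambda>w. ev F w * (\<Prod>F\<in>S. ev F w)) \<in> polys N" "ps.nz (\<lambda>w. ev F w * (\<Prod>F\<in>S. ev F w))"
      using ev nzF by (auto intro!: polys_mult ps.nz_mult[of _ N])
    then show ?case using insert.hyps by simp
  qed
  have nzg: "ps.nz vg"
  proof -
    obtain w c where w: "w \<in> hat Y" "c \<noteq> 0" "tup w = (\<lambda>i. Polynomial.smult c (x0 i))" using hat_exists[OF x0] by blast
    have hc: "hrel (h :: nat \<Rightarrow> nat \<Rightarrow> complex) e M (c * u) (c * v) (c * l) = c ^ M * hrel h e M u v l" if "e \<le> M" for h e M u v l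
    proof -
      have "h s a * ((c * u) ^ a * (c * v) ^ (M - s - a) * (c * l) ^ s) = c ^ M * (h s a * (u ^ a * v ^ (M - s - a) * l ^ s))"
        if "s \<le> e" "a \<le> M - s" for s a
      proof -
        have "c ^ M = c ^ a * c ^ (M - s - a) * c ^ s" using that \<open>e \<le> M\<close> by (simp flip: power_add)
        then show ?thesis by (simp add: power_mult_distrib ac_simps)
      qed
      then show ?thesis unfolding hrel_def sum_distrib_left by (intro sum.cong) auto
    qed
    have tc: "htop (h :: nat \<Rightarrow> nat \<Rightarrow> complex) e M (c * u) (c * v) = c ^ (M - e) * htop h e M u v" for h e M u v
    proof -
      have "h e a * ((c * u) ^ a * (c * v) ^ (M - e - a)) = c ^ (M - e) * (h e a * (u ^ a * v ^ (M - e - a)))"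
        if "a \<le> M - e" for a
      proof -
        have "c ^ (M - e) = c ^ a * c ^ (M - e - a)" using that by (simp only: power_add[symmetric] le_add_diff_inverse)
        then show ?thesis by (simp add: power_mult_distrib ac_simps)
      qed
      then show ?thesis unfolding htop_def sum_distrib_left by (intro sum.cong) auto
    qed
    \<comment> \<open>Rescaling the tuple to \<open>lam = 1\<close> multiplies each of the values
      that define goodness by a power of the nonzero constant \<open>c\<close>.\<close>
    have "cd.good t0 L (tup w)"
      using good w(2) cd.e unfolding cd.good_def w(3) lf_smult unfolding eval_hom(2,3) poly_smult unfolding hder_def
      by (auto simp: hc tc diff_le_mono)
    then show ?thesis using vg(2)[of w] w(1) by (auto simp: ps.nz_def)
  qed
  define v where "v = (\<lambda>w. vg w * (vp w * (\<Prod>F\<in>Fs. ev F w)))"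
  have v: "v \<in> polys N" "ps.nz v"
    unfolding v_def using vg vp nzg prodF[OF Fs(1)] by (auto intro!: polys_mult ps.nz_mult[of _ N])
  have sec: "tup w \<in> sections b \<and> cd.good t0 L (tup w) \<and> lam (tup w) = 1 \<and> jets w (tup w)"
    if w: "w \<in> closed_to N (hat Y)" "v w \<noteq> 0" for w
  proof -
    have "b > 0" using x0(1) by (auto simp: sections_def)
    then have "Polynomial.degree (tup w i) < b" for i
      by (intro degree_lessI) (auto simp: coeff_tup)
    moreover have "primitive n (tup w)" using vp(3)[OF w(1)] w(2) by (auto simp: v_def)
    ultimately show ?thesis
      using closed_Pts[OF w(1)] closed_normal[OF w(1)] vg(2)[of w] w(2) by (auto simp: sections_def normal_def v_def)
  qed
  have jets_cong: "jets \<alpha> x" if "jets w x" "\<forall>j<k. w j = \<alpha> j" for w \<alpha> x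
    using that unfolding jets_def pjets_def by (auto intro!: sum.cong)
  have fin: "finite {w \<in> closed_to N (hat Y). v w \<noteq> 0 \<and> (\<forall>j<k. w j = \<alpha> j) \<and> (\<forall>j\<ge>N. w j = 0)}" (is "finite ?A") for \<alpha>
  proof -
    have inj: "inj_on tup ?A"
    proof (rule inj_onI, rule ext)
      fix w w' m assume w: "w \<in> ?A" "w' \<in> ?A" "tup w = tup w'"
      consider "m < k" | "m \<ge> N" | "\<not> m < k" "m < N" by linarith
      then show "w m = w' m"
      proof cases
        case 3
        define i j where "i = (m - k) div b" and "j = (m - k) mod b"
        have "m - k < Suc n * b" using 3 by (simp add: N_def)
        moreover from this have "b > 0" by (cases b) auto
        ultimately have ij: "i < Suc n" "j < b" by (simp_all add: i_def j_def less_mult_imp_div_less)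
        have mm: "m = k + i * b + j" using 3 by (simp add: i_def j_def)
        show ?thesis using coeff_tup[of w i j] coeff_tup[of w' i j] ij w(3) by (simp add: mm)
      qed (use w in auto)
    qed
    have "card G \<le> d * (d * m)" if G: "G \<subseteq> tup ` ?A" "finite G" for G
    proof (rule section_bound[OF k L m G(2), where \<alpha> = \<alpha>])
      fix x assume "x \<in> G"
      then obtain w where w: "w \<in> ?A" "x = tup w" using G(1) by blast
      then show "x \<in> sections b \<and> cd.good t0 L x \<and> lam x = 1 \<and> jets \<alpha> x"
        using sec[of w] jets_cong[of w "tup w" \<alpha>] by auto
    qed
    then have "finite (tup ` ?A)" using finite_if_finite_subsets_card_bdd[of "tup ` ?A"] by blast
    then show ?thesis using finite_imageD[OF _ inj] by blast
  qed
  obtain E Mf where Mf: "\<And>D l. l \<in> exps r D \<Longrightarrow> Mf D l \<in> polyfun N (E * D)"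
    "\<And>D c. (\<forall>w\<in>hat Y. (\<Sum>l\<in>exps r D. c l * Mf D l w) = 0) \<Longrightarrow> (\<forall>l\<in>exps r D. c l = 0)"
    using chain_family[OF chain] by blast
  have kN: "k \<le> N" by (simp add: N_def)
  have supp: "w j = 0" if "w \<in> hat Y" "j \<ge> N" for w j using that by (simp add: hat_def)
  show "r \<le> k"
  proof (rule ps.finite_fibres_dim(1)[where k = k and v = v and r = r and M = Mf and E = E, OF kN v])
    show "finite {w \<in> closed_to N (hat Y). v w \<noteq> 0 \<and> (\<forall>j<k. w j = \<alpha> j) \<and> (\<forall>j\<ge>N. w j = 0)}" for \<alpha> by (rule fin)
    show "w j = 0" if "w \<in> hat Y" "j \<ge> N" for w j using that by (rule supp)
    show "Mf D l \<in> polyfun N (E * D)" if "l \<in> exps r D" for D l using that by (rule Mf(1))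
    show "\<forall>l\<in>exps r D. c l = 0" if "\<forall>w\<in>hat Y. (\<Sum>l\<in>exps r D. c l * Mf D l w) = 0" for D c using that by (rule Mf(2))
  qed
  assume rk: "r = k"
  have "\<exists>Q\<in>polys k. (\<exists>x. Q x \<noteq> 0) \<and>
      (\<forall>\<alpha>. Q \<alpha> \<noteq> 0 \<longrightarrow> (\<exists>x\<in>closed_to N (hat Y). v x \<noteq> 0 \<and> (\<forall>j<k. x j = \<alpha> j) \<and> (\<forall>j\<ge>N. x j = 0)))"
  proof (rule ps.finite_fibres_dim(2)[where k = k and v = v and r = r and M = Mf and E = E, OF kN v])
    show "finite {w \<in> closed_to N (hat Y). v w \<noteq> 0 \<and> (\<forall>j<k. w j = \<alpha> j) \<and> (\<forall>j\<ge>N. w j = 0)}" for \<alpha> by (rule fin)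
    show "w j = 0" if "w \<in> hat Y" "j \<ge> N" for w j using that by (rule supp)
    show "Mf D l \<in> polyfun N (E * D)" if "l \<in> exps r D" for D l using that by (rule Mf(1))
    show "\<forall>l\<in>exps r D. c l = 0" if "\<forall>w\<in>hat Y. (\<Sum>l\<in>exps r D. c l * Mf D l w) = 0" for D c using that by (rule Mf(2))
  qed (rule rk)
  then obtain Q where Q: "Q \<in> polys k" "\<exists>x. Q x \<noteq> 0"
    "\<And>\<alpha>. Q \<alpha> \<noteq> 0 \<Longrightarrow> (\<exists>w\<in>closed_to N (hat Y). v w \<noteq> 0 \<and> (\<forall>j<k. w j = \<alpha> j) \<and> (\<forall>j\<ge>N. w j = 0))"
    by blast
  have "\<exists>x. x \<in> sections b \<and> cd.good t0 L x \<and> lam x = 1 \<and> jets \<alpha> x \<and>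
        (\<forall>F m. F \<in> forms Idx m \<longrightarrow> vanish_on F Y \<longrightarrow> mpoly_eval id F (cvec x) = 0) \<and>
        (\<forall>F\<in>Fs. mpoly_eval id F (cvec x) \<noteq> 0)" if Qa: "Q \<alpha> \<noteq> 0" for \<alpha>
  proof -
    obtain w where w: "w \<in> closed_to N (hat Y)" "v w \<noteq> 0" "\<forall>j<k. w j = \<alpha> j" using Q(3)[OF Qa] by blast
    have "mpoly_eval id F (cvec (tup w)) = 0" if "F \<in> forms Idx m" "vanish_on F Y" for F m
    proof (rule closed_form[OF w(1) that(1)])
      show "\<forall>p\<in>Y. vanishes_at id F p"
        using that vanish_on_iff[OF that(1)] Y_sub sections_proj by blast
    qed
    moreover have "mpoly_eval id F (cvec (tup w)) \<noteq> 0" if "F \<in> Fs" for F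
      using w(2) Fs(1) that by (auto simp: v_def ev_def)
    ultimately show ?thesis using sec[OF w(1,2)] jets_cong[of w "tup w" \<alpha>] w(3)
      by (intro exI[of _ "tup w"]) blast
  qed
  then show "\<exists>Q\<in>polys k. (\<exists>\<alpha>. Q \<alpha> \<noteq> 0) \<and> (\<forall>\<alpha>. Q \<alpha> \<noteq> 0 \<longrightarrow>
      (\<exists>x. x \<in> sections b \<and> cd.good t0 L x \<and> lam x = 1 \<and> jets \<alpha> x \<and>
        (\<forall>F m. F \<in> forms Idx m \<longrightarrow> vanish_on F Y \<longrightarrow> mpoly_eval id F (cvec x) = 0) \<and>
        (\<forall>F\<in>Fs. mpoly_eval id F (cvec x) \<noteq> 0)))" using Q(1,2) by blast
qed

end

section \<open>The number of components\<close>

lemma sum_min_exact: "m < d \<Longrightarrow> 2 * (\<Sum>j\<le>m. min d (Suc j)) = Suc m * (m + 2)"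
  by (induction m) simp_all

text \<open>Equality holds for \<open>m + 1 \<ge> d\<close>; for smaller \<open>m\<close> the two
  sides differ by \<open>(d - m - 1) (d - m - 2)\<close>, a product of two consecutive
  integers.\<close>

lemma sum_min_lower: "2 * int d * (int m + 1) \<le> 2 * int (\<Sum>j\<le>m. min d (Suc j)) + int d * (int d - 1)"
proof (induction m)
  case 0
  have "0 \<le> (int d - 1) * (int d - 2) \<or> d = 0"
  proof (cases "d \<le> 1")
    case False
    then show ?thesis by (intro disjI1 mult_nonneg_nonneg) auto
  qed (auto simp: le_Suc_eq)
  then show ?case by (cases "d = 0") (auto simp: min_def algebra_simps)
next
  case (Suc m)
  show ?case
  proof (cases "Suc m < d")
    case True
    have "0 \<le> (int d - int (Suc m) - 1) * (int d - int (Suc m) - 2)"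
    proof (cases "d = Suc (Suc m)")
      case False
      then show ?thesis using True by (intro mult_nonneg_nonneg) auto
    qed simp
    moreover have "2 * int (\<Sum>j\<le>Suc m. min d (Suc j)) = int (Suc (Suc m)) * (int (Suc m) + 2)"
      using arg_cong[OF sum_min_exact[OF True], of int] by (simp only: of_nat_mult of_nat_add of_nat_numeral)
    ultimately show ?thesis by (simp add: algebra_simps)
  next
    case False
    then have "min d (Suc (Suc m)) = d" by simp
    then have "int (\<Sum>j\<le>Suc m. min d (Suc j)) = int (\<Sum>j\<le>m. min d (Suc j)) + int d" by simp
    then show ?thesis using Suc by (simp add: algebra_simps)
  qed
qed

text \<open>With \<open>\<delta> = k d - 2 h > 0\<close>, the first condition follows from \<open>2 m \<delta> > k (d - 1) (d - 2)\<close>.\<close>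

lemma auxiliary_degree:
  fixes d h :: nat
  assumes d: "d > 0"
  defines "k \<equiv> 2 * h div d + 1"
  shows "\<exists>m. 2 * (m * h) < k * ((\<Sum>j\<le>m. min d (Suc j)) - 1) \<and> d * (d * m) \<le> 2 * d ^ 3 * (h + 1)"
proof -
  define \<delta> where "\<delta> = k * d - 2 * h"
  have kd: "2 * h < k * d"
    unfolding k_def using dividend_less_times_div[OF d, of "2 * h"] by (simp add: algebra_simps)
  then have \<delta>: "\<delta> > 0" "k * d = 2 * h + \<delta>" by (simp_all add: \<delta>_def)
  define c where "c = (d - 1) * (d - 2)"
  have c: "int c = (int d - 1) * (int d - 2)"
    using d by (cases "d = 1") (auto simp: c_def of_nat_diff)
  \<comment> \<open>The least \<open>m\<close> with \<open>2 \<delta> m > k (d - 1) (d - 2)\<close>.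
    Being least, it satisfies the opposite inequality for \<open>m - 1\<close>, which bounds it from
    above.\<close>
  define m where "m = k * c div (2 * \<delta>) + 1"
  define S where "S = (\<Sum>j\<le>m. min d (Suc j))"
  have "2 * \<delta> * (k * c div (2 * \<delta>)) \<le> k * c" by simp
  then have m1: "2 * \<delta> * (m - 1) \<le> k * c" by (simp add: m_def)
  have m2: "k * c < 2 * \<delta> * m"
    unfolding m_def using dividend_less_times_div[of "2 * \<delta>" "k * c"] \<delta>(1) by simp
  have "S \<ge> 1"
  proof -
    have "min d (Suc 0) \<le> S" unfolding S_def by (rule member_le_sum[of 0 "{..m}" "\<lambda>j. min d (Suc j)"]) auto
    then show ?thesis using d by simp
  qed
  have "int (2 * \<delta> * m) = 2 * int m * (int k * int d - 2 * int h)"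
    using arg_cong[OF \<delta>(2), of int] by (simp add: algebra_simps)
  then have "int k * int c < 2 * int m * (int k * int d - 2 * int h)" using m2 by (metis of_nat_less_iff of_nat_mult)
  moreover have "int k * (2 * int d * int m - int c) \<le> int k * (2 * int S - 2)"
    using sum_min_lower[of d m] unfolding c S_def[symmetric] by (intro mult_left_mono) (auto simp: algebra_simps)
  ultimately have "2 * (2 * (int m * int h)) < 2 * (int k * (int S - 1))" by (simp add: algebra_simps)
  then have "int (2 * (m * h)) < int (k * (S - 1))" using \<open>S \<ge> 1\<close> by (simp add: of_nat_diff algebra_simps)
  then have 1: "2 * (m * h) < k * (S - 1)" by (simp only: of_nat_less_iff)
  \<comment> \<open>From \<open>\<delta> \<ge> 1\<close> follows
    \<open>k d = 2 h + \<delta> \<le> 2 \<delta> (h + 1)\<close>, so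
    \<open>d (m - 1) \<le> (h + 1) d^2\<close>. The remaining summand \<open>d\<close> is absorbed
    by doubling, which is the origin of the constant 2.\<close>
  have "2 * \<delta> * (d * (m - 1)) = (2 * \<delta> * (m - 1)) * d" by (simp only: ac_simps)
  also have "\<dots> \<le> (k * c) * d" using m1 by (rule mult_le_mono1)
  also have "\<dots> = (2 * h + \<delta>) * c" using \<delta>(2) by (simp only: ac_simps)
  also have "\<dots> \<le> (2 * \<delta> * (h + 1)) * c"
  proof (rule mult_le_mono1)
    have "1 * h \<le> \<delta> * h" using \<delta>(1) by (intro mult_le_mono1) simp
    moreover have "2 * \<delta> * (h + 1) = 2 * (\<delta> * h) + 2 * \<delta>" by (simp add: algebra_simps)
    ultimately show "2 * h + \<delta> \<le> 2 * \<delta> * (h + 1)" by linarith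
  qed
  finally have "2 * \<delta> * (d * (m - 1)) \<le> 2 * \<delta> * ((h + 1) * c)" by (simp only: mult.assoc)
  then have "d * (m - 1) \<le> (h + 1) * c" using \<delta>(1) by simp
  moreover have "c \<le> d * d" unfolding c_def by (intro mult_le_mono) auto
  then have "(h + 1) * c \<le> (h + 1) * (d * d)" by (rule mult_le_mono2)
  ultimately have "d * (m - 1) \<le> (h + 1) * (d * d)" by (rule le_trans)
  moreover have "d * m = d * (m - 1) + d" by (simp add: m_def)
  moreover have "d \<le> (h + 1) * (d * d)" using d by (cases d) auto
  ultimately have "d * m \<le> 2 * ((h + 1) * (d * d))" by linarith
  then have "d * (d * m) \<le> d * (2 * ((h + 1) * (d * d)))" by (rule mult_le_mono2)
  also have "\<dots> = 2 * d ^ 3 * (h + 1)" by (simp add: power3_eq_cube algebra_simps)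
  finally show ?thesis using 1 unfolding S_def by blast
qed

section \<open>Chains and the Krull dimension\<close>

definition chain_in :: "'a topology \<Rightarrow> nat \<Rightarrow> (nat \<Rightarrow> 'a set) \<Rightarrow> bool" where
  "chain_in T r Y \<longleftrightarrow> (\<forall>i\<le>r. closedin T (Y i) \<and> irreducible_in T (Y i)) \<and> (\<forall>i<r. Y i \<subset> Y (Suc i))"

lemma krull_dim_eq: "krull_dim T = Sup {ereal (real k) | k. \<exists>Y. chain_in T k Y}"
  by (simp add: krull_dim_def chain_in_def)

lemma krull_dim_le: "(\<And>r Y. chain_in T r Y \<Longrightarrow> r \<le> k) \<Longrightarrow> krull_dim T \<le> ereal (real k)"
  unfolding krull_dim_eq by (rule Sup_least) auto

lemma krull_dim_attained:
  assumes "krull_dim T = ereal (real k)" "k > 0"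
  shows "\<exists>Y. chain_in T k Y"
proof (rule ccontr)
  assume no: "\<not> (\<exists>Y. chain_in T k Y)"
  have "r \<le> k - 1" if "chain_in T r Y" for r Y
  proof -
    have "ereal (real r) \<le> krull_dim T" unfolding krull_dim_eq using that by (intro Sup_upper) auto
    then have "r \<le> k" using assms(1) by simp
    moreover have "r \<noteq> k" using no that by blast
    ultimately show ?thesis by simp
  qed
  then have "krull_dim T \<le> ereal (real (k - 1))" by (rule krull_dim_le)
  then show False using assms by simp
qed

text \<open>If the set were finite, a product of linear forms, each vanishing at one of its points
  but not on the whole set, would vanish on all of it, against irreducibility. Infinity ensures a
  good section, since pairwise non-proportional bad ones are bounded in number.\<close>

lemma irreducible_infinite:
  assumes irr: "irreducible_in (zariski (id :: complex \<Rightarrow> complex) I) Y" and pq: "p \<in> Y" "q \<in> Y" "p \<noteq> q"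
  shows "infinite Y"
proof
  assume fin: "finite Y"
  have sub: "Y \<subseteq> proj_space I" using irreducible_proj[OF irr] by simp
  have sep: "\<exists>f. f \<in> forms I 1 \<and> vanish_on f {a} \<and> \<not> vanish_on f Y" if a: "a \<in> Y" for a
  proof -
    obtain c where c: "c \<in> Y" "c \<noteq> a" using pq by blast
    have "a \<in> proj_space I" "c \<in> proj_space I" using a c(1) sub by blast+
    then obtain v w where v: "a = proj_class v" "\<forall>i. i \<notin> I \<longrightarrow> v i = 0" "\<exists>i\<in>I. v i \<noteq> 0"
      and w: "c = proj_class w" "\<forall>i. i \<notin> I \<longrightarrow> w i = 0" "\<exists>i\<in>I. w i \<noteq> 0" by (auto simp: proj_space_def)
    have "\<exists>i\<in>I. \<exists>j\<in>I. v i * w j \<noteq> v j * w i"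
    proof (rule ccontr)
      assume "\<not> ?thesis"
      then have e: "v i * w j = v j * w i" for i j using v(2) w(2) by (cases "i \<in> I"; cases "j \<in> I") auto
      obtain i where i: "v i \<noteq> 0" using v(3) by blast
      obtain j where j: "w j \<noteq> 0" using w(3) by blast
      have "w i \<noteq> 0" using e[of i j] i j by auto
      then have "w \<in> proj_class v"
        unfolding proj_class_def using i e[of i] by (intro CollectI exI[of _ "w i / v i"]) (auto simp: fun_eq_iff field_simps)
      then show False using c(2) proj_class_eq v(1) w(1) by blast
    qed
    then obtain i j where ij: "i \<in> I" "j \<in> I" "v i * w j \<noteq> v j * w i" by blast
    define f where "f = mpoly_scale (v i) (mvar j) + mpoly_scale (- v j) (mvar i)"
    have f: "f \<in> forms I 1" unfolding f_def using ij by (intro forms_add forms_scale mvar_forms)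
    have ev: "mpoly_eval id f u = v i * u j - v j * u i" for u
      unfolding f_def cx.eval_add cx.eval_scale cx.eval_var by simp
    have "vanish_on f {a}"
    proof -
      have "vanishes_at id f a" unfolding v(1) cx.vanishes_at_class[OF f] ev by simp
      then show ?thesis using vanish_on_iff[OF f, of "{a}"] a sub by blast
    qed
    moreover have "\<not> vanish_on f Y"
      using c(1) ij(3) unfolding vanish_on_def w(1) by (auto simp: ev)
    ultimately show ?thesis using f by blast
  qed
  have "\<forall>a\<in>Y. \<exists>f. f \<in> forms I 1 \<and> vanish_on f {a} \<and> \<not> vanish_on f Y" using sep by (rule ballI)
  from bchoice[OF this] obtain f where f': "\<forall>a\<in>Y. f a \<in> forms I 1 \<and> vanish_on (f a) {a} \<and> \<not> vanish_on (f a) Y" ..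
  then have f: "\<And>a. a \<in> Y \<Longrightarrow> f a \<in> forms I 1 \<and> vanish_on (f a) {a} \<and> \<not> vanish_on (f a) Y" by (rule bspec)
  have "\<not> vanish_on (\<Prod>a\<in>A. f a) Y" if "finite A" "A \<subseteq> Y" for A
    using that
  proof (induction A rule: finite_induct)
    case empty
    have "p \<in> proj_space I" using pq(1) sub by blast
    then obtain v where "p = proj_class v" by (auto simp: proj_space_def)
    then show ?case using pq(1) eval_prod[of f "{}" v] by (auto simp: vanish_on_def)
  next
    case (insert a A)
    show ?case
    proof
      assume van: "vanish_on (\<Prod>a\<in>insert a A. f a) Y"
      have "vanish_on (f a) Y \<or> vanish_on (\<Prod>a\<in>A. f a) Y"
      proof (rule irreducible_vanish_on[OF irr])
        show "f a \<in> forms I 1" using f insert.prems by blast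
        show "(\<Prod>a\<in>A. f a) \<in> forms I (\<Sum>a\<in>A. 1)" using f insert.hyps insert.prems by (intro forms_prod) auto
        show "mpoly_eval id (f a) v * mpoly_eval id (\<Prod>a\<in>A. f a) v = 0" if "proj_class v \<in> Y" for v
          using van that insert.hyps by (simp add: vanish_on_def cx.eval_mult)
      qed
      then show False using f insert by blast
    qed
  qed
  moreover have "vanish_on (\<Prod>a\<in>Y. f a) Y"
    unfolding vanish_on_def
  proof (intro allI impI)
    fix v assume v: "proj_class v \<in> Y"
    then have "mpoly_eval id (f (proj_class v)) v = 0" using f by (simp add: vanish_on_def)
    then show "mpoly_eval id (\<Prod>a\<in>Y. f a) v = 0"
      unfolding eval_prod using fin v by (intro prod_zero) auto
  qed
  ultimately show False using fin by blast
qed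

text \<open>Here \<open>t0\<close> is left open: it can be chosen only after a regular section on
  each component is known.\<close>

locale charts = curve n C d + cd: curve_data n d "curve.Pts n C" U V e M g e' M' g'
  for n C d U V e M g e' M' g' +
  fixes b k L m :: nat
  assumes k_pos: "k > 0" and L_ge: "L \<ge> n * (Suc d * Suc d)"
    and m_bound: "2 * (m * (b - 1)) < k * ((\<Sum>j\<le>m. min d (Suc j)) - 1)"
    and bad_bound: "\<exists>K. \<forall>P. finite P \<longrightarrow> P \<subseteq> Pts \<longrightarrow> (\<forall>x\<in>P. \<forall>y\<in>P. x \<noteq> y \<longrightarrow> \<not> parallel x y) \<longrightarrow>
      (\<forall>x\<in>P. lf n V x = 0 \<or> (\<exists>i\<le>n. hder (g i) (e i) (M i) (lf n U x) (lf n V x) (x i) = 0) \<or>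
        (\<exists>c\<le>L. htop (g' c) (e' c) (M' c) (lf n U x) (lf n V x) = 0)) \<longrightarrow> card P \<le> K"
begin

section \<open>Counting the components in a common chart\<close>

abbreviation Idx :: "(nat \<times> nat) set" where "Idx \<equiv> {..n} \<times> {..<b}"

text \<open>More than \<open>K\<close> pairwise non-proportional sections cannot all be degenerate.
  For one that is not, the values that define goodness are nonzero polynomials in \<open>t\<close>;
  \<open>B\<close> is their product. The proper subset \<open>Y'\<close> provides two points, so
  that \<open>Y\<close> is infinite.\<close>

lemma regular_point:
  assumes irrY: "irreducible_in (zariski id Idx) Y" and sub: "Y \<subseteq> coeff_point ` sections b"
    and Y': "Y' \<subset> Y" "Y' \<noteq> {}"
  shows "\<exists>x B. x \<in> sections b \<and> coeff_point x \<in> Y \<and> B \<noteq> 0 \<and> (\<forall>t0. poly B t0 \<noteq> 0 \<longrightarrow> cd.good t0 L x)"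
proof -
  obtain K where K: "\<And>P. finite P \<Longrightarrow> P \<subseteq> Pts \<Longrightarrow> (\<forall>x\<in>P. \<forall>y\<in>P. x \<noteq> y \<longrightarrow> \<not> parallel x y) \<Longrightarrow>
      (\<forall>x\<in>P. lf n V x = 0 \<or> (\<exists>i\<le>n. hder (g i) (e i) (M i) (lf n U x) (lf n V x) (x i) = 0) \<or>
        (\<exists>c\<le>L. htop (g' c) (e' c) (M' c) (lf n U x) (lf n V x) = 0)) \<Longrightarrow> card P \<le> K"
    using bad_bound by blast
  obtain p q where "p \<in> Y" "q \<in> Y" "p \<noteq> q" using Y' by blast
  then have "infinite Y" by (rule irreducible_infinite[OF irrY])
  then obtain A where A: "finite A" "card A = Suc K" "A \<subseteq> Y" using infinite_arbitrarily_large by blast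
  have "\<forall>p\<in>A. \<exists>x. x \<in> sections b \<and> coeff_point x = p" using A(3) sub by blast
  from bchoice[OF this] obtain \<rho> where \<rho>: "\<And>p. p \<in> A \<Longrightarrow> \<rho> p \<in> sections b" "\<And>p. p \<in> A \<Longrightarrow> coeff_point (\<rho> p) = p" by blast
  have inj: "inj_on \<rho> A" using \<rho>(2) by (metis inj_onI)
  have "\<not> card (\<rho> ` A) \<le> K" using A(2) by (simp add: card_image[OF inj])
  moreover have "\<rho> ` A \<subseteq> Pts" using \<rho>(1) by (auto simp: sections_def)
  moreover have "\<forall>x\<in>\<rho> ` A. \<forall>y\<in>\<rho> ` A. x \<noteq> y \<longrightarrow> \<not> parallel x y"
  proof (intro ballI impI notI)
    fix x y assume xy: "x \<in> \<rho> ` A" "y \<in> \<rho> ` A" "x \<noteq> y" "parallel x y"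
    then obtain p q where p: "p \<in> A" "x = \<rho> p" "q \<in> A" "y = \<rho> q" by blast
    obtain c where c: "c \<noteq> 0" "\<forall>i. y i = Polynomial.smult c (x i)"
      using parallel_sections[of x b y] \<rho>(1) p xy(4) by blast
    then have "y = (\<lambda>i. Polynomial.smult c (x i))" by blast
    then have "coeff_point y = coeff_point x" using coeff_point_scale[OF c(1)] by simp
    then show False using \<rho>(2) p xy(3) by metis
  qed
  ultimately obtain x where x: "x \<in> \<rho> ` A" "\<not> (lf n V x = 0 \<or> (\<exists>i\<le>n. hder (g i) (e i) (M i) (lf n U x) (lf n V x) (x i) = 0) \<or>
        (\<exists>c\<le>L. htop (g' c) (e' c) (M' c) (lf n U x) (lf n V x) = 0))"
    using K[of "\<rho> ` A"] A(1) by blast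
  define B where "B = lf n V x * ((\<Prod>i\<le>n. hder (g i) (e i) (M i) (lf n U x) (lf n V x) (x i)) *
    (\<Prod>c\<le>L. htop (g' c) (e' c) (M' c) (lf n U x) (lf n V x)))"
  have "B \<noteq> 0" using x(2) by (auto simp: B_def)
  moreover have "cd.good t0 L x" if "poly B t0 \<noteq> 0" for t0
    using that by (auto simp: B_def cd.good_def poly_prod)
  moreover have "x \<in> sections b" "coeff_point x \<in> Y" using x(1) \<rho> A(3) by auto
  ultimately show ?thesis by blast
qed

lemma separating_form:
  assumes "closedin (bounded_height_space n C b) A" "B \<subseteq> coeff_point ` sections b" "\<not> B \<subseteq> A"
  shows "\<exists>F m. F \<in> forms Idx m \<and> vanish_on F A \<and> \<not> vanish_on F B"
proof -
  obtain p where p: "p \<in> B" "p \<notin> A" using assms(3) by blast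
  have ps: "p \<in> coeff_point ` sections b" using p assms(2) by blast
  then have pp: "p \<in> proj_space Idx" using sections_proj by blast
  obtain F m where F: "F \<in> forms Idx m" "\<not> vanishes_at id F p" "\<And>q. q \<in> A \<Longrightarrow> vanishes_at id F q"
    using cx.closed_separate[OF assms(1)[unfolded bounded_height_space_eq] ps pp p(2)] by blast
  have "A \<subseteq> coeff_point ` sections b"
    using closedin_subset[OF assms(1)] unfolding bounded_height_space_eq by auto
  then have "A \<subseteq> proj_space Idx" "B \<subseteq> proj_space Idx" using assms(2) sections_proj by blast+
  then show ?thesis using vanish_on_iff[OF F(1)] F p(1) by blast
qed

lemma chain_props:
  assumes "chain_in (bounded_height_space n C b) r Y"
  shows "i \<le> r \<Longrightarrow> irreducible_in (zariski id Idx) (Y i)" "i \<le> r \<Longrightarrow> Y i \<subseteq> coeff_point ` sections b"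
    "i < r \<Longrightarrow> Y i \<subset> Y (Suc i)"
    "i < r \<Longrightarrow> \<exists>f m. f \<in> forms Idx m \<and> vanish_on f (Y i) \<and> \<not> vanish_on f (Y (Suc i))"
proof -
  have "irreducible_in (zariski id Idx) (Y i) \<and> Y i \<subseteq> coeff_point ` sections b" if "i \<le> r" for i
    using assms that unfolding chain_in_def bounded_height_space_eq irreducible_in_subtopology by blast
  then show 1: "i \<le> r \<Longrightarrow> irreducible_in (zariski id Idx) (Y i)"
    and 2: "i \<le> r \<Longrightarrow> Y i \<subseteq> coeff_point ` sections b" for i by blast+
  show 3: "i < r \<Longrightarrow> Y i \<subset> Y (Suc i)" using assms by (simp add: chain_in_def)
  show "\<exists>f m. f \<in> forms Idx m \<and> vanish_on f (Y i) \<and> \<not> vanish_on f (Y (Suc i))" if "i < r"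
  proof (rule separating_form)
    show "closedin (bounded_height_space n C b) (Y i)" using assms that by (simp add: chain_in_def)
    show "Y (Suc i) \<subseteq> coeff_point ` sections b" using 2[of "Suc i"] that by simp
    show "\<not> Y (Suc i) \<subseteq> Y i" using 3 that by blast
  qed
qed

text \<open>For \<open>r > 0\<close> the top member properly contains a nonempty set, hence has a
  section that is good for all but finitely many \<open>t0\<close>; any such \<open>t0\<close> gives
  a chart in which the dimension bound applies.\<close>

lemma chain_length:
  assumes "chain_in (bounded_height_space n C b) r Y"
  shows "r \<le> k"
proof (cases "r = 0")
  case False
  then obtain r' where r: "r = Suc r'" by (cases r) auto
  note ch = chain_props[OF assms]
  have "Y r' \<noteq> {}" using irreducible_proj[OF ch(1)[of r']] r by simp
  then obtain x B where x: "x \<in> sections b" "coeff_point x \<in> Y r" "B \<noteq> 0" "\<And>t0. poly B t0 \<noteq> 0 \<Longrightarrow> cd.good t0 L x"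
    using regular_point[OF ch(1)[of r] ch(2)[of r], of "Y r'"] ch(3)[of r'] unfolding r by blast
  obtain t0 where "poly B t0 \<noteq> 0" using x(3) poly_all_0_iff_0 by blast
  then have good: "cd.good t0 L x" by (rule x(4))
  then have "poly (lf n V x) t0 \<noteq> 0" by (simp add: cd.good_def)
  interpret ch: chart n C d U V e M g e' M' g' b k t0 by unfold_locales
  interpret component n C d U V e M g e' M' g' b k t0 "Y r" x
  proof unfold_locales
    show "irreducible_in (zariski id ({..n} \<times> {..<b})) (Y r)" by (rule ch(1)) simp
    show "Y r \<subseteq> coeff_point ` sections b" by (rule ch(2)) simp
    show "ch.lam x \<noteq> 0" using \<open>poly (lf n V x) t0 \<noteq> 0\<close> by (simp add: ch.lam_def)
  qed (rule x)+
  show ?thesis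
  proof (rule component_dim(1)[OF k_pos L_ge m_bound good, where Fs = "{}" and Yc = Y])
    show "irreducible_in (zariski id Idx) (Y i)" if "i \<le> r" for i using that by (rule ch(1))
    show "Y i \<subseteq> Y (Suc i)" if "i < r" for i using ch(3)[OF that] by blast
    show "\<exists>f m. f \<in> forms Idx m \<and> vanish_on f (Y i) \<and> \<not> vanish_on f (Y (Suc i))" if "i < r" for i using that by (rule ch(4))
  qed simp_all
qed simp

end

context charts
begin

text \<open>One \<open>t0\<close> outside the roots of finitely many polynomials suits all the
  components, and one jet \<open>\<alpha>\<close> is generic for all of them. The sections found on
  the components then lie in a single fibre.\<close>

lemma component_count:
  assumes fin: "finite Zs" and ch: "\<And>Z. Z \<in> Zs \<Longrightarrow> \<exists>Y. chain_in (bounded_height_space n C b) k Y \<and> Y k = Z"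
    and incomp: "\<And>Z Z'. Z \<in> Zs \<Longrightarrow> Z' \<in> Zs \<Longrightarrow> Z \<noteq> Z' \<Longrightarrow> \<not> Z \<subseteq> Z'"
  shows "card Zs \<le> d * (d * m)"
proof -
  have "\<forall>Z\<in>Zs. \<exists>Y. chain_in (bounded_height_space n C b) k Y \<and> Y k = Z" using ch by blast
  from bchoice[OF this] obtain Yc where Yc: "\<And>Z. Z \<in> Zs \<Longrightarrow> chain_in (bounded_height_space n C b) k (Yc Z)"
    "\<And>Z. Z \<in> Zs \<Longrightarrow> Yc Z k = Z" by blast
  have irrZ: "irreducible_in (zariski id Idx) Z" and subZ: "Z \<subseteq> coeff_point ` sections b"
    and closedZ: "closedin (bounded_height_space n C b) Z" if "Z \<in> Zs" for Z
    using chain_props(1,2)[OF Yc(1)[OF that], of k] Yc(1)[OF that] Yc(2)[OF that] by (auto simp: chain_in_def)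
  have "\<forall>Z\<in>Zs. \<exists>xB. fst xB \<in> sections b \<and> coeff_point (fst xB) \<in> Z \<and> snd xB \<noteq> 0 \<and>
      (\<forall>t0. poly (snd xB) t0 \<noteq> 0 \<longrightarrow> cd.good t0 L (fst xB))"
  proof
    fix Z assume Z: "Z \<in> Zs"
    obtain k' where k': "k = Suc k'" using k_pos by (cases k) auto
    have "Yc Z k' \<subset> Z" using chain_props(3)[OF Yc(1)[OF Z], of k'] Yc(2)[OF Z] k' by simp
    moreover have "Yc Z k' \<noteq> {}" using irreducible_proj[OF chain_props(1)[OF Yc(1)[OF Z], of k']] k' by simp
    ultimately have "\<exists>x B. x \<in> sections b \<and> coeff_point x \<in> Z \<and> B \<noteq> 0 \<and> (\<forall>t0. poly B t0 \<noteq> 0 \<longrightarrow> cd.good t0 L x)"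
      by (rule regular_point[OF irrZ[OF Z] subZ[OF Z]])
    then obtain x B where "x \<in> sections b" "coeff_point x \<in> Z" "B \<noteq> 0" "\<forall>t0. poly B t0 \<noteq> 0 \<longrightarrow> cd.good t0 L x"
      by (elim exE conjE)
    then show "\<exists>xB. fst xB \<in> sections b \<and> coeff_point (fst xB) \<in> Z \<and> snd xB \<noteq> 0 \<and>
      (\<forall>t0. poly (snd xB) t0 \<noteq> 0 \<longrightarrow> cd.good t0 L (fst xB))"
      by (intro exI[of _ "(x, B)"]) (simp only: fst_conv snd_conv simp_thms)
  qed
  from bchoice[OF this] obtain \<xi> where \<xi>: "\<And>Z. Z \<in> Zs \<Longrightarrow> fst (\<xi> Z) \<in> sections b"
    "\<And>Z. Z \<in> Zs \<Longrightarrow> coeff_point (fst (\<xi> Z)) \<in> Z" "\<And>Z. Z \<in> Zs \<Longrightarrow> snd (\<xi> Z) \<noteq> 0"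
    "\<And>Z t0. Z \<in> Zs \<Longrightarrow> poly (snd (\<xi> Z)) t0 \<noteq> 0 \<Longrightarrow> cd.good t0 L (fst (\<xi> Z))" by blast
  have "(\<Prod>Z\<in>Zs. snd (\<xi> Z)) \<noteq> 0" using fin \<xi>(3) by simp
  then obtain t0 where "poly (\<Prod>Z\<in>Zs. snd (\<xi> Z)) t0 \<noteq> 0" using poly_all_0_iff_0 by blast
  then have good: "cd.good t0 L (fst (\<xi> Z))" if "Z \<in> Zs" for Z
    using that \<xi>(4) fin by (auto simp: poly_prod)
  interpret ch: chart n C d U V e M g e' M' g' b k t0 by unfold_locales
  \<comment> \<open>\<open>S (Z, Z')\<close> vanishes on \<open>Z'\<close> but not on
    \<open>Z\<close>. Required to be nonzero at the section chosen for \<open>Z\<close>, it tells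
    this section from the one chosen for \<open>Z'\<close>.\<close>
  have "\<forall>p. \<exists>F. fst p \<in> Zs \<longrightarrow> snd p \<in> Zs \<longrightarrow> fst p \<noteq> snd p \<longrightarrow>
      (\<exists>m. F \<in> forms Idx m) \<and> vanish_on F (snd p) \<and> \<not> vanish_on F (fst p)"
  proof
    fix p show "\<exists>F. fst p \<in> Zs \<longrightarrow> snd p \<in> Zs \<longrightarrow> fst p \<noteq> snd p \<longrightarrow>
      (\<exists>m. F \<in> forms Idx m) \<and> vanish_on F (snd p) \<and> \<not> vanish_on F (fst p)"
    proof (cases "fst p \<in> Zs \<and> snd p \<in> Zs \<and> fst p \<noteq> snd p")
      case True
      then show ?thesis using separating_form[OF closedZ[of "snd p"] subZ[of "fst p"]] incomp by blast
    qed blast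
  qed
  from choice[OF this] obtain S where S: "\<And>Z Z'. Z \<in> Zs \<Longrightarrow> Z' \<in> Zs \<Longrightarrow> Z \<noteq> Z' \<Longrightarrow>
      (\<exists>m. S (Z, Z') \<in> forms Idx m) \<and> vanish_on (S (Z, Z')) Z' \<and> \<not> vanish_on (S (Z, Z')) Z" by auto
  define W where "W Z \<alpha> x \<longleftrightarrow> x \<in> sections b \<and> cd.good t0 L x \<and> ch.lam x = 1 \<and> ch.jets \<alpha> x \<and>
        (\<forall>F m. F \<in> forms Idx m \<longrightarrow> vanish_on F Z \<longrightarrow> mpoly_eval id F (cvec x) = 0) \<and>
        (\<forall>F\<in>(\<lambda>Z'. S (Z, Z')) ` (Zs - {Z}). mpoly_eval id F (cvec x) \<noteq> 0)" for Z \<alpha> x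
  have "\<exists>Q. Q \<in> polys k \<and> (\<exists>\<alpha>. Q \<alpha> \<noteq> 0) \<and> (\<forall>\<alpha>. Q \<alpha> \<noteq> 0 \<longrightarrow> (\<exists>x. W Z \<alpha> x))" if Z: "Z \<in> Zs" for Z
  proof -
    have lam: "ch.lam (fst (\<xi> Z)) \<noteq> 0" using good[OF Z] by (simp add: cd.good_def ch.lam_def)
    interpret cm: component n C d U V e M g e' M' g' b k t0 Z "fst (\<xi> Z)"
      by unfold_locales (rule irrZ[OF Z] subZ[OF Z] \<xi>(1,2)[OF Z] lam)+
    note pr = chain_props[OF Yc(1)[OF Z]]
    have "\<exists>Q\<in>polys k. (\<exists>\<alpha>. Q \<alpha> \<noteq> 0) \<and> (\<forall>\<alpha>. Q \<alpha> \<noteq> 0 \<longrightarrow> (\<exists>x. W Z \<alpha> x))"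
      unfolding W_def
    proof (rule cm.component_dim(2)[OF k_pos L_ge m_bound good[OF Z], where Yc = "Yc Z" and r = k])
      show "finite ((\<lambda>Z'. S (Z, Z')) ` (Zs - {Z}))" using fin by simp
      show "\<exists>m. F \<in> forms Idx m \<and> \<not> vanish_on F Z" if "F \<in> (\<lambda>Z'. S (Z, Z')) ` (Zs - {Z})" for F
        using that S Z by blast
      show "irreducible_in (zariski id Idx) (Yc Z i)" if "i \<le> k" for i using that by (rule pr(1))
      show "Yc Z i \<subseteq> Yc Z (Suc i)" if "i < k" for i using pr(3)[OF that] by blast
      show "\<exists>f m. f \<in> forms Idx m \<and> vanish_on f (Yc Z i) \<and> \<not> vanish_on f (Yc Z (Suc i))" if "i < k" for i
        using that by (rule pr(4))
      show "Yc Z k = Z" by (rule Yc(2)[OF Z])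
    qed (rule refl)
    then show ?thesis by blast
  qed
  then have "\<forall>Z\<in>Zs. \<exists>Q. Q \<in> polys k \<and> (\<exists>\<alpha>. Q \<alpha> \<noteq> 0) \<and> (\<forall>\<alpha>. Q \<alpha> \<noteq> 0 \<longrightarrow> (\<exists>x. W Z \<alpha> x))" by blast
  from bchoice[OF this] obtain Q where Q: "\<And>Z. Z \<in> Zs \<Longrightarrow> Q Z \<in> polys k \<and> (\<exists>\<alpha>. Q Z \<alpha> \<noteq> 0)"
    "\<And>Z \<alpha>. Z \<in> Zs \<Longrightarrow> Q Z \<alpha> \<noteq> 0 \<Longrightarrow> \<exists>x. W Z \<alpha> x" by blast
  obtain \<alpha> where "\<forall>v\<in>Q ` Zs. v \<alpha> \<noteq> 0" using polys_common_nonzero[of "Q ` Zs" k] fin Q(1) by blast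
  then have "\<forall>Z\<in>Zs. \<exists>x. W Z \<alpha> x" using Q(2) by blast
  from bchoice[OF this] obtain x where x: "\<And>Z. Z \<in> Zs \<Longrightarrow> W Z \<alpha> (x Z)" by blast
  have inj: "inj_on x Zs"
  proof (rule inj_onI, rule ccontr)
    fix Z Z' assume Z: "Z \<in> Zs" "Z' \<in> Zs" "x Z = x Z'" "Z \<noteq> Z'"
    have "mpoly_eval id (S (Z, Z')) (cvec (x Z)) \<noteq> 0" using x[OF Z(1)] Z unfolding W_def by blast
    moreover have "mpoly_eval id (S (Z, Z')) (cvec (x Z')) = 0" using x[OF Z(2)] S[OF Z(1,2,4)] unfolding W_def by blast
    ultimately show False using Z(3) by simp
  qed
  have "card (x ` Zs) \<le> d * (d * m)"
  proof (rule ch.section_bound[OF k_pos L_ge m_bound, where \<alpha> = \<alpha>])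
    show "finite (x ` Zs)" using fin by simp
    show "y \<in> sections b \<and> cd.good t0 L y \<and> ch.lam y = 1 \<and> ch.jets \<alpha> y" if "y \<in> x ` Zs" for y
      using that x unfolding W_def by blast
  qed
  then show ?thesis by (simp add: card_image[OF inj])
qed

end

lemma (in curve) dimension_and_count:
  assumes b: "b \<ge> 1"
  defines "k \<equiv> 2 * (b - 1) div d + 1" and "T \<equiv> bounded_height_space n C b"
  defines "Z \<equiv> {S \<in> irreducible_components T. krull_dim (subtopology T S) = ereal (real k)}"
  shows "krull_dim T \<le> ereal (real k)" "finite Z \<and> card Z \<le> 2 * d ^ 3 * b"
proof -
  obtain m where m: "2 * (m * (b - 1)) < k * ((\<Sum>j\<le>m. min d (Suc j)) - 1)" "d * (d * m) \<le> 2 * d ^ 3 * (b - 1 + 1)"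
    using auxiliary_degree[OF degree_pos, of "b - 1"] unfolding k_def by blast
  obtain U V e M g e' M' g' where cd: "curve_data n d Pts U V e M g e' M' g'"
    and bd: "\<forall>L. \<exists>K. \<forall>P. finite P \<longrightarrow> P \<subseteq> Pts \<longrightarrow> (\<forall>x\<in>P. \<forall>y\<in>P. x \<noteq> y \<longrightarrow> \<not> parallel x y) \<longrightarrow>
      (\<forall>x\<in>P. lf n V x = 0 \<or> (\<exists>i\<le>n. hder (g i) (e i) (M i) (lf n U x) (lf n V x) (x i) = 0) \<or>
        (\<exists>c\<le>L. htop (g' c) (e' c) (M' c) (lf n U x) (lf n V x) = 0)) \<longrightarrow> card P \<le> K"
    using good_curve_data by (elim exE conjE)
  have "charts n C d U V e M g e' M' g' b k (n * (Suc d * Suc d)) m"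
    by (intro charts.intro curve_axioms cd charts_axioms.intro m(1) spec[OF bd]) (simp_all add: k_def)
  then interpret charts n C d U V e M g e' M' g' b k "n * (Suc d * Suc d)" m .
  show "krull_dim T \<le> ereal (real k)" unfolding T_def by (rule krull_dim_le) (rule chain_length)
  have comp: "closedin T S \<and> irreducible_in T S \<and> (\<forall>S'. irreducible_in T S' \<longrightarrow> S \<subseteq> S' \<longrightarrow> S' = S)" if "S \<in> Z" for S
    using that irreducible_component_closed[of S T] by (auto simp: Z_def irreducible_components_def)
  have chain: "\<exists>Y. chain_in T k Y \<and> Y k = S" if S: "S \<in> Z" for S
  proof -
    have "krull_dim (subtopology T S) = ereal (real k)" using S by (simp add: Z_def)
    then obtain Y where Y: "chain_in (subtopology T S) k Y" using krull_dim_attained[of "subtopology T S" k] by (auto simp: k_def)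
    have cl: "closedin T S" using comp[OF S] by blast
    have "closedin T (Y i) \<and> Y i \<subseteq> S \<and> irreducible_in T (Y i)" if "i \<le> k" for i
      using Y that unfolding chain_in_def irreducible_in_subtopology closedin_closed_subtopology[OF cl] by blast
    moreover have "Y i \<subset> Y (Suc i)" if "i < k" for i using Y that by (simp add: chain_in_def)
    \<comment> \<open>The top member of the chain is replaced by the component, which contains it,
      so that the chain ends in \<open>S\<close> itself.\<close>
    ultimately have "chain_in T k (Y(k := S))"
      unfolding chain_in_def using comp[OF S] by (auto simp: less_Suc_eq) blast+
    then show ?thesis by (intro exI[of _ "Y(k := S)"]) simp
  qed
  \<comment> \<open>Finiteness of \<open>Z\<close> is not known in advance, so the count is made for
    its finite subsets; the uniform bound then gives both claims.\<close>
  have "card G \<le> 2 * d ^ 3 * b" if G: "G \<subseteq> Z" "finite G" for G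
  proof -
    have "card G \<le> d * (d * m)"
    proof (rule component_count[OF G(2)])
      show "\<exists>Y. chain_in (bounded_height_space n C b) k Y \<and> Y k = S" if "S \<in> G" for S
        using chain that G(1) unfolding T_def by blast
      show "\<not> S \<subseteq> S'" if "S \<in> G" "S' \<in> G" "S \<noteq> S'" for S S'
        using comp that G(1) by blast
    qed
    then show ?thesis using m(2) b by simp
  qed
  then show "finite Z \<and> card Z \<le> 2 * d ^ 3 * b" by (rule finite_if_finite_subsets_card_bdd)
qed

theorem theorem4:
  shows "\<exists>c::real. c > 0 \<and>
    (\<forall>(n::nat) (d::nat) (C :: (nat \<Rightarrow> complex poly fract alg_closure) set set) (b::nat).
      irreducible_projective_curve n C \<and> has_proj_degree n C d \<and> b \<ge> 1 \<longrightarrow>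
        krull_dim (bounded_height_space n C b)
          \<le> ereal (of_int (\<lfloor>2 * (real b - 1) / real d\<rfloor> + 1)) \<and>
        \<lfloor>2 * (real b - 1) / real d\<rfloor> + 1 \<le> \<lceil>2 * real b / real d\<rceil> \<and>
        (let Z = {S \<in> irreducible_components (bounded_height_space n C b).
                    krull_dim (subtopology (bounded_height_space n C b) S)
                      = ereal (of_int (\<lfloor>2 * (real b - 1) / real d\<rfloor> + 1))}
         in finite Z \<and> real (card Z) \<le> c * real d ^ 3 * real b))"
proof (intro exI[of _ 2] conjI allI impI)
  fix n d b :: nat and C :: "(nat \<Rightarrow> complex poly fract alg_closure) set set"
  assume asm: "irreducible_projective_curve n C \<and> has_proj_degree n C d \<and> b \<ge> 1"
  interpret curve n C d by (rule curve.intro[OF conjunct1[OF asm] conjunct1[OF conjunct2[OF asm]]])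
  define q where "q = 2 * (b - 1) div d"
  have b: "b \<ge> 1" by (rule conjunct2[OF conjunct2[OF asm]])
  have "2 * (real b - 1) = real (2 * (b - 1))" using b by (simp add: of_nat_diff)
  then have q: "\<lfloor>2 * (real b - 1) / real d\<rfloor> = int q"
    unfolding q_def by (simp only: floor_divide_of_nat_eq)
  have r: "(of_int (int q + 1) :: real) = real (q + 1)" by simp
  show "krull_dim (bounded_height_space n C b) \<le> ereal (of_int (\<lfloor>2 * (real b - 1) / real d\<rfloor> + 1))"
    unfolding q r unfolding q_def by (rule dimension_and_count(1)[OF b])
  show "\<lfloor>2 * (real b - 1) / real d\<rfloor> + 1 \<le> \<lceil>2 * real b / real d\<rceil>"
  proof -
    have "of_int \<lfloor>2 * (real b - 1) / real d\<rfloor> \<le> 2 * (real b - 1) / real d" by (rule of_int_floor_le)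
    also have "\<dots> < 2 * real b / real d" using degree_pos by (simp add: divide_strict_right_mono)
    finally have "\<lfloor>2 * (real b - 1) / real d\<rfloor> < \<lceil>2 * real b / real d\<rceil>" by (simp only: less_ceiling_iff)
    then show ?thesis by simp
  qed
  have fz: "finite {S \<in> irreducible_components (bounded_height_space n C b).
      krull_dim (subtopology (bounded_height_space n C b) S) = ereal (real (q + 1))} \<and>
    card {S \<in> irreducible_components (bounded_height_space n C b).
      krull_dim (subtopology (bounded_height_space n C b) S) = ereal (real (q + 1))} \<le> 2 * d ^ 3 * b"
    unfolding q_def by (rule dimension_and_count(2)[OF b])
  have le: "real c \<le> 2 * real d ^ 3 * real b" if "c \<le> 2 * d ^ 3 * b" for c
    using of_nat_mono[OF that, where 'a = real] by simp
  show "let Z = {S \<in> irreducible_components (bounded_height_space n C b).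
                    krull_dim (subtopology (bounded_height_space n C b) S)
                      = ereal (of_int (\<lfloor>2 * (real b - 1) / real d\<rfloor> + 1))}
         in finite Z \<and> real (card Z) \<le> 2 * real d ^ 3 * real b"
    unfolding Let_def q r using fz le by blast
qed simp

end
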